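(* Let $d\ge3$ and consider the maximum likelihood estimator $\hat h_n$ of $h$ in the annealed Ising model on random $d$-regular graphs with parameters $\beta>0$, $h\in\mathbb R$, with $A$, $\beta_c$, $\mathcal U$ as in the context. The following convergences in law hold as $n\to\infty$. (i) If $(\beta,h)\in\mathcal U$, then $\sqrt n(\hat h_n-h)\to N(0,\sigma_h)$, with $\sigma_h$ a positive constant. (ii) If $\beta>\beta_c$ and $h=0$, then $\sqrt n(\hat h_n-h)\to U_h$, where $U_h$ has the mixture law $p_h^-N^-(0,\sigma_h^-)+p_h^+N^+(0,\sigma_h^+)+(1-p_h^--p_h^+)\delta_0$, with $p_h^\pm,\sigma_h^\pm$ positive constants. (iii) If $\beta=\beta_c$ and $h=0$, then $n^{3/4}(\hat h_n-h)\to Z_h$, where $Z_h$ has distribution $\mathbb P[Z_h\le t]=\mathbb P\big[Y_h(0)\le\mathbb E[Y_h(t)]\big]$, $t\in\mathbb R$, with $Y_h(t)$ having density proportional to $\exp(c_*y^4+2ty)$ and $c_*=A^{(4)}(1/2)/24$.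
   Context: Let $G_n=(V_n,E_n)$ be the random regular graph of degree $d\ge3$ with $n$ vertices $v_1,\dots,v_n$. The annealed Ising measure on $\{1,-1\}^n$ is $$\mu_n(\omega)\propto\mathbb E\Big[\exp\Big(\beta\sum_{(v_i,v_j)\in E_n}\omega_i\omega_j+h\sum_{i=1}^n\omega_i\Big)\Big],$$ where the expectation is over the space of random regular graphs with respect to the uniform distribution. The parameter $h$ is estimated from one sample $\omega\sim\mu_n$ with $\beta$ known: with $M_n=\sum_i\omega_i$, $\hat h_n$ is the solution $x$ of $\mathbb E_x[M_n]=M_n(\omega)$, where $\mathbb E_x$ is expectation under $\mu_n$ with $h$ replaced by $x$. Define $$g_\beta(a)=\int_0^{a\wedge(1-a)}\log\frac{e^{-2\beta}(1-2s)+\sqrt{1+(e^{-4\beta}-1)(1-2s)^2}}{2(1-s)}\,ds,\qquad A(a)=2ha+d\,g_\beta(a)+I(a),\quad a\in[0,1],$$ with $I(a)=-a\log a-(1-a)\log(1-a)$ ($0\log0=0$). Let $\beta_c=\operatorname{atanh}(1/(d-1))$ and $\mathcal U=\{(\beta,h):\beta>0,h\ne0,\text{ or }0<\beta<\beta_c,h=0\}$. It is known (part of the setting) that: if $(\beta,h)\in\mathcal U$, $A$ has a unique maximizer $a_*\in(0,1)$, and $A''(a_* )<0$; if $\beta>\beta_c$, $h=0$, $A$ has exactly two maximizers $0<a_-<a_+=1-a_-<1$, with $A''(a_\pm)<0$; if $\beta=\beta_c$, $h=0$, $A$ has the unique maximizer $1/2$, with $A''(1/2)=A'''(1/2)=0$,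 $A^{(4)}(1/2)<0$. $N(0,\sigma)$ is the centered normal law with variance $\sigma$; $N^+(0,\sigma)$ and $N^-(0,\sigma)$ are the laws of $|Z|$ and $-|Z|$ with $Z\sim N(0,\sigma)$. *)

theory Defs
  imports "HOL-Probability.Probability"
begin

text \<open>The simple \<open>d\<close>-regular graphs on the vertex set \<open>{..<n}\<close>, each given by its set of edges
  \<open>e = {i, j}\<close>. The set is empty if \<open>d * n\<close> is odd or \<open>0 < n \<le> d\<close>.\<close>

definition regular_graphs :: "nat \<Rightarrow> nat \<Rightarrow> nat set set set" where
  "regular_graphs d n =
     {E. E \<subseteq> {e. e \<subseteq> {..<n} \<and> card e = 2} \<and> (\<forall>v<n. card {e \<in> E. v \<in> e} = d)}"

definition spin_configs :: "nat \<Rightarrow> (nat \<Rightarrow> real) set" where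
  "spin_configs n = {..<n} \<rightarrow>\<^sub>E {-1, 1}"

definition magnetization :: "nat \<Rightarrow> (nat \<Rightarrow> real) \<Rightarrow> real" where
  "magnetization n \<omega> = (\<Sum>i<n. \<omega> i)"

text \<open>For an edge \<open>e = {i, j}\<close> the inner product is \<open>\<omega> i * \<omega> j\<close>.\<close>

definition annealed_weight :: "nat \<Rightarrow> real \<Rightarrow> real \<Rightarrow> nat \<Rightarrow> (nat \<Rightarrow> real) \<Rightarrow> real" where
  "annealed_weight d \<beta> h n \<omega> =
     measure_pmf.expectation (pmf_of_set (regular_graphs d n))
       (\<lambda>E. exp (\<beta> * (\<Sum>e\<in>E. \<Prod>i\<in>e. \<omega> i) + h * magnetization n \<omega>))"

definition annealed_ising :: "nat \<Rightarrow> real \<Rightarrow> real \<Rightarrow> nat \<Rightarrow> (nat \<Rightarrow> real) measure" where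
  "annealed_ising d \<beta> h n =
     point_measure (spin_configs n)
       (\<lambda>\<omega>. ennreal (annealed_weight d \<beta> h n \<omega>
                      / (\<Sum>\<omega>'\<in>spin_configs n. annealed_weight d \<beta> h n \<omega>')))"

text \<open>The likelihood equation has no solution for the two constant configurations (where the
  magnetization is \<open>n\<close> or \<open>-n\<close>); there the estimator is an unspecified real number.\<close>

definition mle :: "nat \<Rightarrow> real \<Rightarrow> nat \<Rightarrow> (nat \<Rightarrow> real) \<Rightarrow> real" where
  "mle d \<beta> n \<omega> =
     (THE x. (LINT \<omega>'|annealed_ising d \<beta> x n. magnetization n \<omega>') = magnetization n \<omega>)"

text \<open>Convergence in law of \<open>c n * (mle - h)\<close> to \<open>L\<close> as \<open>n\<close> tends to infinity. As \<open>d\<close>-regular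
  graphs on \<open>n\<close> vertices exist only if \<open>d * n\<close> is even, \<open>n\<close> runs along arbitrary strictly
  increasing sequences of numbers with this property.\<close>

definition mle_converges_in_law ::
    "nat \<Rightarrow> real \<Rightarrow> real \<Rightarrow> (nat \<Rightarrow> real) \<Rightarrow> real measure \<Rightarrow> bool" where
  "mle_converges_in_law d \<beta> h c L \<longleftrightarrow>
     (\<forall>r::nat \<Rightarrow> nat. strict_mono r \<and> (\<forall>k. even (d * r k)) \<longrightarrow>
        weak_conv_m
          (\<lambda>k. distr (annealed_ising d \<beta> h (r k)) borel (\<lambda>\<omega>. c (r k) * (mle d \<beta> (r k) \<omega> - h)))
          L)"

definition g_fun :: "real \<Rightarrow> real \<Rightarrow> real" where
  "g_fun \<beta> a = integral {0..min a (1 - a)}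
     (\<lambda>s. ln ((exp (-2 * \<beta>) * (1 - 2 * s) + sqrt (1 + (exp (-4 * \<beta>) - 1) * (1 - 2 * s)\<^sup>2))
              / (2 * (1 - s))))"

text \<open>In HOL \<open>ln 0 = 0\<close>, so \<open>0 * ln 0 = 0\<close> as required.\<close>

definition entropy_fun :: "real \<Rightarrow> real" where
  "entropy_fun a = - a * ln a - (1 - a) * ln (1 - a)"

definition A_fun :: "nat \<Rightarrow> real \<Rightarrow> real \<Rightarrow> real \<Rightarrow> real" where
  "A_fun d \<beta> h a = 2 * h * a + real d * g_fun \<beta> a + entropy_fun a"

definition beta_c :: "nat \<Rightarrow> real" where
  "beta_c d = artanh (1 / (real d - 1))"

definition uniqueness_regime :: "nat \<Rightarrow> (real \<times> real) set" where
  "uniqueness_regime d =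
     {(\<beta>, h). (\<beta> > 0 \<and> h \<noteq> 0) \<or> (0 < \<beta> \<and> \<beta> < beta_c d \<and> h = 0)}"

text \<open>Here \<open>\<sigma>\<close> is the variance, whereas \<open>normal_density\<close> takes the standard deviation.\<close>

definition normal_law :: "real \<Rightarrow> real measure" where
  "normal_law \<sigma> = density lborel (\<lambda>x. ennreal (normal_density 0 (sqrt \<sigma>) x))"

definition pos_half_normal_law :: "real \<Rightarrow> real measure" where
  "pos_half_normal_law \<sigma> = distr (normal_law \<sigma>) borel (\<lambda>z. \<bar>z\<bar>)"

definition neg_half_normal_law :: "real \<Rightarrow> real measure" where
  "neg_half_normal_law \<sigma> = distr (normal_law \<sigma>) borel (\<lambda>z. - \<bar>z\<bar>)"

text \<open>The law of \<open>Y\<^sub>h(t)\<close>, with density proportional to \<open>exp (c * y ^ 4 + 2 * t * y)\<close>;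
  meaningful for \<open>c < 0\<close>.\<close>

definition quartic_law :: "real \<Rightarrow> real \<Rightarrow> real measure" where
  "quartic_law c t = density lborel
     (\<lambda>y. ennreal (exp (c * y ^ 4 + 2 * t * y) / (LINT z|lborel. exp (c * z ^ 4 + 2 * t * z))))"

end

theory Submission
  imports Defs "HOL-Real_Asymp.Real_Asymp"
begin

text \<open>Write \<open>Z(j)\<close> for the annealed partition sum over the configurations with \<open>j\<close> plus spins, at
  \<open>h = 0\<close>. Exchanging the ends of two edges of a regular graph preserves regularity. Applied under
  the annealed measure, such switchings give Stein equations which show that the number of cut edges
  concentrates and that the number of plus neighbours of a minus vertex is asymptotically binomial.
  Hence \<open>Z(j + 1) / Z(j) = exp (A'(j / n)) (1 + O(1 / n))\<close> with the function \<open>A\<close> for \<open>h = 0\<close>, so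
  \<open>Z(j) / Z(i)\<close> is \<open>exp (n (A(j / n) - A(i / n)))\<close> up to a factor \<open>exp (O(\<bar>j - i\<bar> / n))\<close>. Near a maximizer \<open>a\<close> of
  order \<open>p\<close> (2 or 4) the number \<open>J\<close> of plus spins therefore satisfies a limit theorem at scale
  \<open>n powr (1 - 1 / p)\<close>, with density proportional to \<open>exp (c y ^ p)\<close>; shifting the field by
  \<open>t / n powr (1 - 1 / p)\<close> tilts this density by \<open>exp (2 t y)\<close>. As the estimator is at most \<open>x\<close> if and only if
  \<open>J\<close> is at most its mean under the field \<open>x\<close>, this gives the limit of its distribution function.
  For two symmetric maximizers a positive shift selects the upper one, and the lower half of the mass
  always lies below the mean: this produces the atom at \<open>0\<close>.\<close>

section \<open>Cuts of regular graphs\<close>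

text \<open>The law is uniform over simple regular graphs, so edges cannot be exposed one by one
  with independent choices. A switching stays inside this set, and of the (d n)^2 ordered pairs of
  arcs only O(n) cannot be switched; an identity that would be exact for free pairs therefore holds
  with relative error O(1/n). That order is what the limits need: it vanishes when summed over
  windows of width \<open>n powr (1 - 1 / p)\<close>, also for p = 4, and stays bounded over the
  whole bulk. Errors of the size of the fluctuations, of order \<open>n powr (- 1 / 2)\<close> per
  step, would not vanish, so the mean of the cut density is controlled to order 1/n and not only its
  variance. Put b = exp (-2 \<beta>). Moving a vertex with i plus neighbours into the plus set
  multiplies the weight by b^d (1 / b^2)^i, so a ratio of partition sums is a generating function of
  plus degrees at 1 / b^2. The binomial limit makes it a d-th power, whose base is the expression
  under the logarithm in the integrand of g. These estimates degenerate near the constant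
  configurations; a crude bound on a single flip replaces them there. The facts about the maximizers
  of A are derived from the sign of A''.\<close>

definition nbrs :: "nat set set \<Rightarrow> nat \<Rightarrow> nat set" where
  "nbrs E v = {u. {v, u} \<in> E}"

text \<open>Both orientations of an edge occur. An ordered pair of arcs thus records which ends a
  switching exchanges, and prescribing the sides of the four ends selects a kind of
  switching.\<close>

definition arcs :: "nat set set \<Rightarrow> (nat \<times> nat) set" where
  "arcs E = {(v, u). {v, u} \<in> E}"

definition cut_size :: "nat set \<Rightarrow> nat set set \<Rightarrow> nat" where
  "cut_size S E = card {e \<in> E. card (e \<inter> S) = 1}"

text \<open>Counted by edges and not by neighbours, so that its change under a switching can be read
  off from \<open>sum_switch\<close>. For \<open>v\<close> outside \<open>S\<close>, the case that
  matters, it is the number of neighbours in \<open>S\<close>.\<close>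

definition plus_degree :: "nat set \<Rightarrow> nat set set \<Rightarrow> nat \<Rightarrow> nat" where
  "plus_degree S E v = card {e \<in> E. v \<in> e \<and> e \<inter> S \<noteq> {}}"

lemma finite_regular_graphs [simp]: "finite (regular_graphs d n)"
proof -
  have "regular_graphs d n \<subseteq> Pow (Pow {..<n})"
    unfolding regular_graphs_def by auto
  thus ?thesis by (rule finite_subset) simp
qed

lemma regular_graph_edgeD:
  assumes "E \<in> regular_graphs d n" "{v, u} \<in> E"
  shows "v < n" "u < n" "v \<noteq> u"
proof -
  from assms have "{v, u} \<subseteq> {..<n}" "card {v, u} = 2"
    unfolding regular_graphs_def by auto
  thus "v < n" "u < n" "v \<noteq> u" by (auto simp: card_insert_if split: if_splits)
qed

lemma regular_graph_edge_ex:
  assumes "E \<in> regular_graphs d n" "e \<in> E"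
  shows "\<exists>v u. e = {v, u} \<and> v < n \<and> u < n \<and> v \<noteq> u"
proof -
  from assms have "e \<subseteq> {..<n}" "card e = 2"
    unfolding regular_graphs_def by auto
  thus ?thesis by (auto simp: card_2_iff)
qed

lemma finite_regular_graph:
  assumes "E \<in> regular_graphs d n"
  shows "finite E"
proof -
  have "E \<subseteq> Pow {..<n}" using assms unfolding regular_graphs_def by auto
  thus ?thesis by (rule finite_subset) simp
qed

lemma nbrs_subset:
  assumes "E \<in> regular_graphs d n"
  shows "nbrs E v \<subseteq> {..<n}"
  using regular_graph_edgeD[OF assms] unfolding nbrs_def by auto

lemma finite_nbrs [simp]:
  assumes "E \<in> regular_graphs d n"
  shows "finite (nbrs E v)"
  using nbrs_subset[OF assms] by (rule finite_subset) simp

lemma card_nbrs: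
  assumes E: "E \<in> regular_graphs d n" and "v < n"
  shows "card (nbrs E v) = d"
proof -
  have "bij_betw (\<lambda>u. {v, u}) (nbrs E v) {e \<in> E. v \<in> e}"
  proof (rule bij_betwI')
    show "({v, x} = {v, y}) = (x = y)" if "x \<in> nbrs E v" "y \<in> nbrs E v" for x y
      using that by (auto simp: doubleton_eq_iff)
    show "{v, x} \<in> {e \<in> E. v \<in> e}" if "x \<in> nbrs E v" for x
      using that by (auto simp: nbrs_def)
    show "\<exists>x\<in>nbrs E v. y = {v, x}" if y: "y \<in> {e \<in> E. v \<in> e}" for y
    proof -
      from y obtain a c where "y = {a, c}" "a \<noteq> c" using regular_graph_edge_ex[OF E, of y] by auto
      with y have "y = {v, a} \<or> y = {v, c}" by auto
      thus ?thesis using y by (auto simp: nbrs_def)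
    qed
  qed
  hence "card (nbrs E v) = card {e \<in> E. v \<in> e}" by (rule bij_betw_same_card)
  thus ?thesis using assms unfolding regular_graphs_def by auto
qed

lemma arcs_eq_Sigma:
  assumes "E \<in> regular_graphs d n"
  shows "arcs E = Sigma {..<n} (nbrs E)"
  using regular_graph_edgeD[OF assms] unfolding arcs_def nbrs_def by auto

lemma sum_arcs:
  assumes "E \<in> regular_graphs d n"
  shows "(\<Sum>a\<in>arcs E. f a) = (\<Sum>v<n. \<Sum>u\<in>nbrs E v. f (v, u))"
  unfolding arcs_eq_Sigma[OF assms] using assms by (subst sum.Sigma) auto

lemma finite_arcs [simp]: "E \<in> regular_graphs d n \<Longrightarrow> finite (arcs E)"
  by (auto simp: arcs_eq_Sigma)

lemma card_arcs: "E \<in> regular_graphs d n \<Longrightarrow> card (arcs E) = d * n"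
  by (simp add: arcs_eq_Sigma card_nbrs)

text \<open>A cut edge has exactly one orientation that leaves \<open>S\<close>.\<close>

lemma cut_size_eq_card_arcs:
  assumes E: "E \<in> regular_graphs d n"
  shows "cut_size S E = card {(v, u). {v, u} \<in> E \<and> v \<in> S \<and> u \<notin> S}"
proof -
  have "bij_betw (\<lambda>(v, u). {v, u}) {(v, u). {v, u} \<in> E \<and> v \<in> S \<and> u \<notin> S}
          {e \<in> E. card (e \<inter> S) = 1}"
  proof (rule bij_betwI', goal_cases)
    case (1 x y)
    obtain v u v' u' where xy: "x = (v, u)" "y = (v', u')" by (cases x, cases y)
    show ?case using 1 unfolding xy by (simp add: doubleton_eq_iff) blast
  next
    case (2 x)
    obtain v u where x: "x = (v, u)" by (cases x)
    with 2 have vu: "x = (v, u)" "{v, u} \<in> E" "v \<in> S" "u \<notin> S" by simp_all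
    from vu have "{v, u} \<inter> S = {v}" by auto
    with vu show ?case by simp
  next
    case (3 e)
    hence eE: "e \<in> E" "card (e \<inter> S) = 1" by simp_all
    obtain v u where e: "e = {v, u}" "v \<noteq> u" using regular_graph_edge_ex[OF E eE(1)] by blast
    have "card ({v, u} \<inter> S) = 1" using eE(2) unfolding e(1) .
    hence vu: "(v \<in> S \<and> u \<notin> S) \<or> (u \<in> S \<and> v \<notin> S)" using e(2)
      by (cases "v \<in> S"; cases "u \<in> S") (simp_all add: Int_insert_left)
    have e': "e = {u, v}" using e by (simp add: insert_commute)
    from vu show ?case
    proof
      assume "v \<in> S \<and> u \<notin> S"
      thus ?thesis using eE(1) e(1) by (intro bexI[of _ "(v, u)"]) simp_all
    next
      assume "u \<in> S \<and> v \<notin> S"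
      thus ?thesis using eE(1) e' by (intro bexI[of _ "(u, v)"]) simp_all
    qed
  qed
  thus ?thesis unfolding cut_size_def by (rule bij_betw_same_card[symmetric])
qed

lemma cut_size_arcs:
  assumes E: "E \<in> regular_graphs d n"
  shows "(\<Sum>(v, u)\<in>arcs E. of_bool (v \<in> S \<and> u \<notin> S)) = real (cut_size S E)"
    and "(\<Sum>(v, u)\<in>arcs E. of_bool (v \<notin> S \<and> u \<in> S)) = real (cut_size S E)"
proof -
  have fin: "finite (arcs E)" using E by simp
  have "(\<Sum>(v, u)\<in>arcs E. of_bool (v \<in> S \<and> u \<notin> S)) = (\<Sum>a\<in>arcs E. of_bool (fst a \<in> S \<and> snd a \<notin> S) :: real)"
    by (simp add: case_prod_unfold)
  also have "\<dots> = real (card {a \<in> arcs E. fst a \<in> S \<and> snd a \<notin> S})"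
    by (subst sum_of_bool_eq) (use fin in \<open>auto simp: Int_def\<close>)
  also have "{a \<in> arcs E. fst a \<in> S \<and> snd a \<notin> S} = {(v, u). {v, u} \<in> E \<and> v \<in> S \<and> u \<notin> S}"
    by (auto simp: arcs_def)
  finally show 1: "(\<Sum>(v, u)\<in>arcs E. of_bool (v \<in> S \<and> u \<notin> S)) = real (cut_size S E)"
    by (simp add: cut_size_eq_card_arcs[OF E])
  have "(\<Sum>(v, u)\<in>arcs E. of_bool (v \<notin> S \<and> u \<in> S)) = (\<Sum>(v, u)\<in>arcs E. of_bool (v \<in> S \<and> u \<notin> S) :: real)"
    by (rule sum.reindex_bij_witness[of _ prod.swap prod.swap])
       (auto simp: arcs_def insert_commute)
  with 1 show "(\<Sum>(v, u)\<in>arcs E. of_bool (v \<notin> S \<and> u \<in> S)) = real (cut_size S E)" by simp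
qed

lemma sum_arcs_fst:
  assumes E: "E \<in> regular_graphs d n" and S: "S \<subseteq> {..<n}"
  shows "(\<Sum>(v, u)\<in>arcs E. of_bool (v \<in> S)) = real d * real (card S)"
proof -
  have "(\<Sum>(v, u)\<in>arcs E. of_bool (v \<in> S)) = (\<Sum>v<n. real d * of_bool (v \<in> S))"
    unfolding sum_arcs[OF E] by (intro sum.cong) (auto simp: card_nbrs[OF E])
  also have "\<dots> = real d * real (card S)"
  proof -
    have "{..<n} \<inter> {v. v \<in> S} = S" using S by auto
    thus ?thesis by (simp flip: sum_distrib_left add: sum_of_bool_eq)
  qed
  finally show ?thesis .
qed

text \<open>Each class owns \<open>d\<close> half-edges per vertex, and those that do not lead
  across the cut are inner arcs. Products of such counts are the numbers of pairs of arcs for each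
  kind of switching.\<close>

lemma inner_arcs:
  assumes E: "E \<in> regular_graphs d n" and S: "S \<subseteq> {..<n}"
  shows "(\<Sum>(v, u)\<in>arcs E. of_bool (v \<in> S \<and> u \<in> S)) = real d * real (card S) - real (cut_size S E)"
    and "(\<Sum>(v, u)\<in>arcs E. of_bool (v \<notin> S \<and> u \<notin> S))
          = real d * (real n - real (card S)) - real (cut_size S E)"
proof -
  have "(\<Sum>(v, u)\<in>arcs E. of_bool (v \<in> S \<and> u \<in> S) :: real)
      = (\<Sum>(v, u)\<in>arcs E. of_bool (v \<in> S) - of_bool (v \<in> S \<and> u \<notin> S))"
    by (intro sum.cong) auto
  also have "\<dots> = (\<Sum>(v, u)\<in>arcs E. of_bool (v \<in> S)) - (\<Sum>(v, u)\<in>arcs E. of_bool (v \<in> S \<and> u \<notin> S))"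
    by (simp add: case_prod_unfold sum_subtractf)
  finally show "(\<Sum>(v, u)\<in>arcs E. of_bool (v \<in> S \<and> u \<in> S)) = real d * real (card S) - real (cut_size S E)"
    by (simp add: cut_size_arcs[OF E] sum_arcs_fst[OF E S])
  have "(\<Sum>(v, u)\<in>arcs E. of_bool (v \<notin> S \<and> u \<notin> S) :: real)
      = (\<Sum>(v, u)\<in>arcs E. 1 - of_bool (v \<in> S) - of_bool (v \<notin> S \<and> u \<in> S))"
    by (intro sum.cong) auto
  also have "\<dots> = (\<Sum>(v, u)\<in>arcs E. 1) - (\<Sum>(v, u)\<in>arcs E. of_bool (v \<in> S))
      - (\<Sum>(v, u)\<in>arcs E. of_bool (v \<notin> S \<and> u \<in> S))"
    by (simp add: case_prod_unfold sum_subtractf)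
  finally show "(\<Sum>(v, u)\<in>arcs E. of_bool (v \<notin> S \<and> u \<notin> S))
          = real d * (real n - real (card S)) - real (cut_size S E)"
    by (simp add: cut_size_arcs[OF E] sum_arcs_fst[OF E S] card_arcs[OF E] algebra_simps)
qed

lemma cut_size_le:
  assumes E: "E \<in> regular_graphs d n" and S: "S \<subseteq> {..<n}"
  shows "real (cut_size S E) \<le> real d * real (card S)"
    and "real (cut_size S E) \<le> real d * (real n - real (card S))"
proof -
  have "0 \<le> (\<Sum>(v, u)\<in>arcs E. of_bool (v \<in> S \<and> u \<in> S) :: real)" by (intro sum_nonneg) auto
  thus "real (cut_size S E) \<le> real d * real (card S)" unfolding inner_arcs[OF E S] by simp
  have "0 \<le> (\<Sum>(v, u)\<in>arcs E. of_bool (v \<notin> S \<and> u \<notin> S) :: real)" by (intro sum_nonneg) auto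
  thus "real (cut_size S E) \<le> real d * (real n - real (card S))" unfolding inner_arcs[OF E S] by simp
qed

lemma plus_degree_eq:
  assumes E: "E \<in> regular_graphs d n" and v: "v \<notin> S"
  shows "plus_degree S E v = card (nbrs E v \<inter> S)"
proof -
  have "bij_betw (\<lambda>u. {v, u}) (nbrs E v \<inter> S) {e \<in> E. v \<in> e \<and> e \<inter> S \<noteq> {}}"
  proof (rule bij_betwI', goal_cases)
    case (1 x y) thus ?case by (auto simp: doubleton_eq_iff)
  next
    case (2 x) thus ?case by (auto simp: nbrs_def)
  next
    case (3 e)
    hence eE: "e \<in> E" "v \<in> e" "e \<inter> S \<noteq> {}" by simp_all
    obtain a c where ac: "e = {a, c}" "a \<noteq> c" using regular_graph_edge_ex[OF E eE(1)] by blast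
    from ac eE(2) obtain u where "e = {v, u}" by (metis insert_commute insertE singletonD)
    with eE v show ?case by (intro bexI[of _ u]) (auto simp: nbrs_def)
  qed
  thus ?thesis unfolding plus_degree_def by (rule bij_betw_same_card[symmetric])
qed

lemma plus_degree_le:
  assumes E: "E \<in> regular_graphs d n" and v: "v \<notin> S" "v < n"
  shows "plus_degree S E v \<le> d"
  using card_mono[of "nbrs E v" "nbrs E v \<inter> S"] E v by (simp add: plus_degree_eq card_nbrs)

section \<open>Switchings\<close>

definition switch :: "nat set set \<Rightarrow> nat \<Rightarrow> nat \<Rightarrow> nat \<Rightarrow> nat \<Rightarrow> nat set set" where
  "switch E v u x y = insert {v, y} (insert {x, u} (E - {{v, u}, {x, y}}))"

text \<open>The conditions say that the two new edges are neither loops nor already present, so the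
  result is again a simple graph. They force the four vertices to be distinct, see
  \<open>switchable_distinct\<close>.\<close>

definition switchable :: "nat set set \<Rightarrow> ((nat \<times> nat) \<times> (nat \<times> nat)) set" where
  "switchable E = {((v, u), (x, y)). {v, u} \<in> E \<and> {x, y} \<in> E \<and> {v, y} \<notin> E \<and> {x, u} \<notin> E
                     \<and> v \<noteq> y \<and> x \<noteq> u}"

text \<open>Degrees, cut sizes and plus degrees are all sums over edges, so this one formula gives
  the effect of a switching on each of them.\<close>

lemma sum_switch:
  fixes f :: "nat set \<Rightarrow> real"
  assumes E: "E \<in> regular_graphs d n" and sw: "((v, u), (x, y)) \<in> switchable E"
  shows "(\<Sum>e\<in>switch E v u x y. f e) = (\<Sum>e\<in>E. f e) - f {v, u} - f {x, y} + f {v, y} + f {x, u}"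
proof -
  have fin: "finite E" using E by (rule finite_regular_graph)
  have mem: "{v, u} \<in> E" "{x, y} \<in> E" "{v, y} \<notin> E" "{x, u} \<notin> E" "v \<noteq> y" "x \<noteq> u"
    using sw by (auto simp: switchable_def)
  have ne: "{v, u} \<noteq> {x, y}" using mem by (auto simp: doubleton_eq_iff)
  have ne': "{v, y} \<noteq> {x, u}" using mem regular_graph_edgeD(3)[OF E mem(1)]
    by (metis doubleton_eq_iff)
  have "(\<Sum>e\<in>E. f e) = f {v, u} + (f {x, y} + (\<Sum>e\<in>E - {{v, u}} - {{x, y}}. f e))"
    using fin mem ne by (subst sum.remove[of _ "{v,u}"], simp, simp, subst sum.remove[of _ "{x,y}"]) auto
  moreover have "E - {{v, u}} - {{x, y}} = E - {{v, u}, {x, y}}" by auto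
  moreover have "(\<Sum>e\<in>switch E v u x y. f e) = f {v, y} + (f {x, u} + (\<Sum>e\<in>E - {{v, u}, {x, y}}. f e))"
    unfolding switch_def using fin mem ne' by (subst sum.insert, simp, simp, subst sum.insert) auto
  ultimately show ?thesis by simp
qed

lemma switchable_distinct:
  assumes E: "E \<in> regular_graphs d n" and sw: "((v, u), (x, y)) \<in> switchable E"
  shows "v \<noteq> u" "x \<noteq> y" "v \<noteq> y" "x \<noteq> u" "v \<noteq> x" "u \<noteq> y" "v < n" "u < n" "x < n" "y < n"
proof -
  have mem: "{v, u} \<in> E" "{x, y} \<in> E" "{v, y} \<notin> E" "{x, u} \<notin> E" "v \<noteq> y" "x \<noteq> u"
    using sw by (auto simp: switchable_def)
  show "v \<noteq> u" "x \<noteq> y" "v < n" "u < n" "x < n" "y < n" using regular_graph_edgeD[OF E] mem by auto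
  show "v \<noteq> y" "x \<noteq> u" "v \<noteq> x" "u \<noteq> y" using mem by auto
qed

lemma switch_regular:
  assumes E: "E \<in> regular_graphs d n" and sw: "((v, u), (x, y)) \<in> switchable E"
  shows "switch E v u x y \<in> regular_graphs d n"
proof -
  note D = switchable_distinct[OF assms]
  have fin: "finite E" using E by (rule finite_regular_graph)
  have fin': "finite (switch E v u x y)" using fin by (simp add: switch_def)
  have "switch E v u x y \<subseteq> {e. e \<subseteq> {..<n} \<and> card e = 2}"
    using E D unfolding switch_def regular_graphs_def by auto
  moreover have "card {e \<in> switch E v u x y. z \<in> e} = d" if "z < n" for z
  proof -
    have c: "real (card {e \<in> F. z \<in> e}) = (\<Sum>e\<in>F. of_bool (z \<in> e))" if "finite F" for F :: "nat set set"
      using that by (simp add: sum_of_bool_eq Int_def)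
    have "real (card {e \<in> switch E v u x y. z \<in> e}) = real (card {e \<in> E. z \<in> e})"
      unfolding c[OF fin'] c[OF fin] sum_switch[OF assms] using D by auto
    also have "card {e \<in> E. z \<in> e} = d" using E that by (auto simp: regular_graphs_def)
    finally show ?thesis by simp
  qed
  ultimately show ?thesis unfolding regular_graphs_def by auto
qed

lemma switch_switchable:
  assumes E: "E \<in> regular_graphs d n" and sw: "((v, u), (x, y)) \<in> switchable E"
  shows "((v, y), (x, u)) \<in> switchable (switch E v u x y)"
    and "switch (switch E v u x y) v y x u = E"
proof -
  note D = switchable_distinct[OF assms]
  have mem: "{v, u} \<in> E" "{x, y} \<in> E" "{v, y} \<notin> E" "{x, u} \<notin> E" "v \<noteq> y" "x \<noteq> u"
    using sw by (auto simp: switchable_def)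
  have ne: "{v, u} \<noteq> {x, u}" "{v, u} \<noteq> {v, y}" "{x, y} \<noteq> {v, y}" "{x, y} \<noteq> {x, u}"
    using D by (auto simp: doubleton_eq_iff)
  show "((v, y), (x, u)) \<in> switchable (switch E v u x y)"
    using D ne unfolding switchable_def switch_def by simp
  show "switch (switch E v u x y) v y x u = E"
    unfolding switch_def using mem ne by auto
qed

text \<open>Switching and exchanging \<open>u\<close> with \<open>y\<close> in the two arcs is an
  involution on the triples of a graph and a switchable pair, by \<open>switch_switchable\<close>.
  The equality is the change of variables along it.\<close>

lemma sum_switchable:
  fixes F F' :: "nat set set \<Rightarrow> nat \<Rightarrow> nat \<Rightarrow> nat \<Rightarrow> nat \<Rightarrow> real"
  assumes FF': "\<And>E v u x y. E \<in> regular_graphs d n \<Longrightarrow> ((v, u), (x, y)) \<in> switchable E \<Longrightarrow>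
                  F E v u x y = F' (switch E v u x y) v y x u"
  shows "(\<Sum>E\<in>regular_graphs d n. \<Sum>((v, u), (x, y))\<in>switchable E. F E v u x y)
       = (\<Sum>E\<in>regular_graphs d n. \<Sum>((v, u), (x, y))\<in>switchable E. F' E v u x y)"
proof -
  have sub: "switchable E \<subseteq> arcs E \<times> arcs E" for E by (auto simp: switchable_def arcs_def)
  have fin: "finite (switchable E)" if "E \<in> regular_graphs d n" for E
    using sub by (rule finite_subset) (use that in auto)
  let ?T = "Sigma (regular_graphs d n) switchable"
  let ?t = "\<lambda>(E, (v, u), (x, y)). (switch E v u x y, (v, y), (x, u))"
  have "(\<Sum>(E, (v, u), (x, y))\<in>?T. F E v u x y) = (\<Sum>(E, (v, u), (x, y))\<in>?T. F' E v u x y)"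
    by (rule sum.reindex_bij_witness[of _ ?t ?t])
       (auto simp: switch_switchable switch_regular FF')
  thus ?thesis using fin by (subst (1 2) sum.Sigma) auto
qed

lemma card_not_switchable:
  assumes E: "E \<in> regular_graphs d n"
  shows "card (arcs E \<times> arcs E - switchable E) \<le> 2 * d\<^sup>2 * (d + 1) * n"
proof -
  \<comment> \<open>The arcs \<open>(x, y)\<close> that cannot be switched with
    \<open>(v, u)\<close>: either \<open>y\<close> is \<open>v\<close> or a neighbour of it, or
    \<open>x\<close> is \<open>u\<close> or a neighbour of it. Each alternative leaves at most
    \<open>(d + 1) * d\<close> arcs.\<close>
  let ?B = "\<lambda>(v, u). (\<lambda>(y, x). (x, y)) ` Sigma (insert v (nbrs E v)) (nbrs E)
                \<union> Sigma (insert u (nbrs E u)) (nbrs E)"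
  have sub: "arcs E \<times> arcs E - switchable E \<subseteq> Sigma (arcs E) ?B"
    by (auto simp: switchable_def arcs_def nbrs_def insert_commute image_iff)
  have card_S: "card (Sigma (insert v (nbrs E v)) (nbrs E)) \<le> (d + 1) * d"
    and fin_S: "finite (Sigma (insert v (nbrs E v)) (nbrs E))" if "v < n" for v
  proof -
    have "card (Sigma (insert v (nbrs E v)) (nbrs E)) = (\<Sum>z\<in>insert v (nbrs E v). card (nbrs E z))"
      using E by simp
    also have "\<dots> = (\<Sum>z\<in>insert v (nbrs E v). d)"
      using that nbrs_subset[OF E] by (intro sum.cong) (auto intro!: card_nbrs[OF E])
    also have "\<dots> \<le> (d + 1) * d"
      using E card_nbrs[OF E that] by (simp add: card_insert_if)
    finally show "card (Sigma (insert v (nbrs E v)) (nbrs E)) \<le> (d + 1) * d" .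
    show "finite (Sigma (insert v (nbrs E v)) (nbrs E))" using E by auto
  qed
  have B: "card (?B a) \<le> 2 * d * (d + 1)" and finB: "finite (?B a)" if "a \<in> arcs E" for a
  proof -
    obtain v u where a: "a = (v, u)" by (cases a)
    with that have "v < n" "u < n" using regular_graph_edgeD[OF E] by (auto simp: arcs_def)
    have "card (?B a) \<le> card ((\<lambda>(y, x). (x, y)) ` Sigma (insert v (nbrs E v)) (nbrs E))
             + card (Sigma (insert u (nbrs E u)) (nbrs E))"
      unfolding a by (simp add: card_Un_le)
    also have "\<dots> \<le> (d + 1) * d + (d + 1) * d"
      by (intro add_mono order.trans[OF card_image_le] card_S fin_S \<open>v < n\<close> \<open>u < n\<close>)
    finally show "card (?B a) \<le> 2 * d * (d + 1)" by (simp add: algebra_simps)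
    show "finite (?B a)" unfolding a using fin_S \<open>v < n\<close> \<open>u < n\<close> by auto
  qed
  have "card (arcs E \<times> arcs E - switchable E) \<le> card (Sigma (arcs E) ?B)"
    using sub finB E by (intro card_mono finite_SigmaI) auto
  also have "\<dots> = (\<Sum>a\<in>arcs E. card (?B a))" using finB E by (intro card_SigmaI) auto
  also have "\<dots> \<le> (\<Sum>a\<in>arcs E. 2 * d * (d + 1))" by (intro sum_mono B)
  also have "\<dots> = 2 * d\<^sup>2 * (d + 1) * n"
    by (simp add: card_arcs[OF E] power2_eq_square algebra_simps)
  finally show ?thesis .
qed

text \<open>On switchable pairs the involution compares the two sums exactly. Over all pairs of arcs
  the sums will factorize into arc counts; passing to them costs at most
  \<open>2 * d\<^sup>2 * (d + 1) * n\<close> pairs on either side, each bounded by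
  \<open>B E\<close>.\<close>

lemma switching_estimate:
  fixes F F' :: "nat set set \<Rightarrow> nat \<Rightarrow> nat \<Rightarrow> nat \<Rightarrow> nat \<Rightarrow> real"
  assumes FF': "\<And>E v u x y. E \<in> regular_graphs d n \<Longrightarrow> ((v, u), (x, y)) \<in> switchable E \<Longrightarrow>
                  F E v u x y = F' (switch E v u x y) v y x u"
  assumes B: "\<And>E v u x y. E \<in> regular_graphs d n \<Longrightarrow> v < n \<Longrightarrow> \<bar>F E v u x y\<bar> \<le> B E"
             "\<And>E v u x y. E \<in> regular_graphs d n \<Longrightarrow> v < n \<Longrightarrow> {v, u} \<in> E \<Longrightarrow> \<bar>F' E v u x y\<bar> \<le> B E"
  shows "\<bar>(\<Sum>E\<in>regular_graphs d n. \<Sum>(v, u)\<in>arcs E. \<Sum>(x, y)\<in>arcs E. F E v u x y)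
        - (\<Sum>E\<in>regular_graphs d n. \<Sum>(v, u)\<in>arcs E. \<Sum>(x, y)\<in>arcs E. F' E v u x y)\<bar>
       \<le> real (4 * d\<^sup>2 * (d + 1) * n) * (\<Sum>E\<in>regular_graphs d n. B E)"
proof -
  let ?R = "regular_graphs d n" and ?c = "2 * d\<^sup>2 * (d + 1) * n"
  have key: "\<bar>(\<Sum>E\<in>?R. \<Sum>(v, u)\<in>arcs E. \<Sum>(x, y)\<in>arcs E. G E v u x y)
        - (\<Sum>E\<in>?R. \<Sum>((v, u), (x, y))\<in>switchable E. G E v u x y)\<bar> \<le> ?c * (\<Sum>E\<in>?R. B E)"
    if G: "\<And>E v u x y. E \<in> ?R \<Longrightarrow> v < n \<Longrightarrow> {v, u} \<in> E \<Longrightarrow> \<bar>G E v u x y\<bar> \<le> B E" for G :: "nat set set \<Rightarrow> nat \<Rightarrow> nat \<Rightarrow> nat \<Rightarrow> nat \<Rightarrow> real"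
  proof -
    have one: "\<bar>(\<Sum>(v, u)\<in>arcs E. \<Sum>(x, y)\<in>arcs E. G E v u x y)
        - (\<Sum>((v, u), (x, y))\<in>switchable E. G E v u x y)\<bar> \<le> ?c * B E" if E: "E \<in> ?R" for E
    \<comment> \<open>Nonnegativity of \<open>B E\<close> follows from the bound \<open>G\<close> as
      soon as there is an arc; without arcs the factor \<open>?c\<close> is 0.\<close>
    proof (cases "arcs E = {}")
      case True
      hence "switchable E = {}" by (auto simp: switchable_def arcs_def)
      have "d * n = 0" using True card_arcs[OF E] by simp
      hence "0 \<le> ?c * B E" by auto
      thus ?thesis using True \<open>switchable E = {}\<close> by simp
    next
      case False
      then obtain v u where "(v, u) \<in> arcs E" by auto
      hence B0: "B E \<ge> 0" using G[OF E, of v u] regular_graph_edgeD[OF E, of v u]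
        by (force simp: arcs_def)
      have sub: "switchable E \<subseteq> arcs E \<times> arcs E" by (auto simp: switchable_def arcs_def)
      let ?g = "\<lambda>((v, u), (x, y)). G E v u x y"
      have "(\<Sum>(v, u)\<in>arcs E. \<Sum>(x, y)\<in>arcs E. G E v u x y) = (\<Sum>p\<in>arcs E \<times> arcs E. ?g p)"
        by (simp add: sum.cartesian_product case_prod_unfold)
      also have "\<dots> = (\<Sum>p\<in>arcs E \<times> arcs E - switchable E. ?g p) + (\<Sum>p\<in>switchable E. ?g p)"
        using E by (intro sum.subset_diff sub) auto
      finally have "\<bar>(\<Sum>(v, u)\<in>arcs E. \<Sum>(x, y)\<in>arcs E. G E v u x y)
        - (\<Sum>((v, u), (x, y))\<in>switchable E. G E v u x y)\<bar> = \<bar>\<Sum>p\<in>arcs E \<times> arcs E - switchable E. ?g p\<bar>"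
        by simp
      also have "\<dots> \<le> (\<Sum>p\<in>arcs E \<times> arcs E - switchable E. \<bar>?g p\<bar>)" by (rule sum_abs)
      also have "\<dots> \<le> (\<Sum>p\<in>arcs E \<times> arcs E - switchable E. B E)"
        using G[OF E] regular_graph_edgeD(1)[OF E] by (intro sum_mono) (auto simp: arcs_def)
      also have "\<dots> = real (card (arcs E \<times> arcs E - switchable E)) * B E" by simp
      also have "\<dots> \<le> real ?c * B E"
        using card_not_switchable[OF E] B0 by (intro mult_right_mono) (simp_all flip: of_nat_mult of_nat_power of_nat_Suc of_nat_add)
      finally show ?thesis by simp
    qed
    have "\<bar>(\<Sum>E\<in>?R. \<Sum>(v, u)\<in>arcs E. \<Sum>(x, y)\<in>arcs E. G E v u x y)
        - (\<Sum>E\<in>?R. \<Sum>((v, u), (x, y))\<in>switchable E. G E v u x y)\<bar>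
      = \<bar>\<Sum>E\<in>?R. (\<Sum>(v, u)\<in>arcs E. \<Sum>(x, y)\<in>arcs E. G E v u x y)
        - (\<Sum>((v, u), (x, y))\<in>switchable E. G E v u x y)\<bar>" by (simp add: sum_subtractf)
    also have "\<dots> \<le> (\<Sum>E\<in>?R. ?c * B E)"
      by (rule order.trans[OF sum_abs sum_mono[OF one]])
    finally show ?thesis by (simp add: sum_distrib_left)
  qed
  have "(\<Sum>E\<in>?R. \<Sum>((v, u), (x, y))\<in>switchable E. F E v u x y)
       = (\<Sum>E\<in>?R. \<Sum>((v, u), (x, y))\<in>switchable E. F' E v u x y)"
    by (rule sum_switchable) (rule FF')
  moreover have "real (4 * d\<^sup>2 * (d + 1) * n) * (\<Sum>E\<in>?R. B E) = ?c * (\<Sum>E\<in>?R. B E) + ?c * (\<Sum>E\<in>?R. B E)"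
    by simp
  moreover have "\<bar>(\<Sum>E\<in>?R. \<Sum>(v, u)\<in>arcs E. \<Sum>(x, y)\<in>arcs E. F E v u x y)
        - (\<Sum>E\<in>?R. \<Sum>((v, u), (x, y))\<in>switchable E. F E v u x y)\<bar> \<le> ?c * (\<Sum>E\<in>?R. B E)"
    by (rule key) (simp add: B(1))
  moreover have "\<bar>(\<Sum>E\<in>?R. \<Sum>(v, u)\<in>arcs E. \<Sum>(x, y)\<in>arcs E. F' E v u x y)
        - (\<Sum>E\<in>?R. \<Sum>((v, u), (x, y))\<in>switchable E. F' E v u x y)\<bar> \<le> ?c * (\<Sum>E\<in>?R. B E)"
    by (rule key) (simp add: B(2))
  ultimately show ?thesis by linarith
qed

lemma card_doubleton_Int_eq_1:
  "v \<noteq> u \<Longrightarrow> card ({v, u} \<inter> S) = 1 \<longleftrightarrow> (v \<in> S) \<noteq> (u \<in> S)"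
  by (cases "v \<in> S"; cases "u \<in> S") (simp_all add: Int_insert_left)

lemma cut_size_switch:
  assumes E: "E \<in> regular_graphs d n" and sw: "((v, u), (x, y)) \<in> switchable E"
  shows "real (cut_size S (switch E v u x y)) = real (cut_size S E)
      - of_bool ((v \<in> S) \<noteq> (u \<in> S)) - of_bool ((x \<in> S) \<noteq> (y \<in> S))
      + of_bool ((v \<in> S) \<noteq> (y \<in> S)) + of_bool ((x \<in> S) \<noteq> (u \<in> S))"
proof -
  have c: "real (cut_size S F) = (\<Sum>e\<in>F. of_bool (card (e \<inter> S) = 1))" if "finite F" for F
    unfolding cut_size_def using that by (simp add: sum_of_bool_eq Int_def)
  note D = switchable_distinct[OF assms]
  have 1: "finite E" using E by (rule finite_regular_graph)
  have 2: "finite (switch E v u x y)" using switch_regular[OF assms] by (rule finite_regular_graph)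
  show ?thesis unfolding c[OF 1] c[OF 2] sum_switch[OF assms]
    using D by (simp only: card_doubleton_Int_eq_1 not_False_eq_True)
qed

text \<open>\<open>v\<close> trades its neighbour \<open>u\<close> outside \<open>S\<close> for
  \<open>y\<close> inside.\<close>

lemma plus_degree_switch:
  assumes E: "E \<in> regular_graphs d n" and sw: "((v, u), (x, y)) \<in> switchable E"
    and S: "v \<notin> S" "u \<notin> S" "x \<notin> S" "y \<in> S"
  shows "plus_degree S (switch E v u x y) v = Suc (plus_degree S E v)"
proof -
  have c: "real (plus_degree S F v) = (\<Sum>e\<in>F. of_bool (v \<in> e \<and> e \<inter> S \<noteq> {}))" if "finite F" for F
    unfolding plus_degree_def using that by (simp add: sum_of_bool_eq Int_def)
  note D = switchable_distinct[OF assms(1,2)]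
  have 1: "finite E" using E by (rule finite_regular_graph)
  have 2: "finite (switch E v u x y)" using switch_regular[OF assms(1,2)] by (rule finite_regular_graph)
  have "real (plus_degree S (switch E v u x y) v) = real (plus_degree S E v) + 1"
    unfolding c[OF 1] c[OF 2] sum_switch[OF assms(1,2)] using D S by simp
  thus ?thesis by linarith
qed

lemma sum_arcs_product:
  fixes f g :: "nat \<Rightarrow> nat \<Rightarrow> real"
  shows "(\<Sum>(v, u)\<in>arcs E. \<Sum>(x, y)\<in>arcs E. c * (f v u * g x y))
       = c * ((\<Sum>(v, u)\<in>arcs E. f v u) * (\<Sum>(x, y)\<in>arcs E. g x y))"
  by (simp add: case_prod_unfold sum_distrib_left[symmetric] sum_distrib_right[symmetric])

lemma sum_arcs_outside_minus:
  fixes f :: "nat \<Rightarrow> real"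
  assumes E: "E \<in> regular_graphs d n"
  shows "(\<Sum>(v, u)\<in>arcs E. f v * of_bool (v \<notin> S \<and> u \<in> S))
           = (\<Sum>v\<in>{..<n} - S. f v * real (plus_degree S E v))" (is ?A)
    and "(\<Sum>(v, u)\<in>arcs E. f v * of_bool (v \<notin> S \<and> u \<notin> S))
           = (\<Sum>v\<in>{..<n} - S. f v * (real d - real (plus_degree S E v)))" (is ?B)
proof -
  have pd: "(\<Sum>u\<in>nbrs E v. of_bool (u \<in> S)) = real (plus_degree S E v)" if "v \<notin> S" for v
    using E that by (simp add: plus_degree_eq sum_of_bool_eq Int_def)
  have pd': "(\<Sum>u\<in>nbrs E v. of_bool (u \<notin> S)) = real d - real (plus_degree S E v)"
    if "v \<notin> S" "v < n" for v
  proof -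
    have "(\<Sum>u\<in>nbrs E v. of_bool (u \<notin> S) :: real) = (\<Sum>u\<in>nbrs E v. 1 - of_bool (u \<in> S))"
      by (intro sum.cong) auto
    also have "\<dots> = real d - real (plus_degree S E v)"
      by (simp add: sum_subtractf pd[OF that(1)] card_nbrs[OF E that(2)])
    finally show ?thesis .
  qed
  have "(\<Sum>(v, u)\<in>arcs E. f v * of_bool (v \<notin> S \<and> u \<in> S))
      = (\<Sum>v<n. f v * of_bool (v \<notin> S) * (\<Sum>u\<in>nbrs E v. of_bool (u \<in> S)))"
    by (simp add: sum_arcs[OF E] of_bool_conj sum_distrib_left algebra_simps)
  also have "\<dots> = (\<Sum>v<n. if v \<in> {..<n} - S then f v * real (plus_degree S E v) else 0)"
    by (intro sum.cong) (auto simp: pd)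
  finally show ?A by (simp add: sum.If_cases Int_def Diff_eq)
  have "(\<Sum>(v, u)\<in>arcs E. f v * of_bool (v \<notin> S \<and> u \<notin> S))
      = (\<Sum>v<n. f v * of_bool (v \<notin> S) * (\<Sum>u\<in>nbrs E v. of_bool (u \<notin> S)))"
    by (simp add: sum_arcs[OF E] of_bool_conj sum_distrib_left algebra_simps)
  also have "\<dots> = (\<Sum>v<n. if v \<in> {..<n} - S then f v * (real d - real (plus_degree S E v)) else 0)"
    by (intro sum.cong) (auto simp: pd')
  finally show ?B by (simp add: sum.If_cases Int_def Diff_eq)
qed

section \<open>Stein equations\<close>

text \<open>For \<open>b = exp (-2 * \<beta>)\<close> this is the Gibbs weight of a graph at zero
  field, up to a factor that depends only on \<open>\<beta>\<close>, \<open>d\<close> and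
  \<open>n\<close>, see \<open>interaction_energy\<close>.\<close>

definition cut_weight :: "real \<Rightarrow> nat set \<Rightarrow> nat set set \<Rightarrow> real" where
  "cut_weight b S E = b ^ cut_size S E"

definition cut_sum :: "nat \<Rightarrow> nat \<Rightarrow> real \<Rightarrow> nat set \<Rightarrow> real" where
  "cut_sum d n b S = (\<Sum>E\<in>regular_graphs d n. cut_weight b S E)"

text \<open>The switchings that turn two edges inside the two classes into two cut edges give a
  Stein equation for the cut size.\<close>

lemma stein_cut_size:
  assumes S: "S \<subseteq> {..<n}" and b: "0 < b" "b \<le> 1"
    and \<theta>: "\<And>k. -2 \<le> k \<Longrightarrow> k \<le> real d * real n \<Longrightarrow> \<bar>\<theta> k\<bar> \<le> B"
  shows "\<bar>\<Sum>E\<in>regular_graphs d n. cut_weight b S E *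
           (b\<^sup>2 * ((real d * real (card S) - real (cut_size S E))
               * (real d * (real n - real (card S)) - real (cut_size S E))) * \<theta> (real (cut_size S E))
            - (real (cut_size S E))\<^sup>2 * \<theta> (real (cut_size S E) - 2))\<bar>
         \<le> real (4 * d\<^sup>2 * (d + 1) * n) * B * cut_sum d n b S"
proof -
  let ?R = "regular_graphs d n" and ?K = "\<lambda>E. real (cut_size S E)"
  define F where "F = (\<lambda>E v u x y. cut_weight b S E * b\<^sup>2 * \<theta> (?K E)
                  * (of_bool (v \<in> S \<and> u \<in> S) * of_bool (x \<notin> S \<and> y \<notin> S)))"
  \<comment> \<open>Seen from the switched graph the cut size has grown by 2, so the test function
    is taken at \<open>?K E - 2\<close>; the factor \<open>b\<^sup>2\<close> of \<open>F\<close> has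
    become part of the weight.\<close>
  define F' where "F' = (\<lambda>E v u x y. cut_weight b S E * \<theta> (?K E - 2)
                  * (of_bool (v \<in> S \<and> u \<notin> S) * of_bool (x \<notin> S \<and> y \<in> S)))"
  have w0: "cut_weight b S E \<ge> 0" for E using b by (simp add: cut_weight_def)
  have Kle: "?K E \<le> real d * real n" if "E \<in> ?R" for E
  proof -
    have "card S \<le> n" using card_mono[OF _ S] by simp
    hence "real d * real (card S) \<le> real d * real n" by (intro mult_left_mono) auto
    with cut_size_le(1)[OF that S] show ?thesis by linarith
  qed
  have sumF: "(\<Sum>(v, u)\<in>arcs E. \<Sum>(x, y)\<in>arcs E. F E v u x y) =
      cut_weight b S E * b\<^sup>2 * \<theta> (?K E) * ((real d * real (card S) - ?K E)
               * (real d * (real n - real (card S)) - ?K E))" if E: "E \<in> ?R" for E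
    unfolding F_def sum_arcs_product inner_arcs[OF E S] ..
  have sumF': "(\<Sum>(v, u)\<in>arcs E. \<Sum>(x, y)\<in>arcs E. F' E v u x y) =
      cut_weight b S E * \<theta> (?K E - 2) * (?K E * ?K E)" if E: "E \<in> ?R" for E
    unfolding F'_def sum_arcs_product cut_size_arcs[OF E] ..
  have "\<bar>(\<Sum>E\<in>?R. \<Sum>(v, u)\<in>arcs E. \<Sum>(x, y)\<in>arcs E. F E v u x y)
        - (\<Sum>E\<in>?R. \<Sum>(v, u)\<in>arcs E. \<Sum>(x, y)\<in>arcs E. F' E v u x y)\<bar>
       \<le> real (4 * d\<^sup>2 * (d + 1) * n) * (\<Sum>E\<in>?R. B * cut_weight b S E)"
  proof (rule switching_estimate)
    fix E v u x y
    assume E: "E \<in> ?R" and sw: "((v, u), (x, y)) \<in> switchable E"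
    show "F E v u x y = F' (switch E v u x y) v y x u"
    proof (cases "v \<in> S \<and> u \<in> S \<and> x \<notin> S \<and> y \<notin> S")
      case True
      hence K: "?K (switch E v u x y) = ?K E + 2"
        using cut_size_switch[OF E sw, of S] by simp
      hence "cut_size S (switch E v u x y) = cut_size S E + 2" by linarith
      hence "cut_weight b S (switch E v u x y) = cut_weight b S E * b\<^sup>2"
        by (simp add: cut_weight_def power_add power2_eq_square)
      with True K show ?thesis by (simp add: F_def F'_def)
    next
      case False thus ?thesis by (auto simp: F_def F'_def)
    qed
  next
    fix E v u x y assume E: "E \<in> ?R"
    have B0: "B \<ge> 0" using \<theta>[of 0] by (smt (verit) of_nat_0_le_iff mult_nonneg_nonneg)
    have "\<bar>F E v u x y\<bar> = cut_weight b S E * (b\<^sup>2 * (\<bar>\<theta> (?K E)\<bar> * \<bar>of_bool (v \<in> S \<and> u \<in> S) * of_bool (x \<notin> S \<and> y \<notin> S)\<bar>))"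
      using w0[of E] by (simp add: F_def abs_mult)
    also have "\<dots> \<le> cut_weight b S E * (1 * (B * 1))"
      using b B0 \<theta>[of "?K E"] Kle[OF E]
      by (intro mult_mono mult_left_mono w0 power_le_one mult_nonneg_nonneg) auto
    finally show "\<bar>F E v u x y\<bar> \<le> B * cut_weight b S E" by (simp add: mult.commute)
    have "\<bar>F' E v u x y\<bar> = cut_weight b S E * (\<bar>\<theta> (?K E - 2)\<bar> * \<bar>of_bool (v \<in> S \<and> u \<notin> S) * of_bool (x \<notin> S \<and> y \<in> S)\<bar>)"
      using w0[of E] by (simp add: F'_def abs_mult)
    also have "\<dots> \<le> cut_weight b S E * (B * 1)"
      using B0 \<theta>[of "?K E - 2"] Kle[OF E]
      by (intro mult_mono mult_left_mono w0 mult_nonneg_nonneg) auto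
    finally show "\<bar>F' E v u x y\<bar> \<le> B * cut_weight b S E" by (simp add: mult.commute)
  qed
  also have "(\<Sum>E\<in>?R. \<Sum>(v, u)\<in>arcs E. \<Sum>(x, y)\<in>arcs E. F E v u x y)
        - (\<Sum>E\<in>?R. \<Sum>(v, u)\<in>arcs E. \<Sum>(x, y)\<in>arcs E. F' E v u x y)
      = (\<Sum>E\<in>?R. cut_weight b S E * b\<^sup>2 * \<theta> (?K E) * ((real d * real (card S) - ?K E)
               * (real d * (real n - real (card S)) - ?K E))
           - cut_weight b S E * \<theta> (?K E - 2) * (?K E * ?K E))"
    by (simp only: sumF sumF' sum_subtractf cong: sum.cong)
  also have "\<dots> = (\<Sum>E\<in>?R. cut_weight b S E *
           (b\<^sup>2 * ((real d * real (card S) - ?K E)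
               * (real d * (real n - real (card S)) - ?K E)) * \<theta> (?K E)
            - (?K E)\<^sup>2 * \<theta> (?K E - 2)))"
    by (intro sum.cong) (simp_all add: algebra_simps power2_eq_square)
  finally show ?thesis by (simp add: cut_sum_def sum_distrib_left mult.assoc)
qed

text \<open>The switchings that preserve the cut size show that the spins of the neighbours of a
  vertex outside \<open>S\<close> are asymptotically independent, stated here for their generating
  function.\<close>

lemma stein_plus_degree:
  assumes S: "S \<subseteq> {..<n}" and b: "0 < b" "b \<le> 1" and s: "s \<ge> 1"
    and \<eta>: "\<And>E. E \<in> regular_graphs d n \<Longrightarrow> \<bar>\<eta> (cut_size S E)\<bar> \<le> B"
  shows "\<bar>\<Sum>E\<in>regular_graphs d n. cut_weight b S E * \<eta> (cut_size S E) * (\<Sum>v\<in>{..<n} - S.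
           s ^ plus_degree S E v * (real d - real (plus_degree S E v)) * real (cut_size S E)
           - s ^ (plus_degree S E v - 1) * real (plus_degree S E v)
              * (real d * (real n - real (card S)) - real (cut_size S E)))\<bar>
         \<le> real (4 * d\<^sup>2 * (d + 1) * n) * (B * s ^ d) * cut_sum d n b S"
proof -
  let ?R = "regular_graphs d n" and ?K = "\<lambda>E. real (cut_size S E)" and ?i = "plus_degree S"
  \<comment> \<open>An edge on the minus side and a cut edge are switched so that \<open>v\<close>
    gains a plus neighbour. The cut size does not change, so an arbitrary function
    \<open>\<eta>\<close> of it can be carried along.\<close>
  define F where "F = (\<lambda>E v u x y. cut_weight b S E * \<eta> (cut_size S E)
                  * ((s ^ ?i E v * of_bool (v \<notin> S \<and> u \<notin> S)) * of_bool (x \<notin> S \<and> y \<in> S)))"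
  define F' where "F' = (\<lambda>E v u x y. cut_weight b S E * \<eta> (cut_size S E)
                  * ((s ^ (?i E v - 1) * of_bool (v \<notin> S \<and> u \<in> S)) * of_bool (x \<notin> S \<and> y \<notin> S)))"
  have w0: "cut_weight b S E \<ge> 0" for E using b by (simp add: cut_weight_def)
  have sumF: "(\<Sum>(v, u)\<in>arcs E. \<Sum>(x, y)\<in>arcs E. F E v u x y) =
      cut_weight b S E * \<eta> (cut_size S E) *
       ((\<Sum>v\<in>{..<n} - S. s ^ ?i E v * (real d - real (?i E v))) * ?K E)" if E: "E \<in> ?R" for E
    unfolding F_def sum_arcs_product cut_size_arcs[OF E] sum_arcs_outside_minus[OF E] ..
  have sumF': "(\<Sum>(v, u)\<in>arcs E. \<Sum>(x, y)\<in>arcs E. F' E v u x y) =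
      cut_weight b S E * \<eta> (cut_size S E) *
       ((\<Sum>v\<in>{..<n} - S. s ^ (?i E v - 1) * real (?i E v)) * (real d * (real n - real (card S)) - ?K E))"
    if E: "E \<in> ?R" for E
    unfolding F'_def sum_arcs_product inner_arcs[OF E S] sum_arcs_outside_minus[OF E] ..
  have "\<bar>(\<Sum>E\<in>?R. \<Sum>(v, u)\<in>arcs E. \<Sum>(x, y)\<in>arcs E. F E v u x y)
        - (\<Sum>E\<in>?R. \<Sum>(v, u)\<in>arcs E. \<Sum>(x, y)\<in>arcs E. F' E v u x y)\<bar>
       \<le> real (4 * d\<^sup>2 * (d + 1) * n) * (\<Sum>E\<in>?R. B * s ^ d * cut_weight b S E)"
  proof (rule switching_estimate)
    fix E v u x y
    assume E: "E \<in> ?R" and sw: "((v, u), (x, y)) \<in> switchable E"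
    show "F E v u x y = F' (switch E v u x y) v y x u"
    proof (cases "v \<notin> S \<and> u \<notin> S \<and> x \<notin> S \<and> y \<in> S")
      case True
      hence K: "?K (switch E v u x y) = ?K E"
        using cut_size_switch[OF E sw, of S] by simp
      hence K: "cut_size S (switch E v u x y) = cut_size S E" by linarith
      hence "cut_weight b S (switch E v u x y) = cut_weight b S E"
        by (simp add: cut_weight_def)
      with True K plus_degree_switch[OF E sw] show ?thesis by (simp add: F_def F'_def)
    next
      case False thus ?thesis by (auto simp: F_def F'_def)
    qed
  next
    fix E v u x y assume E: "E \<in> ?R" and v: "v < n"
    have B0: "B \<ge> 0" using \<eta>[OF E] by linarith
    have pw: "\<bar>s ^ (?i E v - m) * of_bool (v \<notin> S \<and> P)\<bar> \<le> s ^ d" for P m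
    proof (cases "v \<in> S")
      case False
      have "?i E v - m \<le> d" using plus_degree_le[OF E False v] by linarith
      hence "s ^ (?i E v - m) \<le> s ^ d" using s by (rule power_increasing)
      thus ?thesis using s by (auto simp: of_bool_def)
    qed (use s in simp)
    have g: "\<bar>cut_weight b S E * \<eta> (cut_size S E) * (A * of_bool Q)\<bar> \<le> B * s ^ d * cut_weight b S E"
      if "\<bar>A\<bar> \<le> s ^ d" for A Q
    proof -
      have "\<bar>cut_weight b S E * \<eta> (cut_size S E) * (A * of_bool Q)\<bar>
            = cut_weight b S E * (\<bar>\<eta> (cut_size S E)\<bar> * (\<bar>A\<bar> * of_bool Q))"
        using w0[of E] by (simp add: abs_mult)
      also have "\<dots> \<le> cut_weight b S E * (B * (s ^ d * 1))"
        using \<eta>[OF E] B0 that s by (intro mult_mono mult_left_mono w0 mult_nonneg_nonneg) auto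
      finally show ?thesis by (simp add: algebra_simps)
    qed
    show "\<bar>F E v u x y\<bar> \<le> B * s ^ d * cut_weight b S E"
      unfolding F_def using pw[of 0] by (intro g) simp
    show "\<bar>F' E v u x y\<bar> \<le> B * s ^ d * cut_weight b S E"
      unfolding F'_def by (intro g pw)
  qed
  also have "(\<Sum>E\<in>?R. \<Sum>(v, u)\<in>arcs E. \<Sum>(x, y)\<in>arcs E. F E v u x y)
        - (\<Sum>E\<in>?R. \<Sum>(v, u)\<in>arcs E. \<Sum>(x, y)\<in>arcs E. F' E v u x y)
      = (\<Sum>E\<in>?R. cut_weight b S E * \<eta> (cut_size S E) *
       ((\<Sum>v\<in>{..<n} - S. s ^ ?i E v * (real d - real (?i E v))) * ?K E)
         - cut_weight b S E * \<eta> (cut_size S E) *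
       ((\<Sum>v\<in>{..<n} - S. s ^ (?i E v - 1) * real (?i E v)) * (real d * (real n - real (card S)) - ?K E)))"
    by (simp only: sumF sumF' sum_subtractf cong: sum.cong)
  also have "\<dots> = (\<Sum>E\<in>?R. cut_weight b S E * \<eta> (cut_size S E) * (\<Sum>v\<in>{..<n} - S.
           s ^ ?i E v * (real d - real (?i E v)) * ?K E
           - s ^ (?i E v - 1) * real (?i E v)
              * (real d * (real n - real (card S)) - ?K E)))"
    by (intro sum.cong refl) (simp only: sum_subtractf sum_distrib_right[symmetric] right_diff_distrib)
  finally show ?thesis by (simp add: cut_sum_def sum_distrib_left mult.assoc)
qed

section \<open>Concentration of the cut size\<close>

lemma cut_weight_pos: "0 < b \<Longrightarrow> 0 < cut_weight b S E"
  by (simp add: cut_weight_def)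

lemma cut_sum_nonneg: "0 < b \<Longrightarrow> 0 \<le> cut_sum d n b S"
  unfolding cut_sum_def by (intro sum_nonneg less_imp_le[OF cut_weight_pos])

text \<open>\<open>b * disc b a\<close> is the square root of the discriminant of the quadratic
  equation for \<open>cut_density\<close>. For \<open>b = exp (-2 * \<beta>)\<close>,
  \<open>disc\<close> itself is the square root in the integrand of \<open>g_fun\<close>.\<close>

definition disc :: "real \<Rightarrow> real \<Rightarrow> real" where
  "disc b a = sqrt (1 - (1 - b\<^sup>2) * (1 - 2 * a)\<^sup>2)"

text \<open>The limiting number of cut edges per half-edge; it balances
  \<open>b\<^sup>2 (a - y) (1 - a - y)\<close> against \<open>y\<^sup>2\<close>.\<close>

definition cut_density :: "real \<Rightarrow> real \<Rightarrow> real" where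
  "cut_density b a = b * (disc b a - b) / (2 * (1 - b\<^sup>2))"

lemma disc_sq:
  assumes "0 < b" "b < 1" "0 \<le> a" "a \<le> 1"
  shows "(disc b a)\<^sup>2 = 1 - (1 - b\<^sup>2) * (1 - 2 * a)\<^sup>2" and "b \<le> disc b a"
proof -
  have u: "(1 - 2 * a)\<^sup>2 \<le> 1" using assms by (simp add: abs_square_le_1 abs_le_iff)
  have b2: "0 < 1 - b\<^sup>2" using assms by (simp add: power_less_one_iff)
  have "(1 - b\<^sup>2) * (1 - 2 * a)\<^sup>2 \<le> (1 - b\<^sup>2) * 1" using u b2 by (intro mult_left_mono) auto
  hence *: "b\<^sup>2 \<le> 1 - (1 - b\<^sup>2) * (1 - 2 * a)\<^sup>2" by simp
  thus "(disc b a)\<^sup>2 = 1 - (1 - b\<^sup>2) * (1 - 2 * a)\<^sup>2" unfolding disc_def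
    using order.trans[OF zero_le_power2 *] by simp
  show "b \<le> disc b a" unfolding disc_def by (rule real_le_rsqrt[OF *])
qed

lemma cut_density:
  assumes "0 < b" "b < 1" "0 \<le> a" "a \<le> 1"
  shows "(cut_density b a)\<^sup>2 = b\<^sup>2 * (a - cut_density b a) * (1 - a - cut_density b a)"
    and "0 \<le> cut_density b a" and "cut_density b a \<le> 1 - a" and "cut_density b a \<le> 1"
proof -
  let ?y = "cut_density b a" and ?D = "disc b a"
  have b2: "0 < 1 - b\<^sup>2" using assms by (simp add: power_less_one_iff)
  have D: "b * ?D = 2 * (1 - b\<^sup>2) * ?y + b\<^sup>2"
    using b2 by (simp add: cut_density_def field_simps power2_eq_square)
  have "(2 * (1 - b\<^sup>2) * ?y + b\<^sup>2)\<^sup>2 = b\<^sup>2 * (1 - (1 - b\<^sup>2) * (1 - 2 * a)\<^sup>2)"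
    unfolding D[symmetric] power_mult_distrib disc_sq(1)[OF assms] ..
  hence "4 * (1 - b\<^sup>2) * (?y\<^sup>2 - b\<^sup>2 * (a - ?y) * (1 - a - ?y)) = 0"
    by (simp add: algebra_simps power2_eq_square)
  thus eq: "?y\<^sup>2 = b\<^sup>2 * (a - ?y) * (1 - a - ?y)" using b2 by simp
  show y0: "0 \<le> ?y" unfolding cut_density_def using disc_sq(2)[OF assms] assms b2
    by (intro divide_nonneg_pos mult_nonneg_nonneg) auto
  show le: "?y \<le> 1 - a"
  \<comment> \<open>The quadratic equation reads
    \<open>(1 - b^2) y^2 + b^2 y = b^2 a (1 - a)\<close>; for \<open>y > 1 - a\<close> its linear
    term alone exceeds the right side.\<close>
  proof (rule ccontr)
    assume "\<not> ?y \<le> 1 - a"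
    hence gt: "?y > 1 - a" by simp
    have q: "(1 - b\<^sup>2) * ?y\<^sup>2 + b\<^sup>2 * ?y = b\<^sup>2 * a * (1 - a)"
      using eq by (simp add: algebra_simps power2_eq_square)
    have "b\<^sup>2 * a * (1 - a) \<le> b\<^sup>2 * 1 * (1 - a)"
      using assms by (intro mult_right_mono mult_left_mono) auto
    also have "\<dots> < b\<^sup>2 * ?y" using gt assms by simp
    also have "\<dots> \<le> (1 - b\<^sup>2) * ?y\<^sup>2 + b\<^sup>2 * ?y" using b2 by simp
    finally show False using q by simp
  qed
  show "?y \<le> 1" using le assms by linarith
qed

lemma le_divide_twiceI:
  fixes r n A C W :: real
  assumes "r > 0" "n > 0" "n * r * A \<le> C * W"
  shows "A \<le> C / r / n * W"
proof -
  have "A \<le> C * W / (n * r)" using assms by (simp add: pos_le_divide_eq mult.commute)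
  also have "\<dots> = C / r / n * W" by (simp add: mult.commute)
  finally show ?thesis .
qed

text \<open>The balance function of the Stein equation vanishes at the limit \<open>x\<close> and
  factors as \<open>- (X - x) * L X\<close> with \<open>L\<close> bounded below. The test function
  \<open>X - x\<close> therefore controls the second moment, and the constant test function controls
  the mean. That the mean is of order \<open>1 / n\<close> as well is essential, since it enters the
  ratio of partition sums linearly.\<close>

lemma cut_size_moments:
  assumes d: "d \<ge> 1" and b: "0 < b" "b < 1"
  shows "\<exists>C\<ge>0. \<forall>n S. n \<ge> 2 \<longrightarrow> S \<subseteq> {..<n} \<longrightarrow>
       (\<Sum>E\<in>regular_graphs d n. cut_weight b S E *
          (real (cut_size S E) / real n - real d * cut_density b (real (card S) / real n))\<^sup>2)
         \<le> C / real n * cut_sum d n b S \<and>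
       \<bar>\<Sum>E\<in>regular_graphs d n. cut_weight b S E *
          (real (cut_size S E) / real n - real d * cut_density b (real (card S) / real n))\<bar>
         \<le> C / real n * cut_sum d n b S"
proof -
  define c where "c = real (4 * d\<^sup>2 * (d + 1))"
  define C1 where "C1 = (2 * (real d)\<^sup>2 + c * (real d + 1)) / (b\<^sup>2 * real d)"
  define C2 where "C2 = (c + C1) / (b\<^sup>2 * real d)"
  have pos: "b\<^sup>2 * real d > 0" using d b by simp
  have c0: "c \<ge> 0" by (simp add: c_def)
  have C1: "C1 \<ge> 0" unfolding C1_def using pos c0 by (intro divide_nonneg_pos add_nonneg_nonneg) auto
  have C2: "C2 \<ge> 0" unfolding C2_def using pos c0 C1 by (intro divide_nonneg_pos) auto
  have b2: "0 < 1 - b\<^sup>2" using b by (simp add: power_less_one_iff)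
  have main: "(\<Sum>E\<in>regular_graphs d n. cut_weight b S E *
          (real (cut_size S E) / real n - real d * cut_density b (real (card S) / real n))\<^sup>2)
       \<le> C1 / real n * cut_sum d n b S"
    "\<bar>\<Sum>E\<in>regular_graphs d n. cut_weight b S E *
          (real (cut_size S E) / real n - real d * cut_density b (real (card S) / real n))\<bar>
       \<le> C2 / real n * cut_sum d n b S"
    if n: "n \<ge> 2" and S: "S \<subseteq> {..<n}" for n S
  proof -
    define a where "a = real (card S) / real n"
    define x where "x = real d * cut_density b a"
    define X where "X = (\<lambda>E. real (cut_size S E) / real n)"
    \<comment> \<open>The cofactor of \<open>X - x\<close> in the balance function; on nonnegative
      arguments it is at least \<open>b\<^sup>2 * real d\<close>.\<close>
    define L where "L = (\<lambda>X. (1 - b\<^sup>2) * (X + x) + b\<^sup>2 * real d)"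
    let ?R = "regular_graphs d n" and ?w = "cut_weight b S" and ?W = "cut_sum d n b S"
    have n0: "real n > 0" using n by simp
    have "card S \<le> n" using card_mono[OF _ S] by simp
    hence a: "0 \<le> a" "a \<le> 1" using n0 by (simp_all add: a_def)
    have cS: "real (card S) = real n * a" using n0 by (simp add: a_def)
    have K: "real (cut_size S E) = real n * X E" for E using n0 by (simp add: X_def)
    note y = cut_density[OF b a]
    have x0: "0 \<le> x" "x \<le> real d" using y(2) mult_left_mono[OF y(4), of "real d"] by (auto simp: x_def)
    have xeq: "x\<^sup>2 = b\<^sup>2 * (real d * a - x) * (real d * (1 - a) - x)"
    proof -
      have "x\<^sup>2 = (real d)\<^sup>2 * (b\<^sup>2 * (a - cut_density b a) * (1 - a - cut_density b a))"
        using y(1) by (simp add: x_def power_mult_distrib)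
      thus ?thesis by (simp add: x_def algebra_simps power2_eq_square)
    qed
    have H: "b\<^sup>2 * ((real d * real (card S) - real (cut_size S E)) *
               (real d * (real n - real (card S)) - real (cut_size S E))) - (real (cut_size S E))\<^sup>2
            = - (real n)\<^sup>2 * ((X E - x) * L (X E))" for E
    proof -
      have "b\<^sup>2 * ((real d * real (card S) - real (cut_size S E)) *
               (real d * (real n - real (card S)) - real (cut_size S E))) - (real (cut_size S E))\<^sup>2
          = (real n)\<^sup>2 * (b\<^sup>2 * (real d * a - X E) * (real d * (1 - a) - X E) - (X E)\<^sup>2)"
        unfolding cS K by (simp add: algebra_simps power2_eq_square)
      also have "b\<^sup>2 * (real d * a - X E) * (real d * (1 - a) - X E) - (X E)\<^sup>2
          = b\<^sup>2 * (real d * a - X E) * (real d * (1 - a) - X E) - (X E)\<^sup>2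
            - (b\<^sup>2 * (real d * a - x) * (real d * (1 - a) - x) - x\<^sup>2)" using xeq by simp
      also have "\<dots> = - ((X E - x) * L (X E))"
        unfolding L_def by (simp add: algebra_simps power2_eq_square)
      finally show ?thesis by simp
    qed
    have X01: "0 \<le> X E" "X E \<le> real d" if "E \<in> ?R" for E
    proof -
      have "real (cut_size S E) \<le> real d * real (card S)" by (rule cut_size_le[OF that S])
      also have "\<dots> \<le> real d * real n" using \<open>card S \<le> n\<close> by (intro mult_left_mono) auto
      finally show "X E \<le> real d" using n0 by (simp add: X_def field_simps)
      show "0 \<le> X E" by (simp add: X_def)
    qed
    have w0: "0 \<le> ?w E" for E using b by (simp add: cut_weight_def)
    have Lge: "L z \<ge> b\<^sup>2 * real d" if "z \<ge> 0" for z using that x0 b2 by (simp add: L_def)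
    have 1: "\<bar>\<Sum>E\<in>?R. ?w E * (- (real n)\<^sup>2 * ((X E - x) * L (X E)))\<bar> \<le> c * real n * 1 * ?W"
    proof -
      have "\<bar>\<Sum>E\<in>?R. ?w E * (b\<^sup>2 * ((real d * real (card S) - real (cut_size S E))
               * (real d * (real n - real (card S)) - real (cut_size S E))) * 1
            - (real (cut_size S E))\<^sup>2 * 1)\<bar>
         \<le> real (4 * d\<^sup>2 * (d + 1) * n) * 1 * ?W"
        using b S by (intro stein_cut_size[where \<theta> = "\<lambda>_. 1"]) auto
      thus ?thesis unfolding mult_1_right H by (simp add: c_def)
    qed
    \<comment> \<open>Test function \<open>X - x\<close>. Its shift by \<open>2 / n\<close> for the
      reverse switchings produces the extra term \<open>2 * real n * (X E)\<^sup>2\<close>, which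
      has the same order as the error.\<close>
    have 2: "\<bar>\<Sum>E\<in>?R. ?w E * (- (real n)\<^sup>2 * ((X E - x)\<^sup>2 * L (X E)) + 2 * real n * (X E)\<^sup>2)\<bar>
         \<le> c * real n * (real d + 1) * ?W"
    proof -
      have "\<bar>\<Sum>E\<in>?R. ?w E * (b\<^sup>2 * ((real d * real (card S) - real (cut_size S E))
               * (real d * (real n - real (card S)) - real (cut_size S E)))
                  * (real (cut_size S E) / real n - x)
            - (real (cut_size S E))\<^sup>2 * ((real (cut_size S E) - 2) / real n - x))\<bar>
         \<le> real (4 * d\<^sup>2 * (d + 1) * n) * (real d + 1) * ?W"
      proof (rule stein_cut_size[where \<theta> = "\<lambda>k. k / real n - x"])
        fix k :: real assume k: "- 2 \<le> k" "k \<le> real d * real n"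
        have "k / real n \<le> real d" using k n0 by (simp add: field_simps)
        moreover have "k / real n \<ge> -1" using k n by (simp add: field_simps)
        ultimately show "\<bar>k / real n - x\<bar> \<le> real d + 1" using x0 by linarith
      qed (use b S in auto)
      moreover have "b\<^sup>2 * ((real d * real (card S) - real (cut_size S E))
               * (real d * (real n - real (card S)) - real (cut_size S E)))
                  * (real (cut_size S E) / real n - x)
            - (real (cut_size S E))\<^sup>2 * ((real (cut_size S E) - 2) / real n - x)
          = - (real n)\<^sup>2 * ((X E - x)\<^sup>2 * L (X E)) + 2 * real n * (X E)\<^sup>2" for E
      proof -
        have "(real (cut_size S E) - 2) / real n - x = (X E - x) - 2 / real n"
          by (simp add: X_def diff_divide_distrib)
        note eq = this
        have e1: "real (cut_size S E) / real n = X E" by (simp add: X_def)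
        have gen: "A * z - k * (z - t) = (A - k) * z + t * k" for A z k t :: real
          by (simp add: algebra_simps)
        have "b\<^sup>2 * ((real d * real (card S) - real (cut_size S E))
               * (real d * (real n - real (card S)) - real (cut_size S E)))
                  * (real (cut_size S E) / real n - x)
            - (real (cut_size S E))\<^sup>2 * ((real (cut_size S E) - 2) / real n - x)
           = (b\<^sup>2 * ((real d * real (card S) - real (cut_size S E)) *
               (real d * (real n - real (card S)) - real (cut_size S E))) - (real (cut_size S E))\<^sup>2)
              * (X E - x) + 2 / real n * (real (cut_size S E))\<^sup>2"
          unfolding eq e1 by (rule gen)
        also have "2 / real n * (real (cut_size S E))\<^sup>2 = 2 * real n * (X E)\<^sup>2"
          using n0 unfolding K by (simp add: power2_eq_square)
        finally show ?thesis unfolding H by (simp add: power2_eq_square algebra_simps)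
      qed
      ultimately show ?thesis by (simp add: c_def)
    qed
    have var: "(\<Sum>E\<in>?R. ?w E * (X E - x)\<^sup>2) \<le> C1 / real n * ?W"
    proof -
      have "(real n)\<^sup>2 * (b\<^sup>2 * real d) * (\<Sum>E\<in>?R. ?w E * (X E - x)\<^sup>2)
          = (\<Sum>E\<in>?R. ?w E * ((real n)\<^sup>2 * ((X E - x)\<^sup>2 * (b\<^sup>2 * real d))))"
        by (simp add: sum_distrib_left algebra_simps)
      also have "\<dots> \<le> (\<Sum>E\<in>?R. ?w E * ((real n)\<^sup>2 * ((X E - x)\<^sup>2 * L (X E))))"
        using Lge X01 by (intro sum_mono mult_left_mono w0) auto
      also have "\<dots> = (\<Sum>E\<in>?R. 2 * real n * (?w E * (X E)\<^sup>2))
           - (\<Sum>E\<in>?R. ?w E * (- (real n)\<^sup>2 * ((X E - x)\<^sup>2 * L (X E)) + 2 * real n * (X E)\<^sup>2))"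
        by (simp add: sum_subtractf[symmetric] algebra_simps)
      also have "\<dots> \<le> (\<Sum>E\<in>?R. 2 * real n * (?w E * (real d)\<^sup>2)) + c * real n * (real d + 1) * ?W"
      proof -
        have "(\<Sum>E\<in>?R. 2 * real n * (?w E * (X E)\<^sup>2)) \<le> (\<Sum>E\<in>?R. 2 * real n * (?w E * (real d)\<^sup>2))"
          using X01 w0 by (intro sum_mono mult_left_mono power_mono) auto
        thus ?thesis using 2 by linarith
      qed
      also have "\<dots> = real n * (2 * (real d)\<^sup>2 + c * (real d + 1)) * ?W"
        by (simp add: cut_sum_def sum_distrib_left sum_distrib_right algebra_simps)
      finally have "real n * (real n * (b\<^sup>2 * real d) * (\<Sum>E\<in>?R. ?w E * (X E - x)\<^sup>2))
          \<le> real n * ((2 * (real d)\<^sup>2 + c * (real d + 1)) * ?W)" by (simp add: power2_eq_square algebra_simps)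
      hence "real n * (b\<^sup>2 * real d) * (\<Sum>E\<in>?R. ?w E * (X E - x)\<^sup>2) \<le> (2 * (real d)\<^sup>2 + c * (real d + 1)) * ?W"
        by (simp only: mult_le_cancel_left_pos[OF n0])
      thus ?thesis unfolding C1_def by (rule le_divide_twiceI[OF pos n0])
    qed
    thus "(\<Sum>E\<in>?R. ?w E * (real (cut_size S E) / real n - real d * cut_density b (real (card S) / real n))\<^sup>2)
       \<le> C1 / real n * ?W" by (simp add: X_def x_def a_def)
    \<comment> \<open>\<open>L X\<close> equals \<open>L x\<close> plus a multiple of
      \<open>X - x\<close>, so replacing it costs only the second moment, already bounded in
      \<open>var\<close>.\<close>
    have eqL: "(real n)\<^sup>2 * (L x * (\<Sum>E\<in>?R. ?w E * (X E - x)))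
        = - (\<Sum>E\<in>?R. ?w E * (- (real n)\<^sup>2 * ((X E - x) * L (X E))))
          - (real n)\<^sup>2 * (1 - b\<^sup>2) * (\<Sum>E\<in>?R. ?w E * (X E - x)\<^sup>2)"
      by (simp add: sum_distrib_left sum_subtractf[symmetric] sum_negf[symmetric] L_def algebra_simps power2_eq_square)
    have "(real n)\<^sup>2 * \<bar>L x * (\<Sum>E\<in>?R. ?w E * (X E - x))\<bar>
        = \<bar>- (\<Sum>E\<in>?R. ?w E * (- (real n)\<^sup>2 * ((X E - x) * L (X E))))
          - (real n)\<^sup>2 * (1 - b\<^sup>2) * (\<Sum>E\<in>?R. ?w E * (X E - x)\<^sup>2)\<bar>"
      unfolding eqL[symmetric] by (simp add: abs_mult)
    also have "\<dots> \<le> c * real n * 1 * ?W + (real n)\<^sup>2 * (1 - b\<^sup>2) * (\<Sum>E\<in>?R. ?w E * (X E - x)\<^sup>2)"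
    proof -
      have "0 \<le> (real n)\<^sup>2 * (1 - b\<^sup>2) * (\<Sum>E\<in>?R. ?w E * (X E - x)\<^sup>2)"
        using b2 w0 by (intro mult_nonneg_nonneg sum_nonneg) auto
      thus ?thesis using 1 by linarith
    qed
    also have "\<dots> \<le> c * real n * 1 * ?W + (real n)\<^sup>2 * 1 * (C1 / real n * ?W)"
      using var b2 w0 by (intro add_left_mono mult_mono mult_nonneg_nonneg sum_nonneg) auto
    also have "\<dots> = real n * ((c + C1) * ?W)" using n0 by (simp add: power2_eq_square algebra_simps)
    finally have "real n * (real n * \<bar>L x * (\<Sum>E\<in>?R. ?w E * (X E - x))\<bar>) \<le> real n * ((c + C1) * ?W)"
      by (simp add: power2_eq_square mult.assoc)
    hence "real n * (L x * \<bar>\<Sum>E\<in>?R. ?w E * (X E - x)\<bar>) \<le> (c + C1) * ?W"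
      using n0 Lge[OF x0(1)] pos by (simp add: abs_mult)
    moreover have "real n * (b\<^sup>2 * real d * \<bar>\<Sum>E\<in>?R. ?w E * (X E - x)\<bar>)
        \<le> real n * (L x * \<bar>\<Sum>E\<in>?R. ?w E * (X E - x)\<bar>)"
      using n0 Lge[OF x0(1)] by (intro mult_left_mono mult_right_mono) auto
    ultimately have "real n * (b\<^sup>2 * real d) * \<bar>\<Sum>E\<in>?R. ?w E * (X E - x)\<bar> \<le> (c + C1) * ?W"
      by (simp add: algebra_simps)
    hence "\<bar>\<Sum>E\<in>?R. ?w E * (X E - x)\<bar> \<le> C2 / real n * ?W"
      unfolding C2_def by (rule le_divide_twiceI[OF pos n0])
    thus "\<bar>\<Sum>E\<in>?R. ?w E * (real (cut_size S E) / real n - real d * cut_density b (real (card S) / real n))\<bar>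
       \<le> C2 / real n * ?W" by (simp add: X_def x_def a_def)
  qed
  show ?thesis
  proof (intro exI[of _ "C1 + C2"] conjI allI impI)
    fix n :: nat and S :: "nat set" assume nS: "n \<ge> 2" "S \<subseteq> {..<n}"
    have W: "0 \<le> cut_sum d n b S" using b by (simp add: cut_sum_nonneg)
    have "C1 / real n * cut_sum d n b S \<le> (C1 + C2) / real n * cut_sum d n b S"
         "C2 / real n * cut_sum d n b S \<le> (C1 + C2) / real n * cut_sum d n b S"
      using C1 C2 W by (intro mult_right_mono divide_right_mono; simp)+
    with main[OF nS] show
      "(\<Sum>E\<in>regular_graphs d n. cut_weight b S E *
          (real (cut_size S E) / real n - real d * cut_density b (real (card S) / real n))\<^sup>2)
       \<le> (C1 + C2) / real n * cut_sum d n b S"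
      "\<bar>\<Sum>E\<in>regular_graphs d n. cut_weight b S E *
          (real (cut_size S E) / real n - real d * cut_density b (real (card S) / real n))\<bar>
       \<le> (C1 + C2) / real n * cut_sum d n b S" by linarith+
  qed (use C1 C2 in simp)
qed

lemma power_taylor2:
  fixes x y s :: real
  assumes "0 \<le> x" "x \<le> s" "0 \<le> y" "y \<le> s" "1 \<le> s"
  shows "\<bar>x ^ d - y ^ d - real d * y ^ (d - 1) * (x - y)\<bar> \<le> (real d)\<^sup>2 * s ^ d * (x - y)\<^sup>2"
proof (induction d)
  case (Suc d)
  have eq: "x ^ Suc d - y ^ Suc d - real (Suc d) * y ^ (Suc d - 1) * (x - y)
      = x * (x ^ d - y ^ d - real d * y ^ (d - 1) * (x - y)) + real d * y ^ (d - 1) * (x - y)\<^sup>2"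
    by (cases d) (simp_all add: algebra_simps power2_eq_square)
  have "\<bar>x ^ Suc d - y ^ Suc d - real (Suc d) * y ^ (Suc d - 1) * (x - y)\<bar>
      \<le> \<bar>x * (x ^ d - y ^ d - real d * y ^ (d - 1) * (x - y))\<bar> + \<bar>real d * y ^ (d - 1) * (x - y)\<^sup>2\<bar>"
    unfolding eq by (rule abs_triangle_ineq)
  also have "\<dots> = x * \<bar>x ^ d - y ^ d - real d * y ^ (d - 1) * (x - y)\<bar> + real d * y ^ (d - 1) * (x - y)\<^sup>2"
    using assms by (simp add: abs_mult)
  also have "\<dots> \<le> s * ((real d)\<^sup>2 * s ^ d * (x - y)\<^sup>2) + real d * s ^ Suc d * (x - y)\<^sup>2"
  proof (intro add_mono mult_mono mult_nonneg_nonneg Suc)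
    have "y ^ (d - 1) \<le> s ^ (d - 1)" using assms by (intro power_mono) auto
    also have "\<dots> \<le> s ^ Suc d" using assms by (intro power_increasing) auto
    finally show "y ^ (d - 1) \<le> s ^ Suc d" .
  qed (use assms in auto)
  also have "\<dots> = ((real d)\<^sup>2 + real d) * s ^ Suc d * (x - y)\<^sup>2" by (simp add: algebra_simps)
  also have "\<dots> \<le> (real (Suc d))\<^sup>2 * s ^ Suc d * (x - y)\<^sup>2"
  proof -
    have "(real d)\<^sup>2 + real d \<le> (real (Suc d))\<^sup>2" by (simp add: power2_eq_square algebra_simps)
    thus ?thesis using assms by (intro mult_right_mono) auto
  qed
  finally show ?case .
qed simp

text \<open>With \<open>\<psi>(s)\<close> the expected generating function of the plus degrees, the Stein equation is
  the approximate differential equation \<open>d p \<psi> = (1 - p + p s) \<psi>'\<close>, solved by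
  \<open>(1 - p + p s)\<^sup>d\<close>; here it is integrated from \<open>1\<close> to \<open>s\<close>.\<close>

lemma plus_degree_generating_function:
  assumes S: "S \<subseteq> {..<n}" and b: "0 < b" "b \<le> 1" and s0: "s0 > 1" and Sn: "card S < n" and d: "d \<ge> 1"
  defines "m \<equiv> real d * (real n - real (card S))"
  shows "\<bar>(\<Sum>E\<in>regular_graphs d n. cut_weight b S E * (\<Sum>v\<in>{..<n} - S. s0 ^ plus_degree S E v))
        - (real n - real (card S)) * (\<Sum>E\<in>regular_graphs d n. cut_weight b S E *
             (1 + real (cut_size S E) / m * (s0 - 1)) ^ d)\<bar>
     \<le> (s0 - 1) * (real n / m * real (4 * d\<^sup>2 * (d + 1)) * s0 ^ (2 * d)) * cut_sum d n b S"
proof -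
  let ?R = "regular_graphs d n" and ?w = "cut_weight b S" and ?i = "plus_degree S"
  define p where "p = (\<lambda>E. real (cut_size S E) / m)"
  have m0: "m > 0" using d Sn by (simp add: m_def)
  have p01: "0 \<le> p E" "p E \<le> 1" if "E \<in> ?R" for E
    using cut_size_le(2)[OF that S] m0 by (simp_all add: p_def m_def[symmetric])
  have q1: "1 \<le> 1 + p E * (s - 1)" "1 + p E * (s - 1) \<le> s" if "E \<in> ?R" "s \<ge> 1" for E s
  proof -
    show "1 \<le> 1 + p E * (s - 1)" using p01[OF that(1)] that(2) by simp
    have "p E * (s - 1) \<le> 1 * (s - 1)" using p01[OF that(1)] that(2) by (intro mult_right_mono) auto
    thus "1 + p E * (s - 1) \<le> s" by simp
  qed
  \<comment> \<open>For each graph the generating function is divided by its predicted value at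
    \<open>s\<close>, so that the Stein equation makes the derivative small. At \<open>s0\<close>
    the two powers cancel, and at \<open>1\<close> the inner sum is the number of vertices outside
    \<open>S\<close>; thus \<open>H s0 - H 1\<close> is the difference to be bounded.\<close>
  define H where "H = (\<lambda>s. \<Sum>E\<in>?R. ?w E * (1 + p E * (s0 - 1)) ^ d *
                     (\<Sum>v\<in>{..<n} - S. s ^ ?i E v / (1 + p E * (s - 1)) ^ d))"
  define H' where "H' = (\<lambda>s. \<Sum>E\<in>?R. ?w E * (1 + p E * (s0 - 1)) ^ d *
                     (\<Sum>v\<in>{..<n} - S. (real (?i E v) * s ^ (?i E v - 1) * (1 - p E)
                         - (real d - real (?i E v)) * p E * s ^ ?i E v) / (1 + p E * (s - 1)) ^ Suc d))"
  have deriv: "(H has_real_derivative H' s) (at s)" if s: "s \<ge> 1" for s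
  proof -
    have one: "((\<lambda>s. s ^ i / (1 + p E * (s - 1)) ^ d) has_real_derivative
       (real i * s ^ (i - 1) * (1 - p E) - (real d - real i) * p E * s ^ i) / (1 + p E * (s - 1)) ^ Suc d) (at s)"
      if E: "E \<in> ?R" for E i
    proof -
      define q where "q = 1 + p E * (s - 1)"
      have q: "q > 0" using q1[OF E s] by (simp add: q_def)
      have pq: "p E * s = q - 1 + p E" by (simp add: q_def algebra_simps)
      have si: "real i * s ^ i = real i * s ^ (i - 1) * s" by (cases i) auto
      obtain d' where d': "d = Suc d'" using d by (cases d) auto
      have "((\<lambda>s. s ^ i / (1 + p E * (s - 1)) ^ d) has_real_derivative
          ((real i * s ^ (i - 1)) * q ^ d - s ^ i * (real d * q ^ (d - 1) * p E)) / (q ^ d * q ^ d)) (at s)"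
        using q unfolding q_def by (auto intro!: derivative_eq_intros simp: mult_ac)
      moreover have "((real i * s ^ (i - 1)) * q ^ d - s ^ i * (real d * q ^ (d - 1) * p E)) / (q ^ d * q ^ d)
         = ((real i * s ^ (i - 1)) * q - s ^ i * (real d * p E)) / q ^ Suc d"
        using q by (simp add: d' field_simps)
      moreover have "real i * s ^ (i - 1) * q - s ^ i * (real d * p E)
         = real i * s ^ (i - 1) * (1 - p E) - (real d - real i) * p E * s ^ i"
      proof -
        have "real i * s ^ (i - 1) * q = real i * s ^ (i - 1) * (1 - p E) + p E * (real i * s ^ (i - 1) * s)"
          by (simp add: q_def algebra_simps)
        thus ?thesis unfolding si[symmetric] by (simp add: algebra_simps)
      qed
      ultimately show ?thesis by (simp add: q_def)
    qed
    show ?thesis unfolding H_def H'_def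
      by (intro DERIV_sum DERIV_cmult one)
  qed
  have bound: "\<bar>H' s\<bar> \<le> real n / m * real (4 * d\<^sup>2 * (d + 1)) * s0 ^ (2 * d) * cut_sum d n b S"
    if s: "1 \<le> s" "s \<le> s0" for s
  proof -
    \<comment> \<open>In \<open>H' s\<close>, everything besides the plus degrees depends on the
      graph through its cut size only, and so qualifies as the test function of
      \<open>stein_plus_degree\<close>.\<close>
    define \<eta> where "\<eta> = (\<lambda>k. (1 + real k / m * (s0 - 1)) ^ d / (1 + real k / m * (s - 1)) ^ Suc d)"
    have "H' s = (\<Sum>E\<in>?R. - (1 / m) * (?w E * \<eta> (cut_size S E) * (\<Sum>v\<in>{..<n} - S.
           s ^ ?i E v * (real d - real (?i E v)) * real (cut_size S E)
           - s ^ (?i E v - 1) * real (?i E v) * (m - real (cut_size S E)))))"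
      unfolding H'_def
    proof (intro sum.cong refl)
      fix E assume E: "E \<in> ?R"
      define q where "q = 1 + p E * (s - 1)"
      have q: "q > 0" using q1[OF E s(1)] by (simp add: q_def)
      have K: "real (cut_size S E) = m * p E" using m0 by (simp add: p_def)
      have \<eta>q: "\<eta> (cut_size S E) = (1 + p E * (s0 - 1)) ^ d / q ^ Suc d"
        by (simp add: \<eta>_def p_def q_def)
      have "(\<Sum>v\<in>{..<n} - S. (real (?i E v) * s ^ (?i E v - 1) * (1 - p E)
                         - (real d - real (?i E v)) * p E * s ^ ?i E v) / q ^ Suc d)
         = (\<Sum>v\<in>{..<n} - S. - (1 / m) / q ^ Suc d * (s ^ ?i E v * (real d - real (?i E v)) * real (cut_size S E)
           - s ^ (?i E v - 1) * real (?i E v) * (m - real (cut_size S E))))"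
        using m0 q unfolding K by (intro sum.cong refl) (simp add: field_simps)
      thus "?w E * (1 + p E * (s0 - 1)) ^ d *
                     (\<Sum>v\<in>{..<n} - S. (real (?i E v) * s ^ (?i E v - 1) * (1 - p E)
                         - (real d - real (?i E v)) * p E * s ^ ?i E v) / (1 + p E * (s - 1)) ^ Suc d)
         = - (1 / m) * (?w E * \<eta> (cut_size S E) * (\<Sum>v\<in>{..<n} - S.
           s ^ ?i E v * (real d - real (?i E v)) * real (cut_size S E)
           - s ^ (?i E v - 1) * real (?i E v) * (m - real (cut_size S E))))"
        unfolding q_def[symmetric] \<eta>q sum_distrib_left[symmetric] by simp
    qed
    hence "\<bar>H' s\<bar> = (1 / m) * \<bar>\<Sum>E\<in>?R. ?w E * \<eta> (cut_size S E) * (\<Sum>v\<in>{..<n} - S.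
           s ^ ?i E v * (real d - real (?i E v)) * real (cut_size S E)
           - s ^ (?i E v - 1) * real (?i E v) * (m - real (cut_size S E)))\<bar>"
      using m0 by (simp only: sum_distrib_left[symmetric] abs_mult) simp
    also have "\<dots> \<le> (1 / m) * (real (4 * d\<^sup>2 * (d + 1) * n) * (s0 ^ d * s ^ d) * cut_sum d n b S)"
      unfolding m_def
    proof (intro mult_left_mono stein_plus_degree)
      fix E assume E: "E \<in> ?R"
      have "(1 + p E * (s0 - 1)) ^ d \<le> s0 ^ d" using q1[OF E, of s0] s0 by (intro power_mono) auto
      moreover have "(1 + p E * (s - 1)) ^ Suc d \<ge> 1" using q1(1)[OF E s(1)] by (rule one_le_power)
      moreover have "(1 + p E * (s0 - 1)) ^ d \<ge> 0" using q1(1)[OF E, of s0] s0 by simp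
      ultimately have "(1 + p E * (s0 - 1)) ^ d / (1 + p E * (s - 1)) ^ Suc d \<le> s0 ^ d / 1"
                      "0 \<le> (1 + p E * (s0 - 1)) ^ d / (1 + p E * (s - 1)) ^ Suc d"
        by (intro frac_le divide_nonneg_nonneg; simp)+
      moreover have "\<eta> (cut_size S E) = (1 + p E * (s0 - 1)) ^ d / (1 + p E * (s - 1)) ^ Suc d"
        by (simp add: \<eta>_def p_def)
      ultimately show "\<bar>\<eta> (cut_size S E)\<bar> \<le> s0 ^ d" by (simp only: abs_of_nonneg div_by_1)
    qed (use S b s m0 in \<open>auto simp: m_def\<close>)
    also have "\<dots> \<le> (1 / m) * (real (4 * d\<^sup>2 * (d + 1) * n) * (s0 ^ d * s0 ^ d) * cut_sum d n b S)"
      using m0 s b by (intro mult_left_mono mult_right_mono power_mono cut_sum_nonneg) auto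
    also have "s0 ^ d * s0 ^ d = s0 ^ (2 * d)" by (simp add: mult_2 power_add)
    finally show ?thesis by (simp add: mult_ac)
  qed
  have "\<exists>z>1. z < s0 \<and> H s0 - H 1 = (s0 - 1) * H' z"
    using deriv s0 by (intro MVT2) auto
  then obtain z where z: "z > 1" "z < s0" "H s0 - H 1 = (s0 - 1) * H' z" by blast
  have "\<bar>H s0 - H 1\<bar> = (s0 - 1) * \<bar>H' z\<bar>" unfolding z(3) using s0 by (simp add: abs_mult)
  also have "\<dots> \<le> (s0 - 1) * (real n / m * real (4 * d\<^sup>2 * (d + 1)) * s0 ^ (2 * d) * cut_sum d n b S)"
    using z s0 by (intro mult_left_mono bound) auto
  finally have "\<bar>H s0 - H 1\<bar> \<le> (s0 - 1) * (real n / m * real (4 * d\<^sup>2 * (d + 1)) * s0 ^ (2 * d)) * cut_sum d n b S"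
    by (simp add: mult.assoc)
  moreover have "H s0 = (\<Sum>E\<in>?R. ?w E * (\<Sum>v\<in>{..<n} - S. s0 ^ ?i E v))"
    unfolding H_def
  proof (intro sum.cong refl)
    fix E assume E: "E \<in> ?R"
    have "1 + p E * (s0 - 1) > 0" using q1(1)[OF E, of s0] s0 by simp
    thus "?w E * (1 + p E * (s0 - 1)) ^ d * (\<Sum>v\<in>{..<n} - S. s0 ^ ?i E v / (1 + p E * (s0 - 1)) ^ d)
       = ?w E * (\<Sum>v\<in>{..<n} - S. s0 ^ ?i E v)"
      by (simp add: sum_divide_distrib[symmetric])
  qed
  moreover have "H 1 = (real n - real (card S)) * (\<Sum>E\<in>?R. ?w E * (1 + real (cut_size S E) / m * (s0 - 1)) ^ d)"
  proof -
    have "card ({..<n} - S) = n - card S" using S by (simp add: card_Diff_subset finite_subset)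
    hence "real (card ({..<n} - S)) = real n - real (card S)" using Sn by simp
    thus ?thesis by (simp add: H_def p_def sum_distrib_left mult_ac)
  qed
  ultimately show ?thesis by simp
qed

text \<open>When \<open>v\<close> joins \<open>S\<close>, its edges into \<open>S\<close> cease to
  be cut and its remaining edges become cut.\<close>

lemma cut_size_insert:
  assumes E: "E \<in> regular_graphs d n" and v: "v < n" "v \<notin> S"
  shows "cut_size (insert v S) E + 2 * plus_degree S E v = cut_size S E + d"
proof -
  have fin: "finite E" using E by (rule finite_regular_graph)
  have cs: "real (cut_size T E) = (\<Sum>e\<in>E. of_bool (card (e \<inter> T) = 1))" for T
    unfolding cut_size_def using fin by (simp add: sum_of_bool_eq Int_def)
  have pd: "real (plus_degree S E v) = (\<Sum>e\<in>E. of_bool (v \<in> e \<and> e \<inter> S \<noteq> {}))"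
    unfolding plus_degree_def using fin by (simp add: sum_of_bool_eq Int_def)
  have dd: "real d = (\<Sum>e\<in>E. of_bool (v \<in> e))"
  proof -
    have "d = card {e \<in> E. v \<in> e}" using E v by (simp add: regular_graphs_def)
    thus ?thesis using fin by (simp add: sum_of_bool_eq Int_def)
  qed
  have "real (cut_size (insert v S) E) + 2 * real (plus_degree S E v) = real (cut_size S E) + real d"
    unfolding cs pd dd sum_distrib_left sum.distrib[symmetric]
  proof (intro sum.cong refl)
    fix e assume "e \<in> E"
    then obtain x y where e: "e = {x, y}" "x \<noteq> y" using regular_graph_edge_ex[OF E] by blast
    show "of_bool (card (e \<inter> insert v S) = 1) + 2 * of_bool (v \<in> e \<and> e \<inter> S \<noteq> {})
        = of_bool (card (e \<inter> S) = 1) + (of_bool (v \<in> e) :: real)"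
      unfolding e(1) card_doubleton_Int_eq_1[OF e(2)] using e(2) v
      by (cases "v = x"; cases "v = y"; cases "x \<in> S"; cases "y \<in> S") auto
  qed
  thus ?thesis by linarith
qed

lemma cut_weight_insert:
  assumes E: "E \<in> regular_graphs d n" and v: "v < n" "v \<notin> S" and b: "0 < b"
  shows "cut_weight b (insert v S) E = b ^ d * (cut_weight b S E * (1 / b\<^sup>2) ^ plus_degree S E v)"
proof -
  have "b ^ cut_size (insert v S) E * b ^ (2 * plus_degree S E v) = b ^ cut_size S E * b ^ d"
    unfolding power_add[symmetric] cut_size_insert[OF E v] ..
  thus ?thesis using b by (simp add: cut_weight_def power_mult power_one_over field_simps)
qed

text \<open>A flip adds at most \<open>d\<close> cut edges. Unlike the sharp estimate below, this
  one is uniform in \<open>S\<close>, and it is what remains available close to the constant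
  configurations.\<close>

lemma cut_sum_insert_ge:
  assumes S: "S \<subseteq> {..<n}" and v: "v < n" "v \<notin> S" and b: "0 < b" "b \<le> 1"
  shows "b ^ d * cut_sum d n b S \<le> cut_sum d n b (insert v S)"
  unfolding cut_sum_def sum_distrib_left
proof (rule sum_mono)
  fix E assume E: "E \<in> regular_graphs d n"
  have "1 \<le> (1 / b\<^sup>2) ^ plus_degree S E v" using b by (intro one_le_power) (simp add: power_le_one)
  hence "b ^ d * (cut_weight b S E * 1) \<le> b ^ d * (cut_weight b S E * (1 / b\<^sup>2) ^ plus_degree S E v)"
    using b cut_weight_pos[of b S E] by (intro mult_left_mono) auto
  thus "b ^ d * cut_weight b S E \<le> cut_weight b (insert v S) E"
    by (simp add: cut_weight_insert[OF E v b(1)])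
qed

text \<open>The share of one edge in the factor gained by a flip. With
  \<open>p = cut_density b a / (1 - a)\<close>, the limiting probability that a neighbour of a minus
  vertex is plus, it is \<open>b\<close> times the mean of \<open>(1 / b\<^sup>2) ^ X\<close> for a
  Bernoulli variable \<open>X\<close> with parameter \<open>p\<close>.\<close>

definition flip_factor :: "real \<Rightarrow> real \<Rightarrow> real" where
  "flip_factor b a = b * (1 + cut_density b a / (1 - a) * (1 / b\<^sup>2 - 1))"

text \<open>By \<open>cut_weight_insert\<close> the sum over the flipped vertex is the generating
  function of the plus degrees at \<open>1 / b\<^sup>2\<close>. Its approximation still contains the
  random cut size; a second order expansion around the limiting density, together with the two
  moment bounds, removes it. The bound on \<open>card S\<close> keeps the divisor
  \<open>1 - a\<close> away from 0.\<close>

lemma sum_cut_sum_insert: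
  assumes d: "d \<ge> 1" and b: "0 < b" "b < 1" and \<epsilon>: "\<epsilon> > 0"
  shows "\<exists>C\<ge>0. \<forall>n S. n \<ge> 2 \<longrightarrow> S \<subseteq> {..<n} \<longrightarrow> real (card S) \<le> (1 - \<epsilon>) * real n \<longrightarrow>
       \<bar>(\<Sum>v\<in>{..<n} - S. cut_sum d n b (insert v S))
         - (real n - real (card S)) * flip_factor b (real (card S) / real n) ^ d * cut_sum d n b S\<bar>
       \<le> C * cut_sum d n b S"
proof -
  obtain C1 where C1: "C1 \<ge> 0" and C1': "\<forall>n S. n \<ge> 2 \<longrightarrow> S \<subseteq> {..<n} \<longrightarrow>
       (\<Sum>E\<in>regular_graphs d n. cut_weight b S E *
          (real (cut_size S E) / real n - real d * cut_density b (real (card S) / real n))\<^sup>2)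
         \<le> C1 / real n * cut_sum d n b S \<and>
       \<bar>\<Sum>E\<in>regular_graphs d n. cut_weight b S E *
          (real (cut_size S E) / real n - real d * cut_density b (real (card S) / real n))\<bar>
         \<le> C1 / real n * cut_sum d n b S"
    using cut_size_moments[OF d b] by blast
  define s where "s = 1 / b\<^sup>2"
  have s1: "s > 1" using b by (simp add: s_def power_less_one_iff)
  \<comment> \<open>\<open>A\<close> collects the error of the generating function, \<open>B\<close>
    the linear and the quadratic term of the expansion in the cut size.\<close>
  define A where "A = (s - 1) * (1 / (real d * \<epsilon>) * real (4 * d\<^sup>2 * (d + 1)) * s ^ (2 * d))"
  define B where "B = real d * s ^ d * ((s - 1) / (real d * \<epsilon>)) * C1
                      + (real d)\<^sup>2 * s ^ d * ((s - 1) / (real d * \<epsilon>))\<^sup>2 * C1"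
  have A0: "A \<ge> 0" and B0: "B \<ge> 0" using s1 C1 \<epsilon> d by (simp_all add: A_def B_def)
  show ?thesis
  proof (intro exI[of _ "b ^ d * (A + B)"] conjI allI impI)
    show "0 \<le> b ^ d * (A + B)" using A0 B0 b by simp
  next
    fix n S assume n: "n \<ge> 2" and S: "S \<subseteq> {..<n}" and Sn: "real (card S) \<le> (1 - \<epsilon>) * real n"
    let ?R = "regular_graphs d n" and ?w = "cut_weight b S" and ?W = "cut_sum d n b S"
    define a where "a = real (card S) / real n"
    define m where "m = real d * (real n - real (card S))"
    define y where "y = cut_density b a"
    have n0: "real n > 0" using n by simp
    have a: "0 \<le> a" "1 - a \<ge> \<epsilon>" using Sn n0 by (simp_all add: a_def field_simps)
    have cS: "real (card S) = real n * a" using n0 by (simp add: a_def)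
    have a1: "a < 1" using a \<epsilon> by linarith
    have "card S < n" using a1 n0 by (simp add: a_def)
    have m: "m = real n * (real d * (1 - a))" by (simp add: m_def cS algebra_simps)
    have da: "real d * (1 - a) \<ge> real d * \<epsilon>" "real d * \<epsilon> > 0" using a \<epsilon> d by (auto intro: mult_left_mono)
    hence da0: "real d * (1 - a) > 0" by linarith
    have m0: "m > 0" unfolding m using n0 da0 by simp
    have W0: "?W \<ge> 0" using b by (simp add: cut_sum_nonneg)
    have w0: "?w E \<ge> 0" for E using b by (simp add: cut_weight_def)
    have "(\<Sum>v\<in>{..<n} - S. cut_sum d n b (insert v S))
        = (\<Sum>v\<in>{..<n} - S. \<Sum>E\<in>?R. b ^ d * (?w E * s ^ plus_degree S E v))"
      unfolding cut_sum_def s_def using b by (intro sum.cong refl cut_weight_insert) auto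
    also have "\<dots> = b ^ d * (\<Sum>E\<in>?R. ?w E * (\<Sum>v\<in>{..<n} - S. s ^ plus_degree S E v))"
      by (subst sum.swap) (simp add: sum_distrib_left)
    finally have eq1: "(\<Sum>v\<in>{..<n} - S. cut_sum d n b (insert v S))
        = b ^ d * (\<Sum>E\<in>?R. ?w E * (\<Sum>v\<in>{..<n} - S. s ^ plus_degree S E v))" .
    define P where "P = (\<lambda>E. 1 + real (cut_size S E) / m * (s - 1))"
    define P0 where "P0 = 1 + y / (1 - a) * (s - 1)"
    have step1: "\<bar>(\<Sum>E\<in>?R. ?w E * (\<Sum>v\<in>{..<n} - S. s ^ plus_degree S E v))
        - (real n - real (card S)) * (\<Sum>E\<in>?R. ?w E * P E ^ d)\<bar> \<le> A * ?W"
    proof -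
      have "\<bar>(\<Sum>E\<in>?R. ?w E * (\<Sum>v\<in>{..<n} - S. s ^ plus_degree S E v))
        - (real n - real (card S)) * (\<Sum>E\<in>?R. ?w E * P E ^ d)\<bar>
          \<le> (s - 1) * (real n / m * real (4 * d\<^sup>2 * (d + 1)) * s ^ (2 * d)) * ?W"
        unfolding P_def m_def using b S s1 \<open>card S < n\<close> d
        by (intro plus_degree_generating_function) auto
      also have "\<dots> \<le> A * ?W" unfolding A_def
      proof (intro mult_right_mono mult_left_mono W0)
        show "real n / m \<le> 1 / (real d * \<epsilon>)" unfolding m using n0 da da0 by (simp add: frac_le)
      qed (use s1 in auto)
      finally show ?thesis .
    qed
    have y01: "0 \<le> y / (1 - a)" "y / (1 - a) \<le> 1"
      using cut_density[OF b a(1)] a1 by (simp_all add: y_def)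
    have P0: "0 \<le> P0" "P0 \<le> s"
    proof -
      show "0 \<le> P0" unfolding P0_def using mult_nonneg_nonneg[OF y01(1), of "s - 1"] s1 by linarith
      have "y / (1 - a) * (s - 1) \<le> 1 * (s - 1)" using y01 s1 by (intro mult_right_mono) auto
      thus "P0 \<le> s" by (simp add: P0_def)
    qed
    have P: "0 \<le> P E" "P E \<le> s" if "E \<in> ?R" for E
    proof -
      have p: "0 \<le> real (cut_size S E) / m" "real (cut_size S E) / m \<le> 1"
        using cut_size_le(2)[OF that S] m0 by (simp_all add: m_def[symmetric])
      show "0 \<le> P E" unfolding P_def using mult_nonneg_nonneg[OF p(1), of "s - 1"] s1 by linarith
      have "real (cut_size S E) / m * (s - 1) \<le> 1 * (s - 1)" using p s1 by (intro mult_right_mono) auto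
      thus "P E \<le> s" by (simp add: P_def)
    qed
    define X where "X = (\<lambda>E. real (cut_size S E) / real n - real d * y)"
    define c where "c = (s - 1) / (real d * (1 - a))"
    have PX: "P E - P0 = c * X E" for E
    proof -
      have e1: "real (cut_size S E) / m = (real (cut_size S E) / real n) / (real d * (1 - a))"
        by (simp add: m)
      have e2: "y / (1 - a) = (real d * y) / (real d * (1 - a))" using d by simp
      have gen: "(Y / D - Z / D) * t = t / D * (Y - Z)" for Y Z D t :: real
        by (simp add: diff_divide_distrib algebra_simps)
      have "P E - P0 = ((real (cut_size S E) / real n) / (real d * (1 - a)) - (real d * y) / (real d * (1 - a))) * (s - 1)"
        unfolding P_def P0_def e1 e2 by (simp only: left_diff_distrib add_diff_cancel_left)
      thus ?thesis unfolding X_def c_def gen .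
    qed
    have c: "0 \<le> c" "c \<le> (s - 1) / (real d * \<epsilon>)"
    proof -
      show "0 \<le> c" using s1 da0 by (simp add: c_def)
      show "c \<le> (s - 1) / (real d * \<epsilon>)" unfolding c_def using s1 da da0 by (intro divide_left_mono) auto
    qed
    have M2: "(\<Sum>E\<in>?R. ?w E * (X E)\<^sup>2) \<le> C1 / real n * ?W"
     and M1: "\<bar>\<Sum>E\<in>?R. ?w E * X E\<bar> \<le> C1 / real n * ?W"
      using C1'[rule_format, OF n S] by (simp_all add: X_def y_def a_def)
    have step2: "\<bar>(\<Sum>E\<in>?R. ?w E * P E ^ d) - P0 ^ d * ?W\<bar> \<le> B / real n * ?W"
    proof -
      have "(\<Sum>E\<in>?R. ?w E * P E ^ d) - P0 ^ d * ?W = (\<Sum>E\<in>?R. ?w E * (P E ^ d - P0 ^ d))"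
        by (simp add: cut_sum_def sum_distrib_left sum_subtractf[symmetric] algebra_simps)
      also have "\<dots> = (\<Sum>E\<in>?R. ?w E * (real d * P0 ^ (d - 1) * (P E - P0)))
          + (\<Sum>E\<in>?R. ?w E * (P E ^ d - P0 ^ d - real d * P0 ^ (d - 1) * (P E - P0)))"
        by (simp add: sum.distrib[symmetric] algebra_simps)
      finally have eqP: "(\<Sum>E\<in>?R. ?w E * P E ^ d) - P0 ^ d * ?W
          = (\<Sum>E\<in>?R. ?w E * (real d * P0 ^ (d - 1) * (P E - P0)))
          + (\<Sum>E\<in>?R. ?w E * (P E ^ d - P0 ^ d - real d * P0 ^ (d - 1) * (P E - P0)))" .
      have t1: "\<bar>\<Sum>E\<in>?R. ?w E * (real d * P0 ^ (d - 1) * (P E - P0))\<bar>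
          \<le> real d * s ^ d * ((s - 1) / (real d * \<epsilon>)) * (C1 / real n * ?W)"
      proof -
        have "(\<Sum>E\<in>?R. ?w E * (real d * P0 ^ (d - 1) * (P E - P0)))
           = real d * P0 ^ (d - 1) * c * (\<Sum>E\<in>?R. ?w E * X E)"
          unfolding PX by (simp add: sum_distrib_left mult_ac)
        hence "\<bar>\<Sum>E\<in>?R. ?w E * (real d * P0 ^ (d - 1) * (P E - P0))\<bar>
          = real d * P0 ^ (d - 1) * c * \<bar>\<Sum>E\<in>?R. ?w E * X E\<bar>"
          using c(1) P0 by (simp add: abs_mult)
        also have "\<dots> \<le> real d * s ^ d * ((s - 1) / (real d * \<epsilon>)) * (C1 / real n * ?W)"
        proof (intro mult_mono M1 c mult_nonneg_nonneg)
          have "P0 ^ (d - 1) \<le> s ^ (d - 1)" using P0 by (intro power_mono) auto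
          also have "\<dots> \<le> s ^ d" using s1 by (intro power_increasing) auto
          finally show "P0 ^ (d - 1) \<le> s ^ d" .
        qed (use P0 s1 c da in auto)
        finally show ?thesis .
      qed
      have t2: "\<bar>\<Sum>E\<in>?R. ?w E * (P E ^ d - P0 ^ d - real d * P0 ^ (d - 1) * (P E - P0))\<bar>
          \<le> (real d)\<^sup>2 * s ^ d * ((s - 1) / (real d * \<epsilon>))\<^sup>2 * (C1 / real n * ?W)"
      proof -
        have "\<bar>\<Sum>E\<in>?R. ?w E * (P E ^ d - P0 ^ d - real d * P0 ^ (d - 1) * (P E - P0))\<bar>
          \<le> (\<Sum>E\<in>?R. ?w E * ((real d)\<^sup>2 * s ^ d * (P E - P0)\<^sup>2))"
        proof (rule order.trans[OF sum_abs sum_mono])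
          fix E assume E: "E \<in> ?R"
          have "\<bar>?w E * (P E ^ d - P0 ^ d - real d * P0 ^ (d - 1) * (P E - P0))\<bar>
            = ?w E * \<bar>P E ^ d - P0 ^ d - real d * P0 ^ (d - 1) * (P E - P0)\<bar>"
            using w0[of E] by (simp add: abs_mult)
          also have "\<dots> \<le> ?w E * ((real d)\<^sup>2 * s ^ d * (P E - P0)\<^sup>2)"
            using P[OF E] P0 s1 by (intro mult_left_mono w0 power_taylor2) auto
          finally show "\<bar>?w E * (P E ^ d - P0 ^ d - real d * P0 ^ (d - 1) * (P E - P0))\<bar>
             \<le> ?w E * ((real d)\<^sup>2 * s ^ d * (P E - P0)\<^sup>2)" .
        qed
        also have "(\<Sum>E\<in>?R. ?w E * ((real d)\<^sup>2 * s ^ d * (P E - P0)\<^sup>2))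
            = (real d)\<^sup>2 * s ^ d * c\<^sup>2 * (\<Sum>E\<in>?R. ?w E * (X E)\<^sup>2)"
          unfolding PX by (simp add: sum_distrib_left power_mult_distrib mult_ac)
        also have "\<dots> \<le> (real d)\<^sup>2 * s ^ d * ((s - 1) / (real d * \<epsilon>))\<^sup>2 * (C1 / real n * ?W)"
          using c s1 w0 by (intro mult_mono M2 power_mono mult_nonneg_nonneg sum_nonneg) auto
        finally show ?thesis .
      qed
      have eqB: "B / real n * ?W = real d * s ^ d * ((s - 1) / (real d * \<epsilon>)) * (C1 / real n * ?W) +
          (real d)\<^sup>2 * s ^ d * ((s - 1) / (real d * \<epsilon>))\<^sup>2 * (C1 / real n * ?W)"
      proof -
        have "(g * C + h * C) / r * w = g * (C / r * w) + h * (C / r * w)" for g h C r w :: real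
          by (simp add: add_divide_distrib distrib_right)
        thus ?thesis unfolding B_def .
      qed
      show ?thesis unfolding eqP eqB
        by (rule order.trans[OF abs_triangle_ineq add_mono[OF t1 t2]])
    qed
    have nS: "0 \<le> real n - real (card S)" "real n - real (card S) \<le> real n"
      using \<open>card S < n\<close> by simp_all
    have "\<bar>(\<Sum>E\<in>?R. ?w E * (\<Sum>v\<in>{..<n} - S. s ^ plus_degree S E v)) - (real n - real (card S)) * (P0 ^ d * ?W)\<bar>
        \<le> A * ?W + (real n - real (card S)) * (B / real n * ?W)"
    proof -
      have "\<bar>(real n - real (card S)) * (\<Sum>E\<in>?R. ?w E * P E ^ d) - (real n - real (card S)) * (P0 ^ d * ?W)\<bar>
         = (real n - real (card S)) * \<bar>(\<Sum>E\<in>?R. ?w E * P E ^ d) - P0 ^ d * ?W\<bar>"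
        using nS by (simp flip: right_diff_distrib add: abs_mult)
      also have "\<dots> \<le> (real n - real (card S)) * (B / real n * ?W)"
        using nS by (intro mult_left_mono step2)
      finally show ?thesis using step1 by linarith
    qed
    also have "\<dots> \<le> A * ?W + real n * (B / real n * ?W)"
      using nS B0 W0 by (intro add_left_mono mult_right_mono) auto
    also have "\<dots> = (A + B) * ?W" using n0 by (simp add: algebra_simps)
    finally have fin: "\<bar>(\<Sum>E\<in>?R. ?w E * (\<Sum>v\<in>{..<n} - S. s ^ plus_degree S E v)) - (real n - real (card S)) * (P0 ^ d * ?W)\<bar>
        \<le> (A + B) * ?W" .
    have ff: "flip_factor b (real (card S) / real n) = b * P0"
      unfolding flip_factor_def P0_def y_def a_def s_def ..
    have "\<bar>(\<Sum>v\<in>{..<n} - S. cut_sum d n b (insert v S)) - (real n - real (card S)) * (b * P0) ^ d * ?W\<bar>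
       = b ^ d * \<bar>(\<Sum>E\<in>?R. ?w E * (\<Sum>v\<in>{..<n} - S. s ^ plus_degree S E v)) - (real n - real (card S)) * (P0 ^ d * ?W)\<bar>"
    proof -
      have "(\<Sum>v\<in>{..<n} - S. cut_sum d n b (insert v S)) - (real n - real (card S)) * (b * P0) ^ d * ?W
        = b ^ d * ((\<Sum>E\<in>?R. ?w E * (\<Sum>v\<in>{..<n} - S. s ^ plus_degree S E v)) - (real n - real (card S)) * (P0 ^ d * ?W))"
        unfolding eq1 by (simp add: power_mult_distrib algebra_simps)
      thus ?thesis using b by (simp add: abs_mult)
    qed
    also have "\<dots> \<le> b ^ d * ((A + B) * ?W)" using b fin by (intro mult_left_mono) auto
    finally show "\<bar>(\<Sum>v\<in>{..<n} - S. cut_sum d n b (insert v S))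
         - (real n - real (card S)) * flip_factor b (real (card S) / real n) ^ d * cut_sum d n b S\<bar>
       \<le> b ^ d * (A + B) * cut_sum d n b S"
      unfolding ff by (simp only: mult.assoc)
  qed
qed

section \<open>The function \<open>A\<close>\<close>

text \<open>For \<open>b = exp (-2 * \<beta>)\<close> the integrand of \<open>g_fun\<close>; it is
  considered beyond \<open>1 / 2\<close> as well, where \<open>g_fun\<close> itself stops
  integrating.\<close>

definition edge_field :: "real \<Rightarrow> real \<Rightarrow> real" where
  "edge_field b a = ln ((b * (1 - 2 * a) + disc b a) / (2 * (1 - a)))"

lemma disc_pos:
  assumes "0 < b" "b < 1" "0 \<le> a" "a \<le> 1"
  shows "disc b a > 0"
  using disc_sq(2)[OF assms] assms(1) by linarith

lemma disc_half [simp]: "disc b (1 / 2) = 1"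
  by (simp add: disc_def)

lemma disc_reflect: "disc b (1 - a) = disc b a"
  by (simp add: disc_def power2_eq_square algebra_simps)

lemma edge_numerator_pos:
  assumes b: "0 < b" "b < 1" and a: "0 \<le> a" "a < 1"
  shows "b * (1 - 2 * a) + disc b a > 0"
proof (cases "a \<le> 1 / 2")
  case True
  hence "b * (1 - 2 * a) \<ge> 0" using b by simp
  thus ?thesis using disc_pos[of b a] assms by linarith
next
  case False
  have "(b * (2 * a - 1))\<^sup>2 < (disc b a)\<^sup>2"
  proof -
    have "(2 * a - 1)\<^sup>2 < 1" using a False by (simp add: abs_square_less_1)
    moreover have "(disc b a)\<^sup>2 - (b * (2 * a - 1))\<^sup>2 = 1 - (2 * a - 1)\<^sup>2"
      using disc_sq(1)[of b a] assms by (simp add: power_mult_distrib) (simp add: power2_eq_square algebra_simps)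
    ultimately show ?thesis by linarith
  qed
  hence "b * (2 * a - 1) < disc b a"
    using disc_pos[of b a] assms by (intro power2_less_imp_less[of _ "disc b a"]) auto
  thus ?thesis by (simp add: algebra_simps)
qed

text \<open>The numerators at \<open>a\<close> and \<open>1 - a\<close> are conjugate: their product
  is \<open>disc^2 - b^2 (1 - 2 a)^2 = 4 a (1 - a)\<close>, so the two arguments of the logarithm
  are inverse to each other.\<close>

lemma edge_field_reflect:
  assumes b: "0 < b" "b < 1" and a: "0 < a" "a < 1"
  shows "edge_field b (1 - a) = - edge_field b a"
proof -
  let ?D = "disc b a" and ?u = "1 - 2 * a"
  have p1: "b * ?u + ?D > 0" using edge_numerator_pos[of b a] assms by simp
  have p2: "- (b * ?u) + ?D > 0"
    using edge_numerator_pos[of b "1 - a"] assms by (simp add: disc_reflect algebra_simps)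
  have "(b * ?u + ?D) * (- (b * ?u) + ?D) = ?D\<^sup>2 - b\<^sup>2 * ?u\<^sup>2"
    by (simp add: power2_eq_square algebra_simps)
  also have "\<dots> = (2 * (1 - a)) * (2 * a)"
    using disc_sq(1)[of b a] assms by (simp add: power2_eq_square algebra_simps)
  finally have prod: "(b * ?u + ?D) * (- (b * ?u) + ?D) = (2 * (1 - a)) * (2 * a)" .
  have e: "edge_field b (1 - a) = ln ((- (b * ?u) + ?D) / (2 * a))"
    by (simp add: edge_field_def disc_reflect algebra_simps)
  have "edge_field b (1 - a) + edge_field b a
      = ln (((- (b * ?u) + ?D) / (2 * a)) * ((b * ?u + ?D) / (2 * (1 - a))))"
    unfolding e unfolding edge_field_def using p1 p2 a by (subst ln_mult_pos) auto
  also have "((- (b * ?u) + ?D) / (2 * a)) * ((b * ?u + ?D) / (2 * (1 - a))) = 1"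
    using prod a by (simp add: field_simps)
  finally show ?thesis by simp
qed

lemma edge_field_half: "0 < b \<Longrightarrow> b < 1 \<Longrightarrow> edge_field b (1 / 2) = 0"
  by (simp add: edge_field_def)

text \<open>Here the probabilistic and the analytic side meet: the limiting factor of a flip, found
  by switchings, is the exponential of the derivative of \<open>g_fun\<close>.\<close>

lemma exp_edge_field:
  assumes b: "0 < b" "b < 1" and a: "0 \<le> a" "a < 1"
  shows "exp (edge_field b a) = flip_factor b a"
proof -
  have b2: "1 - b\<^sup>2 > 0" using b by (simp add: power_less_one_iff)
  have "cut_density b a * (1 / b\<^sup>2 - 1) = (disc b a - b) / (2 * b)"
  proof -
    have e: "1 / b\<^sup>2 - 1 = (1 - b\<^sup>2) / b\<^sup>2" using b by (simp add: diff_divide_distrib)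
    have gen: "b * x / (2 * q) * (q / b\<^sup>2) = x / (2 * b)" if "q > 0" for q x
      using b that by (simp add: power2_eq_square)
    show ?thesis unfolding cut_density_def e by (rule gen[OF b2])
  qed
  hence "flip_factor b a = b * (1 + ((disc b a - b) / (2 * b)) / (1 - a))"
    by (simp add: flip_factor_def)
  also have "\<dots> = (b * (1 - 2 * a) + disc b a) / (2 * (1 - a))"
    using b a by (simp add: field_simps)
  also have "\<dots> = exp (edge_field b a)"
    unfolding edge_field_def using edge_numerator_pos[OF b a] a by (subst exp_ln) auto
  finally show ?thesis by simp
qed

lemma flip_factor_ge:
  assumes b: "0 < b" "b < 1" and a: "0 \<le> a" "a < 1"
  shows "b \<le> flip_factor b a"
proof -
  have b2: "1 / b\<^sup>2 - 1 \<ge> 0" using b by (simp add: power_le_one)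
  have "0 \<le> cut_density b a / (1 - a) * (1 / b\<^sup>2 - 1)"
    using cut_density(2)[of b a] assms b2 by (intro mult_nonneg_nonneg divide_nonneg_pos) auto
  thus ?thesis unfolding flip_factor_def using b by simp
qed

lemma edge_field_ge:
  assumes b: "0 < b" "b < 1" and a: "0 \<le> a" "a < 1"
  shows "ln b \<le> edge_field b a"
proof -
  have "ln b \<le> ln (exp (edge_field b a))"
    unfolding exp_edge_field[OF assms] using flip_factor_ge[OF assms] b by (subst ln_le_cancel_iff) auto
  thus ?thesis by simp
qed

lemma disc_has_derivative:
  assumes b: "0 < b" "b < 1" and a: "0 \<le> a" "a \<le> 1"
  shows "(disc b has_real_derivative 2 * (1 - b\<^sup>2) * (1 - 2 * a) / disc b a) (at a)"
proof -
  have "1 - (1 - b\<^sup>2) * (1 - 2 * a)\<^sup>2 = (disc b a)\<^sup>2" using disc_sq(1)[OF assms] by simp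
  also have "\<dots> > 0" using disc_pos[OF assms] by simp
  finally have p: "1 - (1 - b\<^sup>2) * (1 - 2 * a)\<^sup>2 > 0" .
  show ?thesis unfolding disc_def[abs_def] using p
    by (auto intro!: derivative_eq_intros simp: field_simps)
qed

lemma edge_field_has_derivative:
  assumes b: "0 < b" "b < 1" and a: "0 < a" "a < 1"
  shows "(edge_field b has_real_derivative (1 - b / disc b a) / (2 * a * (1 - a))) (at a)"
proof -
  define D where "D = disc b a"
  define N where "N = b * (1 - 2 * a) + D"
  have D: "D > 0" using disc_pos[of b a] assms by (simp add: D_def)
  have N: "N > 0" using edge_numerator_pos[of b a] assms by (simp add: D_def N_def)
  have D2: "D * D = 1 - (1 - b * b) * ((1 - 2 * a) * (1 - 2 * a))"
    using disc_sq(1)[of b a] assms by (simp add: D_def power2_eq_square)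
  have dD: "(disc b has_real_derivative 2 * (1 - b\<^sup>2) * (1 - 2 * a) / D) (at a)"
    using disc_has_derivative[of b a] assms by (simp add: D_def)
  have pos: "0 < (b * (1 - 2 * a) + disc b a) / (2 * (1 - a))"
    using N a by (simp add: N_def D_def)
  have "(edge_field b has_real_derivative
     (((b * (- 2) + 2 * (1 - b\<^sup>2) * (1 - 2 * a) / D) * (2 * (1 - a)) - N * (- 2)) / (2 * (1 - a) * (2 * (1 - a))))
       / (N / (2 * (1 - a)))) (at a)"
    unfolding edge_field_def[abs_def] N_def D_def using pos dD[unfolded D_def] a
    by (auto intro!: derivative_eq_intros simp: ac_simps)
  moreover have "(((b * (- 2) + 2 * (1 - b\<^sup>2) * (1 - 2 * a) / D) * (2 * (1 - a)) - N * (- 2)) / (2 * (1 - a) * (2 * (1 - a))))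
       / (N / (2 * (1 - a))) = (1 - b / D) / (2 * a * (1 - a))"
  proof -
    \<comment> \<open>With denominators cleared the claim is polynomial in \<open>a\<close>,
      \<open>b\<close> and \<open>D\<close>, and holds modulo the relation
      \<open>D2\<close>.\<close>
    have key: "2 * a * ((- 2 * b * D + 2 * (1 - b * b) * (1 - 2 * a)) * (1 - a) + N * D) = (D - b) * N"
      using D2 unfolding N_def by algebra
    have "(((b * (- 2) + 2 * (1 - b\<^sup>2) * (1 - 2 * a) / D) * (2 * (1 - a)) - N * (- 2)) / (2 * (1 - a) * (2 * (1 - a))))
       / (N / (2 * (1 - a))) = ((- 2 * b * D + 2 * (1 - b * b) * (1 - 2 * a)) * (1 - a) + N * D) / (N * D * (1 - a))"
      using a N D by (simp add: divide_simps power2_eq_square) (simp add: algebra_simps)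
    also have "\<dots> = (2 * a * ((- 2 * b * D + 2 * (1 - b * b) * (1 - 2 * a)) * (1 - a) + N * D)) / (2 * a * (N * D * (1 - a)))"
      using a by simp
    also have "\<dots> = (1 - b / D) / (2 * a * (1 - a))" unfolding key using a N D by (simp add: field_simps)
    finally show ?thesis .
  qed
  ultimately show ?thesis by (simp add: D_def)
qed

lemma continuous_on_edge_field:
  assumes b: "0 < b" "b < 1" and c: "c < 1"
  shows "continuous_on {0..c} (edge_field b)"
proof -
  have "continuous_on {0..c} (disc b)" unfolding disc_def[abs_def] by (intro continuous_intros)
  moreover have "(b * (1 - 2 * a) + disc b a) / (2 * (1 - a)) \<noteq> 0" if "a \<in> {0..c}" for a
    using edge_numerator_pos[OF b, of a] that c by auto
  ultimately show ?thesis unfolding edge_field_def[abs_def] using c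
    by (intro continuous_intros) auto
qed

lemma g_fun_has_derivative:
  assumes \<beta>: "\<beta> > 0" and a: "0 < a" "a < 1"
  shows "(g_fun \<beta> has_real_derivative edge_field (exp (-2 * \<beta>)) a) (at a)"
proof -
  define b where "b = exp (-2 * \<beta>)"
  have b: "0 < b" "b < 1" using \<beta> by (simp_all add: b_def)
  define G where "G = (\<lambda>a. integral {0..a} (edge_field b))"
  have b2: "exp (-4 * \<beta>) = b\<^sup>2" by (simp add: b_def power2_eq_square exp_add[symmetric])
  have int: "(\<lambda>s. ln ((exp (-2 * \<beta>) * (1 - 2 * s) + sqrt (1 + (exp (-4 * \<beta>) - 1) * (1 - 2 * s)\<^sup>2))
              / (2 * (1 - s)))) = edge_field b"
    unfolding edge_field_def disc_def b2 b_def[symmetric] by (simp add: algebra_simps)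
  have G: "(G has_real_derivative edge_field b t) (at t)" if "0 < t" "t < 1" for t
  proof -
    define c where "c = (1 + t) / 2"
    have "(G has_real_derivative edge_field b t) (at t within {0..c})"
      unfolding G_def using that b
      by (intro integral_has_real_derivative continuous_on_edge_field) (auto simp: c_def)
    thus ?thesis using that by (subst (asm) at_within_interior[of t]) (auto simp: c_def)
  qed
  have G': "((\<lambda>t. G (1 - t)) has_real_derivative - edge_field b (1 - t)) (at t)" if "0 < t" "t < 1" for t
  proof -
    have "((\<lambda>t. 1 - t) has_real_derivative -1) (at t)" by (auto intro!: derivative_eq_intros)
    moreover have "(G has_real_derivative edge_field b (1 - t)) (at (1 - t))"
      using that by (intro G) auto
    ultimately show ?thesis
      using DERIV_chain2[where f = G and g = "\<lambda>t. 1 - t" and x = t and s = UNIV] by fastforce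
  qed
  have sym: "G (1 - t) = G t" if t: "0 < t" "t < 1" for t
  proof -
    have "(\<lambda>t. G t - G (1 - t)) t = (\<lambda>t. G t - G (1 - t)) (1 / 2)"
    proof (rule DERIV_isconst3[where a = 0 and b = 1 and f = "\<lambda>t. G t - G (1 - t)"])
      fix x :: real assume "x \<in> {0<..<1}"
      thus "((\<lambda>t. G t - G (1 - t)) has_real_derivative 0) (at x)"
        using DERIV_diff[OF G[of x] G'[of x]] edge_field_reflect[OF b, of x] by simp
    qed (use t in auto)
    thus ?thesis by simp
  qed
  have eq: "g_fun \<beta> t = G t" if "0 < t" "t < 1" for t
  proof (cases "t \<le> 1 / 2")
    case True
    hence "min t (1 - t) = t" by simp
    thus ?thesis unfolding g_fun_def int G_def by simp
  next
    case False
    hence "min t (1 - t) = 1 - t" by simp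
    hence "g_fun \<beta> t = G (1 - t)" unfolding g_fun_def int G_def by simp
    thus ?thesis using sym that by simp
  qed
  have "eventually (\<lambda>t. t \<in> {0<..<1}) (nhds a)" using a by (intro eventually_nhds_in_open) auto
  hence "eventually (\<lambda>t. g_fun \<beta> t = G t) (nhds a)" by eventually_elim (use eq in auto)
  hence "(g_fun \<beta> has_real_derivative edge_field b a) (at a) \<longleftrightarrow> (G has_real_derivative edge_field b a) (at a)"
    by (intro DERIV_cong_ev) auto
  thus ?thesis using G[OF a] by (simp add: b_def)
qed

definition A_deriv :: "nat \<Rightarrow> real \<Rightarrow> real \<Rightarrow> real \<Rightarrow> real" where
  "A_deriv d b h a = 2 * h + real d * edge_field b a + ln (1 - a) - ln a"

definition A_deriv2 :: "nat \<Rightarrow> real \<Rightarrow> real \<Rightarrow> real" where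
  "A_deriv2 d b a = (real d - 2 - real d * b / disc b a) / (2 * a * (1 - a))"

lemma A_fun_has_derivative:
  assumes \<beta>: "\<beta> > 0" and a: "0 < a" "a < 1"
  shows "(A_fun d \<beta> h has_real_derivative A_deriv d (exp (-2 * \<beta>)) h a) (at a)"
  unfolding A_fun_def[abs_def] entropy_fun_def A_deriv_def
  using a by (auto intro!: derivative_eq_intros g_fun_has_derivative[OF \<beta>])

lemma A_deriv_has_derivative:
  assumes b: "0 < b" "b < 1" and a: "0 < a" "a < 1"
  shows "(A_deriv d b h has_real_derivative A_deriv2 d b a) (at a)"
proof -
  have D: "disc b a > 0" using disc_pos[of b a] assms by simp
  have "(A_deriv d b h has_real_derivative
     real d * ((1 - b / disc b a) / (2 * a * (1 - a))) + (- 1) / (1 - a) - 1 / a) (at a)"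
    unfolding A_deriv_def[abs_def]
    using a by (auto intro!: derivative_eq_intros edge_field_has_derivative[OF b a])
  moreover have "real d * ((1 - b / disc b a) / (2 * a * (1 - a))) + (- 1) / (1 - a) - 1 / a = A_deriv2 d b a"
    unfolding A_deriv2_def using a D by (simp add: divide_simps) (simp add: algebra_simps)
  ultimately show ?thesis by simp
qed

lemma A_fun_reflect: "A_fun d \<beta> h (1 - a) = A_fun d \<beta> h a + 2 * h * (1 - 2 * a)"
  unfolding A_fun_def entropy_fun_def g_fun_def by (simp add: min.commute algebra_simps)

lemma A_fun_neg_reflect: "A_fun d \<beta> (- h) (1 - a) = A_fun d \<beta> h a - 2 * h"
  unfolding A_fun_def entropy_fun_def g_fun_def by (simp add: min.commute algebra_simps)

lemma A_deriv_neg_reflect: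
  assumes b: "0 < b" "b < 1" and a: "0 < a" "a < 1"
  shows "A_deriv d b (- h) (1 - a) = - A_deriv d b h a"
  unfolding A_deriv_def edge_field_reflect[OF assms] by simp

lemma A_deriv2_reflect: "A_deriv2 d b (1 - a) = A_deriv2 d b a"
  unfolding A_deriv2_def disc_reflect by (simp add: mult_ac)

lemma A_deriv_half: "0 < b \<Longrightarrow> b < 1 \<Longrightarrow> A_deriv d b h (1 / 2) = 2 * h"
  by (simp add: A_deriv_def edge_field_half)

section \<open>The critical temperature and the maximizers of \<open>A\<close>\<close>

lemma exp_beta_c:
  assumes "d \<ge> 3"
  shows "exp (- 2 * beta_c d) = (real d - 2) / real d"
proof -
  have d: "real d \<ge> 3" using assms by simp
  have "beta_c d = ln (real d / (real d - 2)) / 2"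
  proof -
    have "(1 + 1 / (real d - 1)) / (1 - 1 / (real d - 1)) = real d / (real d - 2)"
      using d by (simp add: divide_simps)
    thus ?thesis by (simp add: beta_c_def artanh_def)
  qed
  hence "exp (- 2 * beta_c d) = inverse (real d / (real d - 2))"
  proof -
    have "- 2 * beta_c d = - ln (real d / (real d - 2))" unfolding \<open>beta_c d = _\<close> by simp
    thus ?thesis using d by (simp only: exp_minus) simp
  qed
  thus ?thesis by simp
qed

text \<open>Since \<open>disc b (1 / 2) = 1\<close>, comparing \<open>real d * b\<close> with
  \<open>real d - 2\<close> decides the sign of the second derivative of \<open>A\<close> at
  \<open>1 / 2\<close>; \<open>beta_c\<close> is where this sign changes.\<close>

lemma exp_beta_c_iff:
  assumes "d \<ge> 3"
  shows "\<beta> < beta_c d \<longleftrightarrow> real d - 2 < real d * exp (-2 * \<beta>)"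
    and "\<beta> > beta_c d \<longleftrightarrow> real d * exp (-2 * \<beta>) < real d - 2"
    and "\<beta> = beta_c d \<longleftrightarrow> real d * exp (-2 * \<beta>) = real d - 2"
proof -
  have e: "real d - 2 = real d * exp (-2 * beta_c d)" using exp_beta_c[OF assms] assms by simp
  have d0: "real d > 0" using assms by simp
  show "\<beta> < beta_c d \<longleftrightarrow> real d - 2 < real d * exp (-2 * \<beta>)"
    and "\<beta> > beta_c d \<longleftrightarrow> real d * exp (-2 * \<beta>) < real d - 2"
    and "\<beta> = beta_c d \<longleftrightarrow> real d * exp (-2 * \<beta>) = real d - 2"
    unfolding e using d0 by auto
qed

lemma A_deriv2_sign:
  assumes b: "0 < b" "b < 1" and a: "0 < a" "a < 1"
  shows "A_deriv2 d b a < 0 \<longleftrightarrow> real d - 2 < real d * b / disc b a"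
    and "A_deriv2 d b a > 0 \<longleftrightarrow> real d * b / disc b a < real d - 2"
proof -
  have q: "2 * a * (1 - a) > 0" using a by simp
  show "A_deriv2 d b a < 0 \<longleftrightarrow> real d - 2 < real d * b / disc b a"
    and "A_deriv2 d b a > 0 \<longleftrightarrow> real d * b / disc b a < real d - 2"
    unfolding A_deriv2_def pos_divide_less_eq[OF q] pos_less_divide_eq[OF q] by auto
qed

lemma disc_strict_antimono:
  assumes b: "0 < b" "b < 1" and xy: "1 / 2 \<le> x" "x < y" "y \<le> 1"
  shows "disc b y < disc b x"
proof -
  have "(2 * x - 1)\<^sup>2 < (2 * y - 1)\<^sup>2" using xy by (intro power_strict_mono) auto
  hence "(1 - 2 * x)\<^sup>2 < (1 - 2 * y)\<^sup>2" by (simp add: power2_commute)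
  moreover have "0 < 1 - b\<^sup>2" using b by (simp add: power_less_one_iff)
  ultimately have "(1 - b\<^sup>2) * (1 - 2 * x)\<^sup>2 < (1 - b\<^sup>2) * (1 - 2 * y)\<^sup>2" by simp
  thus ?thesis unfolding disc_def by simp
qed

text \<open>With \<open>A_deriv2_sign\<close> this reduces the sign of the second derivative on a
  whole interval in \<open>[1 / 2, 1)\<close> to a comparison at one of its ends.\<close>

lemma curvature_strict_mono:
  assumes d: "d \<ge> 3" and b: "0 < b" "b < 1" and xy: "1 / 2 \<le> x" "x < y" "y \<le> 1"
  shows "real d * b / disc b x < real d * b / disc b y"
proof -
  have "disc b x > 0" "disc b y > 0" using xy by (auto intro!: disc_pos[OF b])
  moreover have "real d * b > 0" using d b by simp
  ultimately show ?thesis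
    by (intro divide_strict_left_mono disc_strict_antimono[OF b xy]) simp_all
qed

lemma A_deriv_increasing:
  assumes b: "0 < b" "b < 1" and xy: "0 < x" "x < y" "y < 1"
    and pos: "\<And>t. x < t \<Longrightarrow> t < y \<Longrightarrow> A_deriv2 d b t > 0"
  shows "A_deriv d b h x < A_deriv d b h y"
proof (rule DERIV_pos_imp_increasing_open[OF xy(2)])
  show "\<exists>D. (A_deriv d b h has_real_derivative D) (at t) \<and> 0 < D" if "x < t" "t < y" for t
    using A_deriv_has_derivative[OF b, of t] pos[OF that] that xy by auto
  show "continuous_on {x..y} (A_deriv d b h)"
    using A_deriv_has_derivative[OF b] xy
    by (intro DERIV_continuous_on[where D = "A_deriv2 d b"]) (auto intro: has_field_derivative_at_within)
qed

lemma A_deriv_decreasing: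
  assumes b: "0 < b" "b < 1" and xy: "0 < x" "x < y" "y < 1"
    and neg: "\<And>t. x < t \<Longrightarrow> t < y \<Longrightarrow> A_deriv2 d b t < 0"
  shows "A_deriv d b h y < A_deriv d b h x"
proof (rule DERIV_neg_imp_decreasing_open[OF xy(2)])
  show "\<exists>D. (A_deriv d b h has_real_derivative D) (at t) \<and> D < 0" if "x < t" "t < y" for t
    using A_deriv_has_derivative[OF b, of t] neg[OF that] that xy by auto
  show "continuous_on {x..y} (A_deriv d b h)"
    using A_deriv_has_derivative[OF b] xy
    by (intro DERIV_continuous_on[where D = "A_deriv2 d b"]) (auto intro: has_field_derivative_at_within)
qed

lemma continuous_on_A_fun:
  assumes "\<beta> > 0" "S \<subseteq> {0<..<1}"
  shows "continuous_on S (A_fun d \<beta> h)"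
proof (rule DERIV_continuous_on)
  fix x assume "x \<in> S"
  with assms(2) have "0 < x" "x < 1" by auto
  thus "(A_fun d \<beta> h has_real_derivative A_deriv d (exp (-2 * \<beta>)) h x) (at x within S)"
    by (rule has_field_derivative_at_within[OF A_fun_has_derivative[OF assms(1)]])
qed

lemma A_fun_increasing:
  assumes \<beta>: "\<beta> > 0" and xy: "0 < x" "x < y" "y < 1"
    and pos: "\<And>t. x < t \<Longrightarrow> t < y \<Longrightarrow> A_deriv d (exp (-2 * \<beta>)) h t > 0"
  shows "A_fun d \<beta> h x < A_fun d \<beta> h y"
proof (rule DERIV_pos_imp_increasing_open[OF xy(2)])
  show "\<exists>D. (A_fun d \<beta> h has_real_derivative D) (at t) \<and> 0 < D" if "x < t" "t < y" for t
    using A_fun_has_derivative[OF \<beta>, of t] pos[OF that] that xy by force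
  show "continuous_on {x..y} (A_fun d \<beta> h)"
    using xy \<beta> by (intro continuous_on_A_fun) auto
qed

lemma A_fun_decreasing:
  assumes \<beta>: "\<beta> > 0" and xy: "0 < x" "x < y" "y < 1"
    and neg: "\<And>t. x < t \<Longrightarrow> t < y \<Longrightarrow> A_deriv d (exp (-2 * \<beta>)) h t < 0"
  shows "A_fun d \<beta> h y < A_fun d \<beta> h x"
proof (rule DERIV_neg_imp_decreasing_open[OF xy(2)])
  show "\<exists>D. (A_fun d \<beta> h has_real_derivative D) (at t) \<and> D < 0" if "x < t" "t < y" for t
    using A_fun_has_derivative[OF \<beta>, of t] neg[OF that] that xy by force
  show "continuous_on {x..y} (A_fun d \<beta> h)"
    using xy \<beta> by (intro continuous_on_A_fun) auto
qed

text \<open>On \<open>[1/2, 1)\<close> the second derivative of \<open>A\<close> changes sign at most once, from positive to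
  negative.\<close>

lemma A_deriv_positive_half:
  assumes d: "d \<ge> 3" and b: "0 < b" "b < 1" and h: "h \<ge> 0" "h > 0 \<or> real d * b < real d - 2"
  shows "\<exists>a. 1 / 2 < a \<and> a < 1 \<and> A_deriv d b h a = 0 \<and> A_deriv2 d b a < 0 \<and>
           (\<forall>x. 1 / 2 < x \<and> x < a \<longrightarrow> A_deriv d b h x > 0) \<and>
           (\<forall>x. a < x \<and> x < 1 \<longrightarrow> A_deriv d b h x < 0)"
proof -
  let ?A1 = "A_deriv d b h" and ?A2 = "A_deriv2 d b" and ?\<Gamma> = "\<lambda>x. real d * b / disc b x"
  have neg: "?A1 x \<le> 2 * h - real d * ln b + ln ((1 - x) / x)" if "1 / 2 < x" "x < 1" for x
  proof -
    have "edge_field b x = - edge_field b (1 - x)" using edge_field_reflect[OF b, of x] that by simp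
    also have "\<dots> \<le> - ln b" using edge_field_ge[OF b, of "1 - x"] that by simp
    finally have "real d * edge_field b x \<le> real d * - ln b" by (intro mult_left_mono) auto
    moreover have "ln ((1 - x) / x) = ln (1 - x) - ln x" using that by (simp add: ln_div)
    ultimately show ?thesis by (simp add: A_deriv_def)
  qed
  \<comment> \<open>The edge term is bounded while the entropy term tends to minus infinity.
    \<open>K\<close> is chosen so that the bound \<open>neg\<close> equals \<open>-1\<close> at the
    point \<open>a1\<close> with \<open>ln ((1 - a1) / a1) = - K\<close>.\<close>
  define K where "K = 2 * h - real d * ln b + 1"
  have "real d * ln b \<le> 0" using b by (intro mult_nonneg_nonpos) auto
  hence K: "K > 0" using h by (simp add: K_def)
  define a1 where "a1 = 1 / (1 + exp (- K))"
  have gen: "1 / 2 < 1 / (1 + t)" "1 / (1 + t) < 1" "(1 - 1 / (1 + t)) / (1 / (1 + t)) = t"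
    if "0 < t" "t < 1" for t :: real
    using that by (simp_all add: field_simps)
  have "1 / 2 < a1" unfolding a1_def by (rule gen(1)) (use K in auto)
  moreover have "a1 < 1" unfolding a1_def by (rule gen(2)) (use K in auto)
  ultimately have a1: "1 / 2 < a1" "a1 < 1" .
  have "(1 - a1) / a1 = exp (- K)" unfolding a1_def by (rule gen(3)) (use K in auto)
  hence A1a1: "?A1 a1 < 0" using neg[OF a1] by (simp add: K_def)
  \<comment> \<open>At \<open>1 / 2\<close> the derivative is \<open>2 * h\<close>. If this is 0,
    the second derivative is positive there, which makes the derivative positive just to the
    right.\<close>
  have "\<exists>a0. 1 / 2 \<le> a0 \<and> a0 < a1 \<and> ?A1 a0 > 0"
  proof (cases "h > 0")
    case True
    thus ?thesis using a1 A_deriv_half[OF b] by (intro exI[of _ "1 / 2"]) auto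
  next
    case False
    hence h0: "h = 0" "real d * b < real d - 2" using h by auto
    have "?A2 (1 / 2) > 0" using h0 b by (subst A_deriv2_sign(2)) auto
    then obtain \<delta> where \<delta>: "\<delta> > 0" "\<forall>t>0. t < \<delta> \<longrightarrow> ?A1 (1 / 2) < ?A1 (1 / 2 + t)"
      using DERIV_pos_inc_right[OF A_deriv_has_derivative[OF b, of "1 / 2" d h]] by auto
    define t where "t = min (\<delta> / 2) ((a1 - 1 / 2) / 2)"
    have t: "0 < t" "t < \<delta>" "t < a1 - 1 / 2" using \<delta>(1) a1 by (auto simp: t_def min_def)
    have "?A1 (1 / 2 + t) > 0" using \<delta>(2)[rule_format, OF t(1,2)] A_deriv_half[OF b] h0 by simp
    thus ?thesis using t by (intro exI[of _ "1 / 2 + t"]) auto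
  qed
  then obtain a0 where a0: "1 / 2 \<le> a0" "a0 < a1" "?A1 a0 > 0" by blast
  have cont: "continuous_on {a0..a1} ?A1"
    using A_deriv_has_derivative[OF b] a0 a1
    by (intro DERIV_continuous_on[where D = ?A2]) (auto intro: has_field_derivative_at_within)
  then obtain a where a: "a0 \<le> a" "a \<le> a1" "?A1 a = 0"
    using IVT2'[of ?A1 a1 0 a0] a0 A1a1 by auto
  have "a \<noteq> a0" using a a0 by auto
  hence a': "a0 < a" "1 / 2 < a" "a < 1" using a a0 a1 by auto
  \<comment> \<open>If the curvature had not passed the threshold at \<open>a\<close>, the
    derivative would increase from a positive value at \<open>a0\<close> to 0 at
    \<open>a\<close>.\<close>
  have \<Gamma>a: "real d - 2 < ?\<Gamma> a"
  proof (rule ccontr)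
    assume "\<not> real d - 2 < ?\<Gamma> a"
    hence "?A1 a0 < ?A1 a"
    proof (intro A_deriv_increasing[OF b])
      fix t assume t: "a0 < t" "t < a"
      have "?\<Gamma> t < ?\<Gamma> a" using curvature_strict_mono[OF d b, of t a] t a0 a' by auto
      thus "?A2 t > 0" using \<open>\<not> real d - 2 < ?\<Gamma> a\<close> t a0 a' b by (subst A_deriv2_sign(2)) auto
    qed (use a0 a' in auto)
    thus False using a a0 by simp
  qed
  have after: "?A1 x < 0" if x: "a < x" "x < 1" for x
  proof -
    have "?A1 x < ?A1 a"
    proof (intro A_deriv_decreasing[OF b])
      fix t assume t: "a < t" "t < x"
      have "?\<Gamma> a < ?\<Gamma> t" using curvature_strict_mono[OF d b, of a t] t x a' by auto
      thus "?A2 t < 0" using \<Gamma>a t x a' b by (subst A_deriv2_sign(1)) auto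
    qed (use a' x in auto)
    thus ?thesis using a by simp
  qed
  \<comment> \<open>If the threshold is reached at \<open>x\<close>, the derivative decreases from
    \<open>x\<close> to its zero \<open>a\<close>; otherwise it increases up to \<open>x\<close>
    from \<open>2 * h\<close>, which is nonnegative. Either way it is positive at
    \<open>x\<close>.\<close>
  have before: "?A1 x > 0" if x: "1 / 2 < x" "x < a" for x
  proof (rule ccontr)
    assume n: "\<not> ?A1 x > 0"
    show False
    proof (cases "?\<Gamma> x \<ge> real d - 2")
      case True
      have "?A1 a < ?A1 x"
      proof (intro A_deriv_decreasing[OF b])
        fix t assume t: "x < t" "t < a"
        have "?\<Gamma> x < ?\<Gamma> t" using curvature_strict_mono[OF d b, of x t] t x a' by auto
        thus "?A2 t < 0" using True t x a' b by (subst A_deriv2_sign(1)) auto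
      qed (use a' x in auto)
      thus False using n a by simp
    next
      case False
      have "?A1 (1 / 2) < ?A1 x"
      proof (intro A_deriv_increasing[OF b])
        fix t assume t: "1 / 2 < t" "t < x"
        have "?\<Gamma> t < ?\<Gamma> x" using curvature_strict_mono[OF d b, of t x] t x a' by auto
        thus "?A2 t > 0" using False t x a' b by (subst A_deriv2_sign(2)) auto
      qed (use a' x in auto)
      thus False using n h A_deriv_half[OF b] by simp
    qed
  qed
  have "?A2 a < 0" using \<Gamma>a a' b by (subst A_deriv2_sign(1)) auto
  thus ?thesis using a a' after before by blast
qed

lemma A_fun_max_positive_half:
  assumes d: "d \<ge> 3" and \<beta>: "\<beta> > 0"
    and h: "h \<ge> 0" "h > 0 \<or> real d * exp (-2 * \<beta>) < real d - 2"
  shows "\<exists>a. 1 / 2 < a \<and> a < 1 \<and> A_deriv d (exp (-2 * \<beta>)) h a = 0 \<and> A_deriv2 d (exp (-2 * \<beta>)) a < 0 \<and>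
           (\<forall>x. 1 / 2 \<le> x \<and> x < 1 \<and> x \<noteq> a \<longrightarrow> A_fun d \<beta> h x < A_fun d \<beta> h a)"
proof -
  have b: "0 < exp (-2 * \<beta>)" "exp (-2 * \<beta>) < 1" using \<beta> by auto
  from A_deriv_positive_half[OF d b h] obtain a where a: "1 / 2 < a" "a < 1"
     "A_deriv d (exp (-2 * \<beta>)) h a = 0" "A_deriv2 d (exp (-2 * \<beta>)) a < 0"
     "\<forall>x. 1 / 2 < x \<and> x < a \<longrightarrow> A_deriv d (exp (-2 * \<beta>)) h x > 0"
     "\<forall>x. a < x \<and> x < 1 \<longrightarrow> A_deriv d (exp (-2 * \<beta>)) h x < 0" by blast
  have "A_fun d \<beta> h x < A_fun d \<beta> h a" if x: "1 / 2 \<le> x" "x < 1" "x \<noteq> a" for x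
  proof (cases "x < a")
    case True
    show ?thesis by (rule A_fun_increasing[OF \<beta>]) (use x a True in auto)
  next
    case False
    show ?thesis by (rule A_fun_decreasing[OF \<beta>]) (use x a False in auto)
  qed
  with a show ?thesis by blast
qed

text \<open>At \<open>1 / 2\<close> the curvature ratio is
  \<open>real d * exp (-2 * \<beta>)\<close>, already at the threshold or above it, and it strictly
  increases to the right. Hence \<open>A\<close> is strictly concave on the right half, also at the
  critical temperature, and reflection covers the left half.\<close>

lemma A_fun_max_half:
  assumes d: "d \<ge> 3" and \<beta>: "\<beta> > 0" and crit: "real d - 2 \<le> real d * exp (-2 * \<beta>)"
    and x: "0 < x" "x < 1" "x \<noteq> 1 / 2"
  shows "A_fun d \<beta> 0 x < A_fun d \<beta> 0 (1 / 2)"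
proof -
  let ?b = "exp (-2 * \<beta>)"
  have b: "0 < ?b" "?b < 1" using \<beta> by auto
  have right: "A_fun d \<beta> 0 x < A_fun d \<beta> 0 (1 / 2)" if x: "1 / 2 < x" "x < 1" for x
  proof (rule A_fun_decreasing[OF \<beta>])
    fix t assume t: "1 / 2 < t" "t < x"
    have "A_deriv d ?b 0 t < A_deriv d ?b 0 (1 / 2)"
    proof (intro A_deriv_decreasing[OF b])
      fix s assume s: "1 / 2 < s" "s < t"
      have "real d * ?b / disc ?b (1 / 2) < real d * ?b / disc ?b s"
        using s t x by (intro curvature_strict_mono[OF d b]) auto
      thus "A_deriv2 d ?b s < 0" using crit s t x b by (subst A_deriv2_sign(1)) auto
    qed (use t x in auto)
    thus "A_deriv d ?b 0 t < 0" using A_deriv_half[OF b] by simp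
  qed (use x in auto)
  show ?thesis
  proof (cases "1 / 2 < x")
    case False
    hence "A_fun d \<beta> 0 (1 - x) < A_fun d \<beta> 0 (1 / 2)" using x by (intro right) auto
    thus ?thesis by (simp add: A_fun_reflect)
  qed (use right x in auto)
qed

text \<open>The limit fixes the order \<open>p\<close> and the leading coefficient \<open>c\<close>
  at \<open>a\<close>; the last clause is a global bound by the same power. \<open>J\<close> is a
  set on which \<open>a\<close> is the only maximizer, so that one of two symmetric phases can be
  studied alone. The ends of the unit interval are cut off because level ratios are compared with
  \<open>A\<close> only away from them.\<close>

definition peak :: "(real \<Rightarrow> real) \<Rightarrow> real set \<Rightarrow> nat \<Rightarrow> real \<Rightarrow> real \<Rightarrow> bool" where
  "peak f J p a c \<longleftrightarrow> 0 < a \<and> a < 1 \<and> a \<in> J \<and> even p \<and> p > 0 \<and> c < 0 \<and>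
     ((\<lambda>x. (f x - f a) / (x - a) ^ p) \<longlongrightarrow> c) (at a) \<and>
     (\<forall>\<epsilon>>0. \<exists>\<kappa>>0. \<forall>x\<in>J. \<epsilon> \<le> x \<and> x \<le> 1 - \<epsilon> \<longrightarrow> f x - f a \<le> - \<kappa> * (x - a) ^ p)"

text \<open>Close to \<open>a\<close> the limit gives the power bound with half of \<open>c\<close>;
  at distance at least \<open>\<delta>\<close> compactness gives a negative gap.\<close>

lemma peakI:
  assumes a: "0 < a" "a < 1" "a \<in> J" and p: "even p" "p > 0" and c: "c < 0" and J: "closed J"
    and lim: "((\<lambda>x. (f x - f a) / (x - a) ^ p) \<longlongrightarrow> c) (at a)"
    and max: "\<And>x. x \<in> J \<Longrightarrow> 0 < x \<Longrightarrow> x < 1 \<Longrightarrow> x \<noteq> a \<Longrightarrow> f x < f a"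
    and cont: "continuous_on {0<..<1} f"
  shows "peak f J p a c"
proof -
  have "\<exists>\<kappa>>0. \<forall>x\<in>J. \<epsilon> \<le> x \<and> x \<le> 1 - \<epsilon> \<longrightarrow> f x - f a \<le> - \<kappa> * (x - a) ^ p" if \<epsilon>: "\<epsilon> > 0" for \<epsilon>
  proof -
    have "eventually (\<lambda>x. (f x - f a) / (x - a) ^ p < c / 2) (at a)"
      using lim c by (intro order_tendstoD(2)[OF lim]) auto
    then obtain \<delta> where \<delta>: "\<delta> > 0" "\<And>x. x \<noteq> a \<Longrightarrow> \<bar>x - a\<bar> < \<delta> \<Longrightarrow> (f x - f a) / (x - a) ^ p < c / 2"
      unfolding eventually_at by (auto simp: dist_real_def)
    have pp: "(x - a) ^ p \<ge> 0" for x using p by (simp add: zero_le_even_power)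
    have near: "f x - f a \<le> c / 2 * (x - a) ^ p" if "\<bar>x - a\<bar> < \<delta>" for x
    proof (cases "x = a")
      case False
      hence "(x - a) ^ p > 0" using p by (simp add: zero_less_power_eq)
      thus ?thesis using \<delta>(2)[OF False that] by (simp add: pos_divide_less_eq)
    qed (use p in \<open>simp add: zero_power\<close>)
    define K where "K = (J \<inter> {\<epsilon>..1 - \<epsilon>}) \<inter> {x. \<bar>x - a\<bar> \<ge> \<delta>}"
    have "\<exists>m<0. \<forall>x\<in>K. f x - f a \<le> m"
    proof (cases "K = {}")
      case True thus ?thesis by (intro exI[of _ "-1"]) auto
    next
      case False
      have "closed {x. \<bar>x - a\<bar> \<ge> \<delta>}" by (intro closed_Collect_le continuous_intros)
      hence "compact K" unfolding K_def using J
        by (intro compact_Int_closed closed_Int_compact) auto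
      moreover have Ksub: "K \<subseteq> {0<..<1}" using \<epsilon> by (auto simp: K_def)
      ultimately obtain x0 where x0: "x0 \<in> K" "\<forall>x\<in>K. f x \<le> f x0"
        using continuous_attains_sup[of K f] False continuous_on_subset[OF cont Ksub] by auto
      have "f x0 < f a" using x0(1) Ksub \<delta>(1) by (intro max) (auto simp: K_def)
      thus ?thesis using x0 by (intro exI[of _ "f x0 - f a"]) auto
    qed
    then obtain m where m: "m < 0" "\<And>x. x \<in> K \<Longrightarrow> f x - f a \<le> m" by blast
    \<comment> \<open>Away from \<open>a\<close> the gap \<open>m\<close> suffices, since
      \<open>(x - a) ^ p\<close> is at most 1 on the interval considered.\<close>
    define \<kappa> where "\<kappa> = min (- c / 2) (- m)"
    have \<kappa>: "\<kappa> > 0" using c m by (simp add: \<kappa>_def)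
    have "f x - f a \<le> - \<kappa> * (x - a) ^ p" if x: "x \<in> J" "\<epsilon> \<le> x" "x \<le> 1 - \<epsilon>" for x
    proof (cases "\<bar>x - a\<bar> < \<delta>")
      case True
      have "c / 2 * (x - a) ^ p \<le> - \<kappa> * (x - a) ^ p"
        using pp by (intro mult_right_mono) (auto simp: \<kappa>_def)
      thus ?thesis using near[OF True] by linarith
    next
      case False
      hence "f x - f a \<le> m" using x by (intro m) (auto simp: K_def)
      also have "m \<le> - \<kappa> * 1" by (simp add: \<kappa>_def)
      also have "\<dots> \<le> - \<kappa> * (x - a) ^ p"
      proof -
        have "\<bar>x - a\<bar> \<le> 1" using x a \<epsilon> by auto
        hence "\<bar>x - a\<bar> ^ p \<le> 1" by (intro power_le_one) auto
        hence "(x - a) ^ p \<le> 1" using p by (simp add: power_even_abs)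
        thus ?thesis using \<kappa> by (intro mult_left_mono_neg) auto
      qed
      finally show ?thesis .
    qed
    thus ?thesis using \<kappa> by blast
  qed
  thus ?thesis unfolding peak_def using a p c lim by blast
qed

text \<open>Integrates a leading term. A quadratic peak takes one use, starting from the derivative
  of \<open>A\<close>; the quartic peak takes two, starting from the second derivative.\<close>

lemma power_lhopital:
  fixes f f' :: "real \<Rightarrow> real"
  assumes f: "eventually (\<lambda>x. (f has_real_derivative f' x) (at x)) (nhds a)" and fa: "f a = 0"
    and lim: "((\<lambda>x. f' x / (real (Suc q) * (x - a) ^ q)) \<longlongrightarrow> c) (at a)"
  shows "((\<lambda>x. f x / (x - a) ^ Suc q) \<longlongrightarrow> c) (at a)"
proof (rule lhopital)
  have "isCont f a" using eventually_nhds_x_imp_x[OF f] by (rule DERIV_isCont)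
  thus "(f \<longlongrightarrow> 0) (at a)" using fa by (simp add: isCont_def)
  have "((\<lambda>x. (x - a) ^ Suc q) \<longlongrightarrow> (a - a) ^ Suc q) (at a)" by (intro tendsto_intros)
  thus "((\<lambda>x. (x - a) ^ Suc q) \<longlongrightarrow> 0) (at a)" by simp
  have ne: "eventually (\<lambda>x. x \<noteq> a) (at a)" by (simp add: eventually_at_filter)
  show "eventually (\<lambda>x. (x - a) ^ Suc q \<noteq> 0) (at a)" using ne by eventually_elim auto
  show "eventually (\<lambda>x. real (Suc q) * (x - a) ^ q \<noteq> 0) (at a)" using ne by eventually_elim auto
  show "eventually (\<lambda>x. (f has_real_derivative f' x) (at x)) (at a)"
    using f by (simp add: eventually_at_filter eventually_mono)
  show "eventually (\<lambda>x. ((\<lambda>x. (x - a) ^ Suc q) has_real_derivative real (Suc q) * (x - a) ^ q) (at x)) (at a)"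
  proof (intro always_eventually allI)
    fix x
    have "((\<lambda>x. x - a) has_real_derivative 1) (at x)" by (auto intro!: derivative_eq_intros)
    from DERIV_power[OF this, of "Suc q"]
    show "((\<lambda>x. (x - a) ^ Suc q) has_real_derivative real (Suc q) * (x - a) ^ q) (at x)" by simp
  qed
qed (rule lim)

lemma A_fun_nhds:
  assumes \<beta>: "\<beta> > 0" and a: "0 < a" "a < 1"
  shows "eventually (\<lambda>x. (A_fun d \<beta> h has_real_derivative A_deriv d (exp (-2 * \<beta>)) h x) (at x)) (nhds a)"
    and "eventually (\<lambda>x. (A_deriv d (exp (-2 * \<beta>)) h has_real_derivative A_deriv2 d (exp (-2 * \<beta>)) x) (at x)) (nhds a)"
proof -
  have b: "0 < exp (-2 * \<beta>)" "exp (-2 * \<beta>) < 1" using \<beta> by auto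
  have ev: "eventually (\<lambda>x. x \<in> {0<..<1}) (nhds a)" using a by (intro eventually_nhds_in_open) auto
  show "eventually (\<lambda>x. (A_fun d \<beta> h has_real_derivative A_deriv d (exp (-2 * \<beta>)) h x) (at x)) (nhds a)"
    using ev by eventually_elim (use A_fun_has_derivative[OF \<beta>] in auto)
  show "eventually (\<lambda>x. (A_deriv d (exp (-2 * \<beta>)) h has_real_derivative A_deriv2 d (exp (-2 * \<beta>)) x) (at x)) (nhds a)"
    using ev by eventually_elim (use A_deriv_has_derivative[OF b] in auto)
qed

lemma A_fun_quadratic_peak:
  assumes \<beta>: "\<beta> > 0" and a: "0 < a" "a < 1" "a \<in> J" and J: "closed J"
    and crit: "A_deriv d (exp (-2 * \<beta>)) h a = 0" and neg: "A_deriv2 d (exp (-2 * \<beta>)) a < 0"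
    and max: "\<And>x. x \<in> J \<Longrightarrow> 0 < x \<Longrightarrow> x < 1 \<Longrightarrow> x \<noteq> a \<Longrightarrow> A_fun d \<beta> h x < A_fun d \<beta> h a"
  shows "peak (A_fun d \<beta> h) J 2 a (A_deriv2 d (exp (-2 * \<beta>)) a / 2)"
proof (rule peakI)
  let ?A1 = "A_deriv d (exp (-2 * \<beta>)) h" and ?A2 = "A_deriv2 d (exp (-2 * \<beta>))"
  have b: "0 < exp (-2 * \<beta>)" "exp (-2 * \<beta>) < 1" using \<beta> by auto
  have "(?A1 has_real_derivative ?A2 a) (at a)" by (rule A_deriv_has_derivative[OF b a(1,2)])
  hence "((\<lambda>x. (?A1 x - ?A1 a) / (x - a)) \<longlongrightarrow> ?A2 a) (at a)" by (simp add: has_field_derivative_iff)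
  hence "((\<lambda>x. (?A1 x - ?A1 a) / (x - a) / 2) \<longlongrightarrow> ?A2 a / 2) (at a)" by (intro tendsto_intros) auto
  hence lim: "((\<lambda>x. ?A1 x / (real (Suc 1) * (x - a) ^ 1)) \<longlongrightarrow> ?A2 a / 2) (at a)"
    using crit by (simp add: mult.commute)
  have "((\<lambda>x. (A_fun d \<beta> h x - A_fun d \<beta> h a) / (x - a) ^ Suc 1) \<longlongrightarrow> ?A2 a / 2) (at a)"
  proof (rule power_lhopital[OF _ _ lim])
    show "eventually (\<lambda>x. ((\<lambda>x. A_fun d \<beta> h x - A_fun d \<beta> h a) has_real_derivative ?A1 x) (at x)) (nhds a)"
      using A_fun_nhds(1)[OF \<beta> a(1,2)] by eventually_elim (auto intro!: derivative_eq_intros)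
  qed simp
  thus "((\<lambda>x. (A_fun d \<beta> h x - A_fun d \<beta> h a) / (x - a)\<^sup>2) \<longlongrightarrow> ?A2 a / 2) (at a)"
    by (simp add: numeral_2_eq_2)
  show "continuous_on {0<..<1} (A_fun d \<beta> h)" by (rule continuous_on_A_fun[OF \<beta>]) simp
qed (use neg a J max in simp_all)

text \<open>For \<open>h > 0\<close> reflecting a point from the left of \<open>1 / 2\<close> to the
  right raises \<open>A\<close> by \<open>2 * h * (1 - 2 * x)\<close>, so the maximizer of the right
  half is global. Negative fields follow by symmetry, and at zero field the maximizer is
  \<open>1 / 2\<close>.\<close>

lemma A_fun_peak_uniqueness:
  assumes d: "d \<ge> 3" and \<beta>: "\<beta> > 0" and U: "h \<noteq> 0 \<or> \<beta> < beta_c d"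
  shows "\<exists>a c. peak (A_fun d \<beta> h) UNIV 2 a c"
proof -
  let ?b = "exp (-2 * \<beta>)"
  have b: "0 < ?b" "?b < 1" using \<beta> by auto
  have pos: "\<exists>a. 0 < a \<and> a < 1 \<and> A_deriv d ?b h a = 0 \<and> A_deriv2 d ?b a < 0 \<and>
       (\<forall>x. 0 < x \<and> x < 1 \<and> x \<noteq> a \<longrightarrow> A_fun d \<beta> h x < A_fun d \<beta> h a)" if h: "h > 0" for h
  proof -
    from A_fun_max_positive_half[OF d \<beta>, of h] h obtain a where a: "1 / 2 < a" "a < 1"
      "A_deriv d ?b h a = 0" "A_deriv2 d ?b a < 0"
      "\<forall>x. 1 / 2 \<le> x \<and> x < 1 \<and> x \<noteq> a \<longrightarrow> A_fun d \<beta> h x < A_fun d \<beta> h a" by auto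
    have "A_fun d \<beta> h x < A_fun d \<beta> h a" if x: "0 < x" "x < 1" "x \<noteq> a" for x
    proof (cases "1 / 2 \<le> x")
      case False
      have "A_fun d \<beta> h x < A_fun d \<beta> h (1 - x)" using False h by (simp add: A_fun_reflect)
      also have "A_fun d \<beta> h (1 - x) \<le> A_fun d \<beta> h a"
        using a(5)[rule_format, of "1 - x"] False x by (cases "1 - x = a") auto
      finally show ?thesis .
    qed (use a x in auto)
    with a show ?thesis by (intro exI[of _ a]) auto
  qed
  have "\<exists>a. 0 < a \<and> a < 1 \<and> A_deriv d ?b h a = 0 \<and> A_deriv2 d ?b a < 0 \<and>
       (\<forall>x. 0 < x \<and> x < 1 \<and> x \<noteq> a \<longrightarrow> A_fun d \<beta> h x < A_fun d \<beta> h a)"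
  proof -
    consider "h > 0" | "h < 0" | "h = 0" "\<beta> < beta_c d" using U by linarith
    thus ?thesis
    proof cases
      case 1 thus ?thesis by (rule pos)
    next
      case 2
      then obtain a where a: "0 < a" "a < 1" "A_deriv d ?b (- h) a = 0" "A_deriv2 d ?b a < 0"
        "\<forall>x. 0 < x \<and> x < 1 \<and> x \<noteq> a \<longrightarrow> A_fun d \<beta> (- h) x < A_fun d \<beta> (- h) a" using pos[of "- h"] by auto
      have "A_fun d \<beta> h x < A_fun d \<beta> h (1 - a)" if x: "0 < x" "x < 1" "x \<noteq> 1 - a" for x
      proof -
        have "A_fun d \<beta> (- h) (1 - x) < A_fun d \<beta> (- h) a" using a(5) x by auto
        thus ?thesis using A_fun_neg_reflect[of d \<beta> h x] A_fun_neg_reflect[of d \<beta> h "1 - a"] by simp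
      qed
      moreover have "A_deriv d ?b h (1 - a) = 0"
        using A_deriv_neg_reflect[OF b, of a d "- h"] a by simp
      ultimately show ?thesis using a by (intro exI[of _ "1 - a"]) (auto simp: A_deriv2_reflect)
    next
      case 3
      hence c: "real d - 2 < real d * ?b" using exp_beta_c_iff(1)[OF d] by simp
      have "A_deriv2 d ?b (1 / 2) < 0" using c b by (subst A_deriv2_sign(1)) auto
      thus ?thesis using A_fun_max_half[OF d \<beta>] c 3 A_deriv_half[OF b] by (intro exI[of _ "1 / 2"]) auto
    qed
  qed
  then obtain a where "0 < a" "a < 1" "A_deriv d ?b h a = 0" "A_deriv2 d ?b a < 0"
       "\<forall>x. 0 < x \<and> x < 1 \<and> x \<noteq> a \<longrightarrow> A_fun d \<beta> h x < A_fun d \<beta> h a" by blast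
  hence "peak (A_fun d \<beta> h) UNIV 2 a (A_deriv2 d ?b a / 2)"
    by (intro A_fun_quadratic_peak[OF \<beta>]) auto
  thus ?thesis by blast
qed

text \<open>At zero field the maximizer has a mirror image below \<open>1 / 2\<close>; restricting
  to \<open>{1 / 2..}\<close> leaves only one of the two.\<close>

lemma A_fun_peak_low_temperature:
  assumes d: "d \<ge> 3" and \<beta>: "\<beta> > 0" "\<beta> > beta_c d"
  shows "\<exists>a c. 1 / 2 < a \<and> peak (A_fun d \<beta> 0) {1 / 2..} 2 a c"
proof -
  have "real d * exp (-2 * \<beta>) < real d - 2" using \<beta> exp_beta_c_iff(2)[OF d] by simp
  from A_fun_max_positive_half[OF d \<beta>(1), of 0] this obtain a where a: "1 / 2 < a" "a < 1"
     "A_deriv d (exp (-2 * \<beta>)) 0 a = 0" "A_deriv2 d (exp (-2 * \<beta>)) a < 0"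
     "\<forall>x. 1 / 2 \<le> x \<and> x < 1 \<and> x \<noteq> a \<longrightarrow> A_fun d \<beta> 0 x < A_fun d \<beta> 0 a" by auto
  hence "peak (A_fun d \<beta> 0) {1 / 2..} 2 a (A_deriv2 d (exp (-2 * \<beta>)) a / 2)"
    by (intro A_fun_quadratic_peak[OF \<beta>(1)]) auto
  thus ?thesis using a by blast
qed

lemma deriv_cong_open:
  fixes f g :: "real \<Rightarrow> real"
  assumes "open S" "x \<in> S" "\<And>y. y \<in> S \<Longrightarrow> f y = g y"
  shows "deriv f x = deriv g x"
proof (rule deriv_cong_ev)
  have "eventually (\<lambda>y. y \<in> S) (nhds x)" using assms(1,2) by (rule eventually_nhds_in_open)
  thus "eventually (\<lambda>y. f y = g y) (nhds x)" by eventually_elim (rule assms(3))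
qed simp

text \<open>At the critical temperature the second derivative has the factor
  \<open>disc - 1\<close>. Rationalizing it exposes a double zero:
  \<open>A'' = - 4 (a - 1 / 2)^2 R\<close> with \<open>R (1 / 2) = \<kappa>\<close>. Two uses of
  l'Hopital's rule give the leading coefficient \<open>- \<kappa> / 3\<close>, and differentiating
  twice more gives the fourth derivative \<open>- 8 * \<kappa>\<close>, which is 24 times as
  large.\<close>

lemma A_fun_peak_critical:
  assumes d: "d \<ge> 3" and \<beta>: "\<beta> > 0" "\<beta> = beta_c d"
  shows "peak (A_fun d \<beta> 0) UNIV 4 (1 / 2) ((deriv ^^ 4) (A_fun d \<beta> 0) (1 / 2) / 24)"
proof -
  define b where "b = exp (-2 * \<beta>)"
  have b: "0 < b" "b < 1" using \<beta> by (auto simp: b_def)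
  have db: "real d * b = real d - 2" using \<beta>(2) exp_beta_c_iff(3)[OF d] unfolding b_def by blast
  define \<kappa> where "\<kappa> = (real d - 2) * (1 - b\<^sup>2)"
  have \<kappa>: "\<kappa> > 0" unfolding \<kappa>_def using d b by (intro mult_pos_pos) (auto simp: power_less_one_iff)
  define P where "P = (\<lambda>a::real. 2 * a * (1 - a))"
  define Q where "Q = (\<lambda>a. disc b a + disc b a * disc b a)"
  define D' where "D' = (\<lambda>a. 2 * (1 - b\<^sup>2) * (1 - 2 * a) / disc b a)"
  define R where "R = (\<lambda>a. \<kappa> / (P a * Q a))"
  define R' where "R' = (\<lambda>a. - \<kappa> * ((2 - 4 * a) * Q a + P a * (D' a + 2 * disc b a * D' a)) / (P a * Q a)\<^sup>2)"
  have Dpos: "disc b a > 0" if "0 < a" "a < 1" for a using disc_pos[OF b, of a] that by simp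
  have PQ: "P a > 0" "Q a > 0" if "0 < a" "a < 1" for a
    using Dpos[OF that] that by (simp_all add: P_def Q_def add_pos_pos)
  have A2: "A_deriv2 d b a = - 4 * (a - 1 / 2)\<^sup>2 * R a" if a: "0 < a" "a < 1" for a
  proof -
    let ?D = "disc b a"
    have D2: "?D * ?D = 1 - (1 - b\<^sup>2) * (1 - 2 * a)\<^sup>2"
      using disc_sq(1)[OF b, of a] a by (simp add: power2_eq_square)
    have "A_deriv2 d b a = (real d - 2) * (?D - 1) / (?D * P a)"
      unfolding A_deriv2_def db P_def using Dpos[OF a] a by (simp add: field_simps)
    also have "\<dots> = (real d - 2) * ((?D - 1) * (1 + ?D)) / (P a * Q a)"
    proof -
      have "Q a = ?D * (1 + ?D)" by (simp add: Q_def algebra_simps)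
      moreover have "x * y / (D * p) = x * (y * (1 + D)) / (p * (D * (1 + D)))"
        if "D > 0" for x y D p :: real using that by simp
      ultimately show ?thesis using Dpos[OF a] by metis
    qed
    also have "(?D - 1) * (1 + ?D) = - (1 - b\<^sup>2) * (4 * (a - 1 / 2)\<^sup>2)"
      using D2 by (simp add: algebra_simps power2_eq_square)
    finally have f: "A_deriv2 d b a = (real d - 2) * (- (1 - b\<^sup>2) * (4 * (a - 1 / 2)\<^sup>2)) / (P a * Q a)" .
    have gen: "x * (- y * (4 * z)) / w = - 4 * z * (x * y / w)" for x y z w :: real
      by (simp add: mult_ac)
    show ?thesis unfolding f R_def \<kappa>_def by (rule gen)
  qed
  have dD: "(disc b has_real_derivative D' a) (at a)" if "0 < a" "a < 1" for a
    unfolding D'_def using that by (intro disc_has_derivative[OF b]) auto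
  have dP: "(P has_real_derivative (2 - 4 * a)) (at a)" for a
    unfolding P_def by (auto intro!: derivative_eq_intros)
  have dQ: "(Q has_real_derivative (D' a + 2 * disc b a * D' a)) (at a)" if "0 < a" "a < 1" for a
    unfolding Q_def using dD[OF that] by (auto intro!: derivative_eq_intros)
  have dR: "(R has_real_derivative R' a) (at a)" if "0 < a" "a < 1" for a
    unfolding R_def R'_def using dP[of a] dQ[OF that] PQ[OF that]
    by (auto intro!: derivative_eq_intros simp: power2_eq_square)
  have contD: "isCont (disc b) (1 / 2)" using dD[of "1 / 2"] by (auto intro: DERIV_isCont)
  have contR: "(R \<longlongrightarrow> \<kappa>) (at (1 / 2))"
  proof -
    have "isCont R (1 / 2)" using dR[of "1 / 2"] by (auto intro: DERIV_isCont)
    moreover have "R (1 / 2) = \<kappa>" by (simp add: R_def P_def Q_def)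
    ultimately show ?thesis by (simp add: isCont_def)
  qed
  have contR': "isCont R' (1 / 2)"
  proof -
    have "isCont P (1 / 2)" "isCont Q (1 / 2)" using dP dQ[of "1 / 2"] by (auto intro: DERIV_isCont)
    moreover have "isCont D' (1 / 2)" unfolding D'_def using contD by (intro continuous_intros) auto
    ultimately show ?thesis unfolding R'_def using contD PQ[of "1 / 2"]
      by (intro continuous_intros) auto
  qed
  have ev: "eventually (\<lambda>x::real. 0 < x \<and> x < 1 \<and> x \<noteq> 1 / 2) (at (1 / 2))"
    using eventually_at_in_open[of "{0<..<1}" "1/2 :: real"] by (simp add: conj_ac)
  have A1half: "A_deriv d b 0 (1 / 2) = 0" using A_deriv_half[OF b] by simp
  note nhds = A_fun_nhds[OF \<beta>(1), of "1 / 2" d 0, folded b_def]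
  have l1: "((\<lambda>x. A_deriv2 d b x / (real (Suc 2) * (x - 1 / 2)\<^sup>2)) \<longlongrightarrow> - 4 / 3 * \<kappa>) (at (1 / 2))"
  proof (rule Lim_transform_eventually)
    show "((\<lambda>x. - 4 / 3 * R x) \<longlongrightarrow> - 4 / 3 * \<kappa>) (at (1 / 2))" using contR by (intro tendsto_intros)
    show "eventually (\<lambda>x. - 4 / 3 * R x = A_deriv2 d b x / (real (Suc 2) * (x - 1 / 2)\<^sup>2)) (at (1 / 2))"
      using ev by eventually_elim (simp add: A2)
  qed
  have l2: "((\<lambda>x. A_deriv d b 0 x / (x - 1 / 2) ^ Suc 2) \<longlongrightarrow> - 4 / 3 * \<kappa>) (at (1 / 2))"
  proof (rule power_lhopital[where f' = "A_deriv2 d b"])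
    show "eventually (\<lambda>x. (A_deriv d b 0 has_real_derivative A_deriv2 d b x) (at x)) (nhds (1 / 2))"
      by (rule nhds(2)) auto
  qed (rule A1half l1)+
  have l3: "((\<lambda>x. A_deriv d b 0 x / (real (Suc 3) * (x - 1 / 2) ^ 3)) \<longlongrightarrow> - \<kappa> / 3) (at (1 / 2))"
    using tendsto_divide[OF l2 tendsto_const, of 4] by (simp add: eval_nat_numeral mult.commute)
  have l4: "((\<lambda>x. (A_fun d \<beta> 0 x - A_fun d \<beta> 0 (1 / 2)) / (x - 1 / 2) ^ Suc 3) \<longlongrightarrow> - \<kappa> / 3) (at (1 / 2))"
  proof (rule power_lhopital[where f' = "A_deriv d b 0"])
    have "eventually (\<lambda>x. (A_fun d \<beta> 0 has_real_derivative A_deriv d b 0 x) (at x)) (nhds (1 / 2))"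
      by (rule nhds(1)) auto
    thus "eventually (\<lambda>x. ((\<lambda>x. A_fun d \<beta> 0 x - A_fun d \<beta> 0 (1 / 2)) has_real_derivative A_deriv d b 0 x) (at x)) (nhds (1 / 2))"
      by eventually_elim (auto intro!: derivative_eq_intros)
  qed (simp, rule l3)
  have e1: "deriv (A_fun d \<beta> 0) x = A_deriv d b 0 x" if "x \<in> {0<..<1}" for x
    using A_fun_has_derivative[OF \<beta>(1), of x d 0] that by (auto simp: b_def intro: DERIV_imp_deriv)
  have e2: "deriv (deriv (A_fun d \<beta> 0)) x = - 4 * (x - 1 / 2)\<^sup>2 * R x" if x: "x \<in> {0<..<1}" for x
  proof -
    have "deriv (deriv (A_fun d \<beta> 0)) x = deriv (A_deriv d b 0) x"
      using e1 x by (intro deriv_cong_open[of "{0<..<1}"]) auto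
    also have "\<dots> = A_deriv2 d b x" using A_deriv_has_derivative[OF b, of x] x by (intro DERIV_imp_deriv) auto
    finally show ?thesis using A2 x by simp
  qed
  define f3 where "f3 = (\<lambda>x. - 8 * (x - 1 / 2) * R x - 4 * (x - 1 / 2)\<^sup>2 * R' x)"
  have e3: "deriv (deriv (deriv (A_fun d \<beta> 0))) x = f3 x" if x: "x \<in> {0<..<1}" for x
  proof -
    have "deriv (deriv (deriv (A_fun d \<beta> 0))) x = deriv (\<lambda>x. - 4 * (x - 1 / 2)\<^sup>2 * R x) x"
      using e2 x by (intro deriv_cong_open[of "{0<..<1}"]) auto
    also have "\<dots> = f3 x" unfolding f3_def using dR[of x] x
      by (intro DERIV_imp_deriv) (auto intro!: derivative_eq_intros simp: algebra_simps)
    finally show ?thesis .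
  qed
  \<comment> \<open>Taken as a limit of difference quotients at the single point
    \<open>1 / 2\<close>: the quadratic factor in front of \<open>R'\<close> makes continuity of
    \<open>R'\<close> suffice.\<close>
  have "(f3 has_real_derivative - 8 * \<kappa>) (at (1 / 2))"
    unfolding has_field_derivative_iff
  proof (rule Lim_transform_eventually)
    have "((\<lambda>x. - 8 * R x - 4 * (x - 1 / 2) * R' x) \<longlongrightarrow> - 8 * \<kappa> - 4 * (1 / 2 - 1 / 2) * R' (1 / 2)) (at (1 / 2))"
      using contR contR'[unfolded isCont_def] by (intro tendsto_intros)
    thus "((\<lambda>x. - 8 * R x - 4 * (x - 1 / 2) * R' x) \<longlongrightarrow> - 8 * \<kappa>) (at (1 / 2))" by simp
    show "eventually (\<lambda>x. - 8 * R x - 4 * (x - 1 / 2) * R' x = (f3 x - f3 (1 / 2)) / (x - 1 / 2)) (at (1 / 2))"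
      using ev
    proof eventually_elim
      case (elim x)
      have "f3 x - f3 (1 / 2) = (- 8 * R x - 4 * (x - 1 / 2) * R' x) * (x - 1 / 2)"
        unfolding f3_def by (simp add: power2_eq_square algebra_simps)
      thus ?case using elim by simp
    qed
  qed
  hence "deriv f3 (1 / 2) = - 8 * \<kappa>" by (rule DERIV_imp_deriv)
  moreover have "(deriv ^^ 4) (A_fun d \<beta> 0) (1 / 2) = deriv f3 (1 / 2)"
  proof -
    have "(deriv ^^ 4) (A_fun d \<beta> 0) = deriv (deriv (deriv (deriv (A_fun d \<beta> 0))))"
      by (simp add: numeral_eq_Suc)
    thus ?thesis using e3 deriv_cong_open[of "{0<..<1}" "1 / 2" "deriv (deriv (deriv (A_fun d \<beta> 0)))" f3] by simp
  qed
  ultimately have c: "(deriv ^^ 4) (A_fun d \<beta> 0) (1 / 2) / 24 = - \<kappa> / 3" by simp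
  show ?thesis unfolding c
  proof (rule peakI)
    show "((\<lambda>x. (A_fun d \<beta> 0 x - A_fun d \<beta> 0 (1 / 2)) / (x - 1 / 2) ^ 4) \<longlongrightarrow> - \<kappa> / 3) (at (1 / 2))"
      using l4 by (simp add: eval_nat_numeral)
    show "continuous_on {0<..<1} (A_fun d \<beta> 0)" by (rule continuous_on_A_fun[OF \<beta>(1)]) simp
    show "A_fun d \<beta> 0 x < A_fun d \<beta> 0 (1 / 2)" if "0 < x" "x < 1" "x \<noteq> 1 / 2" for x
      using A_fun_max_half[OF d \<beta>(1) _ that] db by (simp add: b_def)
  qed (use \<kappa> in auto)
qed

section \<open>Partition sums of fixed magnetization\<close>

definition plus_sets :: "nat \<Rightarrow> nat \<Rightarrow> nat set set" where
  "plus_sets n j = {S. S \<subseteq> {..<n} \<and> card S = j}"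

definition partition_sum :: "nat \<Rightarrow> nat \<Rightarrow> real \<Rightarrow> nat \<Rightarrow> real" where
  "partition_sum d n b j = (\<Sum>S\<in>plus_sets n j. cut_sum d n b S)"

lemma finite_plus_sets [simp]: "finite (plus_sets n j)"
  by (rule finite_subset[of _ "Pow {..<n}"]) (auto simp: plus_sets_def)

lemma plus_setsD:
  assumes "S \<in> plus_sets n j"
  shows "S \<subseteq> {..<n}" "finite S" "card S = j" "j \<le> n" "card ({..<n} - S) = n - j"
proof -
  show S: "S \<subseteq> {..<n}" "card S = j" using assms by (auto simp: plus_sets_def)
  show fin: "finite S" using S(1) by (rule finite_subset) simp
  show "j \<le> n" using card_mono[OF _ S(1)] S(2) by simp
  show "card ({..<n} - S) = n - j" using card_Diff_subset[OF fin S(1)] S(2) by simp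
qed

text \<open>Double counting: a set of \<open>Suc j\<close> vertices arises by insertion from
  \<open>Suc j\<close> pairs.\<close>

lemma sum_plus_sets_insert:
  fixes f :: "nat set \<Rightarrow> real"
  shows "(\<Sum>S\<in>plus_sets n j. \<Sum>v\<in>{..<n} - S. f (insert v S)) = real (Suc j) * (\<Sum>S\<in>plus_sets n (Suc j). f S)"
proof -
  have "(\<Sum>S\<in>plus_sets n j. \<Sum>v\<in>{..<n} - S. f (insert v S))
      = (\<Sum>(S, v)\<in>Sigma (plus_sets n j) (\<lambda>S. {..<n} - S). f (insert v S))"
    by (subst sum.Sigma) auto
  also have "\<dots> = (\<Sum>(T, v)\<in>Sigma (plus_sets n (Suc j)) (\<lambda>T. T). f T)"
  proof (rule sum.reindex_bij_witness[of _ "\<lambda>(T, v). (T - {v}, v)" "\<lambda>(S, v). (insert v S, v)"])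
    fix p assume p: "p \<in> Sigma (plus_sets n j) (\<lambda>S. {..<n} - S)"
    obtain S v where Sv: "p = (S, v)" by (cases p)
    have S: "S \<in> plus_sets n j" "v < n" "v \<notin> S" using p Sv by auto
    show "(case (case p of (S, v) \<Rightarrow> (insert v S, v)) of (T, v) \<Rightarrow> (T - {v}, v)) = p" using S by (simp add: Sv)
    show "(case p of (S, v) \<Rightarrow> (insert v S, v)) \<in> Sigma (plus_sets n (Suc j)) (\<lambda>T. T)"
      using S plus_setsD(2)[OF S(1)] by (auto simp: Sv plus_sets_def)
    show "(case case p of (S, v) \<Rightarrow> (insert v S, v) of (T, v) \<Rightarrow> f T) = (case p of (S, v) \<Rightarrow> f (insert v S))"
      by (simp add: Sv)
  next
    fix q assume q: "q \<in> Sigma (plus_sets n (Suc j)) (\<lambda>T. T)"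
    obtain T v where Tv: "q = (T, v)" by (cases q)
    have T: "T \<in> plus_sets n (Suc j)" "v \<in> T" using q Tv by auto
    show "(case (case q of (T, v) \<Rightarrow> (T - {v}, v)) of (S, v) \<Rightarrow> (insert v S, v)) = q"
      using T by (simp add: Tv insert_absorb)
    show "(case q of (T, v) \<Rightarrow> (T - {v}, v)) \<in> Sigma (plus_sets n j) (\<lambda>S. {..<n} - S)"
      using T plus_setsD(2)[OF T(1)] by (auto simp: Tv plus_sets_def card_Diff_singleton)
  qed
  also have "\<dots> = (\<Sum>T\<in>plus_sets n (Suc j). \<Sum>v\<in>T. f T)"
    using plus_setsD(2) by (subst sum.Sigma) auto
  also have "\<dots> = (\<Sum>T\<in>plus_sets n (Suc j). real (Suc j) * f T)"
    by (intro sum.cong refl) (simp add: plus_setsD(3))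
  finally show ?thesis by (simp only: sum_distrib_left)
qed

lemma partition_sum_Suc_ge:
  assumes b: "0 < b" "b \<le> 1" and j: "j \<le> n"
  shows "(real n - real j) * b ^ d * partition_sum d n b j \<le> real (Suc j) * partition_sum d n b (Suc j)"
proof -
  have "(real n - real j) * b ^ d * partition_sum d n b j
      = (\<Sum>S\<in>plus_sets n j. \<Sum>v\<in>{..<n} - S. b ^ d * cut_sum d n b S)"
    using j by (simp add: partition_sum_def sum_distrib_left plus_setsD(5) of_nat_diff mult.assoc)
  also have "\<dots> \<le> (\<Sum>S\<in>plus_sets n j. \<Sum>v\<in>{..<n} - S. cut_sum d n b (insert v S))"
    using plus_setsD(1) b by (intro sum_mono cut_sum_insert_ge) auto
  also have "\<dots> = real (Suc j) * partition_sum d n b (Suc j)"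
    unfolding partition_sum_def by (rule sum_plus_sets_insert)
  finally show ?thesis .
qed

lemma cut_sum_complement:
  assumes S: "S \<subseteq> {..<n}"
  shows "cut_sum d n b ({..<n} - S) = cut_sum d n b S"
  unfolding cut_sum_def
proof (intro sum.cong refl)
  fix E assume E: "E \<in> regular_graphs d n"
  have "{e \<in> E. card (e \<inter> ({..<n} - S)) = 1} = {e \<in> E. card (e \<inter> S) = 1}"
  proof (intro Collect_cong conj_cong refl)
    fix e assume "e \<in> E"
    then obtain v u where e: "e = {v, u}" "v < n" "u < n" "v \<noteq> u" using regular_graph_edge_ex[OF E] by blast
    show "(card (e \<inter> ({..<n} - S)) = 1) = (card (e \<inter> S) = 1)"
      unfolding e(1) card_doubleton_Int_eq_1[OF e(4)] using e(2,3) by auto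
  qed
  thus "cut_weight b ({..<n} - S) E = cut_weight b S E" by (simp add: cut_weight_def cut_size_def)
qed

lemma partition_sum_reflect:
  assumes "j \<le> n"
  shows "partition_sum d n b (n - j) = partition_sum d n b j"
  unfolding partition_sum_def
proof (rule sum.reindex_bij_witness[of _ "\<lambda>S. {..<n} - S" "\<lambda>S. {..<n} - S"])
  fix S assume S: "S \<in> plus_sets n (n - j)"
  note D = plus_setsD[OF S]
  show "{..<n} - ({..<n} - S) = S" using D(1) by auto
  show "{..<n} - S \<in> plus_sets n j" using D assms by (auto simp: plus_sets_def)
  show "cut_sum d n b ({..<n} - S) = cut_sum d n b S" using D(1) by (rule cut_sum_complement)
next
  fix S assume S: "S \<in> plus_sets n j"
  note D = plus_setsD[OF S]
  show "{..<n} - ({..<n} - S) = S" using D(1) by auto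
  show "{..<n} - S \<in> plus_sets n (n - j)" using D by (auto simp: plus_sets_def)
qed

lemma partition_sum_pos:
  assumes "regular_graphs d n \<noteq> {}" "0 < b" "j \<le> n"
  shows "partition_sum d n b j > 0"
  unfolding partition_sum_def
proof (rule sum_pos)
  have "{..<j} \<in> plus_sets n j" using assms(3) by (auto simp: plus_sets_def)
  thus "plus_sets n j \<noteq> {}" by blast
  show "cut_sum d n b S > 0" for S
    unfolding cut_sum_def using assms by (intro sum_pos cut_weight_pos) auto
qed simp

lemma partition_sum_nonneg: "0 < b \<Longrightarrow> partition_sum d n b j \<ge> 0"
  unfolding partition_sum_def by (intro sum_nonneg cut_sum_nonneg)

lemma partition_sum_step:
  assumes d: "d \<ge> 1" and b: "0 < b" "b < 1" and \<epsilon>: "\<epsilon> > 0"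
  shows "\<exists>C\<ge>0. \<forall>n j. n \<ge> 2 \<longrightarrow> real j \<le> (1 - \<epsilon>) * real n \<longrightarrow>
       \<bar>real (Suc j) * partition_sum d n b (Suc j)
         - (real n - real j) * flip_factor b (real j / real n) ^ d * partition_sum d n b j\<bar>
       \<le> C * partition_sum d n b j"
proof -
  obtain C where C: "C \<ge> 0" and C': "\<forall>n S. n \<ge> 2 \<longrightarrow> S \<subseteq> {..<n} \<longrightarrow> real (card S) \<le> (1 - \<epsilon>) * real n \<longrightarrow>
       \<bar>(\<Sum>v\<in>{..<n} - S. cut_sum d n b (insert v S))
         - (real n - real (card S)) * flip_factor b (real (card S) / real n) ^ d * cut_sum d n b S\<bar>
       \<le> C * cut_sum d n b S"
    using sum_cut_sum_insert[OF d b \<epsilon>] by blast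
  show ?thesis
  proof (intro exI[of _ C] conjI allI impI C)
    fix n j :: nat assume n: "n \<ge> 2" and j: "real j \<le> (1 - \<epsilon>) * real n"
    let ?c = "(real n - real j) * flip_factor b (real j / real n) ^ d"
    have "real (Suc j) * partition_sum d n b (Suc j) - ?c * partition_sum d n b j
       = (\<Sum>S\<in>plus_sets n j. (\<Sum>v\<in>{..<n} - S. cut_sum d n b (insert v S)) - ?c * cut_sum d n b S)"
      unfolding partition_sum_def sum_plus_sets_insert[symmetric] by (simp only: sum_subtractf sum_distrib_left)
    hence "\<bar>real (Suc j) * partition_sum d n b (Suc j) - ?c * partition_sum d n b j\<bar>
       \<le> (\<Sum>S\<in>plus_sets n j. \<bar>(\<Sum>v\<in>{..<n} - S. cut_sum d n b (insert v S)) - ?c * cut_sum d n b S\<bar>)"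
      by (simp only: sum_abs)
    also have "\<dots> \<le> (\<Sum>S\<in>plus_sets n j. C * cut_sum d n b S)"
    proof (rule sum_mono)
      fix S assume S: "S \<in> plus_sets n j"
      note D = plus_setsD[OF S]
      show "\<bar>(\<Sum>v\<in>{..<n} - S. cut_sum d n b (insert v S)) - ?c * cut_sum d n b S\<bar> \<le> C * cut_sum d n b S"
        using C'[rule_format, OF n D(1)] j unfolding D(3) by simp
    qed
    finally show "\<bar>real (Suc j) * partition_sum d n b (Suc j) - ?c * partition_sum d n b j\<bar>
       \<le> C * partition_sum d n b j" by (simp only: partition_sum_def sum_distrib_left)
  qed
qed

section \<open>Logarithms of ratios of partition sums\<close>

lemma abs_ln_quotient_le:
  fixes r q \<delta> :: real
  assumes q: "q > 0" and rq: "\<bar>r - q\<bar> \<le> \<delta> * q" and \<delta>: "\<delta> \<le> 1 / 2"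
  shows "\<bar>ln r - ln q\<bar> \<le> 2 * \<delta>"
proof -
  define x where "x = (r - q) / q"
  have x: "\<bar>x\<bar> \<le> \<delta>" using rq q by (simp add: x_def abs_divide pos_divide_le_eq)
  have "q * x = r - q" using q by (simp add: x_def)
  hence r: "r = q * (1 + x)" by (simp add: distrib_left)
  have x1: "1 + x > 0" using x \<delta> by linarith
  have "\<bar>ln (1 + x) - x\<bar> \<le> 2 * x\<^sup>2" using x \<delta> by (intro abs_ln_one_plus_x_minus_x_bound) linarith
  moreover have "x\<^sup>2 \<le> \<bar>x\<bar> * (1 / 2)"
  proof -
    have "\<bar>x\<bar> * \<bar>x\<bar> \<le> \<bar>x\<bar> * (1 / 2)" using x \<delta> by (intro mult_left_mono) linarith+
    thus ?thesis by (simp add: power2_eq_square)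
  qed
  ultimately have "\<bar>ln (1 + x)\<bar> \<le> 2 * \<bar>x\<bar>" by linarith
  moreover have "ln r = ln q + ln (1 + x)" unfolding r using q x1 by (simp add: ln_mult_pos)
  ultimately show ?thesis using x by linarith
qed

text \<open>Up to a factor \<open>1 + O(1 / n)\<close> the ratio of consecutive sums is
  \<open>(n - j) / (j + 1)\<close> times the \<open>d\<close>-th power of the flip factor. The
  quotient accounts for the derivative of the entropy, the power for that of
  \<open>d * g_fun\<close>; the mean value theorem replaces the derivative of \<open>A\<close> by an
  increment over \<open>1 / n\<close>.\<close>

lemma partition_sum_ln_step:
  assumes d: "d \<ge> 2" and \<beta>: "\<beta> > 0" and \<epsilon>: "\<epsilon> > 0"
  defines "b \<equiv> exp (-2 * \<beta>)"
  shows "\<exists>C\<ge>0. \<exists>N. \<forall>n\<ge>N. regular_graphs d n \<noteq> {} \<longrightarrow>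
     (\<forall>j. \<epsilon> * real n \<le> real j \<longrightarrow> real (Suc j) \<le> (1 - \<epsilon>) * real n \<longrightarrow>
       \<bar>ln (partition_sum d n b (Suc j)) - ln (partition_sum d n b j)
          - real n * (A_fun d \<beta> 0 (real (Suc j) / real n) - A_fun d \<beta> 0 (real j / real n))\<bar> \<le> C / real n)"
proof -
  have b: "0 < b" "b < 1" using \<beta> by (auto simp: b_def)
  have d1: "d \<ge> 1" using d by simp
  obtain C where C: "C \<ge> 0" and C': "\<forall>n j. n \<ge> 2 \<longrightarrow> real j \<le> (1 - \<epsilon>) * real n \<longrightarrow>
       \<bar>real (Suc j) * partition_sum d n b (Suc j)
         - (real n - real j) * flip_factor b (real j / real n) ^ d * partition_sum d n b j\<bar>
       \<le> C * partition_sum d n b j"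
    using partition_sum_step[OF d1 b \<epsilon>] by blast
  \<comment> \<open>The relative error of a ratio is at most \<open>K / n\<close>: \<open>C\<close>
    is divided by \<open>real n - real j \<ge> \<epsilon> * real n\<close> and by
    \<open>b ^ d\<close>, a lower bound of the limiting factor \<open>q\<close>.\<close>
  define K where "K = C / (\<epsilon> * b ^ d)"
  have K: "K \<ge> 0" using C b \<epsilon> by (simp add: K_def)
  \<comment> \<open>A bound for the second derivative of \<open>A\<close> on
    \<open>[\<epsilon>, 1 - \<epsilon>]\<close>.\<close>
  define M where "M = real d / (2 * \<epsilon>\<^sup>2)"
  define N where "N = max 2 (nat \<lceil>2 * K\<rceil>)"
  show ?thesis
  proof (intro exI[of _ "2 * K + 1 / \<epsilon> + M"] conjI exI[of _ N] allI impI)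
    show "0 \<le> 2 * K + 1 / \<epsilon> + M" using K \<epsilon> by (simp add: M_def)
  next
    fix n j :: nat
    assume n: "n \<ge> N" and ne: "regular_graphs d n \<noteq> {}"
      and j: "\<epsilon> * real n \<le> real j" "real (Suc j) \<le> (1 - \<epsilon>) * real n"
    let ?Z = "partition_sum d n b" and ?A = "A_fun d \<beta> 0" and ?A1 = "A_deriv d b 0"
    have n2: "n \<ge> 2" and nK: "real n \<ge> 2 * K" using n by (auto simp: N_def)
    have n0: "real n > 0" using n2 by simp
    define a where "a = real j / real n"
    define a' where "a' = real (Suc j) / real n"
    have aa': "a' = a + 1 / real n" by (simp add: a_def a'_def add_divide_distrib)
    have a: "\<epsilon> \<le> a" "a < a'" "a' \<le> 1 - \<epsilon>" using j n0 aa' by (simp_all add: a_def a'_def field_simps)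
    have a01: "0 < a" "a < 1" using a \<epsilon> by linarith+
    have jn: "real j = real n * a" using n0 by (simp add: a_def)
    have j0: "real j > 0" using jn a01 n0 by simp
    have jle: "real j \<le> (1 - \<epsilon>) * real n" using j by simp
    have nj: "real n - real j \<ge> \<epsilon> * real n"
      using jle by (simp add: algebra_simps)
    hence nj0: "real n - real j > 0" using mult_pos_pos[OF \<epsilon> n0] by linarith
    have jn': "Suc j \<le> n" using nj0 by simp
    have Z: "?Z j > 0" "?Z (Suc j) > 0" using partition_sum_pos[OF ne b(1)] jn' by auto
    define q where "q = flip_factor b a ^ d"
    have ffb: "flip_factor b a \<ge> b" using flip_factor_ge[OF b, of a] a01 by simp
    hence qb: "q \<ge> b ^ d" unfolding q_def using b by (intro power_mono) auto
    have bd: "b ^ d > 0" using b by simp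
    hence q0: "q > 0" using qb by linarith
    define r where "r = real (Suc j) * ?Z (Suc j) / ((real n - real j) * ?Z j)"
    have r0: "r > 0" unfolding r_def using Z nj0 by simp
    have "\<bar>r - q\<bar> \<le> K / real n * q"
    proof -
      have "r - q = (real (Suc j) * ?Z (Suc j) - (real n - real j) * q * ?Z j) / ((real n - real j) * ?Z j)"
        unfolding r_def using nj0 Z by (simp add: diff_divide_distrib)
      hence "\<bar>r - q\<bar> = \<bar>real (Suc j) * ?Z (Suc j) - (real n - real j) * q * ?Z j\<bar> / ((real n - real j) * ?Z j)"
        using nj0 Z by (simp add: abs_divide abs_mult)
      also have "\<dots> \<le> C * ?Z j / ((real n - real j) * ?Z j)"
        using C'[rule_format, OF n2 jle] nj0 Z unfolding q_def a_def by (intro divide_right_mono) auto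
      also have "\<dots> = C / (real n - real j)" using Z by simp
      also have "\<dots> \<le> C / (\<epsilon> * real n)" using nj nj0 C \<epsilon> n0 by (intro divide_left_mono) auto
      also have "\<dots> = K / real n * b ^ d" using b by (simp add: K_def)
      also have "\<dots> \<le> K / real n * q" using qb K n0 by (intro mult_left_mono) auto
      finally show ?thesis .
    qed
    moreover have "K / real n \<le> 1 / 2" using nK n0 by (simp add: field_simps)
    ultimately have lnr: "\<bar>ln r - ln q\<bar> \<le> 2 * (K / real n)" using q0 by (intro abs_ln_quotient_le)
    have "flip_factor b a = exp (edge_field b a)" using exp_edge_field[OF b, of a] a01 by simp
    hence lnq: "ln q = real d * edge_field b a" by (simp add: q_def ln_realpow)
    have lnr': "ln r = ln (real (Suc j)) + ln (?Z (Suc j)) - (ln (real n - real j) + ln (?Z j))"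
      unfolding r_def using Z nj0 by (subst ln_div) (auto simp: ln_mult_pos)
    have "ln (real n - real j) - ln (real j) = ln (1 - a) - ln a"
    proof -
      have "real n - real j = real n * (1 - a)" by (simp add: jn algebra_simps)
      thus ?thesis using n0 a01 by (simp add: jn ln_mult_pos)
    qed
    \<comment> \<open>The ratio contains \<open>j + 1\<close> where the derivative of the entropy
      has \<open>j\<close>; this costs another term of order \<open>1 / n\<close>.\<close>
    moreover have "0 \<le> ln (real (Suc j)) - ln (real j)" "ln (real (Suc j)) - ln (real j) \<le> 1 / \<epsilon> / real n"
    proof -
      show "0 \<le> ln (real (Suc j)) - ln (real j)" using j0 by simp
      have "ln (real (Suc j)) - ln (real j) = ln (1 + 1 / real j)"
      proof -
        have "1 + 1 / real j = real (Suc j) / real j" using j0 by (simp add: field_simps)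
        thus ?thesis using j0 by (simp add: ln_div del: of_nat_Suc)
      qed
      also have "\<dots> \<le> 1 / real j" using j0 by (intro ln_add_one_self_le_self) auto
      also have "\<dots> \<le> 1 / (\<epsilon> * real n)" using j(1) j0 \<epsilon> n0 by (intro divide_left_mono) auto
      finally show "ln (real (Suc j)) - ln (real j) \<le> 1 / \<epsilon> / real n" by simp
    qed
    ultimately have step: "\<bar>ln (?Z (Suc j)) - ln (?Z j) - ?A1 a\<bar> \<le> 2 * (K / real n) + 1 / \<epsilon> / real n"
      using lnr lnr' lnq by (simp add: A_deriv_def)
    obtain \<xi> where \<xi>: "a < \<xi>" "\<xi> < a'" "?A a' - ?A a = (a' - a) * ?A1 \<xi>"
      using MVT2[of a a' ?A ?A1] A_fun_has_derivative[OF \<beta>, of _ d 0] a a01 \<epsilon> by (auto simp: b_def)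
    obtain \<zeta> where \<zeta>: "a < \<zeta>" "\<zeta> < \<xi>" "?A1 \<xi> - ?A1 a = (\<xi> - a) * A_deriv2 d b \<zeta>"
      using MVT2[of a \<xi> ?A1 "A_deriv2 d b"] A_deriv_has_derivative[OF b, of _ d 0] a a01 \<xi> \<epsilon> by auto
    have "\<bar>A_deriv2 d b \<zeta>\<bar> \<le> M"
    proof -
      have z: "\<epsilon> \<le> \<zeta>" "\<zeta> \<le> 1 - \<epsilon>" using \<zeta> \<xi> a by linarith+
      hence z01: "0 < \<zeta>" "\<zeta> < 1" using \<epsilon> by linarith+
      have D: "b \<le> disc b \<zeta>" "disc b \<zeta> > 0" using disc_sq(2)[OF b, of \<zeta>] disc_pos[OF b, of \<zeta>] z01 by auto
      have bD: "0 \<le> b / disc b \<zeta>" "b / disc b \<zeta> \<le> 1" using D b by simp_all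
      have "real d * (b / disc b \<zeta>) \<le> real d * 1" by (rule mult_left_mono[OF bD(2)]) simp
      moreover have "0 \<le> real d * (b / disc b \<zeta>)" by (rule mult_nonneg_nonneg[OF _ bD(1)]) simp
      ultimately have "\<bar>real d - 2 - real d * b / disc b \<zeta>\<bar> \<le> real d" using d by simp
      moreover have "2 * \<epsilon>\<^sup>2 \<le> 2 * \<zeta> * (1 - \<zeta>)"
        using z \<epsilon> mult_mono[of \<epsilon> \<zeta> \<epsilon> "1 - \<zeta>"] by (simp add: power2_eq_square)
      ultimately show ?thesis unfolding A_deriv2_def M_def abs_divide
        using z01 \<epsilon> by (intro frac_le) auto
    qed
    hence "\<bar>?A1 \<xi> - ?A1 a\<bar> \<le> (1 / real n) * M"
      unfolding \<zeta>(3) abs_mult using \<zeta> \<xi> aa' by (intro mult_mono) auto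
    moreover have "real n * (?A a' - ?A a) = ?A1 \<xi>" unfolding \<xi>(3) using n0 aa' by simp
    ultimately have "\<bar>ln (?Z (Suc j)) - ln (?Z j) - real n * (?A a' - ?A a)\<bar>
        \<le> 2 * (K / real n) + 1 / \<epsilon> / real n + 1 / real n * M" using step by linarith
    also have "\<dots> = (2 * K + 1 / \<epsilon> + M) / real n" by (simp add: add_divide_distrib)
    finally show "\<bar>ln (?Z (Suc j)) - ln (?Z j) - real n * (?A (real (Suc j) / real n) - ?A (real j / real n))\<bar>
        \<le> (2 * K + 1 / \<epsilon> + M) / real n" by (simp add: a_def a'_def)
  qed
qed

text \<open>Telescoping. Over a distance \<open>o(n)\<close> the total error vanishes, which serves
  \<open>weight_tendsto\<close>; over the whole bulk it stays bounded, which serves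
  \<open>weight_bound\<close>.\<close>

lemma partition_sum_ln_estimate:
  assumes d: "d \<ge> 2" and \<beta>: "\<beta> > 0" and \<epsilon>: "\<epsilon> > 0"
  defines "b \<equiv> exp (-2 * \<beta>)"
  shows "\<exists>C\<ge>0. \<exists>N. \<forall>n\<ge>N. regular_graphs d n \<noteq> {} \<longrightarrow>
     (\<forall>i j. \<epsilon> * real n \<le> real i \<longrightarrow> real i \<le> (1 - \<epsilon>) * real n \<longrightarrow>
        \<epsilon> * real n \<le> real j \<longrightarrow> real j \<le> (1 - \<epsilon>) * real n \<longrightarrow>
       \<bar>ln (partition_sum d n b j) - ln (partition_sum d n b i)
          - real n * (A_fun d \<beta> 0 (real j / real n) - A_fun d \<beta> 0 (real i / real n))\<bar>
        \<le> C * \<bar>real j - real i\<bar> / real n)"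
proof -
  obtain C N where C: "C \<ge> 0" and step: "\<forall>n\<ge>N. regular_graphs d n \<noteq> {} \<longrightarrow>
     (\<forall>j. \<epsilon> * real n \<le> real j \<longrightarrow> real (Suc j) \<le> (1 - \<epsilon>) * real n \<longrightarrow>
       \<bar>ln (partition_sum d n b (Suc j)) - ln (partition_sum d n b j)
          - real n * (A_fun d \<beta> 0 (real (Suc j) / real n) - A_fun d \<beta> 0 (real j / real n))\<bar> \<le> C / real n)"
    using partition_sum_ln_step[OF d \<beta> \<epsilon>] unfolding b_def by blast
  have le: "\<bar>ln (partition_sum d n b j) - ln (partition_sum d n b i)
          - real n * (A_fun d \<beta> 0 (real j / real n) - A_fun d \<beta> 0 (real i / real n))\<bar>
        \<le> C * (real j - real i) / real n"
    if n: "n \<ge> N" "regular_graphs d n \<noteq> {}" and ij: "i \<le> j" "\<epsilon> * real n \<le> real i" "real j \<le> (1 - \<epsilon>) * real n" for n i j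
    using ij(1,3)
  proof (induction j rule: dec_induct)
    case (step k)
    let ?L = "\<lambda>j. ln (partition_sum d n b j)" and ?A = "\<lambda>j. A_fun d \<beta> 0 (real j / real n)"
    have "\<epsilon> * real n \<le> real k" using ij(2) step.hyps by linarith
    hence "\<bar>?L (Suc k) - ?L k - real n * (?A (Suc k) - ?A k)\<bar> \<le> C / real n"
      using \<open>\<forall>n\<ge>N. _\<close>[rule_format, OF n] step.prems by blast
    moreover have "\<bar>?L k - ?L i - real n * (?A k - ?A i)\<bar> \<le> C * (real k - real i) / real n"
      using step.IH step.prems by simp
    moreover have "real n * (?A (Suc k) - ?A k) + real n * (?A k - ?A i) = real n * (?A (Suc k) - ?A i)"
      by (simp add: algebra_simps)
    moreover have "C / real n + C * (real k - real i) / real n = C * (real (Suc k) - real i) / real n"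
      by (simp add: add_divide_distrib[symmetric] algebra_simps)
    ultimately show ?case by linarith
  qed simp
  show ?thesis
  proof (intro exI[of _ C] conjI exI[of _ N] allI impI C)
    fix n i j :: nat
    assume n: "n \<ge> N" "regular_graphs d n \<noteq> {}"
      and i: "\<epsilon> * real n \<le> real i" "real i \<le> (1 - \<epsilon>) * real n"
      and j: "\<epsilon> * real n \<le> real j" "real j \<le> (1 - \<epsilon>) * real n"
    let ?L = "\<lambda>j. ln (partition_sum d n b j)" and ?A = "\<lambda>j. A_fun d \<beta> 0 (real j / real n)"
    show "\<bar>?L j - ?L i - real n * (?A j - ?A i)\<bar> \<le> C * \<bar>real j - real i\<bar> / real n"
    proof (cases "i \<le> j")
      case True
      thus ?thesis using le[OF n True i(1) j(2)] by simp
    next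
      case False
      hence ji: "j \<le> i" by simp
      have neg: "?L j - ?L i - real n * (?A j - ?A i) = - (?L i - ?L j - real n * (?A i - ?A j))"
        by (simp add: algebra_simps)
      have "\<bar>real j - real i\<bar> = real i - real j" using ji by simp
      thus ?thesis unfolding neg abs_minus_cancel using le[OF n ji j(1) i(2)] by simp
    qed
  qed
qed

section \<open>Existence of regular graphs\<close>

definition cyclic_add :: "nat \<Rightarrow> nat \<Rightarrow> nat \<Rightarrow> nat" where
  "cyclic_add n v x = (if v + x < n then v + x else v + x - n)"

text \<open>Vertices are joined at the cyclic distances in \<open>D\<close>. As \<open>D\<close> is
  symmetric, an edge with \<open>v\<close> as its second end can be rewritten with \<open>v\<close>
  as its first, so the edges at \<open>v\<close> correspond to the elements of
  \<open>D\<close>.\<close>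

lemma circulant_graph_regular:
  assumes D: "D \<subseteq> {1..<n}" "\<And>x. x \<in> D \<Longrightarrow> n - x \<in> D" "card D = d"
  shows "{{v, cyclic_add n v x} |v x. v < n \<and> x \<in> D} \<in> regular_graphs d n" (is "?E \<in> _")
proof -
  have D': "0 < x" "x < n" if "x \<in> D" for x using D(1) that by auto
  have lt: "cyclic_add n v x < n" and ne: "cyclic_add n v x \<noteq> v"
    and bck: "cyclic_add n (cyclic_add n v x) (n - x) = v" if "v < n" "x \<in> D" for v x
    using that(1) D'[OF that(2)] by (auto simp: cyclic_add_def)
  have "card {e \<in> ?E. v \<in> e} = d" if v: "v < n" for v
  proof -
    have "{e \<in> ?E. v \<in> e} = (\<lambda>x. {v, cyclic_add n v x}) ` D"
    proof (intro subset_antisym subsetI)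
      fix e assume "e \<in> {e \<in> ?E. v \<in> e}"
      then obtain u x where u: "e = {u, cyclic_add n u x}" "u < n" "x \<in> D" "v \<in> e" by blast
      show "e \<in> (\<lambda>x. {v, cyclic_add n v x}) ` D"
      proof (cases "v = u")
        case True thus ?thesis using u by blast
      next
        case False
        hence "v = cyclic_add n u x" using u by auto
        hence "cyclic_add n v (n - x) = u" using bck[OF u(2,3)] by simp
        hence "e = {v, cyclic_add n v (n - x)}" using u \<open>v = cyclic_add n u x\<close> by auto
        thus ?thesis using D(2)[OF u(3)] by blast
      qed
    qed (use v in auto)
    moreover have "inj_on (\<lambda>x. {v, cyclic_add n v x}) D"
    proof (rule inj_onI)
      fix x y assume x: "x \<in> D" and y: "y \<in> D" and e: "{v, cyclic_add n v x} = {v, cyclic_add n v y}"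
      have "cyclic_add n v x = cyclic_add n v y"
        using e ne[OF v x] ne[OF v y] by (auto simp: doubleton_eq_iff)
      thus "x = y" using D'[OF x] D'[OF y] v by (auto simp: cyclic_add_def split: if_splits)
    qed
    ultimately show ?thesis by (simp add: card_image D(3))
  qed
  moreover have "?E \<subseteq> {e. e \<subseteq> {..<n} \<and> card e = 2}"
    using lt ne by (fastforce simp: card_2_iff)
  ultimately show ?thesis unfolding regular_graphs_def by blast
qed

text \<open>The distances up to \<open>d div 2\<close> in both directions are used, together with
  the antipodal distance \<open>n / 2\<close> if \<open>d\<close> is odd, in which case
  \<open>n\<close> is even. Nonemptiness is what makes the annealed expectation an average over
  graphs.\<close>

lemma regular_graphs_nonempty:
  assumes n: "n > d" and even: "even (d * n)"
  shows "regular_graphs d n \<noteq> {}"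
proof -
  define k where "k = d div 2"
  define D0 where "D0 = {1..k} \<union> {n - k..<n}"
  have k2: "2 * k \<le> d" by (simp add: k_def)
  hence disj: "{1..k} \<inter> {n - k..<n} = {}" and kn: "k \<le> n" using n by auto
  have card0: "card D0 = 2 * k"
    unfolding D0_def using disj kn by (subst card_Un_disjoint) auto
  have sym0: "n - x \<in> D0" if "x \<in> D0" for x using that k2 n by (auto simp: D0_def)
  have sub0: "D0 \<subseteq> {1..<n}" using k2 n by (auto simp: D0_def)
  have "\<exists>D. D \<subseteq> {1..<n} \<and> (\<forall>x\<in>D. n - x \<in> D) \<and> card D = d"
  proof (cases "even d")
    case True
    hence "2 * k = d" by (simp add: k_def)
    thus ?thesis using card0 sym0 sub0 by (intro exI[of _ D0]) auto
  next
    case False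
    hence d: "d = 2 * k + 1" by (simp add: k_def)
    have "even n" using False even by simp
    then obtain l where l: "n = 2 * l" by (elim evenE)
    have "l \<notin> D0" using l d n by (auto simp: D0_def)
    hence "card (insert l D0) = d" using card0 d by (simp add: D0_def)
    moreover have "insert l D0 \<subseteq> {1..<n}" using sub0 l n by auto
    moreover have "\<forall>x\<in>insert l D0. n - x \<in> insert l D0" using sym0 l by auto
    ultimately show ?thesis by blast
  qed
  then obtain D where "D \<subseteq> {1..<n}" "\<forall>x\<in>D. n - x \<in> D" "card D = d" by blast
  from circulant_graph_regular[OF this(1) _ this(3)] this(2) show ?thesis by blast
qed

section \<open>Laplace's method on a lattice\<close>

lemma integrable_exp_neg_abs:
  fixes \<tau> :: real
  assumes "\<tau> > 0"
  shows "integrable lborel (\<lambda>y. exp (- \<tau> * \<bar>y\<bar>))"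
proof -
  interpret prob_space "density lborel (exponential_density \<tau>)"
    by (rule prob_space_exponential_density[OF assms])
  have nn: "exponential_density \<tau> x \<ge> 0" for x using assms by (simp add: exponential_density_def)
  have "(\<integral>\<^sup>+ x. ennreal (exponential_density \<tau> x) \<partial>lborel) = 1"
    using emeasure_space_1 by (simp add: emeasure_density)
  hence int: "integrable lborel (exponential_density \<tau>)"
    using nn by (intro integrableI_nonneg) auto
  have int': "integrable lborel (\<lambda>x. exponential_density \<tau> (- x))"
    using lborel_integrable_real_affine[OF int, of "-1" 0] by simp
  have "integrable lborel (\<lambda>x. (exponential_density \<tau> x + exponential_density \<tau> (- x)) / \<tau>)"
    by (intro integrable_divide Bochner_Integration.integrable_add int int')
  thus ?thesis
  proof (rule Bochner_Integration.integrable_bound)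
    show "AE x in lborel. norm (exp (- \<tau> * \<bar>x\<bar>)) \<le> norm ((exponential_density \<tau> x + exponential_density \<tau> (- x)) / \<tau>)"
      using assms by (intro AE_I2) (auto simp: exponential_density_def field_simps abs_if)
  qed simp
qed

text \<open>By dominated convergence for the step functions of mesh \<open>1 / lam\<close>.\<close>

lemma lattice_dominated_convergence:
  fixes F :: "nat \<Rightarrow> nat \<Rightarrow> real" and lam c :: "nat \<Rightarrow> real" and n :: "nat \<Rightarrow> nat" and G :: "real \<Rightarrow> real"
  assumes lam: "filterlim lam at_top sequentially"
    and lo: "filterlim (\<lambda>k. c k / lam k) at_top sequentially"
    and hi: "filterlim (\<lambda>k. (real (n k) - c k) / lam k) at_top sequentially"
    and \<tau>: "\<tau> > 0"
    and dom: "eventually (\<lambda>k. \<forall>j\<le>n k. \<bar>F k j\<bar> \<le> C * exp (- \<tau> * \<bar>(real j - c k) / lam k\<bar>)) sequentially"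
    and conv: "\<And>y j. y \<notin> N \<Longrightarrow> (\<lambda>k. (real (j k) - c k) / lam k) \<longlonglongrightarrow> y \<Longrightarrow> (\<lambda>k. F k (j k)) \<longlonglongrightarrow> G y"
    and N: "finite N" and G: "G \<in> borel_measurable borel"
  shows "(\<lambda>k. (\<Sum>j\<le>n k. F k j) / lam k) \<longlonglongrightarrow> (LINT y|lborel. G y)"
proof -
  define s where "s = (\<lambda>k y. \<Sum>j\<le>n k. F k j * indicator {(real j - c k) / lam k ..< (real j + 1 - c k) / lam k} y)"
  \<comment> \<open>The left end of the step that contains \<open>y\<close> is within
    \<open>1 / lam k \<le> 1\<close> of \<open>y\<close>, which costs the factor
    \<open>exp \<tau>\<close>.\<close>
  define w where "w = (\<lambda>y. max C 0 * exp \<tau> * exp (- \<tau> * \<bar>y\<bar>))"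
  have evlam: "eventually (\<lambda>k. lam k \<ge> 1) sequentially" using lam by (simp add: filterlim_at_top)
  have zero: "(\<Sum>j\<le>N. if int j = m then f j else 0) = 0"
    if "\<not> (0 \<le> m \<and> m \<le> int N)" for m :: int and N :: nat and f :: "nat \<Rightarrow> real"
    by (intro sum.neutral) (use that in auto)
  have s_eq: "s k y = (if 0 \<le> \<lfloor>c k + lam k * y\<rfloor> \<and> \<lfloor>c k + lam k * y\<rfloor> \<le> int (n k) then F k (nat \<lfloor>c k + lam k * y\<rfloor>) else 0)"
    if lk: "lam k \<ge> 1" for k y
  proof -
    have ind: "indicator {(real j - c k) / lam k ..< (real j + 1 - c k) / lam k} y
        = (if int j = \<lfloor>c k + lam k * y\<rfloor> then 1 else (0::real))" for j
    proof -
      have "y \<in> {(real j - c k) / lam k ..< (real j + 1 - c k) / lam k}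
          \<longleftrightarrow> real j \<le> c k + lam k * y \<and> c k + lam k * y < real j + 1"
        using lk by (auto simp: field_simps)
      also have "\<dots> \<longleftrightarrow> \<lfloor>c k + lam k * y\<rfloor> = int j" by (simp add: floor_eq_iff)
      finally show ?thesis by (auto simp: indicator_def)
    qed
    have "s k y = (\<Sum>j\<le>n k. if int j = \<lfloor>c k + lam k * y\<rfloor> then F k j else 0)"
      unfolding s_def ind by (intro sum.cong) auto
    also have "\<dots> = (if 0 \<le> \<lfloor>c k + lam k * y\<rfloor> \<and> \<lfloor>c k + lam k * y\<rfloor> \<le> int (n k) then F k (nat \<lfloor>c k + lam k * y\<rfloor>) else 0)"
    proof (cases "0 \<le> \<lfloor>c k + lam k * y\<rfloor> \<and> \<lfloor>c k + lam k * y\<rfloor> \<le> int (n k)")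
      case True
      hence "(\<Sum>j\<le>n k. if int j = \<lfloor>c k + lam k * y\<rfloor> then F k j else 0)
          = (\<Sum>j\<le>n k. if j = nat \<lfloor>c k + lam k * y\<rfloor> then F k j else 0)"
        by (intro sum.cong) auto
      also have "\<dots> = F k (nat \<lfloor>c k + lam k * y\<rfloor>)" using True by (subst sum.delta) auto
      finally show ?thesis using True by simp
    next
      case False
      hence "(\<Sum>j\<le>n k. if int j = \<lfloor>c k + lam k * y\<rfloor> then F k j else 0) = 0"
        by (rule zero)
      thus ?thesis using False by (simp only: if_False)
    qed
    finally show ?thesis .
  qed
  have near: "\<bar>y - (real_of_int \<lfloor>c k + lam k * y\<rfloor> - c k) / lam k\<bar> \<le> 1 / lam k" if lk: "lam k \<ge> 1" for k y
  proof -
    have "y - (real_of_int \<lfloor>c k + lam k * y\<rfloor> - c k) / lam k = (c k + lam k * y - real_of_int \<lfloor>c k + lam k * y\<rfloor>) / lam k"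
      using lk by (simp add: field_simps)
    moreover have "0 \<le> c k + lam k * y - real_of_int \<lfloor>c k + lam k * y\<rfloor>" "c k + lam k * y - real_of_int \<lfloor>c k + lam k * y\<rfloor> \<le> 1"
      by linarith+
    ultimately show ?thesis using lk by (simp add: abs_divide divide_right_mono)
  qed
  have bound: "eventually (\<lambda>k. \<forall>y. \<bar>s k y\<bar> \<le> w y) sequentially"
    using evlam dom
  proof eventually_elim
    case (elim k)
    show ?case
    proof
      fix y
      let ?m = "\<lfloor>c k + lam k * y\<rfloor>"
      show "\<bar>s k y\<bar> \<le> w y"
      proof (cases "0 \<le> ?m \<and> ?m \<le> int (n k)")
        case True
        have "\<bar>s k y\<bar> = \<bar>F k (nat ?m)\<bar>" using True by (simp add: s_eq[OF elim(1)])
        also have "\<dots> \<le> C * exp (- \<tau> * \<bar>(real (nat ?m) - c k) / lam k\<bar>)"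
        proof -
          have "nat ?m \<le> n k" using True by linarith
          thus ?thesis using elim(2) by blast
        qed
        also have "\<dots> \<le> max C 0 * exp (\<tau> + - \<tau> * \<bar>y\<bar>)"
        proof (intro mult_mono)
          have "\<bar>y\<bar> \<le> \<bar>(real_of_int ?m - c k) / lam k\<bar> + 1 / lam k" using near[OF elim(1), of y] by linarith
          also have "1 / lam k \<le> 1" using elim(1) by simp
          finally have "\<tau> * \<bar>y\<bar> \<le> \<tau> * (\<bar>(real_of_int ?m - c k) / lam k\<bar> + 1)" using \<tau> by simp
          thus "exp (- \<tau> * \<bar>(real (nat ?m) - c k) / lam k\<bar>) \<le> exp (\<tau> + - \<tau> * \<bar>y\<bar>)"
            using True by (simp add: algebra_simps)
        qed auto
        finally show ?thesis unfolding w_def exp_add by (simp only: mult.assoc)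
      qed (simp only: s_eq[OF elim(1)] if_False, simp add: w_def)
    qed
  qed
  have lim: "(\<lambda>k. s k y) \<longlonglongrightarrow> G y" if y: "y \<notin> N" for y
  proof -
    have "(\<lambda>k. 1 / lam k) \<longlonglongrightarrow> 0" using tendsto_inverse_0_at_top[OF lam] by (simp add: inverse_eq_divide)
    have conv': "(\<lambda>k. (real_of_int \<lfloor>c k + lam k * y\<rfloor> - c k) / lam k) \<longlonglongrightarrow> y"
    proof (rule Lim_transform2)
      show "(\<lambda>k. y) \<longlonglongrightarrow> y" by simp
      show "(\<lambda>k. y - (real_of_int \<lfloor>c k + lam k * y\<rfloor> - c k) / lam k) \<longlonglongrightarrow> 0"
      proof (rule Lim_null_comparison[OF _ \<open>(\<lambda>k. 1 / lam k) \<longlonglongrightarrow> 0\<close>])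
        show "eventually (\<lambda>k. norm (y - (real_of_int \<lfloor>c k + lam k * y\<rfloor> - c k) / lam k) \<le> 1 / lam k) sequentially"
          using evlam by eventually_elim (use near in simp)
      qed
    qed
    have ev: "eventually (\<lambda>k. 0 \<le> \<lfloor>c k + lam k * y\<rfloor> \<and> \<lfloor>c k + lam k * y\<rfloor> \<le> int (n k)) sequentially"
    proof -
      have "eventually (\<lambda>k. c k / lam k \<ge> - y) sequentially" using lo by (simp add: filterlim_at_top)
      moreover have "eventually (\<lambda>k. (real (n k) - c k) / lam k \<ge> y) sequentially" using hi by (simp add: filterlim_at_top)
      ultimately show ?thesis using evlam
      proof eventually_elim
        case (elim k)
        have "0 \<le> c k + lam k * y" "c k + lam k * y \<le> real (n k)" using elim by (simp_all add: field_simps)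
        thus ?case by (simp add: floor_le_iff)
      qed
    qed
    have "(\<lambda>k. F k (nat \<lfloor>c k + lam k * y\<rfloor>)) \<longlonglongrightarrow> G y"
    proof (rule conv[OF y])
      show "(\<lambda>k. (real (nat \<lfloor>c k + lam k * y\<rfloor>) - c k) / lam k) \<longlonglongrightarrow> y"
        using conv' by (rule Lim_transform_eventually) (use ev in eventually_elim, simp)
    qed
    thus ?thesis by (rule Lim_transform_eventually) (use ev evlam in eventually_elim, simp add: s_eq)
  qed
  obtain K where K: "\<And>k y. k \<ge> K \<Longrightarrow> \<bar>s k y\<bar> \<le> w y" "\<And>k. k \<ge> K \<Longrightarrow> lam k \<ge> 1"
    using eventually_conj[OF bound evlam] by (auto simp: eventually_sequentially)
  have w: "integrable lborel w" unfolding w_def by (intro integrable_mult_right integrable_exp_neg_abs \<tau>)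
  have meas: "s k \<in> borel_measurable lborel" for k unfolding s_def by measurable
  have AEN: "AE y in lborel. y \<notin> N"
    using N by (intro AE_not_in) (simp add: finite_imp_null_set_lborel)
  have AElim: "AE y in lborel. (\<lambda>k. s (k + K) y) \<longlonglongrightarrow> G y"
    using AEN by eventually_elim (intro LIMSEQ_ignore_initial_segment lim)
  have AEb: "AE y in lborel. norm (s (k + K) y) \<le> w y" for k using K(1) by (intro AE_I2) simp
  have Gm: "G \<in> borel_measurable lborel" using G by simp
  have "(\<lambda>k. integral\<^sup>L lborel (s (k + K))) \<longlonglongrightarrow> integral\<^sup>L lborel G"
    by (rule integral_dominated_convergence[OF Gm meas w AElim AEb])
  moreover have "integral\<^sup>L lborel (s (k + K)) = (\<Sum>j\<le>n (k + K). F (k + K) j) / lam (k + K)" for k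
  proof -
    let ?k = "k + K"
    have lk: "lam ?k \<ge> 1" by (rule K(2)) simp
    have le: "(real j - c ?k) / lam ?k \<le> (real j + 1 - c ?k) / lam ?k" for j using lk by (intro divide_right_mono) auto
    have m: "measure lborel {(real j - c ?k) / lam ?k ..< (real j + 1 - c ?k) / lam ?k} = 1 / lam ?k" for j
      using le by (simp add: diff_divide_distrib[symmetric])
    have fin: "emeasure lborel {(real j - c ?k) / lam ?k ..< (real j + 1 - c ?k) / lam ?k} < \<infinity>" for j
      using le by simp
    have "integral\<^sup>L lborel (s ?k) = (\<Sum>j\<le>n ?k. LINT y|lborel. F ?k j * indicator {(real j - c ?k) / lam ?k ..< (real j + 1 - c ?k) / lam ?k} y)"
      unfolding s_def using fin
      by (intro Bochner_Integration.integral_sum integrable_mult_right integrable_real_indicator) auto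
    also have "\<dots> = (\<Sum>j\<le>n ?k. F ?k j * (1 / lam ?k))"
      by (intro sum.cong refl) (simp add: m)
    finally show ?thesis by (simp add: sum_divide_distrib)
  qed
  ultimately have "(\<lambda>k. (\<Sum>j\<le>n (k + K). F (k + K) j) / lam (k + K)) \<longlonglongrightarrow> integral\<^sup>L lborel G" by simp
  thus "(\<lambda>k. (\<Sum>j\<le>n k. F k j) / lam k) \<longlonglongrightarrow> (LINT y|lborel. G y)"
    by (rule LIMSEQ_offset)
qed

text \<open>Up to a factor that does not depend on \<open>j\<close>, the annealed weight of all configurations with
  \<open>j\<close> plus spins.\<close>

definition level_weight :: "nat \<Rightarrow> real \<Rightarrow> real \<Rightarrow> nat \<Rightarrow> nat \<Rightarrow> real" where
  "level_weight d \<beta> h n j = partition_sum d n (exp (-2 * \<beta>)) j * exp (2 * h * real j)"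

lemma level_weight_pos:
  assumes "regular_graphs d n \<noteq> {}" "j \<le> n"
  shows "level_weight d \<beta> h n j > 0"
  unfolding level_weight_def using assms by (intro mult_pos_pos partition_sum_pos) auto

lemma level_weight_nonneg: "level_weight d \<beta> h n j \<ge> 0"
  unfolding level_weight_def by (intro mult_nonneg_nonneg partition_sum_nonneg) auto

lemma A_fun_eq_0: "A_fun d \<beta> h x = A_fun d \<beta> 0 x + 2 * h * x"
  by (simp add: A_fun_def)

lemma level_weight_ln_estimate:
  assumes d: "d \<ge> 2" and \<beta>: "\<beta> > 0" and \<epsilon>: "\<epsilon> > 0"
  shows "\<exists>C\<ge>0. \<exists>N. \<forall>n\<ge>N. regular_graphs d n \<noteq> {} \<longrightarrow>
     (\<forall>i j. \<epsilon> * real n \<le> real i \<longrightarrow> real i \<le> (1 - \<epsilon>) * real n \<longrightarrow>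
        \<epsilon> * real n \<le> real j \<longrightarrow> real j \<le> (1 - \<epsilon>) * real n \<longrightarrow>
       \<bar>ln (level_weight d \<beta> h n j / level_weight d \<beta> h n i)
          - real n * (A_fun d \<beta> h (real j / real n) - A_fun d \<beta> h (real i / real n))\<bar>
        \<le> C * \<bar>real j - real i\<bar> / real n)"
proof -
  let ?Z = "\<lambda>n. partition_sum d n (exp (-2 * \<beta>))"
  obtain C N where C: "C \<ge> 0" and est: "\<forall>n\<ge>N. regular_graphs d n \<noteq> {} \<longrightarrow>
     (\<forall>i j. \<epsilon> * real n \<le> real i \<longrightarrow> real i \<le> (1 - \<epsilon>) * real n \<longrightarrow>
        \<epsilon> * real n \<le> real j \<longrightarrow> real j \<le> (1 - \<epsilon>) * real n \<longrightarrow>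
       \<bar>ln (?Z n j) - ln (?Z n i)
          - real n * (A_fun d \<beta> 0 (real j / real n) - A_fun d \<beta> 0 (real i / real n))\<bar>
        \<le> C * \<bar>real j - real i\<bar> / real n)"
    using partition_sum_ln_estimate[OF d \<beta> \<epsilon>] by blast
  show ?thesis
  proof (intro exI[of _ C] conjI exI[of _ "max N 1"] allI impI C)
    fix n i j :: nat
    assume n: "n \<ge> max N 1" and ne: "regular_graphs d n \<noteq> {}"
      and i: "\<epsilon> * real n \<le> real i" "real i \<le> (1 - \<epsilon>) * real n"
      and j: "\<epsilon> * real n \<le> real j" "real j \<le> (1 - \<epsilon>) * real n"
    have n0: "real n > 0" and nN: "n \<ge> N" using n by auto
    have "(1 - \<epsilon>) * real n \<le> real n" using \<epsilon> by (simp add: algebra_simps)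
    hence ij: "i \<le> n" "j \<le> n" using i j by linarith+
    have Z: "?Z n i > 0" "?Z n j > 0" using ij ne by (auto intro!: partition_sum_pos)
    have "ln (level_weight d \<beta> h n j / level_weight d \<beta> h n i)
        = ln (?Z n j) + 2 * h * real j - (ln (?Z n i) + 2 * h * real i)"
      using Z unfolding level_weight_def by (simp add: ln_div ln_mult_pos)
    moreover have "real n * (A_fun d \<beta> h (real j / real n) - A_fun d \<beta> h (real i / real n))
      = real n * (A_fun d \<beta> 0 (real j / real n) - A_fun d \<beta> 0 (real i / real n)) + 2 * h * real j - 2 * h * real i"
    proof -
      have "real n * (real j / real n) = real j" "real n * (real i / real n) = real i" using n0 by simp_all
      moreover have "real n * (A_fun d \<beta> h (real j / real n) - A_fun d \<beta> h (real i / real n))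
        = real n * (A_fun d \<beta> 0 (real j / real n) - A_fun d \<beta> 0 (real i / real n))
          + 2 * h * (real n * (real j / real n)) - 2 * h * (real n * (real i / real n))"
        unfolding A_fun_eq_0[of d \<beta> h] by (simp only: algebra_simps)
      ultimately show ?thesis by simp
    qed
    ultimately have "ln (level_weight d \<beta> h n j / level_weight d \<beta> h n i)
          - real n * (A_fun d \<beta> h (real j / real n) - A_fun d \<beta> h (real i / real n))
        = ln (?Z n j) - ln (?Z n i)
          - real n * (A_fun d \<beta> 0 (real j / real n) - A_fun d \<beta> 0 (real i / real n))" by simp
    thus "\<bar>ln (level_weight d \<beta> h n j / level_weight d \<beta> h n i)
          - real n * (A_fun d \<beta> h (real j / real n) - A_fun d \<beta> h (real i / real n))\<bar>
        \<le> C * \<bar>real j - real i\<bar> / real n"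
      using est[rule_format, OF nN ne i j] by simp
  qed
qed

text \<open>For \<open>j\<close> up to \<open>\<epsilon> * n\<close> the entropic gain
  \<open>(n - j) / (j + 1)\<close> of a flip is at least \<open>1 / (2 * \<epsilon>)\<close>. The
  bound on \<open>\<epsilon>\<close> lets this outweigh both the energy cost \<open>b ^ d\<close>
  and a field factor \<open>exp (2 * \<bar>h\<bar>)\<close>.\<close>

lemma partition_sum_growth:
  assumes \<beta>: "\<beta> > 0" and \<epsilon>: "0 < \<epsilon>" "\<epsilon> \<le> exp (-2 * \<beta>) ^ d * exp (- 2 * \<bar>h\<bar>) / 2"
    and j: "real (Suc j) \<le> \<epsilon> * real n"
  shows "exp (2 * \<bar>h\<bar>) * partition_sum d n (exp (-2 * \<beta>)) j \<le> partition_sum d n (exp (-2 * \<beta>)) (Suc j)"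
proof -
  let ?b = "exp (-2 * \<beta>)" and ?Z = "partition_sum d n (exp (-2 * \<beta>))"
  have b: "0 < ?b" "?b \<le> 1" using \<beta> by auto
  have "?b ^ d * exp (- 2 * \<bar>h\<bar>) \<le> 1 * 1" using b by (intro mult_mono power_le_one) auto
  hence \<epsilon>2: "\<epsilon> \<le> 1 / 2" using \<epsilon> by simp
  have n0: "real n > 0" using j \<epsilon> by (cases "n = 0") auto
  have "\<epsilon> * real n \<le> 1 / 2 * real n" using \<epsilon>2 by (intro mult_right_mono) auto
  hence jn: "real (Suc j) \<le> real n / 2" using j by simp
  hence "j \<le> n" by simp
  have Z0: "?Z j \<ge> 0" by (rule partition_sum_nonneg) simp
  have "exp (2 * \<bar>h\<bar>) * \<epsilon> * 2 \<le> ?b ^ d"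
  proof -
    have "exp (2 * \<bar>h\<bar>) * (\<epsilon> * 2) \<le> exp (2 * \<bar>h\<bar>) * (?b ^ d * exp (- 2 * \<bar>h\<bar>))"
      using \<epsilon> by (intro mult_left_mono) auto
    also have "\<dots> = ?b ^ d" by (simp add: exp_minus)
    finally show ?thesis by simp
  qed
  have "real (Suc j) * (exp (2 * \<bar>h\<bar>) * ?Z j) \<le> (\<epsilon> * real n) * (exp (2 * \<bar>h\<bar>) * ?Z j)"
    using j Z0 by (intro mult_right_mono) auto
  also have "\<dots> = (real n / 2) * (exp (2 * \<bar>h\<bar>) * \<epsilon> * 2) * ?Z j" by simp
  also have "\<dots> \<le> (real n - real j) * ?b ^ d * ?Z j"
    using jn \<open>exp (2 * \<bar>h\<bar>) * \<epsilon> * 2 \<le> ?b ^ d\<close> Z0 \<epsilon> by (intro mult_right_mono mult_mono) auto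
  also have "\<dots> \<le> real (Suc j) * ?Z (Suc j)" using b \<open>j \<le> n\<close> by (rule partition_sum_Suc_ge)
  finally show ?thesis by (simp only: mult_le_cancel_left_pos of_nat_0_less_iff zero_less_Suc)
qed

lemma level_weight_mono_bottom:
  assumes \<beta>: "\<beta> > 0" and \<epsilon>: "0 < \<epsilon>" "\<epsilon> \<le> exp (-2 * \<beta>) ^ d * exp (- 2 * \<bar>h\<bar>) / 2"
    and j: "real (Suc j) \<le> \<epsilon> * real n"
  shows "level_weight d \<beta> h n j \<le> level_weight d \<beta> h n (Suc j)"
proof -
  let ?Z = "partition_sum d n (exp (-2 * \<beta>))"
  have Z0: "?Z j \<ge> 0" by (rule partition_sum_nonneg) simp
  have "?Z j * exp (2 * h * real j) \<le> (exp (2 * \<bar>h\<bar>) * ?Z j) * (exp (2 * h) * exp (2 * h * real j))"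
  proof -
    have "1 \<le> exp (2 * \<bar>h\<bar>) * exp (2 * h)" by (simp add: exp_add[symmetric])
    hence "1 * (?Z j * exp (2 * h * real j)) \<le> (exp (2 * \<bar>h\<bar>) * exp (2 * h)) * (?Z j * exp (2 * h * real j))"
      using Z0 by (intro mult_right_mono) auto
    thus ?thesis by (simp add: mult_ac)
  qed
  also have "\<dots> \<le> ?Z (Suc j) * (exp (2 * h) * exp (2 * h * real j))"
    by (intro mult_right_mono partition_sum_growth[OF assms]) auto
  finally show ?thesis by (simp add: level_weight_def exp_add[symmetric] algebra_simps)
qed

text \<open>Reflection turns the top into the bottom, and the factor
  \<open>exp (2 * \<bar>h\<bar>)\<close> in \<open>partition_sum_growth\<close> pays for a field of
  either sign.\<close>

lemma level_weight_mono_top: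
  assumes \<beta>: "\<beta> > 0" and \<epsilon>: "0 < \<epsilon>" "\<epsilon> \<le> exp (-2 * \<beta>) ^ d * exp (- 2 * \<bar>h\<bar>) / 2"
    and j: "(1 - \<epsilon>) * real n \<le> real j" "Suc j \<le> n"
  shows "level_weight d \<beta> h n (Suc j) \<le> level_weight d \<beta> h n j"
proof -
  let ?Z = "partition_sum d n (exp (-2 * \<beta>))"
  define l where "l = n - Suc j"
  have l: "Suc l = n - j" using j by (simp add: l_def)
  hence "real (Suc l) \<le> \<epsilon> * real n" using j by (simp add: algebra_simps)
  from partition_sum_growth[OF \<beta> \<epsilon> this] have "exp (2 * \<bar>h\<bar>) * ?Z l \<le> ?Z (Suc l)" .
  moreover have "?Z l = ?Z (Suc j)" unfolding l_def using j(2) by (rule partition_sum_reflect)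
  moreover have "?Z (Suc l) = ?Z j" unfolding l using j(2) by (intro partition_sum_reflect) auto
  ultimately have g: "exp (2 * \<bar>h\<bar>) * ?Z (Suc j) \<le> ?Z j" by simp
  have Z0: "?Z (Suc j) \<ge> 0" by (rule partition_sum_nonneg) simp
  have "?Z (Suc j) * exp (2 * h * real (Suc j)) = exp (2 * h) * ?Z (Suc j) * exp (2 * h * real j)"
    by (simp add: exp_add[symmetric] algebra_simps)
  also have "\<dots> \<le> exp (2 * \<bar>h\<bar>) * ?Z (Suc j) * exp (2 * h * real j)"
    using Z0 by (intro mult_right_mono) auto
  also have "\<dots> \<le> ?Z j * exp (2 * h * real j)" by (intro mult_right_mono g) auto
  finally show ?thesis by (simp add: level_weight_def)
qed

text \<open>Reduces bounds at a peak of any even order to Gaussian ones, at the price of a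
  constant.\<close>

lemma power_even_ge_square:
  fixes y :: real
  assumes p: "even p" "p \<ge> 2"
  shows "y\<^sup>2 - 1 \<le> y ^ p"
proof (cases "\<bar>y\<bar> \<ge> 1")
  case True
  have "\<bar>y\<bar>\<^sup>2 \<le> \<bar>y\<bar> ^ p" using True p by (intro power_increasing) auto
  thus ?thesis using p by (simp add: power_even_abs)
next
  case False
  hence "y\<^sup>2 \<le> 1" by (simp add: abs_square_le_1)
  moreover have "y ^ p \<ge> 0" using p by (simp add: zero_le_even_power)
  ultimately show ?thesis by linarith
qed

text \<open>\<open>J\<close> is upward closed so that a level near 0 whose density is in
  \<open>J\<close> can be raised into the bulk without leaving \<open>J\<close>; the instances are
  the whole line and \<open>{1 / 2..}\<close>. The sizes form a sequence because graphs exist only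
  for even \<open>d * n\<close>.\<close>

locale peak_sequence =
  fixes d :: nat and \<beta> h :: real and J :: "real set" and p :: nat and a c :: real and n :: "nat \<Rightarrow> nat"
  assumes d: "d \<ge> 3" and \<beta>: "\<beta> > 0" and peak: "peak (A_fun d \<beta> h) J p a c"
    and J: "\<And>x y. x \<in> J \<Longrightarrow> x \<le> y \<Longrightarrow> y \<in> J"
    and n: "filterlim n at_top sequentially" and even_n: "\<And>k. even (d * n k)"
begin

text \<open>At this distance from the centre the exponent \<open>n (j / n - a)^p\<close> is of order
  1, see \<open>dev_power\<close>.\<close>

definition scale :: "nat \<Rightarrow> real" where "scale k = real (n k) powr (1 - 1 / real p)"
definition centre :: "nat \<Rightarrow> real" where "centre k = a * real (n k)"
definition dev :: "nat \<Rightarrow> nat \<Rightarrow> real" where "dev k j = (real j - centre k) / scale k"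
text \<open>Dividing by the weight of the level just below the centre removes the unknown size of
  the partition sums; the limit at deviation 0 becomes 1.\<close>

definition weight :: "nat \<Rightarrow> nat \<Rightarrow> real" where
  "weight k j = level_weight d \<beta> h (n k) j / level_weight d \<beta> h (n k) (nat \<lfloor>centre k\<rfloor>)"

lemma a: "0 < a" "a < 1" "a \<in> J" and p: "even p" "p \<ge> 2" and c: "c < 0"
  using peak unfolding peak_def by (auto elim: evenE)

lemma n_real: "filterlim (\<lambda>k. real (n k)) at_top sequentially"
  using filterlim_compose[OF filterlim_real_sequentially n] .

lemma eventually_real_n: "eventually (\<lambda>k. real (n k) \<ge> x) sequentially"
  using n_real by (simp add: filterlim_at_top)

lemma eventually_nonempty: "eventually (\<lambda>k. regular_graphs d (n k) \<noteq> {} \<and> n k > 0) sequentially"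
proof -
  have "eventually (\<lambda>k. real (n k) \<ge> real d + 1) sequentially" by (rule eventually_real_n)
  thus ?thesis
  proof eventually_elim
    case (elim k)
    hence "n k > d" by simp
    thus ?case using regular_graphs_nonempty[OF _ even_n] by auto
  qed
qed

lemma exponent: "0 < 1 - 1 / real p" "1 - 1 / real p < 1"
  using p by (auto simp: field_simps)

lemma scale_at_top: "filterlim scale at_top sequentially"
proof -
  have "filterlim (\<lambda>x::real. x powr (1 - 1 / real p)) at_top at_top"
    using exponent by real_asymp
  from filterlim_compose[OF this n_real] show ?thesis by (simp add: scale_def[abs_def])
qed

lemma n_over_scale: "filterlim (\<lambda>k. real (n k) / scale k) at_top sequentially"
proof -
  have "filterlim (\<lambda>x::real. x powr (1 / real p)) at_top at_top" using p by real_asymp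
  from filterlim_compose[OF this n_real] have *: "filterlim (\<lambda>k. real (n k) powr (1 / real p)) at_top sequentially" .
  have "eventually (\<lambda>k. real (n k) powr (1 / real p) = real (n k) / scale k) sequentially"
    using eventually_nonempty
  proof eventually_elim
    case (elim k)
    hence "real (n k) > 0" by simp
    thus ?case by (simp add: scale_def powr_diff)
  qed
  from filterlim_cong[OF refl refl this] * show ?thesis by blast
qed

lemma scale_over_n: "(\<lambda>k. scale k / real (n k)) \<longlonglongrightarrow> 0"
  using tendsto_inverse_0_at_top[OF n_over_scale] by simp

lemma scale_power: "n k > 0 \<Longrightarrow> scale k > 0 \<and> scale k ^ p * real (n k) = real (n k) ^ p"
proof -
  assume "n k > 0"
  hence n0: "real (n k) > 0" by simp
  have "scale k ^ p = real (n k) powr (real p * (1 - 1 / real p))"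
    using n0 unfolding scale_def by (simp add: powr_realpow[symmetric] powr_powr mult.commute)
  also have "real p * (1 - 1 / real p) = real p - 1" using p by (simp add: field_simps)
  also have "real (n k) powr (real p - 1) = real (n k) ^ p / real (n k)"
    using n0 by (simp add: powr_diff powr_realpow)
  finally show ?thesis using n0 by (simp add: scale_def)
qed

lemma dev_power:
  assumes "n k > 0"
  shows "dev k j ^ p = real (n k) * (real j / real (n k) - a) ^ p"
proof -
  have s: "scale k > 0" "scale k ^ p * real (n k) = real (n k) ^ p" using scale_power[OF assms] by auto
  have n0: "real (n k) > 0" using assms by simp
  have "dev k j = (real (n k) * (real j / real (n k) - a)) / scale k"
    using n0 by (simp add: dev_def centre_def algebra_simps)
  hence "dev k j ^ p = real (n k) ^ p / scale k ^ p * (real j / real (n k) - a) ^ p"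
    by (simp add: power_divide power_mult_distrib)
  also have "real (n k) ^ p / scale k ^ p = real (n k)" using s by (simp flip: s(2))
  finally show ?thesis .
qed

lemma dev_tendsto_imp:
  assumes "(\<lambda>k. dev k (j k)) \<longlonglongrightarrow> y"
  shows "(\<lambda>k. real (j k) / real (n k)) \<longlonglongrightarrow> a"
proof -
  have "(\<lambda>k. a + dev k (j k) * (scale k / real (n k))) \<longlonglongrightarrow> a + y * 0"
    by (intro tendsto_intros assms scale_over_n)
  hence "(\<lambda>k. a + dev k (j k) * (scale k / real (n k))) \<longlonglongrightarrow> a" by simp
  thus ?thesis
  proof (rule Lim_transform_eventually)
    show "eventually (\<lambda>k. a + dev k (j k) * (scale k / real (n k)) = real (j k) / real (n k)) sequentially"
      using eventually_nonempty
    proof eventually_elim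
      case (elim k)
      hence "scale k > 0" "real (n k) > 0" using scale_power by auto
      thus ?case by (simp add: dev_def centre_def field_simps)
    qed
  qed
qed

lemma A_fun_scaling:
  assumes y: "(\<lambda>k. dev k (j k)) \<longlonglongrightarrow> y"
  shows "(\<lambda>k. real (n k) * (A_fun d \<beta> h (real (j k) / real (n k)) - A_fun d \<beta> h a)) \<longlonglongrightarrow> c * y ^ p"
proof -
  \<comment> \<open>Filling the removable gap at \<open>a\<close> covers the indices
    \<open>k\<close> with \<open>real (j k) / real (n k) = a\<close>.\<close>
  define \<rho> where "\<rho> = (\<lambda>x. if x = a then c else (A_fun d \<beta> h x - A_fun d \<beta> h a) / (x - a) ^ p)"
  have "((\<lambda>x. (A_fun d \<beta> h x - A_fun d \<beta> h a) / (x - a) ^ p) \<longlongrightarrow> c) (at a)"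
    using peak by (simp add: peak_def)
  hence "(\<rho> \<longlongrightarrow> c) (at a)"
    by (rule Lim_transform_eventually) (simp add: eventually_at_filter \<rho>_def)
  moreover have "\<rho> a = c" by (simp add: \<rho>_def)
  ultimately have "(\<rho> \<longlongrightarrow> \<rho> a) (at a)" by simp
  hence "isCont \<rho> a" by (simp add: isCont_def)
  hence "(\<lambda>k. \<rho> (real (j k) / real (n k))) \<longlonglongrightarrow> \<rho> a"
    by (rule isCont_tendsto_compose) (rule dev_tendsto_imp[OF y])
  hence "(\<lambda>k. dev k (j k) ^ p * \<rho> (real (j k) / real (n k))) \<longlonglongrightarrow> y ^ p * c"
    by (intro tendsto_intros y) (simp add: \<rho>_def)
  thus ?thesis
    unfolding mult.commute[of c]
  proof (rule Lim_transform_eventually)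
    show "eventually (\<lambda>k. dev k (j k) ^ p * \<rho> (real (j k) / real (n k))
        = real (n k) * (A_fun d \<beta> h (real (j k) / real (n k)) - A_fun d \<beta> h a)) sequentially"
      using eventually_nonempty
    proof eventually_elim
      case (elim k)
      hence e: "dev k (j k) ^ p = real (n k) * (real (j k) / real (n k) - a) ^ p" by (intro dev_power) auto
      show ?case unfolding e \<rho>_def using p by (auto simp: zero_power)
    qed
  qed
qed

lemma dev_centre: "(\<lambda>k. dev k (nat \<lfloor>centre k\<rfloor>)) \<longlonglongrightarrow> 0"
proof (rule Lim_null_comparison)
  show "(\<lambda>k. 1 / scale k) \<longlonglongrightarrow> 0"
    using tendsto_inverse_0_at_top[OF scale_at_top] by (simp add: inverse_eq_divide)
  show "eventually (\<lambda>k. norm (dev k (nat \<lfloor>centre k\<rfloor>)) \<le> 1 / scale k) sequentially"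
    using eventually_nonempty
  proof eventually_elim
    case (elim k)
    have s: "scale k > 0" using elim scale_power by auto
    have c0: "centre k \<ge> 0" using a by (simp add: centre_def)
    have "\<bar>real (nat \<lfloor>centre k\<rfloor>) - centre k\<bar> \<le> 1" using c0 by linarith
    thus ?case using s by (simp add: dev_def abs_divide divide_right_mono)
  qed
qed

text \<open>Both \<open>j\<close> and the reference level are \<open>a n + o(n)\<close>, so the
  accumulated error of the ratio estimate vanishes and only the expansion of \<open>A\<close> at the
  peak remains.\<close>

lemma weight_tendsto:
  assumes y: "(\<lambda>k. dev k (j k)) \<longlonglongrightarrow> y"
  shows "(\<lambda>k. weight k (j k)) \<longlonglongrightarrow> exp (c * y ^ p)"
proof -
  define \<epsilon> where "\<epsilon> = min a (1 - a) / 2"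
  have e: "2 * \<epsilon> \<le> a" "2 * \<epsilon> \<le> 1 - a" "\<epsilon> > 0" using a(1,2) unfolding \<epsilon>_def by (simp_all add: min_def)
  have \<epsilon>: "\<epsilon> > 0" "\<epsilon> < a" "a < 1 - \<epsilon>" using e by simp_all
  let ?A = "A_fun d \<beta> h" and ?i = "\<lambda>k. nat \<lfloor>centre k\<rfloor>"
  have d2: "d \<ge> 2" using d by simp
  obtain C N where C: "C \<ge> 0" and est: "\<forall>n\<ge>N. regular_graphs d n \<noteq> {} \<longrightarrow>
     (\<forall>i j. \<epsilon> * real n \<le> real i \<longrightarrow> real i \<le> (1 - \<epsilon>) * real n \<longrightarrow>
        \<epsilon> * real n \<le> real j \<longrightarrow> real j \<le> (1 - \<epsilon>) * real n \<longrightarrow>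
       \<bar>ln (level_weight d \<beta> h n j / level_weight d \<beta> h n i)
          - real n * (?A (real j / real n) - ?A (real i / real n))\<bar>
        \<le> C * \<bar>real j - real i\<bar> / real n)"
    using level_weight_ln_estimate[OF d2 \<beta> \<epsilon>(1), of h] by blast
  note xj = dev_tendsto_imp[OF y] and xi = dev_tendsto_imp[OF dev_centre]
  have bulk: "eventually (\<lambda>k. \<epsilon> * real (n k) \<le> real (l k) \<and> real (l k) \<le> (1 - \<epsilon>) * real (n k)) sequentially"
    if l: "(\<lambda>k. real (l k) / real (n k)) \<longlonglongrightarrow> a" for l
    using order_tendstoD(1)[OF l \<epsilon>(2)] order_tendstoD(2)[OF l \<epsilon>(3)] eventually_nonempty
  proof eventually_elim
    case (elim k)
    hence "real (n k) > 0" by simp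
    thus ?case using elim by (simp add: field_simps)
  qed
  have ev: "eventually (\<lambda>k. n k \<ge> N) sequentially"
    using n by (simp add: filterlim_at_top)
  have lim: "(\<lambda>k. real (n k) * (?A (real (j k) / real (n k)) - ?A a)
       - real (n k) * (?A (real (?i k) / real (n k)) - ?A a)) \<longlonglongrightarrow> c * y ^ p"
    using tendsto_diff[OF A_fun_scaling[OF y] A_fun_scaling[OF dev_centre]] p by (simp add: zero_power)
  have "(\<lambda>k. ln (weight k (j k)) - (real (n k) * (?A (real (j k) / real (n k)) - ?A a)
       - real (n k) * (?A (real (?i k) / real (n k)) - ?A a))) \<longlonglongrightarrow> 0"
  proof (rule Lim_null_comparison)
    have "(\<lambda>k. C * \<bar>real (j k) / real (n k) - real (?i k) / real (n k)\<bar>) \<longlonglongrightarrow> C * \<bar>a - a\<bar>"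
      by (intro tendsto_intros xj xi)
    thus "(\<lambda>k. C * \<bar>real (j k) / real (n k) - real (?i k) / real (n k)\<bar>) \<longlonglongrightarrow> 0" by simp
    show "eventually (\<lambda>k. norm (ln (weight k (j k)) - (real (n k) * (?A (real (j k) / real (n k)) - ?A a)
       - real (n k) * (?A (real (?i k) / real (n k)) - ?A a))) \<le> C * \<bar>real (j k) / real (n k) - real (?i k) / real (n k)\<bar>) sequentially"
      using bulk[OF xj] bulk[OF xi] eventually_nonempty ev
    proof eventually_elim
      case (elim k)
      have e1: "real (n k) * (?A (real (j k) / real (n k)) - ?A a) - real (n k) * (?A (real (?i k) / real (n k)) - ?A a)
         = real (n k) * (?A (real (j k) / real (n k)) - ?A (real (?i k) / real (n k)))"
        by (simp add: algebra_simps)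
      have e2: "\<bar>real (j k) / real (n k) - real (?i k) / real (n k)\<bar> = \<bar>real (j k) - real (?i k)\<bar> / real (n k)"
        by (simp add: diff_divide_distrib[symmetric] abs_divide)
      show ?case unfolding e1 e2 weight_def real_norm_def
        using est[rule_format, of "n k" "?i k" "j k"] elim by simp
    qed
  qed
  from tendsto_add[OF this lim] have "(\<lambda>k. ln (weight k (j k))) \<longlonglongrightarrow> c * y ^ p" by simp
  hence "(\<lambda>k. exp (ln (weight k (j k)))) \<longlonglongrightarrow> exp (c * y ^ p)" by (rule tendsto_exp)
  thus ?thesis
  proof (rule Lim_transform_eventually)
    show "eventually (\<lambda>k. exp (ln (weight k (j k))) = weight k (j k)) sequentially"
      using bulk[OF xj] bulk[OF xi] eventually_nonempty
    proof eventually_elim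
      case (elim k)
      have "(1 - \<epsilon>) * real (n k) \<le> real (n k)" using \<epsilon> by (simp add: algebra_simps)
      hence "j k \<le> n k" "?i k \<le> n k" using elim by linarith+
      hence "weight k (j k) > 0" unfolding weight_def using elim by (intro divide_pos_pos level_weight_pos) auto
      thus ?case by simp
    qed
  qed
qed

text \<open>A level outside \<open>[\<epsilon> n, (1 - \<epsilon>) n]\<close> is compared with the border of that interval, towards which
  the weights increase.\<close>

lemma weight_bound:
  "\<exists>C \<kappa>. \<kappa> > 0 \<and> eventually (\<lambda>k. \<forall>j\<le>n k. real j / real (n k) \<in> J \<longrightarrow>
       weight k j \<le> C * exp (- \<kappa> * (dev k j)\<^sup>2)) sequentially"
proof -
  define b where "b = exp (-2 * \<beta>) ^ d * exp (- 2 * \<bar>h\<bar>) / 2"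
  \<comment> \<open>The weights increase up to \<open>2 * \<epsilon> * n\<close> and decrease from
    \<open>(1 - 2 * \<epsilon>) * n\<close> on; the factor 2 leaves room for rounding the border of
    the bulk to an integer. The point \<open>a\<close> stays at distance at least
    \<open>4 * \<epsilon>\<close> from 0 and 1, which the comparison of deviations uses.\<close>
  define \<epsilon> where "\<epsilon> = min (min a (1 - a)) b / 4"
  have b0: "b > 0" by (simp add: b_def)
  have e: "4 * \<epsilon> \<le> a" "4 * \<epsilon> \<le> 1 - a" "4 * \<epsilon> \<le> b" "\<epsilon> > 0" using a(1,2) b0 unfolding \<epsilon>_def by (auto simp: min_def)
  have \<epsilon>2: "0 < 2 * \<epsilon>" "2 * \<epsilon> \<le> exp (-2 * \<beta>) ^ d * exp (- 2 * \<bar>h\<bar>) / 2" using e unfolding b_def by linarith+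
  let ?A = "A_fun d \<beta> h" and ?i = "\<lambda>k. nat \<lfloor>centre k\<rfloor>" and ?L = "level_weight d \<beta> h"
  have d2: "d \<ge> 2" using d by simp
  obtain C N where C: "C \<ge> 0" and est: "\<forall>n\<ge>N. regular_graphs d n \<noteq> {} \<longrightarrow>
     (\<forall>i j. \<epsilon> * real n \<le> real i \<longrightarrow> real i \<le> (1 - \<epsilon>) * real n \<longrightarrow>
        \<epsilon> * real n \<le> real j \<longrightarrow> real j \<le> (1 - \<epsilon>) * real n \<longrightarrow>
       \<bar>ln (?L n j / ?L n i) - real n * (?A (real j / real n) - ?A (real i / real n))\<bar>
        \<le> C * \<bar>real j - real i\<bar> / real n)"
    using level_weight_ln_estimate[OF d2 \<beta> e(4), of h] by blast
  obtain \<kappa> where \<kappa>: "\<kappa> > 0" "\<forall>x\<in>J. \<epsilon> \<le> x \<and> x \<le> 1 - \<epsilon> \<longrightarrow> ?A x - ?A a \<le> - \<kappa> * (x - a) ^ p"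
    using peak e(4) unfolding peak_def by blast
  \<comment> \<open>The summands of the exponent come from the reference level not being exactly at
    \<open>a\<close>, from the accumulated error of the ratio estimate, and from the loss in
    \<open>y^2 - 1 \<le> y^p\<close>.\<close>
  define C' where "C' = exp (1 + C + \<kappa>)"
  have xi: "(\<lambda>k. real (?i k) / real (n k)) \<longlonglongrightarrow> a" by (rule dev_tendsto_imp[OF dev_centre])
  have evA: "eventually (\<lambda>k. \<bar>real (n k) * (?A (real (?i k) / real (n k)) - ?A a)\<bar> < 1) sequentially"
  proof -
    have "(\<lambda>k. \<bar>real (n k) * (?A (real (?i k) / real (n k)) - ?A a)\<bar>) \<longlonglongrightarrow> \<bar>c * 0 ^ p\<bar>"
      by (intro tendsto_intros A_fun_scaling dev_centre)
    thus ?thesis using p by (intro order_tendstoD(2)) (auto simp: zero_power)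
  qed
  have evi: "eventually (\<lambda>k. \<epsilon> < real (?i k) / real (n k)) sequentially"
            "eventually (\<lambda>k. real (?i k) / real (n k) < 1 - \<epsilon>) sequentially"
    using e a by (auto intro!: order_tendstoD[OF xi])
  have evN: "eventually (\<lambda>k. n k \<ge> N) sequentially" using n by (simp add: filterlim_at_top)
  have evn: "eventually (\<lambda>k. real (n k) \<ge> 1 / \<epsilon>) sequentially" by (rule eventually_real_n)
  \<comment> \<open>A border level \<open>l\<close> that replaces \<open>j\<close> satisfies
    \<open>\<bar>dev k j\<bar> \<le> 2 * \<bar>dev k l\<bar>\<close>, so a quarter of the Gaussian
    rate survives.\<close>
  have "eventually (\<lambda>k. \<forall>j\<le>n k. real j / real (n k) \<in> J \<longrightarrow>
       weight k j \<le> C' * exp (- (\<kappa> / 4) * (dev k j)\<^sup>2)) sequentially"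
    using evA evi evN evn eventually_nonempty
  proof eventually_elim
    case (elim k)
    define m where "m = real (n k)"
    have m: "m > 0" "\<epsilon> * m \<ge> 1" using elim e by (simp_all add: m_def field_simps)
    have ne: "regular_graphs d (n k) \<noteq> {}" using elim by simp
    have s: "scale k > 0" using elim scale_power by auto
    have i: "\<epsilon> * m \<le> real (?i k)" "real (?i k) \<le> (1 - \<epsilon>) * m"
      using elim m by (simp_all add: m_def field_simps)
    have em: "\<epsilon> * m \<le> m" using e a m by (intro mult_left_le_one_le) auto
    have ile: "?i k \<le> n k" using i e m unfolding m_def by (smt (verit) mult_left_le_one_le of_nat_le_iff mult_nonneg_nonneg)
    have bulk: "weight k j \<le> C' * exp (- \<kappa> * (dev k j)\<^sup>2)"
      if j: "\<epsilon> * m \<le> real j" "real j \<le> (1 - \<epsilon>) * m" "j \<le> n k" and jJ: "real j / m \<in> J" for j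
    proof -
      have W: "weight k j > 0" unfolding weight_def using j ile ne by (intro divide_pos_pos level_weight_pos) auto
      have 1: "ln (weight k j) \<le> m * (?A (real j / m) - ?A (real (?i k) / m)) + C * \<bar>real j - real (?i k)\<bar> / m"
        using est[rule_format, of "n k" "?i k" j] elim(4) ne i j unfolding m_def weight_def by linarith
      have "\<bar>real j - real (?i k)\<bar> / m \<le> 1" using j ile m by (auto simp: m_def)
      hence 2: "C * \<bar>real j - real (?i k)\<bar> / m \<le> C" using C mult_left_mono[of _ 1 C] by fastforce
      have 3: "m * (?A (real j / m) - ?A a) \<le> - \<kappa> * dev k j ^ p"
      proof -
        have "?A (real j / m) - ?A a \<le> - \<kappa> * (real j / m - a) ^ p"
          using \<kappa>(2) jJ j m by (auto simp: field_simps)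
        hence "m * (?A (real j / m) - ?A a) \<le> m * (- \<kappa> * (real j / m - a) ^ p)"
          using m by (intro mult_left_mono) auto
        also have "\<dots> = - \<kappa> * dev k j ^ p" using elim by (simp add: dev_power m_def)
        finally show ?thesis .
      qed
      have 4: "(dev k j)\<^sup>2 - 1 \<le> dev k j ^ p" by (rule power_even_ge_square[OF p])
      have "\<kappa> * ((dev k j)\<^sup>2 - 1) \<le> \<kappa> * dev k j ^ p" using 4 \<kappa> by (intro mult_left_mono) auto
      moreover have "m * (?A (real j / m) - ?A (real (?i k) / m))
          = m * (?A (real j / m) - ?A a) - m * (?A (real (?i k) / m) - ?A a)" by (simp add: algebra_simps)
      ultimately have "ln (weight k j) \<le> (1 + C + \<kappa>) + - \<kappa> * (dev k j)\<^sup>2"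
        using 1 2 3 elim(1) unfolding m_def by (simp add: algebra_simps)
      hence "exp (ln (weight k j)) \<le> exp ((1 + C + \<kappa>) + - \<kappa> * (dev k j)\<^sup>2)" by (subst exp_le_cancel_iff)
      thus ?thesis using W unfolding C'_def by (simp only: exp_add exp_ln)
    qed
    show ?case
    proof (intro allI impI)
      fix j assume j: "j \<le> n k" and "real j / real (n k) \<in> J"
      hence jJ: "real j / m \<in> J" by (simp add: m_def)
      have jm: "real j \<le> m" using j by (simp add: m_def)
      have C'0: "C' > 0" by (simp add: C'_def)
      have reduce: "weight k j \<le> C' * exp (- (\<kappa> / 4) * (dev k j)\<^sup>2)"
        if l: "\<epsilon> * m \<le> real l" "real l \<le> (1 - \<epsilon>) * m" "l \<le> n k" "real l / m \<in> J"
          and lj: "?L (n k) j \<le> ?L (n k) l" and dl: "\<bar>dev k j\<bar> \<le> 2 * \<bar>dev k l\<bar>" for l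
      proof -
        have "weight k j \<le> weight k l" unfolding weight_def
          using lj level_weight_nonneg by (intro divide_right_mono) auto
        also have "\<dots> \<le> C' * exp (- \<kappa> * (dev k l)\<^sup>2)" by (rule bulk[OF l])
        also have "\<dots> \<le> C' * exp (- (\<kappa> / 4) * (dev k j)\<^sup>2)"
        proof -
          have "\<bar>dev k j\<bar>\<^sup>2 \<le> (2 * \<bar>dev k l\<bar>)\<^sup>2" using dl by (intro power_mono) auto
          hence "(dev k j)\<^sup>2 \<le> 4 * (dev k l)\<^sup>2" by (simp add: power_mult_distrib)
          hence "\<kappa> / 4 * (dev k j)\<^sup>2 \<le> \<kappa> / 4 * (4 * (dev k l)\<^sup>2)" using \<kappa> by (intro mult_left_mono) auto
          thus ?thesis using C'0 by simp
        qed
        finally show ?thesis .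
      qed
      have dv: "\<bar>dev k j\<bar> \<le> 2 * \<bar>dev k l\<bar>" if "\<bar>real j - a * m\<bar> \<le> 2 * \<bar>real l - a * m\<bar>" for l
        using that s by (simp add: dev_def centre_def m_def abs_divide divide_right_mono)
      have am: "4 * (\<epsilon> * m) \<le> a * m" "4 * (\<epsilon> * m) \<le> m - a * m" "1 \<le> \<epsilon> * m"
      proof -
        show "1 \<le> \<epsilon> * m" by (rule m(2))
        show "4 * (\<epsilon> * m) \<le> a * m" using mult_right_mono[OF e(1), of m] m by simp
        have "4 * \<epsilon> * m \<le> (1 - a) * m" using mult_right_mono[OF e(2), of m] m by simp
        thus "4 * (\<epsilon> * m) \<le> m - a * m" by (simp add: algebra_simps)
      qed
      have am0: "a * m \<ge> 0" using a m by simp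
      have e1m: "(1 - \<epsilon>) * m = m - \<epsilon> * m" "(1 - 2 * \<epsilon>) * m = m - 2 * (\<epsilon> * m)" by (simp_all add: algebra_simps)
      consider "real j < \<epsilon> * m" | "\<epsilon> * m \<le> real j" "real j \<le> (1 - \<epsilon>) * m" | "(1 - \<epsilon>) * m < real j" by linarith
      thus "weight k j \<le> C' * exp (- (\<kappa> / 4) * (dev k j)\<^sup>2)"
      proof cases
        case 1
        define l where "l = nat \<lceil>\<epsilon> * m\<rceil>"
        have l: "\<epsilon> * m \<le> real l" "real l \<le> \<epsilon> * m + 1" using m unfolding l_def by linarith+
        hence l2: "real l \<le> 2 * (\<epsilon> * m)" using m by simp
        have jl: "j \<le> l" using 1 l by linarith
        have "?L (n k) j \<le> ?L (n k) l'" if "j \<le> l'" "l' \<le> l" for l'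
          using that
        proof (induction l' rule: dec_induct)
          case (step i)
          have "real (Suc i) \<le> 2 * \<epsilon> * real (n k)" using step.prems l2 unfolding m_def mult.assoc by linarith
          from level_weight_mono_bottom[OF \<beta> \<epsilon>2 this] step show ?case by fastforce
        qed simp
        hence lj: "?L (n k) j \<le> ?L (n k) l" using jl by blast
        show ?thesis
        proof (rule reduce[of l])
          show "real l / m \<in> J" using jJ by (rule J) (use jl m in \<open>simp add: divide_right_mono\<close>)
          show "\<bar>dev k j\<bar> \<le> 2 * \<bar>dev k l\<bar>"
          proof (rule dv)
            have "real j \<le> a * m" using 1 am(1) am0 by linarith
            moreover have "2 * real l \<le> a * m" using l2 am(1) by linarith
            ultimately show "\<bar>real j - a * m\<bar> \<le> 2 * \<bar>real l - a * m\<bar>"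
              using am0 by (simp add: abs_if)
          qed
          have "real l \<le> m" using l2 am am0 by linarith
          thus "l \<le> n k" by (simp add: m_def)
          show "real l \<le> (1 - \<epsilon>) * m" using l2 am am0 unfolding e1m by linarith
        qed (use l lj in auto)
      next
        case 2
        show ?thesis by (rule reduce[of j]) (use 2 j jJ in auto)
      next
        case 3
        define l where "l = nat \<lfloor>(1 - \<epsilon>) * m\<rfloor>"
        have nn: "(1 - \<epsilon>) * m \<ge> 0" using am am0 unfolding e1m by linarith
        have l: "(1 - \<epsilon>) * m - 1 \<le> real l" "real l \<le> (1 - \<epsilon>) * m" using nn unfolding l_def by linarith+
        have l2: "(1 - 2 * \<epsilon>) * m \<le> real l" using l m unfolding e1m by linarith
        have jl: "l \<le> j" using 3 l by linarith
        have "?L (n k) j' \<le> ?L (n k) l" if "l \<le> j'" "j' \<le> j" for j'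
          using that
        proof (induction j' rule: dec_induct)
          case (step i)
          have "(1 - 2 * \<epsilon>) * real (n k) \<le> real i" using step.hyps l2 unfolding m_def by linarith
          moreover have "Suc i \<le> n k" using step.prems j by simp
          ultimately show ?case using level_weight_mono_top[OF \<beta> \<epsilon>2] step by fastforce
        qed simp
        hence lj: "?L (n k) j \<le> ?L (n k) l" using jl by blast
        show ?thesis
        proof (rule reduce[of l])
          \<comment> \<open>Here \<open>l\<close> lies below \<open>j\<close>, so membership in
            \<open>J\<close> is inherited from \<open>a\<close> instead.\<close>
          have "a * m \<le> real l" using l2 am unfolding e1m by linarith
          hence "a \<le> real l / m" using m by (simp add: field_simps)
          thus "real l / m \<in> J" using J[OF a(3)] by blast
          show "\<bar>dev k j\<bar> \<le> 2 * \<bar>dev k l\<bar>"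
          proof (rule dv)
            have l3: "m - 2 * (\<epsilon> * m) \<le> real l" using l2 unfolding e1m .
            have "a * m \<le> real j" using 3 am unfolding e1m by linarith
            moreover have "a * m \<le> real l" using l3 am by linarith
            moreover have "m - a * m \<le> 2 * real l - 2 * (a * m)" using l3 am by linarith
            ultimately show "\<bar>real j - a * m\<bar> \<le> 2 * \<bar>real l - a * m\<bar>" using jm by simp
          qed
          show "l \<le> n k" using jl j by simp
          show "\<epsilon> * m \<le> real l" using l2 am am0 unfolding e1m by linarith
        qed (use l lj in auto)
      qed
    qed
  qed
  thus ?thesis using \<kappa> by (intro exI[of _ C'] exI[of _ "\<kappa> / 4"]) auto
qed

end

section \<open>Level probabilities and means under a shifted field\<close>

definition partition_function :: "nat \<Rightarrow> real \<Rightarrow> real \<Rightarrow> nat \<Rightarrow> real" where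
  "partition_function d \<beta> h n = (\<Sum>j\<le>n. level_weight d \<beta> h n j)"

definition level_prob :: "nat \<Rightarrow> real \<Rightarrow> real \<Rightarrow> nat \<Rightarrow> (nat \<Rightarrow> bool) \<Rightarrow> real" where
  "level_prob d \<beta> h n Q = (\<Sum>j\<le>n. level_weight d \<beta> h n j * of_bool (Q j)) / partition_function d \<beta> h n"

definition level_mean :: "nat \<Rightarrow> real \<Rightarrow> real \<Rightarrow> nat \<Rightarrow> real" where
  "level_mean d \<beta> h n = (\<Sum>j\<le>n. level_weight d \<beta> h n j * real j) / partition_function d \<beta> h n"

definition peak_integral :: "nat \<Rightarrow> real \<Rightarrow> (real \<Rightarrow> real) \<Rightarrow> real" where
  "peak_integral p c f = (LINT y|lborel. exp (c * y ^ p) * f y)"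

definition peak_mean :: "nat \<Rightarrow> real \<Rightarrow> real \<Rightarrow> real" where
  "peak_mean p c t = peak_integral p c (\<lambda>y. exp (2 * t * y) * y) / peak_integral p c (\<lambda>y. exp (2 * t * y))"

text \<open>Distribution function of the density proportional to \<open>exp (c * y ^ p)\<close>;
  composed with \<open>peak_mean\<close> it becomes the limiting distribution function of the
  estimator at a single peak.\<close>

definition peak_cdf :: "nat \<Rightarrow> real \<Rightarrow> real \<Rightarrow> real" where
  "peak_cdf p c z = peak_integral p c (\<lambda>y. of_bool (y \<le> z)) / peak_integral p c (\<lambda>y. 1)"

lemma partition_function_pos:
  "regular_graphs d n \<noteq> {} \<Longrightarrow> partition_function d \<beta> h n > 0"
  unfolding partition_function_def by (intro sum_pos level_weight_pos) auto

text \<open>Completing the square: Gaussian decay absorbs an exponential of any rate and still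
  leaves \<open>exp (- \<bar>x\<bar>)\<close>.\<close>

lemma exp_gauss_le:
  fixes \<kappa> s x :: real
  assumes "\<kappa> > 0"
  shows "exp (- \<kappa> * x\<^sup>2) * exp (s * \<bar>x\<bar>) \<le> exp ((s + 1)\<^sup>2 / (4 * \<kappa>)) * exp (- \<bar>x\<bar>)"
proof -
  have "0 \<le> (2 * \<kappa> * \<bar>x\<bar> - (s + 1))\<^sup>2" by simp
  also have "\<dots> = (4 * \<kappa>) * (\<kappa> * x\<^sup>2 - (s + 1) * \<bar>x\<bar>) + (s + 1)\<^sup>2"
    by (simp add: power2_eq_square algebra_simps)
  finally have "((s + 1) * \<bar>x\<bar> - \<kappa> * x\<^sup>2) * (4 * \<kappa>) \<le> (s + 1)\<^sup>2" by (simp add: algebra_simps)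
  hence "(s + 1) * \<bar>x\<bar> - \<kappa> * x\<^sup>2 \<le> (s + 1)\<^sup>2 / (4 * \<kappa>)"
    using assms by (intro mult_imp_le_div_pos) auto
  hence "- \<kappa> * x\<^sup>2 + s * \<bar>x\<bar> \<le> (s + 1)\<^sup>2 / (4 * \<kappa>) + - \<bar>x\<bar>" by (simp add: algebra_simps)
  thus ?thesis unfolding exp_add[symmetric] by (subst exp_le_cancel_iff)
qed

context peak_sequence
begin

lemma centre_over_scale: "filterlim (\<lambda>k. centre k / scale k) at_top sequentially"
proof -
  have "filterlim (\<lambda>k. a * (real (n k) / scale k)) at_top sequentially"
    using a by (intro filterlim_tendsto_pos_mult_at_top[OF tendsto_const _ n_over_scale])
  thus ?thesis by (simp add: centre_def)
qed

lemma codim_over_scale: "filterlim (\<lambda>k. (real (n k) - centre k) / scale k) at_top sequentially"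
proof -
  have "filterlim (\<lambda>k. (1 - a) * (real (n k) / scale k)) at_top sequentially"
    using a by (intro filterlim_tendsto_pos_mult_at_top[OF tendsto_const _ n_over_scale]) auto
  thus ?thesis by (simp add: centre_def algebra_simps)
qed

text \<open>On \<open>J\<close> the bound of \<open>weight_bound\<close> dominates the exponential
  growth allowed for \<open>g\<close>; elsewhere domination has to be supplied by
  \<open>outside\<close>. The finite set \<open>N\<close> admits limits \<open>\<gamma>\<close> with
  jumps, as they occur for distribution functions.\<close>

lemma weighted_sum_tendsto:
  fixes g :: "nat \<Rightarrow> nat \<Rightarrow> real"
  assumes conv: "\<And>y j. y \<notin> N \<Longrightarrow> (\<lambda>k. dev k (j k)) \<longlonglongrightarrow> y \<Longrightarrow> (\<lambda>k. g k (j k)) \<longlonglongrightarrow> \<gamma> y"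
    and N: "finite N" and \<gamma>: "\<gamma> \<in> borel_measurable borel"
    and bound: "\<And>k j. \<bar>g k j\<bar> \<le> B * exp (s * \<bar>dev k j\<bar>)"
    and outside: "eventually (\<lambda>k. \<forall>j\<le>n k. real j / real (n k) \<notin> J \<longrightarrow>
                    \<bar>weight k j * g k j\<bar> \<le> B' * exp (- \<tau> * \<bar>dev k j\<bar>)) sequentially"
    and \<tau>: "0 < \<tau>" "\<tau> \<le> 1"
  shows "(\<lambda>k. (\<Sum>j\<le>n k. weight k j * g k j) / scale k) \<longlonglongrightarrow> peak_integral p c \<gamma>"
proof -
  obtain C \<kappa> where \<kappa>: "\<kappa> > 0" and C: "eventually (\<lambda>k. \<forall>j\<le>n k. real j / real (n k) \<in> J \<longrightarrow>
       weight k j \<le> C * exp (- \<kappa> * (dev k j)\<^sup>2)) sequentially"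
    using weight_bound by blast
  define K where "K = max (\<bar>C\<bar> * \<bar>B\<bar> * exp ((s + 1)\<^sup>2 / (4 * \<kappa>))) \<bar>B'\<bar>"
  have w0: "weight k j \<ge> 0" for k j unfolding weight_def by (intro divide_nonneg_nonneg level_weight_nonneg)
  have dom: "eventually (\<lambda>k. \<forall>j\<le>n k. \<bar>weight k j * g k j\<bar> \<le> K * exp (- \<tau> * \<bar>(real j - centre k) / scale k\<bar>)) sequentially"
    using C outside
  proof eventually_elim
    case (elim k)
    show ?case
    proof (intro allI impI)
      fix j assume j: "j \<le> n k"
      have "\<bar>weight k j * g k j\<bar> \<le> K * exp (- \<tau> * \<bar>dev k j\<bar>)"
      proof (cases "real j / real (n k) \<in> J")
        case True
        have "\<bar>weight k j * g k j\<bar> = weight k j * \<bar>g k j\<bar>" using w0[of k j] by (simp add: abs_mult)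
        also have "\<dots> \<le> (\<bar>C\<bar> * exp (- \<kappa> * (dev k j)\<^sup>2)) * (\<bar>B\<bar> * exp (s * \<bar>dev k j\<bar>))"
        proof (intro mult_mono)
          have "weight k j \<le> C * exp (- \<kappa> * (dev k j)\<^sup>2)" using elim(1) j True by blast
          also have "\<dots> \<le> \<bar>C\<bar> * exp (- \<kappa> * (dev k j)\<^sup>2)" by (intro mult_right_mono) auto
          finally show "weight k j \<le> \<bar>C\<bar> * exp (- \<kappa> * (dev k j)\<^sup>2)" .
          have "B * exp (s * \<bar>dev k j\<bar>) \<le> \<bar>B\<bar> * exp (s * \<bar>dev k j\<bar>)" by (intro mult_right_mono) auto
          with bound[of k j] show "\<bar>g k j\<bar> \<le> \<bar>B\<bar> * exp (s * \<bar>dev k j\<bar>)" by linarith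
        qed auto
        also have "\<dots> = \<bar>C\<bar> * \<bar>B\<bar> * (exp (- \<kappa> * (dev k j)\<^sup>2) * exp (s * \<bar>dev k j\<bar>))" by simp
        also have "\<dots> \<le> \<bar>C\<bar> * \<bar>B\<bar> * (exp ((s + 1)\<^sup>2 / (4 * \<kappa>)) * exp (- \<bar>dev k j\<bar>))"
          by (intro mult_left_mono exp_gauss_le \<kappa>) auto
        also have "\<dots> = (\<bar>C\<bar> * \<bar>B\<bar> * exp ((s + 1)\<^sup>2 / (4 * \<kappa>))) * exp (- \<bar>dev k j\<bar>)" by simp
        also have "\<dots> \<le> K * exp (- \<tau> * \<bar>dev k j\<bar>)"
        proof (intro mult_mono)
          have "\<tau> * \<bar>dev k j\<bar> \<le> 1 * \<bar>dev k j\<bar>" using \<tau> by (intro mult_right_mono) auto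
          thus "exp (- \<bar>dev k j\<bar>) \<le> exp (- \<tau> * \<bar>dev k j\<bar>)" by simp
        qed (auto simp: K_def)
        finally show ?thesis .
      next
        case False
        hence "\<bar>weight k j * g k j\<bar> \<le> B' * exp (- \<tau> * \<bar>dev k j\<bar>)" using elim(2) j by blast
        also have "\<dots> \<le> K * exp (- \<tau> * \<bar>dev k j\<bar>)" by (intro mult_right_mono) (auto simp: K_def)
        finally show ?thesis .
      qed
      thus "\<bar>weight k j * g k j\<bar> \<le> K * exp (- \<tau> * \<bar>(real j - centre k) / scale k\<bar>)" by (simp add: dev_def)
    qed
  qed
  have conv': "(\<lambda>k. weight k (j k) * g k (j k)) \<longlonglongrightarrow> exp (c * y ^ p) * \<gamma> y"
    if "y \<notin> N" "(\<lambda>k. (real (j k) - centre k) / scale k) \<longlonglongrightarrow> y" for y j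
  proof -
    have "(\<lambda>k. dev k (j k)) \<longlonglongrightarrow> y" using that(2) by (simp add: dev_def)
    thus ?thesis by (intro tendsto_mult weight_tendsto conv that(1))
  qed
  have meas: "(\<lambda>y. exp (c * y ^ p) * \<gamma> y) \<in> borel_measurable borel" using \<gamma> by measurable
  show "(\<lambda>k. (\<Sum>j\<le>n k. weight k j * g k j) / scale k) \<longlonglongrightarrow> peak_integral p c \<gamma>"
    unfolding peak_integral_def
    by (rule lattice_dominated_convergence[OF scale_at_top centre_over_scale codim_over_scale \<tau>(1) dom conv' N meas])
qed

end

lemma peak_integral_pos:
  assumes int: "integrable lborel (\<lambda>y. exp (c * y ^ p) * f y)" and f: "\<And>y. f y > 0"
  shows "peak_integral p c f > 0"
proof -
  have "peak_integral p c f \<ge> 0" unfolding peak_integral_def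
    using f by (intro integral_nonneg_AE AE_I2 mult_nonneg_nonneg) (auto intro: less_imp_le)
  moreover have "peak_integral p c f \<noteq> 0"
  proof
    assume "peak_integral p c f = 0"
    hence "AE y in lborel. exp (c * y ^ p) * f y = 0"
      unfolding peak_integral_def using f
      by (subst (asm) integral_nonneg_eq_0_iff_AE[OF int]) (auto intro!: AE_I2 mult_nonneg_nonneg less_imp_le)
    hence "AE y::real in lborel. False"
      by eventually_elim (use f in \<open>metis exp_not_eq_zero less_irrefl mult_eq_0_iff\<close>)
    hence "(UNIV :: real set) \<in> null_sets lborel" by (subst AE_iff_null_sets) auto
    hence "emeasure lborel (UNIV :: real set) = 0" by (rule null_setsD1)
    thus False by simp
  qed
  ultimately show ?thesis by linarith
qed

lemma peak_integrable:
  fixes f :: "real \<Rightarrow> real"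
  assumes p: "even p" "p \<ge> 2" and c: "c < 0" and f: "f \<in> borel_measurable borel"
    and bound: "\<And>y. \<bar>f y\<bar> \<le> B * exp (s * \<bar>y\<bar>)"
  shows "integrable lborel (\<lambda>y. exp (c * y ^ p) * f y)"
proof (rule Bochner_Integration.integrable_bound)
  let ?K = "exp (- c) * \<bar>B\<bar> * exp ((s + 1)\<^sup>2 / (4 * - c))"
  have "integrable lborel (\<lambda>y. ?K * exp (- 1 * \<bar>y\<bar>))"
    by (intro integrable_mult_right integrable_exp_neg_abs) auto
  thus "integrable lborel (\<lambda>y. ?K * exp (- \<bar>y\<bar>))" by simp
  show "(\<lambda>y. exp (c * y ^ p) * f y) \<in> borel_measurable lborel" using f by measurable
  show "AE y in lborel. norm (exp (c * y ^ p) * f y) \<le> norm (?K * exp (- \<bar>y\<bar>))"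
  proof (rule AE_I2)
    fix y :: real
    have "c * y ^ p \<le> c * (y\<^sup>2 - 1)" using c power_even_ge_square[OF p, of y] by (intro mult_left_mono_neg) auto
    hence e: "exp (c * y ^ p) \<le> exp (- c) * exp (- (- c) * y\<^sup>2)"
      by (simp add: exp_add[symmetric] algebra_simps)
    have b: "\<bar>f y\<bar> \<le> \<bar>B\<bar> * exp (s * \<bar>y\<bar>)"
      by (rule order.trans[OF bound mult_right_mono]) auto
    have "norm (exp (c * y ^ p) * f y) = exp (c * y ^ p) * \<bar>f y\<bar>" by (simp add: abs_mult)
    also have "\<dots> \<le> (exp (- c) * exp (- (- c) * y\<^sup>2)) * (\<bar>B\<bar> * exp (s * \<bar>y\<bar>))"
      by (intro mult_mono e b) auto
    also have "\<dots> = (exp (- c) * \<bar>B\<bar>) * (exp (- (- c) * y\<^sup>2) * exp (s * \<bar>y\<bar>))" by simp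
    also have "\<dots> \<le> (exp (- c) * \<bar>B\<bar>) * (exp ((s + 1)\<^sup>2 / (4 * - c)) * exp (- \<bar>y\<bar>))"
      using c by (intro mult_left_mono exp_gauss_le) auto
    also have "\<dots> = norm (?K * exp (- \<bar>y\<bar>))" by (simp add: abs_mult)
    finally show "norm (exp (c * y ^ p) * f y) \<le> norm (?K * exp (- \<bar>y\<bar>))" .
  qed
qed

lemma exp_tilt_bounds:
  fixes t x :: real
  shows "\<bar>exp (2 * t * x)\<bar> \<le> 1 * exp ((2 * \<bar>t\<bar> + 1) * \<bar>x\<bar>)"
    and "\<bar>exp (2 * t * x) * x\<bar> \<le> 1 * exp ((2 * \<bar>t\<bar> + 1) * \<bar>x\<bar>)"
proof -
  have "t * x \<le> \<bar>t * x\<bar>" by simp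
  hence tx: "2 * t * x \<le> 2 * \<bar>t\<bar> * \<bar>x\<bar>" by (simp add: abs_mult)
  moreover have "(2 * \<bar>t\<bar> + 1) * \<bar>x\<bar> = 2 * \<bar>t\<bar> * \<bar>x\<bar> + \<bar>x\<bar>" by (simp add: algebra_simps)
  ultimately have "2 * t * x \<le> (2 * \<bar>t\<bar> + 1) * \<bar>x\<bar>" using abs_ge_zero[of x] by linarith
  thus "\<bar>exp (2 * t * x)\<bar> \<le> 1 * exp ((2 * \<bar>t\<bar> + 1) * \<bar>x\<bar>)" by simp
  have e: "\<bar>x\<bar> \<le> exp \<bar>x\<bar>" using exp_ge_add_one_self[of "\<bar>x\<bar>"] by linarith
  have "exp (2 * t * x) * \<bar>x\<bar> \<le> exp (2 * \<bar>t\<bar> * \<bar>x\<bar>) * exp \<bar>x\<bar>"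
    using tx e by (intro mult_mono) auto
  thus "\<bar>exp (2 * t * x) * x\<bar> \<le> 1 * exp ((2 * \<bar>t\<bar> + 1) * \<bar>x\<bar>)"
    by (simp add: abs_mult exp_add[symmetric] algebra_simps)
qed

lemma peak_integral_1_pos:
  assumes "even p" "p \<ge> 2" "c < 0"
  shows "peak_integral p c (\<lambda>y. 1) > 0"
  using peak_integral_pos[OF peak_integrable[OF assms, of "\<lambda>y. 1" 1 0]] by simp

lemma peak_tilt_integrable:
  fixes c t :: real
  assumes "even p" "p \<ge> 2" "c < 0"
  shows "integrable lborel (\<lambda>y. exp (c * y ^ p) * exp (2 * t * y))"
    and "integrable lborel (\<lambda>y. exp (c * y ^ p) * (exp (2 * t * y) * y))"
proof -
  show "integrable lborel (\<lambda>y. exp (c * y ^ p) * exp (2 * t * y))"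
  proof (rule peak_integrable[OF assms, of _ 1 "2 * \<bar>t\<bar> + 1"])
    show "\<bar>exp (2 * t * y)\<bar> \<le> 1 * exp ((2 * \<bar>t\<bar> + 1) * \<bar>y\<bar>)" for y by (rule exp_tilt_bounds(1))
  qed measurable
  show "integrable lborel (\<lambda>y. exp (c * y ^ p) * (exp (2 * t * y) * y))"
  proof (rule peak_integrable[OF assms, of _ 1 "2 * \<bar>t\<bar> + 1"])
    show "\<bar>exp (2 * t * y) * y\<bar> \<le> 1 * exp ((2 * \<bar>t\<bar> + 1) * \<bar>y\<bar>)" for y by (rule exp_tilt_bounds(2))
  qed measurable
qed

lemma peak_tilt_pos:
  assumes "even p" "p \<ge> 2" "c < 0"
  shows "peak_integral p c (\<lambda>y. exp (2 * t * y)) > 0"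
  by (rule peak_integral_pos[OF peak_tilt_integrable(1)[OF assms]]) simp

context peak_sequence
begin

text \<open>Since \<open>j = centre + scale * dev\<close>, the extra field \<open>t / scale\<close>
  contributes \<open>exp (2 * t * dev)\<close> and a factor that does not depend on
  \<open>j\<close>.\<close>

lemma level_weight_tilt:
  assumes "regular_graphs d (n k) \<noteq> {}" "n k > 0"
  shows "\<exists>u>0. \<forall>j. level_weight d \<beta> (h + t / scale k) (n k) j = u * (weight k j * exp (2 * t * dev k j))"
proof -
  have s: "scale k > 0" using scale_power[OF assms(2)] by simp
  have "centre k \<le> real (n k)" using a by (simp add: centre_def mult_left_le_one_le)
  hence "nat \<lfloor>centre k\<rfloor> \<le> n k" by linarith
  hence L: "level_weight d \<beta> h (n k) (nat \<lfloor>centre k\<rfloor>) > 0" using assms by (intro level_weight_pos) auto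
  define u where "u = level_weight d \<beta> h (n k) (nat \<lfloor>centre k\<rfloor>) * exp (2 * t * centre k / scale k)"
  have "level_weight d \<beta> (h + t / scale k) (n k) j = u * (weight k j * exp (2 * t * dev k j))" for j
  proof -
    have "2 * (h + t / scale k) * real j = 2 * h * real j + (2 * t * centre k / scale k + 2 * t * dev k j)"
      using s by (simp add: dev_def field_simps)
    hence "level_weight d \<beta> (h + t / scale k) (n k) j
       = level_weight d \<beta> h (n k) j * (exp (2 * t * centre k / scale k) * exp (2 * t * dev k j))"
      by (simp add: level_weight_def exp_add)
    thus ?thesis using L by (simp add: u_def weight_def)
  qed
  moreover have "u > 0" using L by (simp add: u_def)
  ultimately show ?thesis by blast
qed

lemma level_mean_dev:
  assumes "regular_graphs d (n k) \<noteq> {}" "n k > 0"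
  shows "(level_mean d \<beta> (h + t / scale k) (n k) - centre k) / scale k
     = (\<Sum>j\<le>n k. weight k j * (exp (2 * t * dev k j) * dev k j)) / (\<Sum>j\<le>n k. weight k j * exp (2 * t * dev k j))"
proof -
  have s: "scale k > 0" using scale_power[OF assms(2)] by simp
  obtain u where u: "u > 0" "\<And>j. level_weight d \<beta> (h + t / scale k) (n k) j = u * (weight k j * exp (2 * t * dev k j))"
    using level_weight_tilt[OF assms, of t] by blast
  let ?W = "\<Sum>j\<le>n k. weight k j * exp (2 * t * dev k j)"
  have PF: "partition_function d \<beta> (h + t / scale k) (n k) = u * ?W"
    unfolding partition_function_def u(2) by (simp only: sum_distrib_left)
  have W: "?W > 0" using partition_function_pos[OF assms(1), of \<beta> "h + t / scale k"] u(1) unfolding PF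
    by (simp add: zero_less_mult_iff)
  have "(\<Sum>j\<le>n k. level_weight d \<beta> (h + t / scale k) (n k) j * real j)
     = u * (centre k * ?W + scale k * (\<Sum>j\<le>n k. weight k j * (exp (2 * t * dev k j) * dev k j)))"
  proof -
    have "real j = centre k + scale k * dev k j" for j using s by (simp add: dev_def)
    hence "(\<Sum>j\<le>n k. level_weight d \<beta> (h + t / scale k) (n k) j * real j)
      = (\<Sum>j\<le>n k. u * (centre k * (weight k j * exp (2 * t * dev k j))
           + scale k * (weight k j * (exp (2 * t * dev k j) * dev k j))))"
      unfolding u(2) by (intro sum.cong refl) (simp add: algebra_simps)
    thus ?thesis by (simp only: sum_distrib_left[symmetric] sum.distrib)
  qed
  hence "level_mean d \<beta> (h + t / scale k) (n k)
     = centre k + scale k * ((\<Sum>j\<le>n k. weight k j * (exp (2 * t * dev k j) * dev k j)) / ?W)"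
    unfolding level_mean_def PF using u(1) W by (simp add: add_divide_distrib)
  thus ?thesis using s by simp
qed

lemma level_prob_weight:
  assumes "regular_graphs d (n k) \<noteq> {}" "n k > 0"
  shows "level_prob d \<beta> h (n k) Q = (\<Sum>j\<le>n k. weight k j * of_bool (Q j)) / (\<Sum>j\<le>n k. weight k j)"
proof -
  obtain u where u: "u > 0" "\<And>j. level_weight d \<beta> h (n k) j = u * weight k j"
    using level_weight_tilt[OF assms, of 0] by auto
  show ?thesis unfolding level_prob_def partition_function_def u(2) mult.assoc sum_distrib_left[symmetric]
    using u(1) by simp
qed

lemma ratio_tendsto:
  assumes "(\<lambda>k. f k / scale k) \<longlonglongrightarrow> x" "(\<lambda>k. g k / scale k) \<longlonglongrightarrow> y" "y \<noteq> 0"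
  shows "(\<lambda>k. f k / g k) \<longlonglongrightarrow> x / y"
proof -
  have "(\<lambda>k. (f k / scale k) / (g k / scale k)) \<longlonglongrightarrow> x / y" by (intro tendsto_divide assms)
  thus ?thesis
  proof (rule Lim_transform_eventually)
    show "eventually (\<lambda>k. (f k / scale k) / (g k / scale k) = f k / g k) sequentially"
      using eventually_nonempty
    proof eventually_elim
      case (elim k)
      hence "scale k > 0" using scale_power by auto
      thus ?case by simp
    qed
  qed
qed

text \<open>The bound \<open>outside\<close> is void for \<open>J = UNIV\<close>; for \<open>J = {1/2..}\<close> it holds if \<open>t > 0\<close>, as the
  tilt then suppresses the phase below \<open>1 / 2\<close>.\<close>

lemma level_mean_tendsto:
  assumes outside: "eventually (\<lambda>k. \<forall>j\<le>n k. real j / real (n k) \<notin> J \<longrightarrow>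
      weight k j * (exp (2 * t * dev k j) * (1 + \<bar>dev k j\<bar>)) \<le> B' * exp (- \<tau> * \<bar>dev k j\<bar>)) sequentially"
    and \<tau>: "0 < \<tau>" "\<tau> \<le> 1"
  shows "(\<lambda>k. (level_mean d \<beta> (h + t / scale k) (n k) - centre k) / scale k) \<longlonglongrightarrow> peak_mean p c t"
proof -
  have w0: "weight k j \<ge> 0" for k j unfolding weight_def by (intro divide_nonneg_nonneg level_weight_nonneg)
  have out0: "eventually (\<lambda>k. \<forall>j\<le>n k. real j / real (n k) \<notin> J \<longrightarrow>
      \<bar>weight k j * exp (2 * t * dev k j)\<bar> \<le> B' * exp (- \<tau> * \<bar>dev k j\<bar>)) sequentially"
    using outside
  proof eventually_elim
    case (elim k)
    have "weight k j * exp (2 * t * dev k j) \<le> weight k j * (exp (2 * t * dev k j) * (1 + \<bar>dev k j\<bar>))" for j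
      using w0 by (intro mult_left_mono) auto
    thus ?case using elim w0 by (fastforce simp: abs_mult intro: order.trans)
  qed
  have out1: "eventually (\<lambda>k. \<forall>j\<le>n k. real j / real (n k) \<notin> J \<longrightarrow>
      \<bar>weight k j * (exp (2 * t * dev k j) * dev k j)\<bar> \<le> B' * exp (- \<tau> * \<bar>dev k j\<bar>)) sequentially"
    using outside
  proof eventually_elim
    case (elim k)
    have "weight k j * (exp (2 * t * dev k j) * \<bar>dev k j\<bar>) \<le> weight k j * (exp (2 * t * dev k j) * (1 + \<bar>dev k j\<bar>))" for j
      using w0 by (intro mult_left_mono) auto
    thus ?case using elim w0 by (fastforce simp: abs_mult intro: order.trans)
  qed
  note W0 = weighted_sum_tendsto[where N = "{}" and B = 1 and s = "2 * \<bar>t\<bar> + 1"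
      and g = "\<lambda>k j. exp (2 * t * dev k j)" and \<gamma> = "\<lambda>y. exp (2 * t * y)", OF _ _ _ _ out0 \<tau>]
  note W1 = weighted_sum_tendsto[where N = "{}" and B = 1 and s = "2 * \<bar>t\<bar> + 1"
      and g = "\<lambda>k j. exp (2 * t * dev k j) * dev k j" and \<gamma> = "\<lambda>y. exp (2 * t * y) * y", OF _ _ _ _ out1 \<tau>]
  have L0: "(\<lambda>k. (\<Sum>j\<le>n k. weight k j * exp (2 * t * dev k j)) / scale k) \<longlonglongrightarrow> peak_integral p c (\<lambda>y. exp (2 * t * y))"
    by (rule W0) (use exp_tilt_bounds(1)[of t] in \<open>auto intro!: tendsto_intros\<close>)
  have L1: "(\<lambda>k. (\<Sum>j\<le>n k. weight k j * (exp (2 * t * dev k j) * dev k j)) / scale k) \<longlonglongrightarrow>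
       peak_integral p c (\<lambda>y. exp (2 * t * y) * y)"
    by (rule W1) (use exp_tilt_bounds(2)[of t] in \<open>auto intro!: tendsto_intros\<close>)
  have pos: "peak_integral p c (\<lambda>y. exp (2 * t * y)) \<noteq> 0"
    using peak_tilt_pos[OF p c, of t] by simp
  show "(\<lambda>k. (level_mean d \<beta> (h + t / scale k) (n k) - centre k) / scale k) \<longlonglongrightarrow> peak_mean p c t"
    unfolding peak_mean_def
    using ratio_tendsto[OF L1 L0 pos]
  proof (rule Lim_transform_eventually)
    show "eventually (\<lambda>k. (\<Sum>j\<le>n k. weight k j * (exp (2 * t * dev k j) * dev k j)) / (\<Sum>j\<le>n k. weight k j * exp (2 * t * dev k j))
        = (level_mean d \<beta> (h + t / scale k) (n k) - centre k) / scale k) sequentially"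
      using eventually_nonempty by eventually_elim (simp add: level_mean_dev)
  qed
qed

end

section \<open>The annealed measure and the estimator\<close>

definition plus_set :: "nat \<Rightarrow> (nat \<Rightarrow> real) \<Rightarrow> nat set" where
  "plus_set n \<omega> = {i. i < n \<and> \<omega> i = 1}"

lemma finite_spin_configs [simp]: "finite (spin_configs n)"
  unfolding spin_configs_def by (intro finite_PiE) auto

lemma bij_betw_plus_set: "bij_betw (plus_set n) (spin_configs n) (Pow {..<n})"
proof (rule bij_betwI[where g = "\<lambda>S. \<lambda>i\<in>{..<n}. if i \<in> S then 1 else -1"])
  show "plus_set n \<in> spin_configs n \<rightarrow> Pow {..<n}" by (auto simp: plus_set_def)
  show "(\<lambda>S. \<lambda>i\<in>{..<n}. if i \<in> S then 1 else -1) \<in> Pow {..<n} \<rightarrow> spin_configs n"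
    by (auto simp: spin_configs_def)
  show "(\<lambda>i\<in>{..<n}. if i \<in> plus_set n \<omega> then 1 else -1) = \<omega>" if "\<omega> \<in> spin_configs n" for \<omega>
  proof
    fix i
    have "i < n \<Longrightarrow> \<omega> i = 1 \<or> \<omega> i = -1" "\<not> i < n \<Longrightarrow> \<omega> i = undefined"
      using that by (auto simp: spin_configs_def PiE_def extensional_def Pi_def)
    thus "(\<lambda>i\<in>{..<n}. if i \<in> plus_set n \<omega> then 1 else -1) i = \<omega> i" by (auto simp: plus_set_def)
  qed
  show "plus_set n (\<lambda>i\<in>{..<n}. if i \<in> S then 1 else -1) = S" if "S \<in> Pow {..<n}" for S
    using that by (auto simp: plus_set_def)
qed

lemma spin_value:
  assumes "\<omega> \<in> spin_configs n" "i < n"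
  shows "\<omega> i = (if i \<in> plus_set n \<omega> then 1 else -1)"
  using assms by (auto simp: spin_configs_def PiE_def Pi_def plus_set_def)

lemma plus_set_subset: "plus_set n \<omega> \<subseteq> {..<n}" by (auto simp: plus_set_def)

lemma card_plus_set_le: "card (plus_set n \<omega>) \<le> n"
  using card_mono[OF _ plus_set_subset, of n \<omega>] by simp

lemma magnetization_eq:
  assumes "\<omega> \<in> spin_configs n"
  shows "magnetization n \<omega> = 2 * real (card (plus_set n \<omega>)) - real n"
proof -
  have "magnetization n \<omega> = (\<Sum>i<n. 2 * of_bool (i \<in> plus_set n \<omega>) - 1)"
    unfolding magnetization_def using spin_value[OF assms] by (intro sum.cong) auto
  also have "\<dots> = 2 * (\<Sum>i<n. of_bool (i \<in> plus_set n \<omega>)) - real n"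
    by (simp add: sum_subtractf sum_distrib_left)
  also have "(\<Sum>i<n. of_bool (i \<in> plus_set n \<omega>) :: real) = real (card (plus_set n \<omega>))"
  proof -
    have "{..<n} \<inter> {i. i \<in> plus_set n \<omega>} = plus_set n \<omega>" using plus_set_subset[of n \<omega>] by auto
    thus ?thesis by (simp add: sum_of_bool_eq)
  qed
  finally show ?thesis .
qed

lemma card_edges:
  assumes E: "E \<in> regular_graphs d n"
  shows "2 * real (card E) = real d * real n"
proof -
  have fin: "finite E" using E by (rule finite_regular_graph)
  have "real d * real n = (\<Sum>v<n. real (card {e \<in> E. v \<in> e}))"
    using E by (simp add: regular_graphs_def)
  also have "\<dots> = (\<Sum>v<n. \<Sum>e\<in>E. of_bool (v \<in> e))"
    using fin by (simp add: sum_of_bool_eq Int_def)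
  also have "\<dots> = (\<Sum>e\<in>E. \<Sum>v<n. of_bool (v \<in> e))" by (rule sum.swap)
  also have "\<dots> = (\<Sum>e\<in>E. 2)"
  proof (intro sum.cong refl)
    fix e assume e: "e \<in> E"
    hence "e \<subseteq> {..<n}" "card e = 2" using E by (auto simp: regular_graphs_def)
    hence "{..<n} \<inter> {v. v \<in> e} = e" by auto
    thus "(\<Sum>v<n. of_bool (v \<in> e)) = (2 :: real)" using \<open>card e = 2\<close> by (simp add: sum_of_bool_eq)
  qed
  finally show ?thesis by simp
qed

text \<open>The product of the two spins of an edge is -1 exactly if the edge is cut, and there are
  \<open>d n / 2\<close> edges.\<close>

lemma interaction_energy:
  assumes E: "E \<in> regular_graphs d n" and \<omega>: "\<omega> \<in> spin_configs n"
  shows "(\<Sum>e\<in>E. \<Prod>i\<in>e. \<omega> i) = real d * real n / 2 - 2 * real (cut_size (plus_set n \<omega>) E)"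
proof -
  let ?S = "plus_set n \<omega>"
  have fin: "finite E" using E by (rule finite_regular_graph)
  have "(\<Sum>e\<in>E. \<Prod>i\<in>e. \<omega> i) = (\<Sum>e\<in>E. 1 - 2 * of_bool (card (e \<inter> ?S) = 1))"
  proof (intro sum.cong refl)
    fix e assume "e \<in> E"
    then obtain v u where e: "e = {v, u}" "v < n" "u < n" "v \<noteq> u" using regular_graph_edge_ex[OF E] by blast
    have "(\<Prod>i\<in>e. \<omega> i) = \<omega> v * \<omega> u" using e by simp
    thus "(\<Prod>i\<in>e. \<omega> i) = 1 - 2 * of_bool (card (e \<inter> ?S) = 1)"
      unfolding e(1) card_doubleton_Int_eq_1[OF e(4)] using spin_value[OF \<omega>] e by auto
  qed
  also have "\<dots> = real (card E) - 2 * (\<Sum>e\<in>E. of_bool (card (e \<inter> ?S) = 1))"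
    by (simp only: sum_subtractf sum_distrib_left) simp
  also have "(\<Sum>e\<in>E. of_bool (card (e \<inter> ?S) = 1)) = real (cut_size ?S E)"
    unfolding cut_size_def using fin by (simp add: sum_of_bool_eq Int_def)
  finally show ?thesis using card_edges[OF E] by simp
qed

lemma annealed_weight_eq:
  assumes ne: "regular_graphs d n \<noteq> {}" and \<omega>: "\<omega> \<in> spin_configs n"
  shows "annealed_weight d \<beta> h n \<omega> =
     exp (\<beta> * real d * real n / 2 - h * real n) / real (card (regular_graphs d n))
       * (exp (2 * h * real (card (plus_set n \<omega>))) * cut_sum d n (exp (-2 * \<beta>)) (plus_set n \<omega>))"
proof -
  let ?R = "regular_graphs d n" and ?S = "plus_set n \<omega>"
  have "annealed_weight d \<beta> h n \<omega> = (\<Sum>E\<in>?R. exp (\<beta> * (\<Sum>e\<in>E. \<Prod>i\<in>e. \<omega> i) + h * magnetization n \<omega>)) / real (card ?R)"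
    unfolding annealed_weight_def using ne by (intro integral_pmf_of_set) auto
  also have "(\<Sum>E\<in>?R. exp (\<beta> * (\<Sum>e\<in>E. \<Prod>i\<in>e. \<omega> i) + h * magnetization n \<omega>))
      = (\<Sum>E\<in>?R. exp (\<beta> * real d * real n / 2 - h * real n) * (exp (2 * h * real (card ?S)) * cut_weight (exp (-2 * \<beta>)) ?S E))"
  proof (intro sum.cong refl)
    fix E assume E: "E \<in> ?R"
    have "cut_weight (exp (-2 * \<beta>)) ?S E = exp (-2 * \<beta> * real (cut_size ?S E))"
      by (simp add: cut_weight_def exp_of_nat_mult[symmetric] mult.commute)
    moreover have "\<beta> * (\<Sum>e\<in>E. \<Prod>i\<in>e. \<omega> i) + h * magnetization n \<omega>
       = (\<beta> * real d * real n / 2 - h * real n) + (2 * h * real (card ?S) + -2 * \<beta> * real (cut_size ?S E))"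
      unfolding interaction_energy[OF E \<omega>] magnetization_eq[OF \<omega>] by (simp add: algebra_simps)
    ultimately show "exp (\<beta> * (\<Sum>e\<in>E. \<Prod>i\<in>e. \<omega> i) + h * magnetization n \<omega>)
       = exp (\<beta> * real d * real n / 2 - h * real n) * (exp (2 * h * real (card ?S)) * cut_weight (exp (-2 * \<beta>)) ?S E)"
      by (simp only: exp_add)
  qed
  finally show ?thesis
    unfolding cut_sum_def by (simp only: sum_distrib_left[symmetric] times_divide_eq_left)
qed

lemma sum_spin_configs_levels:
  fixes f :: "nat set \<Rightarrow> real" and q :: "nat \<Rightarrow> real"
  shows "(\<Sum>\<omega>\<in>spin_configs n. q (card (plus_set n \<omega>)) * f (plus_set n \<omega>)) = (\<Sum>j\<le>n. q j * (\<Sum>S\<in>plus_sets n j. f S))"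
proof -
  have "(\<Sum>\<omega>\<in>spin_configs n. q (card (plus_set n \<omega>)) * f (plus_set n \<omega>)) = (\<Sum>S\<in>Pow {..<n}. q (card S) * f S)"
    using sum.reindex_bij_betw[OF bij_betw_plus_set, of "\<lambda>S. q (card S) * f S" n] by simp
  also have "\<dots> = (\<Sum>j\<le>n. \<Sum>S\<in>{S \<in> Pow {..<n}. card S = j}. q (card S) * f S)"
  proof (rule sum.group[symmetric])
    show "card ` Pow {..<n} \<subseteq> {..n}" using card_mono[of "{..<n}"] by fastforce
  qed auto
  also have "\<dots> = (\<Sum>j\<le>n. \<Sum>S\<in>plus_sets n j. q j * f S)"
    by (intro sum.cong) (auto simp: plus_sets_def)
  finally show ?thesis by (simp only: sum_distrib_left)
qed

lemma annealed_density:
  assumes ne: "regular_graphs d n \<noteq> {}" and \<omega>: "\<omega> \<in> spin_configs n"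
  shows "annealed_weight d \<beta> h n \<omega> / (\<Sum>\<omega>'\<in>spin_configs n. annealed_weight d \<beta> h n \<omega>')
    = exp (2 * h * real (card (plus_set n \<omega>))) * cut_sum d n (exp (-2 * \<beta>)) (plus_set n \<omega>) / partition_function d \<beta> h n"
proof -
  define K where "K = exp (\<beta> * real d * real n / 2 - h * real n) / real (card (regular_graphs d n))"
  have "K > 0" unfolding K_def using ne by (simp add: card_gt_0_iff)
  have "(\<Sum>\<omega>'\<in>spin_configs n. annealed_weight d \<beta> h n \<omega>')
     = K * (\<Sum>\<omega>'\<in>spin_configs n. exp (2 * h * real (card (plus_set n \<omega>'))) * cut_sum d n (exp (-2 * \<beta>)) (plus_set n \<omega>'))"
    unfolding sum_distrib_left K_def by (intro sum.cong refl annealed_weight_eq[OF ne])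
  also have "(\<Sum>\<omega>'\<in>spin_configs n. exp (2 * h * real (card (plus_set n \<omega>'))) * cut_sum d n (exp (-2 * \<beta>)) (plus_set n \<omega>'))
     = partition_function d \<beta> h n"
    unfolding sum_spin_configs_levels[of "\<lambda>j. exp (2 * h * real j)"] partition_function_def level_weight_def
      partition_sum_def by (simp add: mult.commute)
  finally show ?thesis
    unfolding annealed_weight_eq[OF ne \<omega>] K_def[symmetric] using \<open>K > 0\<close> by simp
qed

lemma annealed_ising_measure:
  assumes ne: "regular_graphs d n \<noteq> {}"
  shows "measure (annealed_ising d \<beta> h n) {\<omega> \<in> spin_configs n. Q (card (plus_set n \<omega>))} = level_prob d \<beta> h n Q"
proof -
  let ?D = "\<lambda>\<omega>. annealed_weight d \<beta> h n \<omega> / (\<Sum>\<omega>'\<in>spin_configs n. annealed_weight d \<beta> h n \<omega>')"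
  let ?f = "\<lambda>\<omega>. exp (2 * h * real (card (plus_set n \<omega>))) * cut_sum d n (exp (-2 * \<beta>)) (plus_set n \<omega>) / partition_function d \<beta> h n"
  have D: "?D \<omega> = ?f \<omega>" if "\<omega> \<in> spin_configs n" for \<omega> using that by (rule annealed_density[OF ne])
  have "?D \<omega> \<ge> 0" if "\<omega> \<in> spin_configs n" for \<omega>
    unfolding D[OF that] using partition_function_pos[OF ne, of \<beta> h]
    by (intro divide_nonneg_pos mult_nonneg_nonneg cut_sum_nonneg) auto
  hence "measure (annealed_ising d \<beta> h n) {\<omega> \<in> spin_configs n. Q (card (plus_set n \<omega>))}
     = (\<Sum>\<omega>\<in>{\<omega> \<in> spin_configs n. Q (card (plus_set n \<omega>))}. ?D \<omega>)"
    unfolding annealed_ising_def by (subst measure_point_measure_finite_if) auto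
  also have "\<dots> = (\<Sum>\<omega>\<in>{\<omega> \<in> spin_configs n. Q (card (plus_set n \<omega>))}. ?f \<omega>)"
    by (intro sum.cong refl D) auto
  also have "\<dots> = (\<Sum>\<omega>\<in>spin_configs n. (exp (2 * h * real (card (plus_set n \<omega>))) * of_bool (Q (card (plus_set n \<omega>)))
        / partition_function d \<beta> h n) * cut_sum d n (exp (-2 * \<beta>)) (plus_set n \<omega>))"
    by (intro sum.mono_neutral_cong_left) auto
  also have "\<dots> = level_prob d \<beta> h n Q"
    unfolding sum_spin_configs_levels[of "\<lambda>j. exp (2 * h * real j) * of_bool (Q j) / partition_function d \<beta> h n"]
      level_prob_def level_weight_def partition_sum_def sum_divide_distrib
    by (intro sum.cong) auto
  finally show ?thesis .
qed

lemma annealed_ising_mean: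
  assumes ne: "regular_graphs d n \<noteq> {}"
  shows "(LINT \<omega>|annealed_ising d \<beta> h n. magnetization n \<omega>) = 2 * level_mean d \<beta> h n - real n"
proof -
  let ?D = "\<lambda>\<omega>. annealed_weight d \<beta> h n \<omega> / (\<Sum>\<omega>'\<in>spin_configs n. annealed_weight d \<beta> h n \<omega>')"
  let ?f = "\<lambda>\<omega>. exp (2 * h * real (card (plus_set n \<omega>))) * cut_sum d n (exp (-2 * \<beta>)) (plus_set n \<omega>) / partition_function d \<beta> h n"
  have PF: "partition_function d \<beta> h n > 0" using ne by (rule partition_function_pos)
  have D: "?D \<omega> = ?f \<omega>" if "\<omega> \<in> spin_configs n" for \<omega> using that by (rule annealed_density[OF ne])
  have "?D \<omega> \<ge> 0" if "\<omega> \<in> spin_configs n" for \<omega>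
    unfolding D[OF that] using PF by (intro divide_nonneg_pos mult_nonneg_nonneg cut_sum_nonneg) auto
  hence "(LINT \<omega>|annealed_ising d \<beta> h n. magnetization n \<omega>) = (\<Sum>\<omega>\<in>spin_configs n. ?D \<omega> * magnetization n \<omega>)"
    unfolding annealed_ising_def by (subst lebesgue_integral_point_measure_finite) auto
  also have "\<dots> = (\<Sum>\<omega>\<in>spin_configs n. (exp (2 * h * real (card (plus_set n \<omega>))) * (2 * real (card (plus_set n \<omega>)) - real n)
        / partition_function d \<beta> h n) * cut_sum d n (exp (-2 * \<beta>)) (plus_set n \<omega>))"
    by (intro sum.cong refl) (simp add: D magnetization_eq)
  also have "\<dots> = (\<Sum>j\<le>n. level_weight d \<beta> h n j * (2 * real j - real n)) / partition_function d \<beta> h n"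
    unfolding sum_spin_configs_levels[of "\<lambda>j. exp (2 * h * real j) * (2 * real j - real n) / partition_function d \<beta> h n"]
      level_weight_def partition_sum_def sum_divide_distrib
    by (intro sum.cong) auto
  also have "(\<Sum>j\<le>n. level_weight d \<beta> h n j * (2 * real j - real n))
     = 2 * (\<Sum>j\<le>n. level_weight d \<beta> h n j * real j) - real n * partition_function d \<beta> h n"
    unfolding partition_function_def sum_distrib_left sum_subtractf[symmetric]
    by (intro sum.cong) (auto simp: algebra_simps)
  finally show ?thesis using PF by (simp add: level_mean_def diff_divide_distrib)
qed

text \<open>\<open>score\<close> has the sign of \<open>level_mean - i\<close> and every summand is monotone in \<open>x\<close>.\<close>

definition score :: "nat \<Rightarrow> real \<Rightarrow> nat \<Rightarrow> nat \<Rightarrow> real \<Rightarrow> real" where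
  "score d \<beta> n i x = (\<Sum>j\<le>n. partition_sum d n (exp (-2 * \<beta>)) j * ((real j - real i) * exp (2 * x * (real j - real i))))"

lemma level_mean_score:
  assumes ne: "regular_graphs d n \<noteq> {}"
  shows "level_mean d \<beta> x n - real i = exp (2 * x * real i) / partition_function d \<beta> x n * score d \<beta> n i x"
proof -
  have PF: "partition_function d \<beta> x n > 0" using ne by (rule partition_function_pos)
  have "(\<Sum>j\<le>n. level_weight d \<beta> x n j * real j) - real i * partition_function d \<beta> x n
     = (\<Sum>j\<le>n. level_weight d \<beta> x n j * (real j - real i))"
    unfolding partition_function_def sum_distrib_left sum_subtractf[symmetric]
    by (intro sum.cong) (auto simp: algebra_simps)
  also have "\<dots> = exp (2 * x * real i) * score d \<beta> n i x"
    unfolding score_def sum_distrib_left level_weight_def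
  proof (intro sum.cong refl)
    fix j
    have "2 * x * real j = 2 * x * real i + 2 * x * (real j - real i)" by (simp add: algebra_simps)
    hence "exp (2 * x * real j) = exp (2 * x * real i) * exp (2 * x * (real j - real i))"
      by (simp only: exp_add)
    thus "partition_sum d n (exp (-2 * \<beta>)) j * exp (2 * x * real j) * (real j - real i)
      = exp (2 * x * real i) * (partition_sum d n (exp (-2 * \<beta>)) j * ((real j - real i) * exp (2 * x * (real j - real i))))"
      by simp
  qed
  finally show ?thesis using PF by (simp add: level_mean_def field_simps)
qed

lemma score_strict_mono:
  assumes ne: "regular_graphs d n \<noteq> {}" and n: "n > 0" and xy: "x < y"
  shows "score d \<beta> n i x < score d \<beta> n i y"
proof -
  let ?Z = "partition_sum d n (exp (-2 * \<beta>))"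
  have Z: "?Z j > 0" if "j \<le> n" for j using ne that by (intro partition_sum_pos) auto
  have lt: "t * exp (2 * x * t) < t * exp (2 * y * t)" if "t \<noteq> 0" for t :: real
  proof (cases "t > 0")
    case True
    hence "exp (2 * x * t) < exp (2 * y * t)" using xy by simp
    thus ?thesis using True by simp
  next
    case False
    hence t: "t < 0" using that by simp
    hence "exp (2 * y * t) < exp (2 * x * t)" using xy by simp
    thus ?thesis using t by (simp add: mult_less_cancel_left)
  qed
  have le: "t * exp (2 * x * t) \<le> t * exp (2 * y * t)" for t :: real
    using lt[of t] by (cases "t = 0") (auto intro: less_imp_le)
  have "\<exists>j\<le>n. real j - real i \<noteq> 0" using n by (cases "i = 0") (auto intro: exI[of _ n] exI[of _ 0])
  then obtain j where j: "j \<le> n" "real j - real i \<noteq> 0" by blast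
  show ?thesis unfolding score_def
  proof (rule sum_strict_mono_ex1)
    show "\<forall>j\<in>{..n}. ?Z j * ((real j - real i) * exp (2 * x * (real j - real i)))
        \<le> ?Z j * ((real j - real i) * exp (2 * y * (real j - real i)))"
      using Z le by (auto intro!: mult_left_mono less_imp_le)
    show "\<exists>j\<in>{..n}. ?Z j * ((real j - real i) * exp (2 * x * (real j - real i)))
        < ?Z j * ((real j - real i) * exp (2 * y * (real j - real i)))"
      using j Z[OF j(1)] lt[OF j(2)] by (intro bexI[of _ j]) auto
  qed simp
qed

lemma sum_reflect: "(\<Sum>j\<le>n. f (n - j)) = (\<Sum>j\<le>(n::nat). f j :: real)"
  by (rule sum.reindex_bij_witness[of _ "\<lambda>j. n - j" "\<lambda>j. n - j"]) auto

lemma score_reflect: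
  assumes "i \<le> n"
  shows "score d \<beta> n i (- x) = - score d \<beta> n (n - i) x"
proof -
  let ?Z = "partition_sum d n (exp (-2 * \<beta>))"
  have neg: "z * (- t * exp (2 * - x * - t)) = - (z * (t * exp (2 * x * t)))" for z t :: real by simp
  have "score d \<beta> n i (- x) = (\<Sum>j\<le>n. ?Z (n - j) * ((real (n - j) - real i) * exp (2 * - x * (real (n - j) - real i))))"
    unfolding score_def by (rule sum_reflect[symmetric])
  also have "\<dots> = (\<Sum>j\<le>n. - (?Z j * ((real j - real (n - i)) * exp (2 * x * (real j - real (n - i))))))"
  proof (intro sum.cong refl)
    fix j assume "j \<in> {..n}"
    hence j: "j \<le> n" by simp
    have e: "real (n - j) - real i = - (real j - real (n - i))" using j assms by (simp add: of_nat_diff)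
    show "?Z (n - j) * ((real (n - j) - real i) * exp (2 * - x * (real (n - j) - real i)))
      = - (?Z j * ((real j - real (n - i)) * exp (2 * x * (real j - real (n - i)))))"
      unfolding e partition_sum_reflect[OF j] by (rule neg)
  qed
  finally show ?thesis by (simp add: score_def sum_negf)
qed

text \<open>For \<open>x \<ge> 0\<close> the terms with \<open>j < i\<close> are bounded below,
  while the top level contributes at least \<open>exp (2 * x)\<close> times its partition sum,
  because \<open>n - i \<ge> 1\<close>.\<close>

lemma score_nonneg_ex:
  assumes ne: "regular_graphs d n \<noteq> {}" and i: "i < n"
  shows "\<exists>x\<ge>0. 0 \<le> score d \<beta> n i x"
proof -
  let ?Z = "partition_sum d n (exp (-2 * \<beta>))"
  have Z: "?Z j > 0" if "j \<le> n" for j using ne that by (intro partition_sum_pos) auto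
  define B where "B = (\<Sum>j\<le>n. ?Z j * \<bar>real j - real i\<bar>)"
  have "B \<ge> 0" unfolding B_def using Z by (intro sum_nonneg mult_nonneg_nonneg) (auto intro: less_imp_le)
  \<comment> \<open>Large enough because \<open>x \<le> exp (2 * x)\<close>, so that the top term is
    at least \<open>B\<close>.\<close>
  define x where "x = B / ?Z n"
  have x: "x \<ge> 0" using \<open>B \<ge> 0\<close> Z[of n] by (simp add: x_def)
  have "?Z n * exp (2 * x) - B
      = (\<Sum>j\<le>n. (if j = n then ?Z n * exp (2 * x) else 0) - ?Z j * \<bar>real j - real i\<bar>)"
    by (simp add: sum_subtractf B_def sum.delta')
  also have "\<dots> \<le> score d \<beta> n i x" unfolding score_def
  proof (rule sum_mono)
    fix j assume "j \<in> {..n}"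
    hence Zj: "?Z j > 0" by (intro Z) auto
    show "(if j = n then ?Z n * exp (2 * x) else 0) - ?Z j * \<bar>real j - real i\<bar>
      \<le> ?Z j * ((real j - real i) * exp (2 * x * (real j - real i)))"
    proof (cases "j = n")
      case True
      have t: "real n - real i \<ge> 1" using i by simp
      hence "x * 1 \<le> x * (real n - real i)" using x by (intro mult_left_mono) auto
      hence "1 * exp (2 * x) \<le> (real n - real i) * exp (2 * x * (real n - real i))" using t by (intro mult_mono) auto
      hence "?Z n * exp (2 * x) \<le> ?Z n * ((real n - real i) * exp (2 * x * (real n - real i)))"
        using Z[of n] by (intro mult_left_mono) auto
      moreover have "?Z j * \<bar>real j - real i\<bar> \<ge> 0" using Zj by simp
      ultimately show ?thesis using True by simp
    next
      case False
      have "- \<bar>t\<bar> \<le> t * exp (2 * x * t)" for t :: real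
      proof (cases "t \<ge> 0")
        case False
        hence "exp (2 * x * t) \<le> 1" using x by (simp add: mult_nonneg_nonpos)
        hence "t * 1 \<le> t * exp (2 * x * t)" using False by (intro mult_left_mono_neg) auto
        thus ?thesis using False by simp
      qed (simp add: order.trans[of _ 0])
      hence "?Z j * - \<bar>real j - real i\<bar> \<le> ?Z j * ((real j - real i) * exp (2 * x * (real j - real i)))"
        using Zj by (intro mult_left_mono) auto
      thus ?thesis using False by simp
    qed
  qed
  finally have "?Z n * exp (2 * x) - B \<le> score d \<beta> n i x" .
  moreover have "B \<le> ?Z n * exp (2 * x)"
  proof -
    have "x \<le> exp (2 * x)" using exp_ge_add_one_self[of "2 * x"] x by linarith
    thus ?thesis using Z[of n] by (simp add: x_def pos_divide_le_eq mult.commute)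
  qed
  ultimately show ?thesis using x by (intro exI[of _ x]) linarith
qed

text \<open>\<open>score_reflect\<close> turns a nonnegative value at the level \<open>n - i\<close>
  into a nonpositive one at the level \<open>i\<close>, and the intermediate value theorem applies.
  At the levels 0 and \<open>n\<close> the score has constant sign.\<close>

lemma score_zero_ex:
  assumes ne: "regular_graphs d n \<noteq> {}" and i: "0 < i" "i < n"
  shows "\<exists>x. score d \<beta> n i x = 0"
proof -
  obtain x where x: "x \<ge> 0" "0 \<le> score d \<beta> n i x" using score_nonneg_ex[OF ne i(2)] by blast
  have "n - i < n" using i by simp
  from score_nonneg_ex[OF ne this] obtain y where y: "y \<ge> 0" "0 \<le> score d \<beta> n (n - i) y" by blast
  have neg: "score d \<beta> n i (- y) \<le> 0" using y score_reflect[of i n d \<beta> y] i by simp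
  have "continuous_on {- y..x} (score d \<beta> n i)"
    unfolding score_def[abs_def] by (intro continuous_intros)
  from IVT'[of "score d \<beta> n i" "- y" 0 x, OF neg x(2) _ this] x y show ?thesis by auto
qed

text \<open>Away from the constant configurations the likelihood equation has exactly one root, so
  the definite description denotes it. As the score increases, the root is at most \<open>x\<close>
  if and only if the score at \<open>x\<close> is nonnegative.\<close>

lemma mle_le_iff:
  assumes ne: "regular_graphs d n \<noteq> {}" and \<omega>: "\<omega> \<in> spin_configs n"
    and i: "0 < card (plus_set n \<omega>)" "card (plus_set n \<omega>) < n"
  shows "mle d \<beta> n \<omega> \<le> x \<longleftrightarrow> real (card (plus_set n \<omega>)) \<le> level_mean d \<beta> x n"
proof -
  let ?i = "card (plus_set n \<omega>)"
  have n: "n > 0" using i by simp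
  have lm: "level_mean d \<beta> x n = real ?i \<longleftrightarrow> score d \<beta> n ?i x = 0"
           "real ?i \<le> level_mean d \<beta> x n \<longleftrightarrow> 0 \<le> score d \<beta> n ?i x" for x
  proof -
    have q: "exp (2 * x * real ?i) / partition_function d \<beta> x n > 0"
      using partition_function_pos[OF ne] by simp
    have gen: "(y = i \<longleftrightarrow> s = 0) \<and> (i \<le> y \<longleftrightarrow> 0 \<le> s)" if "y - i = r * s" "r > 0" for y i r s :: real
    proof -
      have "y = i \<longleftrightarrow> r * s = 0" "i \<le> y \<longleftrightarrow> 0 \<le> r * s" using that(1) by linarith+
      thus ?thesis using that(2) by (auto simp: zero_le_mult_iff)
    qed
    from gen[OF level_mean_score[OF ne] q]
    show "level_mean d \<beta> x n = real ?i \<longleftrightarrow> score d \<beta> n ?i x = 0"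
      "real ?i \<le> level_mean d \<beta> x n \<longleftrightarrow> 0 \<le> score d \<beta> n ?i x" by blast+
  qed
  obtain x0 where x0: "score d \<beta> n ?i x0 = 0" using score_zero_ex[OF ne i] by blast
  have mle: "mle d \<beta> n \<omega> = x0"
    unfolding mle_def annealed_ising_mean[OF ne] magnetization_eq[OF \<omega>]
  proof (rule the_equality)
    show "2 * level_mean d \<beta> x0 n - real n = 2 * real ?i - real n" using x0 lm(1)[of x0] by simp
    fix x assume "2 * level_mean d \<beta> x n - real n = 2 * real ?i - real n"
    hence "score d \<beta> n ?i x = 0" using lm(1)[of x] by simp
    thus "x = x0" using score_strict_mono[OF ne n, of x x0 \<beta> ?i] score_strict_mono[OF ne n, of x0 x \<beta> ?i] x0
      by (cases x x0 rule: linorder_cases) auto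
  qed
  show ?thesis unfolding mle lm(2)
    using score_strict_mono[OF ne n, of x x0 \<beta> ?i] score_strict_mono[OF ne n, of x0 x \<beta> ?i] x0
    by (cases x x0 rule: linorder_cases) auto
qed

text \<open>A constant configuration can be flipped at \<open>n\<close> vertices, each flip costing
  at most a factor \<open>exp (-2 * \<beta>) ^ d\<close> and the field. So the levels 0 and
  \<open>n\<close> carry at most order \<open>1 / n\<close> of the weight of the levels next to
  them.\<close>

lemma level_prob_ends:
  assumes ne: "regular_graphs d n \<noteq> {}" and n: "n \<ge> 1" and \<beta>: "\<beta> > 0"
  shows "level_prob d \<beta> h n (\<lambda>j. j = 0 \<or> j = n) \<le> 2 * exp (2 * \<bar>h\<bar>) / (exp (-2 * \<beta>) ^ d * real n)"
proof -
  let ?b = "exp (-2 * \<beta>)" and ?Z = "partition_sum d n (exp (-2 * \<beta>))" and ?L = "level_weight d \<beta> h n"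
  have b: "0 < ?b" "?b \<le> 1" using \<beta> by auto
  have PF: "partition_function d \<beta> h n > 0" using ne by (rule partition_function_pos)
  have L0: "?L j \<ge> 0" for j by (rule level_weight_nonneg)
  have LPF: "?L j \<le> partition_function d \<beta> h n" if "j \<le> n" for j
    unfolding partition_function_def using that L0 by (intro member_le_sum) auto
  define q where "q = exp (2 * \<bar>h\<bar>) / (?b ^ d * real n)"
  have bn: "?b ^ d * real n > 0" using n by simp
  have Z01: "real n * ?b ^ d * ?Z 0 \<le> ?Z 1" using partition_sum_Suc_ge[OF b, of 0 n d] by simp
  have Z0: "?Z 0 \<ge> 0" "?Z 1 \<ge> 0" by (auto intro: partition_sum_nonneg)
  have key: "?Z 0 * exp x \<le> q * (?Z 1 * exp y)" if "x - y \<le> 2 * \<bar>h\<bar>" for x y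
  proof -
    have "(?b ^ d * real n) * (?Z 0 * exp x) = (real n * ?b ^ d * ?Z 0) * exp x" by simp
    also have "\<dots> \<le> ?Z 1 * (exp (2 * \<bar>h\<bar>) * exp y)"
      using that Z01 Z0 by (intro mult_mono) (auto simp: exp_add[symmetric])
    finally have "(?Z 0 * exp x) * (?b ^ d * real n) \<le> exp (2 * \<bar>h\<bar>) * (?Z 1 * exp y)" by (simp add: mult_ac)
    hence "?Z 0 * exp x \<le> exp (2 * \<bar>h\<bar>) * (?Z 1 * exp y) / (?b ^ d * real n)"
      by (rule mult_imp_le_div_pos[OF bn])
    thus ?thesis by (simp add: q_def)
  qed
  have q0: "q \<ge> 0" using bn by (simp add: q_def)
  have h0: "?L 0 \<le> q * partition_function d \<beta> h n"
  proof -
    have "?L 0 \<le> q * ?L 1" unfolding level_weight_def by (rule key) simp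
    also have "\<dots> \<le> q * partition_function d \<beta> h n" using n q0 by (intro mult_left_mono LPF) auto
    finally show ?thesis .
  qed
  have hn: "?L n \<le> q * partition_function d \<beta> h n"
  proof -
    have Zn: "?Z n = ?Z 0" using partition_sum_reflect[of 0 n d ?b] by simp
    have Zn1: "?Z (n - 1) = ?Z 1" using n by (intro partition_sum_reflect) auto
    have "2 * h * real n - 2 * h * real (n - 1) \<le> 2 * \<bar>h\<bar>" using n by (simp add: of_nat_diff algebra_simps)
    hence "?L n \<le> q * ?L (n - 1)" unfolding level_weight_def Zn Zn1 by (rule key)
    also have "\<dots> \<le> q * partition_function d \<beta> h n" using q0 by (intro mult_left_mono LPF) auto
    finally show ?thesis .
  qed
  have "(\<Sum>j\<le>n. ?L j * of_bool (j = 0 \<or> j = n)) = (\<Sum>j\<in>{0, n}. ?L j)"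
    by (intro sum.mono_neutral_cong_right) auto
  also have "\<dots> = ?L 0 + ?L n" using n by simp
  also have "\<dots> \<le> 2 * q * partition_function d \<beta> h n" using h0 hn by simp
  finally have "level_prob d \<beta> h n (\<lambda>j. j = 0 \<or> j = n) \<le> 2 * q"
    unfolding level_prob_def using PF by (simp add: pos_divide_le_eq)
  thus ?thesis by (simp add: q_def)
qed

lemma level_prob_mono:
  assumes "regular_graphs d n \<noteq> {}" "\<And>j. j \<le> n \<Longrightarrow> P j \<Longrightarrow> Q j"
  shows "level_prob d \<beta> h n P \<le> level_prob d \<beta> h n Q"
  unfolding level_prob_def using partition_function_pos[OF assms(1), of \<beta> h] assms(2)
  by (intro divide_right_mono sum_mono mult_left_mono level_weight_nonneg) (auto simp: of_bool_def)

lemma level_prob_add: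
  assumes "\<And>j. j \<le> n \<Longrightarrow> \<not> (P j \<and> Q j)"
  shows "level_prob d \<beta> h n (\<lambda>j. P j \<or> Q j) = level_prob d \<beta> h n P + level_prob d \<beta> h n Q"
  unfolding level_prob_def add_divide_distrib[symmetric] sum.distrib[symmetric]
  using assms by (intro arg_cong2[where f = "(/)"] sum.cong) (auto simp: of_bool_def)

lemma level_prob_UNIV: "regular_graphs d n \<noteq> {} \<Longrightarrow> level_prob d \<beta> h n (\<lambda>j. True) = 1"
  using partition_function_pos[of d n \<beta> h] by (simp add: level_prob_def partition_function_def)

text \<open>The error comes from the two constant configurations, for which the estimator is unspecified.\<close>

lemma mle_cdf_estimate:
  assumes ne: "regular_graphs d n \<noteq> {}" and n: "n \<ge> 1" and s: "s > 0"
  shows "\<bar>cdf (distr (annealed_ising d \<beta> h n) borel (\<lambda>\<omega>. s * (mle d \<beta> n \<omega> - h))) t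
           - level_prob d \<beta> h n (\<lambda>j. real j \<le> level_mean d \<beta> (h + t / s) n)\<bar>
       \<le> level_prob d \<beta> h n (\<lambda>j. j = 0 \<or> j = n)"
proof -
  let ?M = "annealed_ising d \<beta> h n" and ?m = "level_mean d \<beta> (h + t / s) n" and ?c = "\<lambda>\<omega>. card (plus_set n \<omega>)"
  let ?P = "level_prob d \<beta> h n"
  define A where "A = {\<omega> \<in> spin_configs n. s * (mle d \<beta> n \<omega> - h) \<le> t}"
  have sp: "space ?M = spin_configs n" "sets ?M = Pow (spin_configs n)"
    by (simp_all add: annealed_ising_def space_point_measure sets_point_measure)
  have "cdf (distr ?M borel (\<lambda>\<omega>. s * (mle d \<beta> n \<omega> - h))) t = measure ?M A"
    unfolding cdf_def by (subst measure_distr) (auto simp: sp A_def vimage_def Int_def annealed_ising_def space_point_measure conj_commute)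
  moreover have fm: "finite_measure ?M"
    unfolding annealed_ising_def by (intro finite_measureI) (simp add: space_point_measure emeasure_point_measure_finite)
  have iff: "s * (mle d \<beta> n \<omega> - h) \<le> t \<longleftrightarrow> real (?c \<omega>) \<le> ?m"
    if "\<omega> \<in> spin_configs n" "0 < ?c \<omega>" "?c \<omega> < n" for \<omega>
  proof -
    have "s * (mle d \<beta> n \<omega> - h) \<le> t \<longleftrightarrow> mle d \<beta> n \<omega> \<le> h + t / s" using s by (simp add: field_simps)
    thus ?thesis using mle_le_iff[OF ne that] by simp
  qed
  have ends: "?c \<omega> = 0 \<or> ?c \<omega> = n \<or> (0 < ?c \<omega> \<and> ?c \<omega> < n)" for \<omega> using card_plus_set_le[of n \<omega>] by linarith
  have lo: "?P (\<lambda>j. 0 < j \<and> j < n \<and> real j \<le> ?m) \<le> measure ?M A"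
    unfolding annealed_ising_measure[OF ne, symmetric]
    by (intro finite_measure.finite_measure_mono[OF fm]) (auto simp: A_def iff sp)
  have hi: "measure ?M A \<le> ?P (\<lambda>j. (0 < j \<and> j < n \<and> real j \<le> ?m) \<or> (j = 0 \<or> j = n))"
    unfolding annealed_ising_measure[OF ne, symmetric]
  proof (rule finite_measure.finite_measure_mono[OF fm])
    show "A \<subseteq> {\<omega> \<in> spin_configs n. (0 < ?c \<omega> \<and> ?c \<omega> < n \<and> real (?c \<omega>) \<le> ?m) \<or> (?c \<omega> = 0 \<or> ?c \<omega> = n)}"
    proof
      fix \<omega> assume "\<omega> \<in> A"
      hence \<omega>: "\<omega> \<in> spin_configs n" "s * (mle d \<beta> n \<omega> - h) \<le> t" by (simp_all add: A_def)
      from ends[of \<omega>] iff[OF \<omega>(1)] \<omega>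
      show "\<omega> \<in> {\<omega> \<in> spin_configs n. (0 < ?c \<omega> \<and> ?c \<omega> < n \<and> real (?c \<omega>) \<le> ?m) \<or> (?c \<omega> = 0 \<or> ?c \<omega> = n)}"
        by blast
    qed
  qed (auto simp: sp)
  have add: "?P (\<lambda>j. (0 < j \<and> j < n \<and> real j \<le> ?m) \<or> (j = 0 \<or> j = n))
      = ?P (\<lambda>j. 0 < j \<and> j < n \<and> real j \<le> ?m) + ?P (\<lambda>j. j = 0 \<or> j = n)"
    by (rule level_prob_add) auto
  have "?P (\<lambda>j. 0 < j \<and> j < n \<and> real j \<le> ?m) \<le> ?P (\<lambda>j. real j \<le> ?m)"
    by (rule level_prob_mono[OF ne]) auto
  moreover have "?P (\<lambda>j. real j \<le> ?m) \<le> ?P (\<lambda>j. (0 < j \<and> j < n \<and> real j \<le> ?m) \<or> (j = 0 \<or> j = n))"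
    by (rule level_prob_mono[OF ne]) auto
  ultimately show ?thesis using lo hi add \<open>cdf _ t = measure ?M A\<close> by linarith
qed

context peak_sequence
begin

lemma eventually_in:
  assumes \<delta>: "\<delta> > 0" "{a - \<delta><..} \<subseteq> J'" and y: "(\<lambda>k. dev k (j k)) \<longlonglongrightarrow> y"
  shows "eventually (\<lambda>k. real (j k) / real (n k) \<in> J') sequentially"
proof -
  have "eventually (\<lambda>k. a - \<delta> < real (j k) / real (n k)) sequentially"
    using \<delta> by (intro order_tendstoD(1)[OF dev_tendsto_imp[OF y]]) auto
  thus ?thesis by eventually_elim (use \<delta> in auto)
qed

text \<open>\<open>R\<close> is prescribed except at equality, so weak and strict comparisons are
  both covered. Levels whose deviation tends to some \<open>y \<noteq> z0\<close> end up on one side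
  of \<open>z\<close>, and the single point \<open>z0\<close> is negligible.\<close>

lemma partial_sum_tendsto:
  assumes \<delta>: "\<delta> > 0" "{a - \<delta><..} \<subseteq> J" and z: "z \<longlonglongrightarrow> z0"
    and R: "\<And>k j. dev k j < z k \<Longrightarrow> R k j" "\<And>k j. z k < dev k j \<Longrightarrow> \<not> R k j"
  shows "(\<lambda>k. (\<Sum>j\<le>n k. weight k j * of_bool (real j / real (n k) \<in> J \<and> R k j)) / scale k)
           \<longlonglongrightarrow> peak_integral p c (\<lambda>y. of_bool (y \<le> z0))"
proof -
  have conv: "(\<lambda>k. of_bool (real (j k) / real (n k) \<in> J \<and> R k (j k)) :: real) \<longlonglongrightarrow> of_bool (y \<le> z0)"
    if y: "y \<notin> {z0}" and j: "(\<lambda>k. dev k (j k)) \<longlonglongrightarrow> y" for y j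
  proof (rule tendsto_eventually)
    have d: "(\<lambda>k. z k - dev k (j k)) \<longlonglongrightarrow> z0 - y" by (intro tendsto_intros z j)
    show "eventually (\<lambda>k. of_bool (real (j k) / real (n k) \<in> J \<and> R k (j k)) = (of_bool (y \<le> z0) :: real)) sequentially"
    proof (cases "y < z0")
      case True
      hence "eventually (\<lambda>k. 0 < z k - dev k (j k)) sequentially" by (intro order_tendstoD(1)[OF d]) auto
      thus ?thesis using eventually_in[OF \<delta> j] by eventually_elim (use R True in auto)
    next
      case False
      hence "y > z0" using y by auto
      hence "eventually (\<lambda>k. z k - dev k (j k) < 0) sequentially" by (intro order_tendstoD(2)[OF d]) auto
      thus ?thesis by eventually_elim (use R \<open>y > z0\<close> in auto)
    qed
  qed
  have out: "eventually (\<lambda>k. \<forall>j\<le>n k. real j / real (n k) \<notin> J \<longrightarrow>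
      \<bar>weight k j * of_bool (real j / real (n k) \<in> J \<and> R k j)\<bar> \<le> 0 * exp (- 1 * \<bar>dev k j\<bar>)) sequentially"
    by (intro always_eventually) auto
  have meas: "(\<lambda>y. of_bool (y \<le> z0) :: real) \<in> borel_measurable borel" by measurable
  note W = weighted_sum_tendsto[where N = "{z0}" and B = 1 and s = 0
      and g = "\<lambda>k j. of_bool (real j / real (n k) \<in> J \<and> R k j)" and \<gamma> = "\<lambda>y. of_bool (y \<le> z0)", OF conv _ meas _ out]
  show "(\<lambda>k. (\<Sum>j\<le>n k. weight k j * of_bool (real j / real (n k) \<in> J \<and> R k j)) / scale k)
           \<longlonglongrightarrow> peak_integral p c (\<lambda>y. of_bool (y \<le> z0))"
    by (rule W) auto
qed

text \<open>\<open>J'\<close> may be smaller than \<open>J\<close>: the open half-line above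
  \<open>1 / 2\<close> leaves out the middle level, as the reflection argument for two peaks
  needs.\<close>

lemma total_sum_tendsto:
  assumes \<delta>: "\<delta> > 0" "{a - \<delta><..} \<subseteq> J'" and J': "J' \<subseteq> J"
  shows "(\<lambda>k. (\<Sum>j\<le>n k. weight k j * of_bool (real j / real (n k) \<in> J')) / scale k)
           \<longlonglongrightarrow> peak_integral p c (\<lambda>y. 1)"
proof -
  have conv: "(\<lambda>k. of_bool (real (j k) / real (n k) \<in> J') :: real) \<longlonglongrightarrow> 1"
    if y: "y \<notin> {}" and j: "(\<lambda>k. dev k (j k)) \<longlonglongrightarrow> y" for y j
  proof (rule tendsto_eventually)
    show "eventually (\<lambda>k. of_bool (real (j k) / real (n k) \<in> J') = (1 :: real)) sequentially"
      using eventually_in[OF \<delta> j] by eventually_elim auto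
  qed
  have out: "eventually (\<lambda>k. \<forall>j\<le>n k. real j / real (n k) \<notin> J \<longrightarrow>
      \<bar>weight k j * of_bool (real j / real (n k) \<in> J')\<bar> \<le> 0 * exp (- 1 * \<bar>dev k j\<bar>)) sequentially"
    using J' by (intro always_eventually) auto
  note W = weighted_sum_tendsto[where N = "{}" and B = 1 and s = 0
      and g = "\<lambda>k j. of_bool (real j / real (n k) \<in> J')" and \<gamma> = "\<lambda>y. 1", OF conv _ _ _ out]
  show "(\<lambda>k. (\<Sum>j\<le>n k. weight k j * of_bool (real j / real (n k) \<in> J')) / scale k)
           \<longlonglongrightarrow> peak_integral p c (\<lambda>y. 1)"
    by (rule W) auto
qed

lemma dev_less_iff:
  assumes "n k > 0"
  shows "dev k j < (m - centre k) / scale k \<longleftrightarrow> real j < m" "(m - centre k) / scale k < dev k j \<longleftrightarrow> m < real j"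
  using scale_power[OF assms] by (simp_all add: dev_def divide_less_cancel)

lemma ends_tendsto_0: "(\<lambda>k. level_prob d \<beta> h (n k) (\<lambda>j. j = 0 \<or> j = n k)) \<longlonglongrightarrow> 0"
proof (rule Lim_null_comparison)
  show "eventually (\<lambda>k. norm (level_prob d \<beta> h (n k) (\<lambda>j. j = 0 \<or> j = n k))
       \<le> 2 * exp (2 * \<bar>h\<bar>) / exp (-2 * \<beta>) ^ d * (1 / real (n k))) sequentially"
    using eventually_nonempty
  proof eventually_elim
    case (elim k)
    have "level_prob d \<beta> h (n k) (\<lambda>j. j = 0 \<or> j = n k) \<ge> 0"
      unfolding level_prob_def using elim partition_function_pos[of d "n k" \<beta> h]
      by (intro divide_nonneg_pos sum_nonneg mult_nonneg_nonneg level_weight_nonneg) auto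
    thus ?case using level_prob_ends[of d "n k" \<beta> h] elim \<beta> by simp
  qed
  have "(\<lambda>k. 1 / real (n k)) \<longlonglongrightarrow> 0"
    using tendsto_inverse_0_at_top[OF n_real] by (simp add: inverse_eq_divide)
  from tendsto_mult_right_zero[OF this]
  show "(\<lambda>k. 2 * exp (2 * \<bar>h\<bar>) / exp (-2 * \<beta>) ^ d * (1 / real (n k))) \<longlonglongrightarrow> 0" .
qed

lemma mle_cdf_tendsto:
  assumes "(\<lambda>k. level_prob d \<beta> h (n k) (\<lambda>j. real j \<le> level_mean d \<beta> (h + t / scale k) (n k))) \<longlonglongrightarrow> L"
  shows "(\<lambda>k. cdf (distr (annealed_ising d \<beta> h (n k)) borel (\<lambda>\<omega>. scale k * (mle d \<beta> (n k) \<omega> - h))) t) \<longlonglongrightarrow> L"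
proof -
  have "(\<lambda>k. cdf (distr (annealed_ising d \<beta> h (n k)) borel (\<lambda>\<omega>. scale k * (mle d \<beta> (n k) \<omega> - h))) t
      - level_prob d \<beta> h (n k) (\<lambda>j. real j \<le> level_mean d \<beta> (h + t / scale k) (n k))) \<longlonglongrightarrow> 0"
  proof (rule Lim_null_comparison[OF _ ends_tendsto_0])
    show "eventually (\<lambda>k. norm (cdf (distr (annealed_ising d \<beta> h (n k)) borel (\<lambda>\<omega>. scale k * (mle d \<beta> (n k) \<omega> - h))) t
      - level_prob d \<beta> h (n k) (\<lambda>j. real j \<le> level_mean d \<beta> (h + t / scale k) (n k)))
      \<le> level_prob d \<beta> h (n k) (\<lambda>j. j = 0 \<or> j = n k)) sequentially"
      using eventually_nonempty
    proof eventually_elim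
      case (elim k)
      thus ?case using mle_cdf_estimate[of d "n k" "scale k" \<beta> h t] scale_power[of k] by simp
    qed
  qed
  from tendsto_add[OF this assms] show ?thesis by simp
qed

end

lemma unique_peak_cdf_tendsto:
  assumes "peak_sequence d \<beta> h UNIV p a c n"
  shows "(\<lambda>k. cdf (distr (annealed_ising d \<beta> h (n k)) borel
           (\<lambda>\<omega>. real (n k) powr (1 - 1 / real p) * (mle d \<beta> (n k) \<omega> - h))) t)
         \<longlonglongrightarrow> peak_cdf p c (peak_mean p c t)"
proof -
  interpret peak_sequence d \<beta> h UNIV p a c n by (rule assms)
  define z where "z = (\<lambda>k. (level_mean d \<beta> (h + t / scale k) (n k) - centre k) / scale k)"
  have z: "z \<longlonglongrightarrow> peak_mean p c t"
    unfolding z_def by (rule level_mean_tendsto[where B' = 0 and \<tau> = 1]) auto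
  define R where "R = (\<lambda>k j. dev k j \<le> z k)"
  have num: "(\<lambda>k. (\<Sum>j\<le>n k. weight k j * of_bool (real j / real (n k) \<in> UNIV \<and> R k j)) / scale k)
      \<longlonglongrightarrow> peak_integral p c (\<lambda>y. of_bool (y \<le> peak_mean p c t))"
    by (rule partial_sum_tendsto[OF zero_less_one _ z]) (auto simp: R_def)
  have den: "(\<lambda>k. (\<Sum>j\<le>n k. weight k j * of_bool (real j / real (n k) \<in> UNIV)) / scale k)
      \<longlonglongrightarrow> peak_integral p c (\<lambda>y. 1)"
    by (rule total_sum_tendsto[OF zero_less_one]) auto
  have pos: "peak_integral p c (\<lambda>y. 1) \<noteq> 0" using peak_integral_1_pos[OF p c] by simp
  from ratio_tendsto[OF num den pos]
  have "(\<lambda>k. (\<Sum>j\<le>n k. weight k j * of_bool (R k j)) / (\<Sum>j\<le>n k. weight k j)) \<longlonglongrightarrow> peak_cdf p c (peak_mean p c t)"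
    by (simp add: peak_cdf_def)
  hence "(\<lambda>k. level_prob d \<beta> h (n k) (\<lambda>j. real j \<le> level_mean d \<beta> (h + t / scale k) (n k))) \<longlonglongrightarrow> peak_cdf p c (peak_mean p c t)"
  proof (rule Lim_transform_eventually)
    show "eventually (\<lambda>k. (\<Sum>j\<le>n k. weight k j * of_bool (R k j)) / (\<Sum>j\<le>n k. weight k j)
       = level_prob d \<beta> h (n k) (\<lambda>j. real j \<le> level_mean d \<beta> (h + t / scale k) (n k))) sequentially"
      using eventually_nonempty
    proof eventually_elim
      case (elim k)
      have "R k j \<longleftrightarrow> real j \<le> level_mean d \<beta> (h + t / scale k) (n k)" for j
        unfolding R_def z_def using dev_less_iff(2)[of k] elim by (simp add: not_less[symmetric])
      thus ?case using elim by (simp add: level_prob_weight)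
    qed
  qed
  from mle_cdf_tendsto[OF this] show ?thesis by (simp add: scale_def)
qed

section \<open>Two symmetric peaks\<close>

lemma level_weight_reflect:
  assumes "j \<le> n"
  shows "level_weight d \<beta> 0 n (n - j) = level_weight d \<beta> 0 n j"
  using partition_sum_reflect[OF assms] by (simp add: level_weight_def)

lemma level_mean_reflect:
  assumes ne: "regular_graphs d n \<noteq> {}"
  shows "level_mean d \<beta> (- x) n = real n - level_mean d \<beta> x n"
proof -
  let ?Z = "partition_sum d n (exp (-2 * \<beta>))"
  have w: "level_weight d \<beta> (- x) n (n - j) = exp (- 2 * x * real n) * level_weight d \<beta> x n j" if "j \<le> n" for j
  proof -
    have "2 * - x * real (n - j) = - 2 * x * real n + 2 * x * real j" using that by (simp add: of_nat_diff algebra_simps)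
    hence "exp (2 * - x * real (n - j)) = exp (- 2 * x * real n) * exp (2 * x * real j)" by (simp only: exp_add)
    thus ?thesis using partition_sum_reflect[OF that] by (simp add: level_weight_def)
  qed
  have PF: "partition_function d \<beta> x n > 0" using ne by (rule partition_function_pos)
  have "partition_function d \<beta> (- x) n = (\<Sum>j\<le>n. level_weight d \<beta> (- x) n (n - j))"
    unfolding partition_function_def by (rule sum_reflect[symmetric])
  also have "\<dots> = exp (- 2 * x * real n) * partition_function d \<beta> x n"
    unfolding partition_function_def sum_distrib_left using w by (intro sum.cong) auto
  finally have P: "partition_function d \<beta> (- x) n = exp (- 2 * x * real n) * partition_function d \<beta> x n" .
  have "(\<Sum>j\<le>n. level_weight d \<beta> (- x) n j * real j) = (\<Sum>j\<le>n. level_weight d \<beta> (- x) n (n - j) * real (n - j))"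
    by (rule sum_reflect[symmetric])
  also have "\<dots> = (\<Sum>j\<le>n. exp (- 2 * x * real n) * (level_weight d \<beta> x n j * (real n - real j)))"
    using w by (intro sum.cong) (auto simp: of_nat_diff)
  also have "\<dots> = exp (- 2 * x * real n) * (\<Sum>j\<le>n. level_weight d \<beta> x n j * (real n - real j))"
    by (simp only: sum_distrib_left)
  also have "(\<Sum>j\<le>n. level_weight d \<beta> x n j * (real n - real j))
      = real n * partition_function d \<beta> x n - (\<Sum>j\<le>n. level_weight d \<beta> x n j * real j)"
    unfolding partition_function_def sum_distrib_left sum_subtractf[symmetric]
    by (intro sum.cong) (auto simp: algebra_simps)
  finally show ?thesis unfolding level_mean_def P using PF by (simp add: diff_divide_distrib)
qed

lemma level_prob_reflect: "level_prob d \<beta> 0 n (\<lambda>j. Q (n - j)) = level_prob d \<beta> 0 n Q"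
proof -
  have "(\<Sum>j\<le>n. level_weight d \<beta> 0 n j * of_bool (Q j)) = (\<Sum>j\<le>n. level_weight d \<beta> 0 n (n - j) * of_bool (Q (n - j)))"
    by (rule sum_reflect[symmetric])
  also have "\<dots> = (\<Sum>j\<le>n. level_weight d \<beta> 0 n j * of_bool (Q (n - j)))"
    by (intro sum.cong refl) (simp add: level_weight_reflect)
  finally show ?thesis by (simp add: level_prob_def)
qed

locale symmetric_peaks = peak_sequence d \<beta> 0 "{1 / 2..}" p a c n for d \<beta> p a c n +
  assumes a_half: "1 / 2 < a"
begin

lemma weight_reflect: "j \<le> n k \<Longrightarrow> weight k (n k - j) = weight k j"
  by (simp add: weight_def level_weight_reflect)

text \<open>Below \<open>1 / 2\<close> the weights are bounded because reflection carries them into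
  the upper half, and the deviations are negative. Half of the resulting decay
  \<open>exp (- 2 * t * \<bar>dev k j\<bar>)\<close> absorbs the linear factor, the other half
  remains.\<close>

lemma outside_bound:
  assumes t: "t > 0"
  shows "\<exists>B'. eventually (\<lambda>k. \<forall>j\<le>n k. real j / real (n k) \<notin> {1 / 2..} \<longrightarrow>
      weight k j * (exp (2 * t * dev k j) * (1 + \<bar>dev k j\<bar>)) \<le> B' * exp (- min t 1 * \<bar>dev k j\<bar>)) sequentially"
proof -
  obtain C \<kappa> where \<kappa>: "\<kappa> > 0" and C: "eventually (\<lambda>k. \<forall>j\<le>n k. real j / real (n k) \<in> {1 / 2..} \<longrightarrow>
       weight k j \<le> C * exp (- \<kappa> * (dev k j)\<^sup>2)) sequentially"
    using weight_bound by blast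
  have "eventually (\<lambda>k. \<forall>j\<le>n k. real j / real (n k) \<notin> {1 / 2..} \<longrightarrow>
      weight k j * (exp (2 * t * dev k j) * (1 + \<bar>dev k j\<bar>)) \<le> \<bar>C\<bar> * (1 + 1 / t) * exp (- min t 1 * \<bar>dev k j\<bar>)) sequentially"
    using C eventually_nonempty
  proof eventually_elim
    case (elim k)
    show ?case
    proof (intro allI impI)
      fix j assume j: "j \<le> n k" "real j / real (n k) \<notin> {1 / 2..}"
      have n0: "real (n k) > 0" and s: "scale k > 0" using elim scale_power by auto
      have jn: "real j < real (n k) / 2" using j n0 by (simp add: field_simps)
      have "real (n k - j) / real (n k) \<in> {1 / 2..}" using jn j n0 by (simp add: of_nat_diff field_simps)
      hence "weight k (n k - j) \<le> C * exp (- \<kappa> * (dev k (n k - j))\<^sup>2)"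
        using elim(1)[rule_format, OF diff_le_self] by blast
      also have "\<dots> \<le> \<bar>C\<bar> * 1" using \<kappa> by (intro mult_mono) auto
      finally have w: "weight k j \<le> \<bar>C\<bar>" using weight_reflect[OF j(1)] by simp
      have "real (n k) / 2 \<le> a * real (n k)" using a_half n0 by simp
      hence "real j - a * real (n k) \<le> 0" using jn by linarith
      hence "dev k j \<le> 0" unfolding dev_def centre_def using s by (rule divide_nonpos_pos)
      hence d: "dev k j = - \<bar>dev k j\<bar>" by simp
      have "0 \<le> t * \<bar>dev k j\<bar>" using t by simp
      hence e1: "t * \<bar>dev k j\<bar> \<le> exp (t * \<bar>dev k j\<bar>)" "1 \<le> exp (t * \<bar>dev k j\<bar>)"
        using exp_ge_add_one_self[of "t * \<bar>dev k j\<bar>"] \<open>0 \<le> t * \<bar>dev k j\<bar>\<close> by linarith+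
      have "1 + \<bar>dev k j\<bar> \<le> (1 + 1 / t) * exp (t * \<bar>dev k j\<bar>)"
      proof -
        have "\<bar>dev k j\<bar> \<le> 1 / t * exp (t * \<bar>dev k j\<bar>)" using e1(1) t by (simp add: field_simps)
        moreover have "(1 + 1 / t) * exp (t * \<bar>dev k j\<bar>) = exp (t * \<bar>dev k j\<bar>) + 1 / t * exp (t * \<bar>dev k j\<bar>)"
          by (simp add: algebra_simps)
        ultimately show ?thesis using e1(2) by linarith
      qed
      hence "exp (2 * t * dev k j) * (1 + \<bar>dev k j\<bar>) \<le> exp (2 * t * dev k j) * ((1 + 1 / t) * exp (t * \<bar>dev k j\<bar>))"
        by (intro mult_left_mono) auto
      also have "\<dots> = (1 + 1 / t) * exp (- t * \<bar>dev k j\<bar>)"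
        by (subst d) (simp add: exp_add[symmetric] algebra_simps)
      also have "\<dots> \<le> (1 + 1 / t) * exp (- min t 1 * \<bar>dev k j\<bar>)"
        using t by (intro mult_left_mono) (auto simp: min_def mult_right_mono)
      finally have bd: "exp (2 * t * dev k j) * (1 + \<bar>dev k j\<bar>) \<le> (1 + 1 / t) * exp (- min t 1 * \<bar>dev k j\<bar>)" .
      have "weight k j * (exp (2 * t * dev k j) * (1 + \<bar>dev k j\<bar>))
          \<le> \<bar>C\<bar> * ((1 + 1 / t) * exp (- min t 1 * \<bar>dev k j\<bar>))"
        by (rule mult_mono[OF w bd]) auto
      thus "weight k j * (exp (2 * t * dev k j) * (1 + \<bar>dev k j\<bar>)) \<le> \<bar>C\<bar> * (1 + 1 / t) * exp (- min t 1 * \<bar>dev k j\<bar>)"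
        by (simp add: mult.assoc)
    qed
  qed
  thus ?thesis by blast
qed

text \<open>By symmetry half of the mass lies below \<open>1 / 2\<close>, and all of it is below the
  mean selected by the positive tilt; the upper half behaves as for a single peak. \<open>R\<close>
  is general because positive \<open>t\<close> uses \<open>\<le>\<close>, while negative
  \<open>t\<close> leads to \<open><\<close> after reflection.\<close>

lemma level_prob_half_tendsto:
  fixes R :: "real \<Rightarrow> real \<Rightarrow> bool"
  assumes t: "t > 0" and R: "\<And>x m. x < m \<Longrightarrow> R x m" "\<And>x m. m < x \<Longrightarrow> \<not> R x m"
  shows "(\<lambda>k. level_prob d \<beta> 0 (n k) (\<lambda>j. R (real j) (level_mean d \<beta> (t / scale k) (n k))))
           \<longlonglongrightarrow> 1 / 2 + peak_cdf p c (peak_mean p c t) / 2"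
proof -
  define z where "z = (\<lambda>k. (level_mean d \<beta> (t / scale k) (n k) - centre k) / scale k)"
  obtain B' where B': "eventually (\<lambda>k. \<forall>j\<le>n k. real j / real (n k) \<notin> {1 / 2..} \<longrightarrow>
      weight k j * (exp (2 * t * dev k j) * (1 + \<bar>dev k j\<bar>)) \<le> B' * exp (- min t 1 * \<bar>dev k j\<bar>)) sequentially"
    using outside_bound[OF t] by blast
  have z: "z \<longlonglongrightarrow> peak_mean p c t"
    unfolding z_def using level_mean_tendsto[OF B'] t by simp
  define Rk where "Rk = (\<lambda>k j. if n k > 0 then R (real j) (level_mean d \<beta> (t / scale k) (n k)) else dev k j \<le> z k)"
  have Rk: "dev k j < z k \<Longrightarrow> Rk k j" "z k < dev k j \<Longrightarrow> \<not> Rk k j" for k j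
    using R dev_less_iff[where k = k and j = j and m = "level_mean d \<beta> (t / scale k) (n k)"] by (auto simp: Rk_def z_def)
  define G where "G = peak_integral p c (\<lambda>y. 1)"
  have G: "G > 0" unfolding G_def using p c by (rule peak_integral_1_pos)
  define \<delta> where "\<delta> = a - 1 / 2"
  have \<delta>: "\<delta> > 0" using a_half by (simp add: \<delta>_def)
  have sub: "{a - \<delta><..} \<subseteq> {1 / 2..}" "{a - \<delta><..} \<subseteq> {1 / 2<..}" by (auto simp: \<delta>_def)
  let ?in = "\<lambda>k j. real j / real (n k) \<in> {1 / 2..}"
  have U: "(\<lambda>k. (\<Sum>j\<le>n k. weight k j * of_bool (?in k j \<and> Rk k j)) / scale k)
      \<longlonglongrightarrow> peak_integral p c (\<lambda>y. of_bool (y \<le> peak_mean p c t))"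
    by (rule partial_sum_tendsto[OF \<delta> sub(1) z Rk])
  have Tp: "(\<lambda>k. (\<Sum>j\<le>n k. weight k j * of_bool (?in k j)) / scale k) \<longlonglongrightarrow> G"
    unfolding G_def by (rule total_sum_tendsto[OF \<delta> sub(1)]) auto
  \<comment> \<open>Reflection maps the levels below \<open>1 / 2\<close> to those strictly above,
    hence the open half-line.\<close>
  have Tm': "(\<lambda>k. (\<Sum>j\<le>n k. weight k j * of_bool (real j / real (n k) \<in> {1 / 2<..})) / scale k) \<longlonglongrightarrow> G"
    unfolding G_def by (rule total_sum_tendsto[OF \<delta> sub(2)]) auto
  have Tm: "(\<lambda>k. (\<Sum>j\<le>n k. weight k j * of_bool (\<not> ?in k j)) / scale k) \<longlonglongrightarrow> G"
    using Tm'
  proof (rule Lim_transform_eventually)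
    show "eventually (\<lambda>k. (\<Sum>j\<le>n k. weight k j * of_bool (real j / real (n k) \<in> {1 / 2<..})) / scale k
       = (\<Sum>j\<le>n k. weight k j * of_bool (\<not> ?in k j)) / scale k) sequentially"
      using eventually_nonempty
    proof eventually_elim
      case (elim k)
      hence n0: "real (n k) > 0" by simp
      have "(\<Sum>j\<le>n k. weight k j * of_bool (real j / real (n k) \<in> {1 / 2<..}))
        = (\<Sum>j\<le>n k. weight k (n k - j) * of_bool (real (n k - j) / real (n k) \<in> {1 / 2<..}))"
        by (rule sum_reflect[symmetric])
      also have "\<dots> = (\<Sum>j\<le>n k. weight k j * of_bool (\<not> ?in k j))"
      proof (intro sum.cong refl)
        fix j assume "j \<in> {..n k}"
        hence j: "j \<le> n k" by simp
        have "real (n k - j) / real (n k) \<in> {1 / 2<..} \<longleftrightarrow> \<not> ?in k j"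
          using j n0 by (auto simp: of_nat_diff field_simps)
        thus "weight k (n k - j) * of_bool (real (n k - j) / real (n k) \<in> {1 / 2<..}) = weight k j * of_bool (\<not> ?in k j)"
          by (simp add: weight_reflect[OF j])
      qed
      finally show ?case by simp
    qed
  qed
  \<comment> \<open>The peak lies above \<open>1 / 2\<close> by a fixed fraction of
    \<open>n\<close>, much more than \<open>scale\<close>, whereas the mean stays within order
    \<open>scale\<close> of the peak.\<close>
  have below: "eventually (\<lambda>k. \<forall>j. \<not> ?in k j \<longrightarrow> dev k j < z k) sequentially"
  proof -
    have "filterlim (\<lambda>k. (a - 1 / 2) * (real (n k) / scale k)) at_top sequentially"
      using a_half by (intro filterlim_tendsto_pos_mult_at_top[OF tendsto_const _ n_over_scale]) auto
    hence "eventually (\<lambda>k. (a - 1 / 2) * (real (n k) / scale k) \<ge> 1 - peak_mean p c t) sequentially"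
      by (simp add: filterlim_at_top)
    moreover have "eventually (\<lambda>k. peak_mean p c t - 1 < z k) sequentially"
      by (intro order_tendstoD(1)[OF z]) auto
    ultimately show ?thesis using eventually_nonempty
    proof eventually_elim
      case (elim k)
      have s: "scale k > 0" "real (n k) > 0" using elim scale_power by auto
      show ?case
      proof (intro allI impI)
        fix j assume "\<not> ?in k j"
        hence "real j \<le> real (n k) / 2" using s by (simp add: field_simps)
        hence "dev k j \<le> (real (n k) / 2 - a * real (n k)) / scale k"
          using s unfolding dev_def centre_def by (intro divide_right_mono) auto
        also have "\<dots> = - ((a - 1 / 2) * (real (n k) / scale k))" by (simp add: diff_divide_distrib algebra_simps)
        finally show "dev k j < z k" using elim by linarith
      qed
    qed
  qed
  have num: "(\<lambda>k. ((\<Sum>j\<le>n k. weight k j * of_bool (\<not> ?in k j)) + (\<Sum>j\<le>n k. weight k j * of_bool (?in k j \<and> Rk k j))) / scale k)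
      \<longlonglongrightarrow> G + peak_integral p c (\<lambda>y. of_bool (y \<le> peak_mean p c t))"
    unfolding add_divide_distrib by (intro tendsto_add Tm U)
  have den: "(\<lambda>k. ((\<Sum>j\<le>n k. weight k j * of_bool (\<not> ?in k j)) + (\<Sum>j\<le>n k. weight k j * of_bool (?in k j))) / scale k) \<longlonglongrightarrow> G + G"
    unfolding add_divide_distrib by (intro tendsto_add Tm Tp)
  have "(G + peak_integral p c (\<lambda>y. of_bool (y \<le> peak_mean p c t))) / (G + G) = 1 / 2 + peak_cdf p c (peak_mean p c t) / 2"
    using G by (simp add: peak_cdf_def G_def[symmetric] add_divide_distrib)
  with ratio_tendsto[OF num den] G have
    "(\<lambda>k. ((\<Sum>j\<le>n k. weight k j * of_bool (\<not> ?in k j)) + (\<Sum>j\<le>n k. weight k j * of_bool (?in k j \<and> Rk k j))) /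
       ((\<Sum>j\<le>n k. weight k j * of_bool (\<not> ?in k j)) + (\<Sum>j\<le>n k. weight k j * of_bool (?in k j))))
      \<longlonglongrightarrow> 1 / 2 + peak_cdf p c (peak_mean p c t) / 2" by simp
  thus ?thesis
  proof (rule Lim_transform_eventually)
    show "eventually (\<lambda>k. ((\<Sum>j\<le>n k. weight k j * of_bool (\<not> ?in k j)) + (\<Sum>j\<le>n k. weight k j * of_bool (?in k j \<and> Rk k j))) /
       ((\<Sum>j\<le>n k. weight k j * of_bool (\<not> ?in k j)) + (\<Sum>j\<le>n k. weight k j * of_bool (?in k j)))
       = level_prob d \<beta> 0 (n k) (\<lambda>j. R (real j) (level_mean d \<beta> (t / scale k) (n k)))) sequentially"
      using eventually_nonempty below
    proof eventually_elim
      case (elim k)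
      have R': "R (real j) (level_mean d \<beta> (t / scale k) (n k)) \<longleftrightarrow> \<not> ?in k j \<or> (?in k j \<and> Rk k j)" for j
      proof (cases "?in k j")
        case False
        hence "Rk k j" using elim Rk(1) by blast
        thus ?thesis using elim False by (simp add: Rk_def)
      qed (use elim in \<open>simp add: Rk_def\<close>)
      have e1: "(\<Sum>j\<le>n k. weight k j * of_bool (R (real j) (level_mean d \<beta> (t / scale k) (n k))))
         = (\<Sum>j\<le>n k. weight k j * of_bool (\<not> ?in k j)) + (\<Sum>j\<le>n k. weight k j * of_bool (?in k j \<and> Rk k j))"
        unfolding R' sum.distrib[symmetric] by (intro sum.cong refl) (auto simp: of_bool_def)
      have e2: "(\<Sum>j\<le>n k. weight k j) = (\<Sum>j\<le>n k. weight k j * of_bool (\<not> ?in k j)) + (\<Sum>j\<le>n k. weight k j * of_bool (?in k j))"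
        unfolding sum.distrib[symmetric] by (intro sum.cong refl) (auto simp: of_bool_def)
      show ?case using elim unfolding e1[symmetric] e2[symmetric] by (simp add: level_prob_weight)
    qed
  qed
qed

lemma mle_cdf_pos_tendsto:
  assumes t: "t > 0"
  shows "(\<lambda>k. cdf (distr (annealed_ising d \<beta> 0 (n k)) borel (\<lambda>\<omega>. scale k * (mle d \<beta> (n k) \<omega> - 0))) t)
     \<longlonglongrightarrow> 1 / 2 + peak_cdf p c (peak_mean p c t) / 2"
proof (rule mle_cdf_tendsto)
  show "(\<lambda>k. level_prob d \<beta> 0 (n k) (\<lambda>j. real j \<le> level_mean d \<beta> (0 + t / scale k) (n k)))
      \<longlonglongrightarrow> 1 / 2 + peak_cdf p c (peak_mean p c t) / 2"
    using level_prob_half_tendsto[OF t, of "(\<le>)"] by simp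
qed

text \<open>Reflection reverses the field and turns the event that \<open>j\<close> is at most the
  mean into the complement of the event that \<open>j\<close> is strictly below the mean for the
  field \<open>- t / scale k\<close>.\<close>

lemma mle_cdf_neg_tendsto:
  assumes t: "t < 0"
  shows "(\<lambda>k. cdf (distr (annealed_ising d \<beta> 0 (n k)) borel (\<lambda>\<omega>. scale k * (mle d \<beta> (n k) \<omega> - 0))) t)
     \<longlonglongrightarrow> 1 / 2 - peak_cdf p c (peak_mean p c (- t)) / 2"
proof (rule mle_cdf_tendsto)
  let ?m = "\<lambda>k. level_mean d \<beta> (- t / scale k) (n k)"
  have "(\<lambda>k. level_prob d \<beta> 0 (n k) (\<lambda>j. real j < ?m k)) \<longlonglongrightarrow> 1 / 2 + peak_cdf p c (peak_mean p c (- t)) / 2"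
    using level_prob_half_tendsto[of "- t" "(<)"] t by simp
  hence "(\<lambda>k. 1 - level_prob d \<beta> 0 (n k) (\<lambda>j. real j < ?m k)) \<longlonglongrightarrow> 1 - (1 / 2 + peak_cdf p c (peak_mean p c (- t)) / 2)"
    by (intro tendsto_diff tendsto_const)
  hence lim: "(\<lambda>k. 1 - level_prob d \<beta> 0 (n k) (\<lambda>j. real j < ?m k)) \<longlonglongrightarrow> 1 / 2 - peak_cdf p c (peak_mean p c (- t)) / 2"
    by (simp add: algebra_simps)
  show "(\<lambda>k. level_prob d \<beta> 0 (n k) (\<lambda>j. real j \<le> level_mean d \<beta> (0 + t / scale k) (n k)))
      \<longlonglongrightarrow> 1 / 2 - peak_cdf p c (peak_mean p c (- t)) / 2"
    using lim
  proof (rule Lim_transform_eventually)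
    show "eventually (\<lambda>k. 1 - level_prob d \<beta> 0 (n k) (\<lambda>j. real j < ?m k)
       = level_prob d \<beta> 0 (n k) (\<lambda>j. real j \<le> level_mean d \<beta> (0 + t / scale k) (n k))) sequentially"
      using eventually_nonempty
    proof eventually_elim
      case (elim k)
      hence ne: "regular_graphs d (n k) \<noteq> {}" by simp
      have m: "level_mean d \<beta> (0 + t / scale k) (n k) = real (n k) - ?m k"
        using level_mean_reflect[OF ne, of \<beta> "- t / scale k"] by simp
      have "level_prob d \<beta> 0 (n k) (\<lambda>j. real j \<le> real (n k) - ?m k)
          = level_prob d \<beta> 0 (n k) (\<lambda>j. real (n k - j) \<le> real (n k) - ?m k)"
        by (rule level_prob_reflect[symmetric])
      also have "\<dots> = level_prob d \<beta> 0 (n k) (\<lambda>j. \<not> real j < ?m k)"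
        unfolding level_prob_def by (intro arg_cong2[where f = "(/)"] sum.cong) (auto simp: of_nat_diff)
      finally have e: "level_prob d \<beta> 0 (n k) (\<lambda>j. real j \<le> real (n k) - ?m k) = level_prob d \<beta> 0 (n k) (\<lambda>j. \<not> real j < ?m k)" .
      have "level_prob d \<beta> 0 (n k) (\<lambda>j. real j < ?m k \<or> \<not> real j < ?m k)
         = level_prob d \<beta> 0 (n k) (\<lambda>j. real j < ?m k) + level_prob d \<beta> 0 (n k) (\<lambda>j. \<not> real j < ?m k)"
        by (rule level_prob_add) auto
      moreover have "level_prob d \<beta> 0 (n k) (\<lambda>j. real j < ?m k \<or> \<not> real j < ?m k) = 1"
        using level_prob_UNIV[OF ne, of \<beta> 0] by simp
      ultimately show ?case unfolding m e by simp
    qed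
  qed
qed

end

section \<open>Identification of the limits\<close>

lemma measure_density_real:
  fixes f :: "real \<Rightarrow> real"
  assumes f: "integrable lborel f" "\<And>x. f x \<ge> 0" and A: "A \<in> sets borel"
  shows "measure (density lborel (\<lambda>x. ennreal (f x))) A = (LINT x|lborel. f x * indicator A x)"
proof -
  have int: "integrable lborel (\<lambda>x. f x * indicator A x)"
    using integrable_mult_indicator[OF _ f(1), of A] A by (simp add: mult.commute)
  have "emeasure (density lborel (\<lambda>x. ennreal (f x))) A = (\<integral>\<^sup>+x. ennreal (f x * indicator A x) \<partial>lborel)"
    using f A by (subst emeasure_density) (auto intro!: nn_integral_cong simp: indicator_def borel_measurable_integrable)
  also have "\<dots> = ennreal (LINT x|lborel. f x * indicator A x)"
    using int f(2) by (intro nn_integral_eq_integral) auto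
  finally show ?thesis
    using f(2) by (simp add: measure_def integral_nonneg_AE)
qed

section \<open>The limit laws\<close>

lemma peak_mean_gaussian:
  assumes c: "c < 0"
  shows "peak_mean 2 c t = - t / c"
proof -
  \<comment> \<open>The maximizer of \<open>c y^2 + 2 t y\<close>; shifting by it leaves a centred
    Gaussian.\<close>
  define s where "s = - t / c"
  define I where "I = (LINT u|lborel. exp (c * u\<^sup>2))"
  have cs: "c * s = - t" using c by (simp add: s_def)
  have exponent: "exp (c * (s + u)\<^sup>2) * exp (2 * t * (s + u)) = exp (t * s) * exp (c * u\<^sup>2)" for u
  proof -
    have "c * (s + u)\<^sup>2 + 2 * t * (s + u) = (c * s) * s + 2 * (c * s) * u + c * u\<^sup>2 + 2 * t * s + 2 * t * u"
      by (simp add: power2_eq_square algebra_simps)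
    also have "\<dots> = t * s + c * u\<^sup>2" unfolding cs by (simp add: algebra_simps)
    finally show ?thesis by (simp only: exp_add[symmetric])
  qed
  have int1: "integrable lborel (\<lambda>u. exp (c * u\<^sup>2))"
    using peak_integrable[of 2 c "\<lambda>y. 1" 1 0] c by simp
  have intu: "integrable lborel (\<lambda>u. exp (c * u\<^sup>2) * u)"
    using peak_integrable[of 2 c "\<lambda>y. y" 1 1] exp_tilt_bounds(2)[of 0] c by simp
  have shift: "(LINT y|lborel. g y) = (LINT u|lborel. g (s + u))" for g :: "real \<Rightarrow> real"
    using lborel_integral_real_affine[of 1 g s] by simp
  have Z: "peak_integral 2 c (\<lambda>y. exp (2 * t * y)) = exp (t * s) * I"
    unfolding peak_integral_def I_def by (subst shift) (simp only: exponent integral_mult_right_zero)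
  have odd: "(LINT u|lborel. exp (c * u\<^sup>2) * u) = 0"
    using lborel_integral_real_affine[of "-1" "\<lambda>u. exp (c * u\<^sup>2) * u" 0] by simp
  have "peak_integral 2 c (\<lambda>y. exp (2 * t * y) * y) = (LINT u|lborel. exp (t * s) * (s * exp (c * u\<^sup>2) + exp (c * u\<^sup>2) * u))"
    unfolding peak_integral_def
  proof (subst shift, intro Bochner_Integration.integral_cong refl)
    fix u
    have "exp (c * (s + u)\<^sup>2) * (exp (2 * t * (s + u)) * (s + u))
       = (exp (c * (s + u)\<^sup>2) * exp (2 * t * (s + u))) * (s + u)" by simp
    also have "\<dots> = exp (t * s) * (s * exp (c * u\<^sup>2) + exp (c * u\<^sup>2) * u)"
      unfolding exponent by (simp add: algebra_simps)
    finally show "exp (c * (s + u)\<^sup>2) * (exp (2 * t * (s + u)) * (s + u))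
       = exp (t * s) * (s * exp (c * u\<^sup>2) + exp (c * u\<^sup>2) * u)" .
  qed
  also have "\<dots> = exp (t * s) * (s * I + 0)"
    unfolding integral_mult_right_zero using int1 intu odd
    by (subst Bochner_Integration.integral_add) (auto simp: I_def)
  finally have N: "peak_integral 2 c (\<lambda>y. exp (2 * t * y) * y) = exp (t * s) * (s * I)" by simp
  have "I > 0" using peak_integral_1_pos[of 2 c] c by (simp add: peak_integral_def I_def)
  thus ?thesis unfolding peak_mean_def N Z by (simp add: s_def)
qed

lemma normal_law_measure:
  assumes \<sigma>: "\<sigma> > 0" and A: "A \<in> sets borel"
  shows "measure (normal_law \<sigma>) A = (LINT x|lborel. normal_density 0 (sqrt \<sigma>) x * indicator A x)"
  unfolding normal_law_def using \<sigma> A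
  by (intro measure_density_real integrable_normal_density) auto

lemma normal_law_real_distribution:
  assumes "\<sigma> > 0"
  shows "real_distribution (normal_law \<sigma>)"
proof -
  have "prob_space (normal_law \<sigma>)" unfolding normal_law_def using assms by (intro prob_space_normal_density) auto
  thus ?thesis by (simp add: real_distribution_def real_distribution_axioms_def normal_law_def)
qed

text \<open>The limiting event compares a centred Gaussian \<open>Y\<close> of variance
  \<open>- 1 / (2 * c)\<close> with the tilted mean \<open>- t / c\<close>. So the limit law is that
  of \<open>- c * Y\<close>, whose variance is \<open>c^2\<close> times as large, that is
  \<open>- c / 2\<close>.\<close>

lemma normal_law_cdf:
  assumes c: "c < 0"
  shows "measure (normal_law (- c / 2)) {..t} = peak_cdf 2 c (- t / c)"
proof -
  define \<sigma> where "\<sigma> = - c / 2"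
  define K where "K = 1 / sqrt (2 * pi * \<sigma>)"
  have \<sigma>: "\<sigma> > 0" using c by (simp add: \<sigma>_def)
  have nd: "normal_density 0 (sqrt \<sigma>) (- c * y) = K * exp (c * y\<^sup>2)" for y
  proof -
    have "- (- c * y - 0)\<^sup>2 / (2 * (sqrt \<sigma>)\<^sup>2) = c * y\<^sup>2"
      using \<sigma> c by (simp add: \<sigma>_def power2_eq_square field_simps)
    thus ?thesis using \<sigma> by (simp add: normal_density_def K_def)
  qed
  have aff: "(LINT x|lborel. normal_density 0 (sqrt \<sigma>) x * f x) = - c * K * (LINT y|lborel. exp (c * y\<^sup>2) * f (- c * y))" for f
  proof -
    have "(LINT x|lborel. normal_density 0 (sqrt \<sigma>) x * f x)
       = \<bar>- c\<bar> *\<^sub>R (LINT y|lborel. normal_density 0 (sqrt \<sigma>) (0 + - c * y) * f (0 + - c * y))"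
      using c by (intro lborel_integral_real_affine) auto
    also have "\<dots> = - c * (LINT y|lborel. K * (exp (c * y\<^sup>2) * f (- c * y)))"
      using c by (simp only: nd add_0 mult.assoc) simp
    finally show ?thesis by (simp only: integral_mult_right_zero mult.assoc)
  qed
  have "measure (normal_law \<sigma>) {..t} = - c * K * (LINT y|lborel. exp (c * y\<^sup>2) * indicator {..t} (- c * y))"
    by (subst normal_law_measure[OF \<sigma>]) (auto simp: aff)
  also have "(LINT y|lborel. exp (c * y\<^sup>2) * indicator {..t} (- c * y)) = peak_integral 2 c (\<lambda>y. of_bool (y \<le> - t / c))"
    unfolding peak_integral_def
  proof (intro Bochner_Integration.integral_cong refl)
    fix y
    have "y \<le> - t / c \<longleftrightarrow> - t \<le> y * c" by (rule neg_le_divide_eq[OF c])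
    moreover have "- c * y = - (y * c)" by simp
    ultimately have "- c * y \<le> t \<longleftrightarrow> y \<le> - t / c" by linarith
    thus "exp (c * y\<^sup>2) * indicator {..t} (- c * y) = exp (c * y\<^sup>2) * of_bool (y \<le> - t / c)"
      by (simp add: indicator_def)
  qed
  finally have m: "measure (normal_law \<sigma>) {..t} = - c * K * peak_integral 2 c (\<lambda>y. of_bool (y \<le> - t / c))" .
  have "1 = - c * K * peak_integral 2 c (\<lambda>y. 1)"
    using aff[of "\<lambda>_. 1"] integral_normal_density[of "sqrt \<sigma>" 0] \<sigma> by (simp add: peak_integral_def)
  moreover have "peak_integral 2 c (\<lambda>y. 1) > 0" using c by (intro peak_integral_1_pos) auto
  ultimately have "- c * K = 1 / peak_integral 2 c (\<lambda>y. 1)" by (simp add: field_simps)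
  thus ?thesis using m by (simp add: peak_cdf_def \<sigma>_def)
qed

lemma uminus_vimage_borel:
  assumes "A \<in> sets borel"
  shows "uminus -` A \<in> sets (borel :: real measure)"
proof -
  have "(\<lambda>x::real. -1 * x) \<in> borel_measurable borel" by measurable
  hence "(uminus :: real \<Rightarrow> real) \<in> borel_measurable borel" by (simp only: mult_minus1)
  from measurable_sets[OF this assms] show ?thesis by simp
qed

lemma normal_law_uminus:
  assumes \<sigma>: "\<sigma> > 0" and A: "A \<in> sets borel"
  shows "measure (normal_law \<sigma>) (uminus -` A) = measure (normal_law \<sigma>) A"
proof -
  have A': "uminus -` A \<in> sets borel" using A by (rule uminus_vimage_borel)
  have "measure (normal_law \<sigma>) (uminus -` A) = (LINT x|lborel. normal_density 0 (sqrt \<sigma>) x * indicator A (- x))"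
    unfolding normal_law_measure[OF \<sigma> A'] by (intro Bochner_Integration.integral_cong) (auto simp: indicator_def)
  also have "\<dots> = (LINT x|lborel. normal_density 0 (sqrt \<sigma>) x * indicator A x)"
    using lborel_integral_real_affine[of "-1" "\<lambda>x. normal_density 0 (sqrt \<sigma>) x * indicator A (- x)" 0]
    by (simp add: normal_density_def)
  finally show ?thesis using normal_law_measure[OF \<sigma> A] by simp
qed

lemma normal_law_singleton: "\<sigma> > 0 \<Longrightarrow> measure (normal_law \<sigma>) {x} = 0"
proof -
  assume \<sigma>: "\<sigma> > 0"
  have "AE y in lborel. normal_density 0 (sqrt \<sigma>) y * indicator {x} y = 0"
    using AE_lborel_singleton[of x] by eventually_elim auto
  thus ?thesis by (subst normal_law_measure[OF \<sigma>]) (auto intro: integral_eq_zero_AE)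
qed

lemma normal_law_cdf_uminus:
  assumes \<sigma>: "\<sigma> > 0"
  shows "measure (normal_law \<sigma>) {..- t} = 1 - measure (normal_law \<sigma>) {..t}"
proof -
  interpret real_distribution "normal_law \<sigma>" by (rule normal_law_real_distribution[OF \<sigma>])
  have "measure (normal_law \<sigma>) {..- t} = measure (normal_law \<sigma>) (uminus -` {..- t})"
    by (rule normal_law_uminus[OF \<sigma>, symmetric]) simp
  also have "uminus -` {..- t} = {t..}" by auto
  also have "measure (normal_law \<sigma>) {t..} = measure (normal_law \<sigma>) ({t} \<union> {t<..})"
    by (intro arg_cong[where f = "measure (normal_law \<sigma>)"]) auto
  also have "\<dots> = measure (normal_law \<sigma>) {t} + measure (normal_law \<sigma>) {t<..}"
    by (intro finite_measure_Union) auto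
  also have "\<dots> = measure (normal_law \<sigma>) (space (normal_law \<sigma>) - {..t})"
    using normal_law_singleton[OF \<sigma>] by (auto intro!: arg_cong[where f = "measure (normal_law \<sigma>)"])
  also have "\<dots> = 1 - measure (normal_law \<sigma>) {..t}" by (rule prob_compl) simp
  finally show ?thesis .
qed

text \<open>For every \<open>z\<close> the pairs \<open>(\<bar>z\<bar>, - \<bar>z\<bar>)\<close> and \<open>(z, - z)\<close> agree up to order.\<close>

lemma half_normal_laws:
  assumes \<sigma>: "\<sigma> > 0" and B: "B \<in> sets borel"
  shows "measure (neg_half_normal_law \<sigma>) B + measure (pos_half_normal_law \<sigma>) B = 2 * measure (normal_law \<sigma>) B"
proof -
  interpret real_distribution "normal_law \<sigma>" by (rule normal_law_real_distribution[OF \<sigma>])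
  have m: "measure (distr (normal_law \<sigma>) borel f) B = (LINT z|normal_law \<sigma>. indicator B (f z))"
    and i: "integrable (normal_law \<sigma>) (\<lambda>z. indicator B (f z) :: real)"
    if f: "f \<in> borel_measurable borel" for f
  proof -
    have f': "f \<in> borel_measurable (normal_law \<sigma>)" using f by simp
    have s: "f -` B \<in> sets (normal_law \<sigma>)" using measurable_sets[OF f, of B] B by simp
    have e: "(\<lambda>z. indicator B (f z) :: real) = indicator (f -` B)" by (auto simp: indicator_def)
    show "measure (distr (normal_law \<sigma>) borel f) B = (LINT z|normal_law \<sigma>. indicator B (f z))"
      unfolding e using f' B s by (simp add: measure_distr)
    show "integrable (normal_law \<sigma>) (\<lambda>z. indicator B (f z) :: real)"
      unfolding e using s by (intro integrable_real_indicator) (auto simp: emeasure_eq_measure)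
  qed
  have N: "measure (normal_law \<sigma>) B = (LINT z|normal_law \<sigma>. indicator B z)"
    using B by simp
  have N': "measure (normal_law \<sigma>) B = (LINT z|normal_law \<sigma>. indicator B (- z))"
  proof -
    have "uminus -` B \<in> sets (normal_law \<sigma>)"
      using uminus_vimage_borel[OF B] by simp
    moreover have "(\<lambda>z. indicator B (- z) :: real) = indicator (uminus -` B)" by (auto simp: indicator_def)
    ultimately show ?thesis using normal_law_uminus[OF \<sigma> B] by simp
  qed
  have "measure (neg_half_normal_law \<sigma>) B + measure (pos_half_normal_law \<sigma>) B
     = (LINT z|normal_law \<sigma>. indicator B (- \<bar>z\<bar>)) + (LINT z|normal_law \<sigma>. indicator B \<bar>z\<bar>)"
    unfolding neg_half_normal_law_def pos_half_normal_law_def by (subst (1 2) m) auto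
  also have "\<dots> = (LINT z|normal_law \<sigma>. indicator B (- \<bar>z\<bar>) + indicator B \<bar>z\<bar>)"
    by (intro Bochner_Integration.integral_add[symmetric] i) auto
  also have "\<dots> = (LINT z|normal_law \<sigma>. indicator B z + indicator B (- z))"
    by (intro Bochner_Integration.integral_cong) (auto simp: abs_if)
  also have "\<dots> = (LINT z|normal_law \<sigma>. indicator B z) + (LINT z|normal_law \<sigma>. indicator B (- z))"
    using i[of "\<lambda>z. z"] i[of uminus] by (intro Bochner_Integration.integral_add) auto
  finally show ?thesis using N N' by linarith
qed

text \<open>A fair coin decides between a sample of \<open>N\<close> and 0, so this is a probability
  distribution by construction. For a centred normal \<open>N\<close>,
  \<open>half_normal_laws\<close> turns it into the mixture with weights 1/4, 1/4 and 1/2.\<close>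

definition lazy_law :: "real measure \<Rightarrow> real measure" where
  "lazy_law N = distr (N \<Otimes>\<^sub>M measure_pmf (bernoulli_pmf (1 / 2))) borel (\<lambda>(z, b). if b then z else 0)"

lemma lazy_law:
  assumes N: "real_distribution N"
  shows "real_distribution (lazy_law N)"
    and "B \<in> sets borel \<Longrightarrow> measure (lazy_law N) B = measure N B / 2 + indicator B 0 / 2"
proof -
  interpret N: real_distribution N by (rule N)
  let ?Q = "measure_pmf (bernoulli_pmf (1 / 2))"
  interpret pair_prob_space N ?Q ..
  have [measurable_cong]: "sets N = sets borel" by simp
  have meas: "(\<lambda>(z, b). if b then z else 0) \<in> borel_measurable (N \<Otimes>\<^sub>M ?Q)"
    unfolding case_prod_unfold by measurable
  show "real_distribution (lazy_law N)"
    unfolding lazy_law_def using prob_space_distr[OF meas] by (simp add: real_distribution_def real_distribution_axioms_def)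
  assume B: "B \<in> sets borel"
  have times: "measure (N \<Otimes>\<^sub>M ?Q) (A \<times> C) = measure N A * measure ?Q C" if "A \<in> sets borel" for A C
  proof -
    have "emeasure (N \<Otimes>\<^sub>M ?Q) (A \<times> C) = emeasure N A * emeasure ?Q C"
      using that by (intro measure_pmf.emeasure_pair_measure_Times) auto
    thus ?thesis by (simp add: measure_def enn2real_mult)
  qed
  have "measure (lazy_law N) B = measure (N \<Otimes>\<^sub>M ?Q) ((\<lambda>(z, b). if b then z else 0) -` B \<inter> space (N \<Otimes>\<^sub>M ?Q))"
    unfolding lazy_law_def using meas B by (intro measure_distr) auto
  also have "(\<lambda>(z, b). if b then z else 0) -` B \<inter> space (N \<Otimes>\<^sub>M ?Q) = B \<times> {True} \<union> (if 0 \<in> B then UNIV else {}) \<times> {False}"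
    by (auto simp: space_pair_measure split: if_splits)
  also have "measure (N \<Otimes>\<^sub>M ?Q) \<dots> = measure (N \<Otimes>\<^sub>M ?Q) (B \<times> {True}) + measure (N \<Otimes>\<^sub>M ?Q) ((if 0 \<in> B then UNIV else {}) \<times> {False})"
    using B by (intro finite_measure_Union pair_measureI) auto
  also have "\<dots> = measure N B * (1 / 2) + (if 0 \<in> B then 1 else 0) * (1 / 2)"
    using B N.prob_space by (simp add: times measure_pmf_single)
  finally show "measure (lazy_law N) B = measure N B / 2 + indicator B 0 / 2" by simp
qed

text \<open>Clearing the positive denominator reduces lower bounds on \<open>peak_mean\<close> to
  the sign of one integral, whose integrands can be compared pointwise.\<close>

lemma peak_mean_ge_iff:
  assumes p: "even p" "p \<ge> 2" "c < 0"
  shows "L \<le> peak_mean p c t \<longleftrightarrow> 0 \<le> (LINT y|lborel. exp (c * y ^ p) * (exp (2 * t * y) * (y - L)))"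
proof -
  note I = peak_tilt_integrable[OF p, of t]
  have "(LINT y|lborel. exp (c * y ^ p) * (exp (2 * t * y) * (y - L)))
      = (LINT y|lborel. exp (c * y ^ p) * (exp (2 * t * y) * y) - L * (exp (c * y ^ p) * exp (2 * t * y)))"
    by (intro Bochner_Integration.integral_cong) (auto simp: algebra_simps)
  also have "\<dots> = peak_integral p c (\<lambda>y. exp (2 * t * y) * y) - L * peak_integral p c (\<lambda>y. exp (2 * t * y))"
    unfolding peak_integral_def using I by (subst Bochner_Integration.integral_diff) auto
  finally show ?thesis unfolding peak_mean_def using peak_tilt_pos[OF p, of t] by (simp add: pos_le_divide_eq)
qed

lemma peak_tilt_diff_integrable:
  fixes c t L :: real
  assumes p: "even p" "p \<ge> 2" "c < 0"
  shows "integrable lborel (\<lambda>y. exp (c * y ^ p) * (exp (2 * t * y) * (y - L)))"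
proof -
  have "integrable lborel (\<lambda>y. exp (c * y ^ p) * (exp (2 * t * y) * y) - L * (exp (c * y ^ p) * exp (2 * t * y)))"
    using peak_tilt_integrable[OF p, of t] by (intro Bochner_Integration.integrable_diff integrable_mult_right)
  thus ?thesis by (simp add: algebra_simps)
qed

text \<open>Let \<open>m\<close> be the mean at \<open>s\<close>. On either side of
  \<open>m\<close>, \<open>(y - m) * exp (2 * (t - s) * y)\<close> is at least
  \<open>(y - m) * exp (2 * (t - s) * m)\<close>, and the latter has a nonnegative integral against
  the density tilted by \<open>s\<close>.\<close>

lemma peak_mean_mono:
  assumes p: "even p" "p \<ge> 2" "c < 0" and st: "s \<le> t"
  shows "peak_mean p c s \<le> peak_mean p c t"
proof -
  define m where "m = peak_mean p c s"
  have "0 \<le> (LINT y|lborel. exp (c * y ^ p) * (exp (2 * s * y) * (y - m)))"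
    using peak_mean_ge_iff[OF p, of m s] by (simp add: m_def)
  hence "0 \<le> exp (2 * (t - s) * m) * (LINT y|lborel. exp (c * y ^ p) * (exp (2 * s * y) * (y - m)))" by simp
  also have "\<dots> = (LINT y|lborel. exp (2 * (t - s) * m) * (exp (c * y ^ p) * (exp (2 * s * y) * (y - m))))" by simp
  also have "\<dots> \<le> (LINT y|lborel. exp (c * y ^ p) * (exp (2 * t * y) * (y - m)))"
  proof (rule integral_mono)
    show "integrable lborel (\<lambda>y. exp (2 * (t - s) * m) * (exp (c * y ^ p) * (exp (2 * s * y) * (y - m))))"
      by (intro integrable_mult_right peak_tilt_diff_integrable p)
    show "integrable lborel (\<lambda>y. exp (c * y ^ p) * (exp (2 * t * y) * (y - m)))"
      by (rule peak_tilt_diff_integrable[OF p])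
    fix y
    have le: "(y - m) * exp (2 * (t - s) * m) \<le> (y - m) * exp (2 * (t - s) * y)"
    proof (cases "y \<ge> m")
      case True
      hence "2 * (t - s) * m \<le> 2 * (t - s) * y" using st by (intro mult_left_mono) auto
      hence e: "exp (2 * (t - s) * m) \<le> exp (2 * (t - s) * y)" by (subst exp_le_cancel_iff)
      show ?thesis by (rule mult_left_mono[OF e]) (use True in simp)
    next
      case False
      hence "2 * (t - s) * y \<le> 2 * (t - s) * m" using st by (intro mult_left_mono) auto
      hence e: "exp (2 * (t - s) * y) \<le> exp (2 * (t - s) * m)" by (subst exp_le_cancel_iff)
      show ?thesis by (rule mult_left_mono_neg[OF e]) (use False in simp)
    qed
    have "(exp (c * y ^ p) * exp (2 * s * y)) * ((y - m) * exp (2 * (t - s) * m))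
        \<le> (exp (c * y ^ p) * exp (2 * s * y)) * ((y - m) * exp (2 * (t - s) * y))"
      by (rule mult_left_mono[OF le]) simp
    moreover have "exp (2 * t * y) = exp (2 * s * y) * exp (2 * (t - s) * y)"
      unfolding exp_add[symmetric] by (simp add: algebra_simps)
    moreover have "a * (b * (u * x)) = b * u * (x * a)" "b * (u * a * x) = b * u * (x * a)" for a b u x :: real
      by simp_all
    ultimately show "exp (2 * (t - s) * m) * (exp (c * y ^ p) * (exp (2 * s * y) * (y - m)))
        \<le> exp (c * y ^ p) * (exp (2 * t * y) * (y - m))" by (simp only:)
  qed
  finally show ?thesis using peak_mean_ge_iff[OF p, of m t] by (simp add: m_def)
qed

lemma peak_mean_uminus: "even p \<Longrightarrow> peak_mean p c (- t) = - peak_mean p c t"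
proof -
  assume p: "even p"
  have r: "(LINT y|lborel. g y) = (LINT y|lborel. g (- y))" for g :: "real \<Rightarrow> real"
    using lborel_integral_real_affine[of "-1" g 0] by simp
  have "peak_integral p c (\<lambda>y. exp (2 * - t * y)) = peak_integral p c (\<lambda>y. exp (2 * t * y))"
    unfolding peak_integral_def by (subst r) (simp add: p)
  moreover have "peak_integral p c (\<lambda>y. exp (2 * - t * y) * y) = - peak_integral p c (\<lambda>y. exp (2 * t * y) * y)"
    unfolding peak_integral_def by (subst r) (simp add: p)
  ultimately show ?thesis by (simp add: peak_mean_def)
qed

text \<open>A tilt by \<open>t \<ge> 0\<close> weighs the mass above \<open>L + 1\<close> by at
  least \<open>exp (2 * t * (L + 1))\<close> and the mass below \<open>L\<close> by at most
  \<open>exp (2 * t * L)\<close>, so for large \<open>t\<close> the tilted integral of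
  \<open>y - L\<close> is nonnegative.\<close>

lemma peak_mean_at_top:
  assumes p: "even p" "p \<ge> 2" "c < 0"
  shows "filterlim (peak_mean p c) at_top at_top"
  unfolding filterlim_at_top
proof
  fix L :: real
  let ?f = "\<lambda>y. exp (c * y ^ p)"
  \<comment> \<open>\<open>c1\<close> is the untilted mass above \<open>L + 1\<close>;
    \<open>c2\<close> bounds the untilted integral of \<open>L - y\<close> over
    \<open>y < L\<close>.\<close>
  define c1 where "c1 = (LINT y|lborel. ?f y * indicator {L + 1..} y)"
  define c2 where "c2 = (LINT y|lborel. ?f y * (\<bar>y\<bar> + \<bar>L\<bar>))"
  have f: "integrable lborel ?f" using peak_integrable[OF p, of "\<lambda>y. 1" 1 0] by simp
  have i1: "integrable lborel (\<lambda>y. ?f y * indicator {L + 1..} y)"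
    by (rule peak_integrable[OF p, of _ 1 0]) (auto simp: indicator_def)
  have i2: "integrable lborel (\<lambda>y. ?f y * (\<bar>y\<bar> + \<bar>L\<bar>))"
  proof (rule peak_integrable[OF p, of _ "1 + \<bar>L\<bar>" 1])
    fix y :: real
    have e: "\<bar>y\<bar> \<le> exp \<bar>y\<bar>" "1 \<le> exp \<bar>y\<bar>" using exp_ge_add_one_self[of "\<bar>y\<bar>"] by linarith+
    have "\<bar>L\<bar> * 1 \<le> \<bar>L\<bar> * exp \<bar>y\<bar>" using e by (intro mult_left_mono) auto
    thus "\<bar>\<bar>y\<bar> + \<bar>L\<bar>\<bar> \<le> (1 + \<bar>L\<bar>) * exp (1 * \<bar>y\<bar>)" using e by (simp add: algebra_simps)
  qed measurable
  have c1: "c1 > 0"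
  proof -
    have "(LINT y|lborel. exp (c * (max \<bar>L + 1\<bar> \<bar>L + 2\<bar>) ^ p) * indicator {L + 1..L + 2} y) \<le> c1"
      unfolding c1_def
    proof (rule integral_mono[OF _ i1])
      show "integrable lborel (\<lambda>y. exp (c * (max \<bar>L + 1\<bar> \<bar>L + 2\<bar>) ^ p) * indicator {L + 1..L + 2} y)" by simp
      fix y
      show "exp (c * (max \<bar>L + 1\<bar> \<bar>L + 2\<bar>) ^ p) * indicator {L + 1..L + 2} y \<le> ?f y * indicator {L + 1..} y"
      proof (cases "y \<in> {L + 1..L + 2}")
        case True
        hence "\<bar>y\<bar> ^ p \<le> (max \<bar>L + 1\<bar> \<bar>L + 2\<bar>) ^ p" by (intro power_mono) auto
        hence "c * (max \<bar>L + 1\<bar> \<bar>L + 2\<bar>) ^ p \<le> c * y ^ p"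
          using p by (intro mult_left_mono_neg) (auto simp: power_even_abs)
        thus ?thesis using True by simp
      qed auto
    qed
    moreover have "(LINT y|lborel. exp (c * (max \<bar>L + 1\<bar> \<bar>L + 2\<bar>) ^ p) * indicator {L + 1..L + 2} y)
        = exp (c * (max \<bar>L + 1\<bar> \<bar>L + 2\<bar>) ^ p)" by simp
    ultimately show ?thesis by (smt (verit) exp_gt_zero)
  qed
  have main: "L \<le> peak_mean p c t" if t: "t \<ge> 0" "2 * t \<ge> c2 / c1" for t
  proof -
    have "c2 / c1 \<le> exp (2 * t)" using t exp_ge_add_one_self[of "2 * t"] by linarith
    hence "c2 \<le> exp (2 * t) * c1" using c1 by (simp add: pos_divide_le_eq)
    hence "0 \<le> exp (2 * t * L) * (exp (2 * t) * c1 - c2)" by simp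
    also have "\<dots> = (LINT y|lborel. exp (2 * t * L) * (exp (2 * t) * (?f y * indicator {L + 1..} y) - ?f y * (\<bar>y\<bar> + \<bar>L\<bar>)))"
      using i1 i2 by (simp add: c1_def c2_def)
    also have "\<dots> \<le> (LINT y|lborel. ?f y * (exp (2 * t * y) * (y - L)))"
    proof (rule integral_mono)
      show "integrable lborel (\<lambda>y. exp (2 * t * L) * (exp (2 * t) * (?f y * indicator {L + 1..} y) - ?f y * (\<bar>y\<bar> + \<bar>L\<bar>)))"
        by (intro integrable_mult_right Bochner_Integration.integrable_diff i1 i2)
      show "integrable lborel (\<lambda>y. ?f y * (exp (2 * t * y) * (y - L)))"
        by (rule peak_tilt_diff_integrable[OF p])
      fix y
      have "exp (2 * t * L) * (exp (2 * t) * indicator {L + 1..} y - (\<bar>y\<bar> + \<bar>L\<bar>)) \<le> exp (2 * t * y) * (y - L)"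
      proof (cases "y \<ge> L")
        case False
        hence "t * y \<le> t * L" using t by (intro mult_left_mono) auto
        hence "exp (2 * t * y) * (L - y) \<le> exp (2 * t * L) * (\<bar>y\<bar> + \<bar>L\<bar>)"
          using False by (intro mult_mono) auto
        thus ?thesis using False by (simp add: algebra_simps)
      next
        case True
        have nn: "0 \<le> exp (2 * t * L) * (\<bar>y\<bar> + \<bar>L\<bar>)" by simp
        show ?thesis
        proof (cases "y \<ge> L + 1")
          case True
          hence "t * (L + 1) \<le> t * y" using t by (intro mult_left_mono) auto
          hence "exp (2 * t * L + 2 * t) * 1 \<le> exp (2 * t * y) * (y - L)"
            using True by (intro mult_mono) (auto simp: algebra_simps)
          moreover have "exp (2 * t * L + 2 * t) = exp (2 * t * L) * exp (2 * t)" by (rule exp_add)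
          moreover have "exp (2 * t * L) * (exp (2 * t) * indicator {L + 1..} y - (\<bar>y\<bar> + \<bar>L\<bar>))
              = exp (2 * t * L) * exp (2 * t) - exp (2 * t * L) * (\<bar>y\<bar> + \<bar>L\<bar>)"
            using True by (simp add: right_diff_distrib)
          ultimately show ?thesis using nn by linarith
        next
          case False
          have "0 \<le> exp (2 * t * y) * (y - L)" using True by simp
          moreover have "exp (2 * t * L) * (exp (2 * t) * indicator {L + 1..} y - (\<bar>y\<bar> + \<bar>L\<bar>))
              = - (exp (2 * t * L) * (\<bar>y\<bar> + \<bar>L\<bar>))"
            using False by (simp only: indicator_simps atLeast_iff not_True_eq_False simp_thms mult_zero_right diff_0 mult_minus_right)
          ultimately show ?thesis using nn by linarith
        qed
      qed
      hence "?f y * (exp (2 * t * L) * (exp (2 * t) * indicator {L + 1..} y - (\<bar>y\<bar> + \<bar>L\<bar>))) \<le> ?f y * (exp (2 * t * y) * (y - L))"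
        by (intro mult_left_mono) auto
      thus "exp (2 * t * L) * (exp (2 * t) * (?f y * indicator {L + 1..} y) - ?f y * (\<bar>y\<bar> + \<bar>L\<bar>)) \<le> ?f y * (exp (2 * t * y) * (y - L))"
        by (simp add: algebra_simps)
    qed
    finally show ?thesis using peak_mean_ge_iff[OF p] by blast
  qed
  show "eventually (\<lambda>t. L \<le> peak_mean p c t) at_top"
    using eventually_ge_at_top[of "max 0 (c2 / c1 / 2)"]
  proof eventually_elim
    case (elim t)
    hence "t \<ge> 0" "t \<ge> c2 / c1 / 2" by auto
    thus ?case by (intro main) auto
  qed
qed

lemma peak_mean_at_bot:
  assumes p: "even p" "p \<ge> 2" "c < 0"
  shows "filterlim (peak_mean p c) at_bot at_bot"
proof -
  have "filterlim (\<lambda>t. peak_mean p c (- t)) at_bot at_top"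
    unfolding peak_mean_uminus[OF p(1)] using filterlim_compose[OF filterlim_uminus_at_bot_at_top peak_mean_at_top[OF p]] .
  thus ?thesis by (simp add: filterlim_at_bot_mirror)
qed

lemma peak_mean_continuous:
  assumes p: "even p" "p \<ge> 2" "c < 0"
  shows "isCont (peak_mean p c) t"
  unfolding continuous_at_sequentially comp_def
proof (intro allI impI)
  fix x :: "nat \<Rightarrow> real" assume x: "x \<longlonglongrightarrow> t"
  \<comment> \<open>A convergent sequence of tilts is bounded, so a single exponential dominates all
    integrands.\<close>
  then obtain K where K: "\<And>k. \<bar>x k\<bar> \<le> K"
    using Bseq_def convergent_imp_Bseq convergentI by (metis real_norm_def)
  have K0: "K \<ge> 0" using K[of 0] by linarith
  have tilt: "\<bar>exp (2 * x k * y)\<bar> \<le> exp ((2 * K + 1) * \<bar>y\<bar>)" "\<bar>exp (2 * x k * y) * y\<bar> \<le> exp ((2 * K + 1) * \<bar>y\<bar>)" for k y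
  proof -
    have "exp ((2 * \<bar>x k\<bar> + 1) * \<bar>y\<bar>) \<le> exp ((2 * K + 1) * \<bar>y\<bar>)"
      using K[of k] by (simp add: mult_right_mono)
    thus "\<bar>exp (2 * x k * y)\<bar> \<le> exp ((2 * K + 1) * \<bar>y\<bar>)" "\<bar>exp (2 * x k * y) * y\<bar> \<le> exp ((2 * K + 1) * \<bar>y\<bar>)"
      using exp_tilt_bounds[of "x k" y] by linarith+
  qed
  have w: "integrable lborel (\<lambda>y. exp (c * y ^ p) * exp ((2 * K + 1) * \<bar>y\<bar>))"
    by (rule peak_integrable[OF p, of _ 1 "2 * K + 1"]) auto
  have "(\<lambda>k. peak_integral p c (\<lambda>y. exp (2 * x k * y))) \<longlonglongrightarrow> peak_integral p c (\<lambda>y. exp (2 * t * y))"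
    unfolding peak_integral_def
  proof (rule integral_dominated_convergence[OF _ _ w])
    show "AE y in lborel. (\<lambda>k. exp (c * y ^ p) * exp (2 * x k * y)) \<longlonglongrightarrow> exp (c * y ^ p) * exp (2 * t * y)"
      by (intro AE_I2 tendsto_intros x)
    show "AE y in lborel. norm (exp (c * y ^ p) * exp (2 * x k * y)) \<le> exp (c * y ^ p) * exp ((2 * K + 1) * \<bar>y\<bar>)" for k
      using tilt(1)[of k] by (intro AE_I2) (auto simp: abs_mult)
  qed measurable
  moreover have "(\<lambda>k. peak_integral p c (\<lambda>y. exp (2 * x k * y) * y)) \<longlonglongrightarrow> peak_integral p c (\<lambda>y. exp (2 * t * y) * y)"
    unfolding peak_integral_def
  proof (rule integral_dominated_convergence[OF _ _ w])
    show "AE y in lborel. (\<lambda>k. exp (c * y ^ p) * (exp (2 * x k * y) * y)) \<longlonglongrightarrow> exp (c * y ^ p) * (exp (2 * t * y) * y)"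
      by (intro AE_I2 tendsto_intros x)
    show "AE y in lborel. norm (exp (c * y ^ p) * (exp (2 * x k * y) * y)) \<le> exp (c * y ^ p) * exp ((2 * K + 1) * \<bar>y\<bar>)" for k
      using tilt(2)[of k] by (intro AE_I2) (auto simp: abs_mult)
  qed measurable
  ultimately show "(\<lambda>k. peak_mean p c (x k)) \<longlonglongrightarrow> peak_mean p c t"
    unfolding peak_mean_def using peak_tilt_pos[OF p, of t] by (intro tendsto_divide) auto
qed

lemma quartic_law_alt:
  "quartic_law c t = density lborel (\<lambda>y. ennreal (exp (c * y ^ 4) * exp (2 * t * y) / peak_integral 4 c (\<lambda>y. exp (2 * t * y))))"
  unfolding quartic_law_def peak_integral_def by (simp add: exp_add)

lemma quartic_law_mean:
  assumes c: "c < 0"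
  shows "(LINT y|quartic_law c t. y) = peak_mean 4 c t"
proof -
  have Z: "peak_integral 4 c (\<lambda>y. exp (2 * t * y)) > 0" using c by (intro peak_tilt_pos) auto
  have "(LINT y|quartic_law c t. y) = (LINT y|lborel. (exp (c * y ^ 4) * exp (2 * t * y) / peak_integral 4 c (\<lambda>y. exp (2 * t * y))) *\<^sub>R y)"
    unfolding quartic_law_alt using Z by (intro integral_density) auto
  also have "\<dots> = (LINT y|lborel. exp (c * y ^ 4) * (exp (2 * t * y) * y) / peak_integral 4 c (\<lambda>y. exp (2 * t * y)))"
    by (intro Bochner_Integration.integral_cong) auto
  finally show ?thesis by (simp add: peak_mean_def peak_integral_def)
qed

lemma quartic_law_measure:
  assumes c: "c < 0" and A: "A \<in> sets borel"
  shows "measure (quartic_law c 0) A = (LINT y|lborel. exp (c * y ^ 4) * indicator A y) / peak_integral 4 c (\<lambda>y. 1)"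
proof -
  have Z: "peak_integral 4 c (\<lambda>y. 1) > 0" using c by (intro peak_integral_1_pos) auto
  have int: "integrable lborel (\<lambda>y. exp (c * y ^ 4))"
    using peak_integrable[of 4 c "\<lambda>y. 1" 1 0] c by simp
  have "measure (quartic_law c 0) A = (LINT y|lborel. exp (c * y ^ 4) / peak_integral 4 c (\<lambda>y. 1) * indicator A y)"
  proof -
    have e: "quartic_law c 0 = density lborel (\<lambda>y. ennreal (exp (c * y ^ 4) / peak_integral 4 c (\<lambda>y. 1)))"
      by (simp add: quartic_law_alt)
    show ?thesis unfolding e by (rule measure_density_real[OF _ _ A]) (use Z int in auto)
  qed
  thus ?thesis by simp
qed

lemma quartic_law_cdf:
  assumes c: "c < 0"
  shows "measure (quartic_law c 0) {..z} = peak_cdf 4 c z"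
proof -
  have "(LINT y|lborel. exp (c * y ^ 4) * indicator {..z} y) = peak_integral 4 c (\<lambda>y. of_bool (y \<le> z))"
    unfolding peak_integral_def by (intro Bochner_Integration.integral_cong) (auto simp: indicator_def)
  thus ?thesis by (simp add: quartic_law_measure[OF c] peak_cdf_def)
qed

lemma quartic_law_real_distribution:
  assumes c: "c < 0"
  shows "real_distribution (quartic_law c 0)"
proof -
  have Z: "peak_integral 4 c (\<lambda>y. 1) > 0" using c by (intro peak_integral_1_pos) auto
  have int: "integrable lborel (\<lambda>y. exp (c * y ^ 4) / peak_integral 4 c (\<lambda>y. 1))"
    using peak_integrable[of 4 c "\<lambda>y. 1" 1 0] c by simp
  have "emeasure (quartic_law c 0) (space (quartic_law c 0)) = (\<integral>\<^sup>+y. ennreal (exp (c * y ^ 4) / peak_integral 4 c (\<lambda>y. 1)) \<partial>lborel)"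
    unfolding quartic_law_alt by (simp add: emeasure_density)
  also have "\<dots> = ennreal (LINT y|lborel. exp (c * y ^ 4) / peak_integral 4 c (\<lambda>y. 1))"
    using int Z by (intro nn_integral_eq_integral) auto
  also have "(LINT y|lborel. exp (c * y ^ 4) / peak_integral 4 c (\<lambda>y. 1)) = 1"
    using Z by (simp add: peak_integral_def)
  finally have "prob_space (quartic_law c 0)" by (intro prob_spaceI) simp
  thus ?thesis by (simp add: real_distribution_def real_distribution_axioms_def quartic_law_def)
qed

text \<open>The distribution function of the quartic law is continuous, and \<open>peak_mean\<close>
  is nondecreasing, continuous and unbounded in both directions. Their composition is therefore
  itself a distribution function.\<close>

lemma critical_law_exists:
  assumes c: "c < 0"
  shows "\<exists>Z. real_distribution Z \<and> (\<forall>t. measure Z {..t} = peak_cdf 4 c (peak_mean 4 c t))"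
proof -
  have p: "even (4::nat)" "(4::nat) \<ge> 2" by auto
  let ?Q = "quartic_law c 0" and ?m = "peak_mean 4 c"
  interpret Q: real_distribution ?Q by (rule quartic_law_real_distribution[OF c])
  define F where "F = (\<lambda>t. cdf ?Q (?m t))"
  have F_eq: "F t = peak_cdf 4 c (?m t)" for t by (simp add: F_def cdf_def quartic_law_cdf[OF c])
  have mono: "F x \<le> F y" if "x \<le> y" for x y
    unfolding F_def by (intro Q.cdf_nondecreasing peak_mean_mono p c that)
  have "measure ?Q {x} = 0" for x
  proof -
    have "AE y in lborel. exp (c * y ^ 4) * indicator {x} y = 0"
      using AE_lborel_singleton[of x] by eventually_elim auto
    hence "(LINT y|lborel. exp (c * y ^ 4) * indicator {x} y) = 0" by (intro integral_eq_zero_AE)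
    thus ?thesis by (simp add: quartic_law_measure[OF c])
  qed
  hence "isCont (cdf ?Q) x" for x by (simp add: Q.isCont_cdf)
  hence "isCont F t" for t unfolding F_def
    by (intro isCont_o2[OF peak_mean_continuous[OF p c]])
  hence cont: "continuous (at_right t) F" for t by (rule continuous_at_imp_continuous_at_within)
  have top: "(F \<longlongrightarrow> 1) at_top"
    unfolding F_def using Q.cdf_lim_at_top_prob peak_mean_at_top[OF p c] by (rule filterlim_compose)
  have bot: "(F \<longlongrightarrow> 0) at_bot"
    unfolding F_def using Q.cdf_lim_at_bot peak_mean_at_bot[OF p c] by (rule filterlim_compose)
  have "real_distribution (interval_measure F)" by (rule real_distribution_interval_measure[OF mono cont bot top])
  moreover have "measure (interval_measure F) {..t} = F t" for t
    using fun_cong[OF cdf_interval_measure[OF mono cont bot], of t] by (simp add: cdf_def)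
  ultimately show ?thesis using F_eq by auto
qed

lemma mle_converges_in_lawI:
  assumes lim: "\<And>r t. filterlim r at_top sequentially \<Longrightarrow> (\<And>k. even (d * r k)) \<Longrightarrow> isCont (cdf L) t \<Longrightarrow>
      (\<lambda>k. cdf (distr (annealed_ising d \<beta> h (r k)) borel (\<lambda>\<omega>. s (r k) * (mle d \<beta> (r k) \<omega> - h))) t)
        \<longlonglongrightarrow> measure L {..t}"
  shows "mle_converges_in_law d \<beta> h s L"
  unfolding mle_converges_in_law_def weak_conv_m_def weak_conv_def
proof (intro allI impI)
  fix r :: "nat \<Rightarrow> nat" and t
  assume r: "strict_mono r \<and> (\<forall>k. even (d * r k))" and t: "isCont (cdf L) t"
  thus "(\<lambda>k. cdf (distr (annealed_ising d \<beta> h (r k)) borel (\<lambda>\<omega>. s (r k) * (mle d \<beta> (r k) \<omega> - h))) t) \<longlonglongrightarrow> cdf L t"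
    unfolding cdf_def[of L] using lim[OF filterlim_subseq[of r] _ t] by blast
qed

lemma mle_asymptotically_normal:
  assumes d: "d \<ge> 3" and \<beta>: "\<beta> > 0" and reg: "(\<beta>, h) \<in> uniqueness_regime d"
  shows "\<exists>\<sigma>>0. mle_converges_in_law d \<beta> h (\<lambda>n. sqrt (real n)) (normal_law \<sigma>)"
proof -
  have "h \<noteq> 0 \<or> \<beta> < beta_c d" using reg by (auto simp: uniqueness_regime_def)
  then obtain a c where peak: "peak (A_fun d \<beta> h) UNIV 2 a c"
    using A_fun_peak_uniqueness[OF d \<beta>] by blast
  hence c: "c < 0" by (simp add: peak_def)
  have "mle_converges_in_law d \<beta> h (\<lambda>n. sqrt (real n)) (normal_law (- c / 2))"
  proof (rule mle_converges_in_lawI)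
    fix r :: "nat \<Rightarrow> nat" and t
    assume r: "filterlim r at_top sequentially" "\<And>k. even (d * r k)"
    have "peak_sequence d \<beta> h UNIV 2 a c r"
      unfolding peak_sequence_def using d \<beta> peak r by auto
    from unique_peak_cdf_tendsto[OF this, of t]
    show "(\<lambda>k. cdf (distr (annealed_ising d \<beta> h (r k)) borel (\<lambda>\<omega>. sqrt (real (r k)) * (mle d \<beta> (r k) \<omega> - h))) t)
        \<longlonglongrightarrow> measure (normal_law (- c / 2)) {..t}"
      unfolding normal_law_cdf[OF c] peak_mean_gaussian[OF c] by (simp add: powr_half_sqrt)
  qed
  moreover have "- c / 2 > 0" using c by simp
  ultimately show ?thesis by blast
qed

lemma mle_low_temperature:
  assumes d: "d \<ge> 3" and \<beta>: "\<beta> > 0" and low: "\<beta> > beta_c d"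
  shows "\<exists>\<sigma>>0. mle_converges_in_law d \<beta> 0 (\<lambda>n. sqrt (real n)) (lazy_law (normal_law \<sigma>))"
proof -
  obtain a c where a: "1 / 2 < a" and peak: "peak (A_fun d \<beta> 0) {1 / 2..} 2 a c"
    using A_fun_peak_low_temperature[OF d \<beta> low] by blast
  hence c: "c < 0" by (simp add: peak_def)
  hence \<sigma>: "- c / 2 > 0" by simp
  let ?U = "lazy_law (normal_law (- c / 2))"
  note law = lazy_law[OF normal_law_real_distribution[OF \<sigma>]]
  interpret U: real_distribution ?U by (rule law(1))
  have "mle_converges_in_law d \<beta> 0 (\<lambda>n. sqrt (real n)) ?U"
  proof (rule mle_converges_in_lawI)
    fix r :: "nat \<Rightarrow> nat" and t
    assume r: "filterlim r at_top sequentially" "\<And>k. even (d * r k)" and cont: "isCont (cdf ?U) t"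
    interpret symmetric_peaks d \<beta> 2 a c r
      unfolding symmetric_peaks_def symmetric_peaks_axioms_def peak_sequence_def using d \<beta> peak r a by auto
    have scale: "scale k = sqrt (real (r k))" for k
      by (simp add: scale_def powr_half_sqrt)
    \<comment> \<open>The limit law has an atom of mass 1/2 at 0, so 0 is not a continuity point and
      no limit is required there; at \<open>t = 0\<close> neither phase is selected.\<close>
    have "t \<noteq> 0"
    proof
      assume "t = 0"
      hence "measure ?U {0} = 0" using cont U.isCont_cdf by simp
      thus False using law(2)[of "{0}"] normal_law_singleton[OF \<sigma>, of 0] by simp
    qed
    then consider "t > 0" | "t < 0" by linarith
    thus "(\<lambda>k. cdf (distr (annealed_ising d \<beta> 0 (r k)) borel (\<lambda>\<omega>. sqrt (real (r k)) * (mle d \<beta> (r k) \<omega> - 0))) t)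
        \<longlonglongrightarrow> measure ?U {..t}"
    proof cases
      case 1
      have "measure ?U {..t} = 1 / 2 + peak_cdf 2 c (peak_mean 2 c t) / 2"
        using 1 unfolding law(2)[OF borel_closed[OF closed_atMost]] normal_law_cdf[OF c] peak_mean_gaussian[OF c] by simp
      thus ?thesis using mle_cdf_pos_tendsto[OF 1] by (simp only: scale)
    next
      case 2
      have "measure ?U {..t} = (1 - measure (normal_law (- c / 2)) {..- t}) / 2"
        using 2 normal_law_cdf_uminus[OF \<sigma>, of "- t"] unfolding law(2)[OF borel_closed[OF closed_atMost]] by simp
      also have "\<dots> = 1 / 2 - peak_cdf 2 c (peak_mean 2 c (- t)) / 2"
        unfolding normal_law_cdf[OF c] peak_mean_gaussian[OF c] by (simp add: diff_divide_distrib)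
      finally show ?thesis using mle_cdf_neg_tendsto[OF 2] by (simp only: scale)
    qed
  qed
  thus ?thesis using \<sigma> by blast
qed

lemma mle_critical:
  assumes d: "d \<ge> 3" and \<beta>: "\<beta> > 0" and crit: "\<beta> = beta_c d"
    and c_def: "c = (deriv ^^ 4) (A_fun d \<beta> 0) (1 / 2) / 24"
  shows "\<exists>Z. real_distribution Z \<and>
    (\<forall>t. measure Z {..t} = measure (quartic_law c 0) {..(LINT y|quartic_law c t. y)}) \<and>
    mle_converges_in_law d \<beta> 0 (\<lambda>n. real n powr (3 / 4)) Z"
proof -
  have peak: "peak (A_fun d \<beta> 0) UNIV 4 (1 / 2) c"
    unfolding c_def by (rule A_fun_peak_critical[OF d \<beta> crit])
  hence c: "c < 0" by (simp add: peak_def)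
  obtain Z where Z: "real_distribution Z" "\<And>t. measure Z {..t} = peak_cdf 4 c (peak_mean 4 c t)"
    using critical_law_exists[OF c] by blast
  have "mle_converges_in_law d \<beta> 0 (\<lambda>n. real n powr (3 / 4)) Z"
  proof (rule mle_converges_in_lawI)
    fix r :: "nat \<Rightarrow> nat" and t
    assume r: "filterlim r at_top sequentially" "\<And>k. even (d * r k)"
    have "peak_sequence d \<beta> 0 UNIV 4 (1 / 2) c r"
      unfolding peak_sequence_def using d \<beta> peak r by auto
    from unique_peak_cdf_tendsto[OF this, of t]
    show "(\<lambda>k. cdf (distr (annealed_ising d \<beta> 0 (r k)) borel (\<lambda>\<omega>. real (r k) powr (3 / 4) * (mle d \<beta> (r k) \<omega> - 0))) t)
        \<longlonglongrightarrow> measure Z {..t}"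
      unfolding Z(2) by simp
  qed
  thus ?thesis using Z by (intro exI[of _ Z]) (simp add: quartic_law_cdf[OF c] quartic_law_mean[OF c])
qed

theorem theorem5p10:
  fixes d :: nat and \<beta> h :: real
  assumes "d \<ge> 3" and "\<beta> > 0"
  shows
    "((\<beta>, h) \<in> uniqueness_regime d \<longrightarrow>
        (\<exists>\<sigma>>0. mle_converges_in_law d \<beta> h (\<lambda>n. sqrt (real n)) (normal_law \<sigma>)))
     \<and> (\<beta> > beta_c d \<and> h = 0 \<longrightarrow>
        (\<exists>pm>0. \<exists>pp>0. \<exists>\<sigma>m>0. \<exists>\<sigma>p>0. \<exists>U. pm + pp \<le> 1 \<and> real_distribution U \<and>
           (\<forall>B\<in>sets borel. measure U B =
              pm * measure (neg_half_normal_law \<sigma>m) B + pp * measure (pos_half_normal_law \<sigma>p) B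
              + (1 - pm - pp) * measure (return borel 0) B) \<and>
           mle_converges_in_law d \<beta> h (\<lambda>n. sqrt (real n)) U))
     \<and> (\<beta> = beta_c d \<and> h = 0 \<longrightarrow>
        (let c = (deriv ^^ 4) (A_fun d \<beta> h) (1 / 2) / 24
         in \<exists>Z. real_distribution Z \<and>
              (\<forall>t. measure Z {..t} =
                 measure (quartic_law c 0) {..(LINT y|quartic_law c t. y)}) \<and>
              mle_converges_in_law d \<beta> h (\<lambda>n. real n powr (3 / 4)) Z))"
proof (intro conjI impI)
  assume "(\<beta>, h) \<in> uniqueness_regime d"
  with assms show "\<exists>\<sigma>>0. mle_converges_in_law d \<beta> h (\<lambda>n. sqrt (real n)) (normal_law \<sigma>)"
    by (rule mle_asymptotically_normal)
next
  assume low: "\<beta> > beta_c d \<and> h = 0"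
  then obtain \<sigma> where \<sigma>: "\<sigma> > 0" and U: "mle_converges_in_law d \<beta> h (\<lambda>n. sqrt (real n)) (lazy_law (normal_law \<sigma>))"
    using mle_low_temperature[OF assms] by blast
  note law = lazy_law[OF normal_law_real_distribution[OF \<sigma>]]
  \<comment> \<open>Half of the mass sits at 0. The other half is a centred normal law, which splits
    equally into its two half-normal parts.\<close>
  have mix: "measure (lazy_law (normal_law \<sigma>)) B = 1 / 4 * measure (neg_half_normal_law \<sigma>) B
      + 1 / 4 * measure (pos_half_normal_law \<sigma>) B + (1 - 1 / 4 - 1 / 4) * measure (return borel 0) B"
    if B: "B \<in> sets borel" for B
  proof -
    have "measure (return borel 0) B = indicator B 0" using B by (rule measure_return)
    moreover have "1 - 1 / 4 - 1 / 4 = (1 / 2 :: real)" by simp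
    ultimately show ?thesis using half_normal_laws[OF \<sigma> B] law(2)[OF B] by (simp only:)
  qed
  show "\<exists>pm>0. \<exists>pp>0. \<exists>\<sigma>m>0. \<exists>\<sigma>p>0. \<exists>U. pm + pp \<le> 1 \<and> real_distribution U \<and>
           (\<forall>B\<in>sets borel. measure U B =
              pm * measure (neg_half_normal_law \<sigma>m) B + pp * measure (pos_half_normal_law \<sigma>p) B
              + (1 - pm - pp) * measure (return borel 0) B) \<and>
           mle_converges_in_law d \<beta> h (\<lambda>n. sqrt (real n)) U"
    by (rule exI[of _ "1 / 4"], rule conjI, simp, rule exI[of _ "1 / 4"], rule conjI, simp,
        rule exI[of _ \<sigma>], rule conjI, rule \<sigma>, rule exI[of _ \<sigma>], rule conjI, rule \<sigma>,
        rule exI[of _ "lazy_law (normal_law \<sigma>)"]) (intro conjI ballI law(1) mix U, simp)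
next
  assume crit: "\<beta> = beta_c d \<and> h = 0"
  show "let c = (deriv ^^ 4) (A_fun d \<beta> h) (1 / 2) / 24
         in \<exists>Z. real_distribution Z \<and>
              (\<forall>t. measure Z {..t} =
                 measure (quartic_law c 0) {..(LINT y|quartic_law c t. y)}) \<and>
              mle_converges_in_law d \<beta> h (\<lambda>n. real n powr (3 / 4)) Z"
    unfolding Let_def conjunct2[OF crit]
    by (rule mle_critical[OF assms conjunct1[OF crit] refl])
qed

end
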